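(* Suppose that $\alpha p(p-1)\le 1$. Then the following hold. 1. The operator $\mathcal{T}_\infty$ admits a unique fixed point $\lambda_\infty\in\Pr_1(\mathcal{X})$. 2. The ground state energy converges in $L^1$ to $\mathrm{GSE}:=\mathcal{P}_\infty(\lambda_\infty)$, i.e. $\lim_{N\to\infty}\mathbb{E}\,|\mathrm{GSE}_N-\mathcal{P}_\infty(\lambda_\infty)|=0$.
   Context: **Model.** Let $R>0$ and let $\Sigma\subset[-R,R]$ be compact. Let $p\ge 2$ be an integer, $\alpha>0$, and $\psi:\Sigma\to\mathbb{R}$ a (bounded) Lipschitz function. Let $\theta:\Sigma^p\to\mathbb{R}$ be a random function with $\mathbb{E}\|\theta\|_\infty^2<\infty$ and $\mathbb{E}\,\mathrm{Lip}(\theta)<\infty$, where $\mathrm{Lip}(\theta)=\sup_{x\ne y\in\Sigma^p}|\theta(x)-\theta(y)|/\|x-y\|_2$. Let $(\theta_k)_{k\ge1}$ be i.i.d. copies of $\theta$, let $\pi(\alpha N)$ be Poisson with mean $\alpha N$, and for each $k\ge1$ let $I_k=\{I(k,1),\dots,I(k,p)\}$ be sampled uniformly from the $p$-element subsets of $[N]=\{1,\dots,N\}$; all of these are independent. For $\sigma\in\Sigma^N$, $$H_N(\sigma)=\sum_{k\le\pi(\alpha N)}\theta_k(\sigma_{I(k,1)},\dots,\sigma_{I(k,p)})+\sum_{i=1}^N\psi(\sigma_i),\qquad \mathrm{GSE}_N=\frac1N\max_{\sigma\in\Sigma^N}H_N(\sigma).$$ **Operator and functional.** Let $\mathcal{X}=C(\Sigma)$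 be the space of real continuous functions on $\Sigma$ with the sup norm, and $\Pr_1(\mathcal{X})$ the set of Borel probability measures $\lambda$ on $\mathcal{X}$ with $\int\|f\|_\infty\lambda(df)<\infty$. For $\lambda\in\Pr_1(\mathcal{X})$ let $(X_k)_{k\ge1}$ be i.i.d. with law $\lambda$, let $\pi(\alpha p)$ be Poisson with mean $\alpha p$, with $(X_k)$, $\pi(\alpha p)$, $(\theta_k)$, $\theta$ independent. For $r\ge0$, $\sigma\in\Sigma^{r(p-1)}$, $t\in\Sigma$ let $$\mathcal{I}_r(\sigma,t)=\sum_{k=1}^r\theta_k(\sigma_{(k-1)(p-1)+1},\dots,\sigma_{k(p-1)},t)+\psi(t).$$ $\mathcal{T}_\infty(\lambda)\in\Pr_1(\mathcal{X})$ is the law of the random function $$t\mapsto\sup_{\sigma\in\Sigma^{(p-1)\pi(\alpha p)}}\Bigl(\mathcal{I}_{\pi(\alpha p)}(\sigma,t)+\sum_{k=1}^{(p-1)\pi(\alpha p)}X_k(\sigma_k)\Bigr)-\sup_{(s,\sigma)\in\Sigma^{(p-1)\pi(\alpha p)+1}}\Bigl(\mathcal{I}_{\pi(\alpha p)}(\sigma,s)+\sum_{k=1}^{(p-1)\pi(\alpha p)}X_k(\sigma_k)\Bigr),$$ and $$\mathcal{P}_\infty(\lambda)=\mathbb{E}\sup_{(s,\sigma)\in\Sigma^{(p-1)\pi(\alpha p)+1}}\Bigl(\mathcal{I}_{\pi(\alpha p)}(\sigma,s)+\sum_{k=1}^{(p-1)\pi(\alpha p)}X_k(\sigma_k)\B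igr)-\alpha(p-1)\,\mathbb{E}\sup_{\sigma\in\Sigma^p}\Bigl(\theta(\sigma)+\sum_{k=1}^pX_k(\sigma_k)\Bigr).$$
   Formalization: The law of the random function θ is additionally assumed invariant under permutations of its p arguments; without this the claim fails, e.g. p=2, Σ=[-1,1], ψ=0, θ(x1,x2)=εx1 with ε=±1 uniform. *)

theory Defs
  imports "HOL-Probability.Probability" "HOL-Combinatorics.Permutations"
begin

text \<open>
  All indices start at 0: a point of \<open>S\<close>^\<open>n\<close> is an element of \<open>{..<n} \<rightarrow>\<^sub>E S\<close>, and the topology of
  \<open>S\<close>^\<open>n\<close> is the product topology.
\<close>

definition cube_top :: "real set \<Rightarrow> nat \<Rightarrow> (nat \<Rightarrow> real) topology" where
  "cube_top S n = product_topology (\<lambda>_. top_of_set S) {..<n}"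

text \<open>
  For compact \<open>X\<close>, \<open>cfunspace X euclidean_metric\<close> is the space of all real continuous functions on
  \<open>X\<close> (extended by \<open>undefined\<close> off \<open>X\<close>) with the sup metric. The measure below only serves as a
  carrier of the Borel sigma-algebra of that metric space.
\<close>

definition cont_borel :: "'a topology \<Rightarrow> ('a \<Rightarrow> real) measure" where
  "cont_borel X =
     (let C = mtopology_of (cfunspace X euclidean_metric)
      in sigma (topspace C) {U. openin C U})"

definition sup_norm :: "'a set \<Rightarrow> ('a \<Rightarrow> real) \<Rightarrow> ennreal" where
  "sup_norm A f = (SUP x\<in>A. ennreal \<bar>f x\<bar>)"

definition lip_const :: "real set \<Rightarrow> nat \<Rightarrow> ((nat \<Rightarrow> real) \<Rightarrow> real) \<Rightarrow> ennreal" where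
  "lip_const S p f =
     (SUP (x, y) \<in> {(x, y). x \<in> {..<p} \<rightarrow>\<^sub>E S \<and> y \<in> {..<p} \<rightarrow>\<^sub>E S \<and> x \<noteq> y}.
        ennreal (\<bar>f x - f y\<bar> / L2_set (\<lambda>i. x i - y i) {..<p}))"

text \<open>
  \<open>Q\<close> is the law of a random continuous function on \<open>S\<close>^\<open>p\<close> with the required moments. Continuity
  of every path costs nothing: an integrable Lipschitz constant is almost surely finite.
\<close>

definition clause_law :: "real set \<Rightarrow> nat \<Rightarrow> ((nat \<Rightarrow> real) \<Rightarrow> real) measure \<Rightarrow> bool" where
  "clause_law S p Q \<longleftrightarrow>
     prob_space Q \<and> sets Q = sets (cont_borel (cube_top S p)) \<and>
     (\<integral>\<^sup>+f. (sup_norm ({..<p} \<rightarrow>\<^sub>E S) f)\<^sup>2 \<partial>Q) < \<infinity> \<and>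
     (\<integral>\<^sup>+f. lip_const S p f \<partial>Q) < \<infinity>"

text \<open>
  The law of the random function is invariant under permutations of its \<open>p\<close> arguments. The
  Hamiltonian evaluates it at the spins of an unordered set of \<open>p\<close> indices, and the cavity operator
  always puts the root spin into the last argument; only for a symmetric law does this make sense
  independently of how the index set is enumerated.
\<close>

definition symmetric_law :: "real set \<Rightarrow> nat \<Rightarrow> ((nat \<Rightarrow> real) \<Rightarrow> real) measure \<Rightarrow> bool" where
  "symmetric_law S p Q \<longleftrightarrow>
     (\<forall>\<tau>. \<tau> permutes {..<p} \<longrightarrow>
        distr Q (cont_borel (cube_top S p)) (\<lambda>f. \<lambda>x\<in>({..<p} \<rightarrow>\<^sub>E S). f (x \<circ> \<tau>)) = Q)"

definition index_set_law :: "nat \<Rightarrow> nat \<Rightarrow> nat set measure" where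
  "index_set_law p N = uniform_count_measure {A. A \<subseteq> {..<N} \<and> card A = p}"

definition generated_events :: "'w measure \<Rightarrow> 'b measure \<Rightarrow> ('w \<Rightarrow> 'b) \<Rightarrow> 'w set set" where
  "generated_events M B X = {X -` A \<inter> space M | A. A \<in> sets B}"

text \<open>
  On the probability space \<open>M\<close>: \<open>K\<close> is Poisson with mean \<open>\<alpha> N\<close>, \<open>\<theta> 0, \<theta> 1, \<dots>\<close> have law \<open>Q\<close>,
  \<open>I 0, I 1, \<dots>\<close> are uniform \<open>p\<close>-element subsets of \<open>{..<N}\<close>, and all of these variables are mutually
  independent. As they take values in different types, \<open>indep_vars\<close> does not apply and independence
  is that of the generated sigma-algebras, indexed by \<open>None\<close> for \<open>K\<close>, \<open>Some (Inl k)\<close> for \<open>\<theta> k\<close> and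
  \<open>Some (Inr k)\<close> for \<open>I k\<close>.
\<close>

definition disorder ::
  "real set \<Rightarrow> nat \<Rightarrow> real \<Rightarrow> ((nat \<Rightarrow> real) \<Rightarrow> real) measure \<Rightarrow> nat \<Rightarrow>
   'w measure \<Rightarrow> ('w \<Rightarrow> nat) \<Rightarrow> (nat \<Rightarrow> 'w \<Rightarrow> (nat \<Rightarrow> real) \<Rightarrow> real) \<Rightarrow> (nat \<Rightarrow> 'w \<Rightarrow> nat set) \<Rightarrow> bool" where
  "disorder S p \<alpha> Q N M K \<theta> I \<longleftrightarrow>
     prob_space M \<and>
     K \<in> measurable M (count_space UNIV) \<and>
     distr M (count_space UNIV) K = measure_pmf (poisson_pmf (\<alpha> * real N)) \<and>
     (\<forall>k. \<theta> k \<in> measurable M (cont_borel (cube_top S p)) \<and>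
          distr M (cont_borel (cube_top S p)) (\<theta> k) = Q) \<and>
     (\<forall>k. I k \<in> measurable M (index_set_law p N) \<and>
          distr M (index_set_law p N) (I k) = index_set_law p N) \<and>
     prob_space.indep_sets M
       (case_option (generated_events M (count_space UNIV) K)
         (case_sum (\<lambda>k. generated_events M (cont_borel (cube_top S p)) (\<theta> k))
                   (\<lambda>k. generated_events M (index_set_law p N) (I k))))
       UNIV"

text \<open>The index sets are enumerated increasingly.\<close>

definition hamiltonian ::
  "nat \<Rightarrow> (real \<Rightarrow> real) \<Rightarrow> nat \<Rightarrow> nat \<Rightarrow> (nat \<Rightarrow> (nat \<Rightarrow> real) \<Rightarrow> real) \<Rightarrow> (nat \<Rightarrow> nat set) \<Rightarrow>
   (nat \<Rightarrow> real) \<Rightarrow> real" where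
  "hamiltonian p \<psi> N r \<theta> I \<sigma> =
     (\<Sum>k<r. \<theta> k (\<lambda>j\<in>{..<p}. \<sigma> (sorted_list_of_set (I k) ! j))) + (\<Sum>i<N. \<psi> (\<sigma> i))"

definition GSE ::
  "real set \<Rightarrow> nat \<Rightarrow> (real \<Rightarrow> real) \<Rightarrow> nat \<Rightarrow> nat \<Rightarrow> (nat \<Rightarrow> (nat \<Rightarrow> real) \<Rightarrow> real) \<Rightarrow> (nat \<Rightarrow> nat set) \<Rightarrow>
   real" where
  "GSE S p \<psi> N r \<theta> I = (SUP \<sigma>\<in>({..<N} \<rightarrow>\<^sub>E S). hamiltonian p \<psi> N r \<theta> I \<sigma>) / real N"

definition Pr1 :: "real set \<Rightarrow> (real \<Rightarrow> real) measure set" where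
  "Pr1 S = {L. prob_space L \<and> sets L = sets (cont_borel (top_of_set S)) \<and>
               (\<integral>\<^sup>+f. sup_norm S f \<partial>L) < \<infinity>}"

definition cavity_interaction ::
  "nat \<Rightarrow> (real \<Rightarrow> real) \<Rightarrow> nat \<Rightarrow> (nat \<Rightarrow> (nat \<Rightarrow> real) \<Rightarrow> real) \<Rightarrow> (nat \<Rightarrow> real) \<Rightarrow> real \<Rightarrow> real" where
  "cavity_interaction p \<psi> r \<theta> \<sigma> t =
     (\<Sum>k<r. \<theta> k (\<lambda>j\<in>{..<p}. if j < p - 1 then \<sigma> (k * (p - 1) + j) else t)) + \<psi> t"

definition cavity_energy ::
  "nat \<Rightarrow> (real \<Rightarrow> real) \<Rightarrow> nat \<Rightarrow> (nat \<Rightarrow> (nat \<Rightarrow> real) \<Rightarrow> real) \<Rightarrow> (nat \<Rightarrow> real \<Rightarrow> real) \<Rightarrow>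
   (nat \<Rightarrow> real) \<Rightarrow> real \<Rightarrow> real" where
  "cavity_energy p \<psi> r \<theta> X \<sigma> t =
     cavity_interaction p \<psi> r \<theta> \<sigma> t + (\<Sum>k<(p - 1) * r. X k (\<sigma> k))"

definition cavity_max ::
  "real set \<Rightarrow> nat \<Rightarrow> (real \<Rightarrow> real) \<Rightarrow> nat \<Rightarrow> (nat \<Rightarrow> (nat \<Rightarrow> real) \<Rightarrow> real) \<Rightarrow> (nat \<Rightarrow> real \<Rightarrow> real) \<Rightarrow>
   real" where
  "cavity_max S p \<psi> r \<theta> X =
     (SUP (s, \<sigma>) \<in> S \<times> ({..<(p - 1) * r} \<rightarrow>\<^sub>E S). cavity_energy p \<psi> r \<theta> X \<sigma> s)"

text \<open>The joint law of the Poisson variable, the \<open>\<theta>\<close>-sequence and the \<open>X\<close>-sequence.\<close>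

definition cavity_law ::
  "nat \<Rightarrow> real \<Rightarrow> ((nat \<Rightarrow> real) \<Rightarrow> real) measure \<Rightarrow> (real \<Rightarrow> real) measure \<Rightarrow>
   (nat \<times> (nat \<Rightarrow> (nat \<Rightarrow> real) \<Rightarrow> real) \<times> (nat \<Rightarrow> real \<Rightarrow> real)) measure" where
  "cavity_law p \<alpha> Q L =
     measure_pmf (poisson_pmf (\<alpha> * real p)) \<Otimes>\<^sub>M (Pi\<^sub>M UNIV (\<lambda>_. Q) \<Otimes>\<^sub>M Pi\<^sub>M UNIV (\<lambda>_. L))"

definition T_infty ::
  "real set \<Rightarrow> nat \<Rightarrow> real \<Rightarrow> (real \<Rightarrow> real) \<Rightarrow> ((nat \<Rightarrow> real) \<Rightarrow> real) measure \<Rightarrow>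
   (real \<Rightarrow> real) measure \<Rightarrow> (real \<Rightarrow> real) measure" where
  "T_infty S p \<alpha> \<psi> Q L =
     distr (cavity_law p \<alpha> Q L) (cont_borel (top_of_set S))
       (\<lambda>(r, \<theta>, X). \<lambda>t\<in>S.
          (SUP \<sigma>\<in>({..<(p - 1) * r} \<rightarrow>\<^sub>E S). cavity_energy p \<psi> r \<theta> X \<sigma> t) - cavity_max S p \<psi> r \<theta> X)"

definition P_infty ::
  "real set \<Rightarrow> nat \<Rightarrow> real \<Rightarrow> (real \<Rightarrow> real) \<Rightarrow> ((nat \<Rightarrow> real) \<Rightarrow> real) measure \<Rightarrow>
   (real \<Rightarrow> real) measure \<Rightarrow> real" where
  "P_infty S p \<alpha> \<psi> Q L =
     (\<integral>(r, \<theta>, X). cavity_max S p \<psi> r \<theta> X \<partial>cavity_law p \<alpha> Q L)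
     - \<alpha> * (real p - 1) *
       (\<integral>(f, X). (SUP \<sigma>\<in>({..<p} \<rightarrow>\<^sub>E S). f \<sigma> + (\<Sum>k<p. X k (\<sigma> k)))
          \<partial>(Q \<Otimes>\<^sub>M Pi\<^sub>M UNIV (\<lambda>_. L)))"

end

theory Submission
  imports Defs "HOL-Library.Function_Algebras" "HOL-Real_Asymp.Real_Asymp"
begin

text \<open>
  A configuration assigns a spin to every natural number, an energy is a continuous function of a
  configuration, and a random clause is a random energy that is added. The expected ground state
  energy is then built from one kind of operator, \<open>avg \<mu> \<Phi> E\<close>, the mean of \<open>\<Phi> (E + Z)\<close> for \<open>Z\<close> of
  law \<open>\<mu>\<close>. It acts on \<open>observables\<close>: functionals that commute with adding constants and are
  1-Lipschitz for the sup norm. The maximum is one of them.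

  The number of clauses at a vertex is asymptotically Poisson with mean \<open>\<alpha> p\<close>, and each brings in
  \<open>p - 1\<close> further vertices. So the neighbourhood of a vertex is a branching process with mean
  offspring \<open>\<alpha> p (p - 1) \<le> 1\<close>, which dies out. In the proof extinction is a statement about
  numbers: the sequence \<open>s(0) = 1\<close>, \<open>s(j + 1) = E min 1 ((p - 1) r s(j))\<close> with \<open>r\<close> Poisson of mean
  \<open>\<alpha> p\<close> tends to 0 (\<open>survival_seq_props\<close>). A positive limit \<open>s\<close> would give
  \<open>s = E min 1 ((p - 1) r s) < (p - 1) \<alpha> p s \<le> s\<close>. Two different recursions are bounded by this
  sequence.

  The cavity operator. For a fixed number \<open>r\<close> of clauses its value is a function of \<open>(p - 1) r\<close>
  independent fields, so it sends laws at total variation distance \<open>d\<close> to laws at distance at most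
  \<open>E min 1 ((p - 1) r d)\<close> (\<open>T_contraction\<close>). Hence the iterates from any two laws are within \<open>s(n)\<close> of
  each other. This yields uniqueness, and the limit of the iterates exists as a uniform limit of
  measures. The limit has a first moment because subtracting the maximum leaves at most the
  oscillation of \<open>\<psi>\<close> and of the clauses at the root, whatever the incoming fields are (\<open>T_Pr1\<close>).

  Locality. Let \<open>discrepancy k n m\<close> be the least \<open>\<delta>\<close> such that, on \<open>n\<close> vertices with a Poisson
  number \<open>m\<close> of clauses, the change of the expected ground state energy under a change of the energy
  at \<open>k\<close> vertices differs by at most \<open>\<delta>\<close> times the size of the change from what it would be if each
  of the \<open>k\<close> vertices carried an independent field of the fixed point law \<open>L\<close> and nothing else. It is at
  most 2, and it is 0 for \<open>k = 0\<close>. Removing one of the \<open>k\<close> vertices (Poisson thinning splits off its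
  clauses) and using the fixed point equation for its field exposes \<open>r\<close> clauses. Up to \<open>O(1/n)\<close> these
  reach \<open>(p - 1) r\<close> new vertices, and \<open>k\<close> becomes \<open>k - 1 + (p - 1) r\<close> (\<open>discrepancy_step\<close>). So the
  discrepancy is at most \<open>2 min 1 (k s(j)) + o(1)\<close> for every \<open>j\<close> (\<open>discrepancy_limsup\<close>), and vanishes
  in the limit.

  The energy. The graphs on \<open>N\<close> and on \<open>N + 1\<close> vertices both arise from the graph on \<open>N\<close> vertices with
  mean number \<open>\<alpha> (N + 1 - p)\<close> of clauses: the second by a new vertex with a Poisson number \<open>\<alpha> p\<close> of
  clauses, the first by a Poisson number \<open>\<alpha> (p - 1)\<close> of clauses. By locality the two increments
  converge to the two terms of \<open>P_infty\<close>, and averaging over \<open>N\<close> gives the limit of the mean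
  (\<open>graph_max_limit\<close>, \<open>mean_energy_limit\<close>). A single clause moves the maximum by at most its norm, so
  the variance is \<open>O(N)\<close> (\<open>cpoisson_mean_deviation\<close>) and the convergence is in \<open>L\<^sup>1\<close>. Finally the
  independent variables of the disorder have to be recognised as a compound Poisson sum of clauses
  (\<open>disorder_energy_law\<close>).
\<close>

section \<open>Energies of infinitely many spins\<close>

lemma sum_fun_apply: "(\<Sum>i\<in>A. f i) x = (\<Sum>i\<in>A. f i x)" for f :: "'i \<Rightarrow> 'a \<Rightarrow> 'b::comm_monoid_add"
  by (induct A rule: infinite_finite_induct) auto

locale spin_space =
  fixes S :: "real set"
  assumes S_compact: "compact S" and S_ne: "S \<noteq> {}"
begin

text \<open>
  All systems live on the same space: a system on a finite vertex set is an energy that does not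
  depend on the other coordinates. So systems of different sizes can be compared and added.
\<close>

definition configs :: "(nat \<Rightarrow> real) set" where "configs = Pi UNIV (\<lambda>_. S)"

definition energies :: "((nat \<Rightarrow> real) \<Rightarrow> real) set" where "energies = {E. continuous_on configs E}"

text \<open>
  Measurability is tested at the points of \<open>configs\<close> only. Energies that agree on \<open>configs\<close> may
  differ elsewhere, and no measurable set separates them.
\<close>

definition energy_space :: "((nat \<Rightarrow> real) \<Rightarrow> real) measure" where
  "energy_space = vimage_algebra energies (\<lambda>E. restrict E configs) (PiM configs (\<lambda>_. borel))"

definition maxE :: "((nat \<Rightarrow> real) \<Rightarrow> real) \<Rightarrow> real" where "maxE E = (SUP \<sigma>\<in>configs. E \<sigma>)"

definition nrm :: "((nat \<Rightarrow> real) \<Rightarrow> real) \<Rightarrow> real" where "nrm E = maxE (\<lambda>\<sigma>. \<bar>E \<sigma>\<bar>)"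

lemma configs_iff: "\<sigma> \<in> configs \<longleftrightarrow> (\<forall>i. \<sigma> i \<in> S)"
  by (auto simp: configs_def)

lemma configs_D: "\<sigma> \<in> configs \<Longrightarrow> \<sigma> i \<in> S"
  by (simp add: configs_iff)

lemma compact_configs: "compact configs"
proof -
  have "compactin (product_topology (\<lambda>_::nat. euclidean::real topology) UNIV) (PiE UNIV (\<lambda>_. S))"
    using S_compact by (simp add: compactin_PiE)
  then show ?thesis by (simp add: euclidean_product_topology configs_def PiE_UNIV_domain)
qed

lemma configs_ne: "configs \<noteq> {}"
  using S_ne by (auto simp: configs_def Pi_eq_empty)

lemma closed_configs: "closed configs"
  by (simp add: compact_configs compact_imp_closed)

lemma energies_cont: "E \<in> energies \<Longrightarrow> continuous_on configs E"
  by (simp add: energies_def)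

lemma energies_add [intro, simp]: "E \<in> energies \<Longrightarrow> F \<in> energies \<Longrightarrow> E + F \<in> energies"
  by (auto simp: energies_def plus_fun_def intro!: continuous_intros)

lemma energies_diff [intro, simp]: "E \<in> energies \<Longrightarrow> F \<in> energies \<Longrightarrow> E - F \<in> energies"
  by (auto simp: energies_def fun_diff_def intro!: continuous_intros)

lemma energies_const [intro, simp]: "(\<lambda>_. c) \<in> energies"
  by (auto simp: energies_def)

lemma energies_0 [intro, simp]: "0 \<in> energies"
  by (simp add: zero_fun_def)

lemma energies_abs [intro]: "E \<in> energies \<Longrightarrow> (\<lambda>\<sigma>. \<bar>E \<sigma>\<bar>) \<in> energies"
  by (auto simp: energies_def intro!: continuous_intros)

lemma energies_sum [intro]: "(\<And>i. i \<in> A \<Longrightarrow> E i \<in> energies) \<Longrightarrow> (\<Sum>i\<in>A. E i) \<in> energies"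
  by (induct A rule: infinite_finite_induct) auto

lemma energies_bdd: assumes "E \<in> energies" shows "bdd_above (E ` configs)"
  using compact_continuous_image[OF energies_cont[OF assms] compact_configs] 
  by (simp add: bounded_imp_bdd_above compact_imp_bounded)

lemma maxE_ge: "E \<in> energies \<Longrightarrow> \<sigma> \<in> configs \<Longrightarrow> E \<sigma> \<le> maxE E"
  unfolding maxE_def by (rule cSUP_upper) (auto intro: energies_bdd)

lemma maxE_le: "(\<And>\<sigma>. \<sigma> \<in> configs \<Longrightarrow> E \<sigma> \<le> c) \<Longrightarrow> maxE E \<le> c"
  unfolding maxE_def by (rule cSUP_least) (auto simp: configs_ne)

lemma maxE_attained: assumes "E \<in> energies" obtains \<sigma> where "\<sigma> \<in> configs" "E \<sigma> = maxE E"
proof -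
  obtain \<sigma> where "\<sigma> \<in> configs" "\<forall>\<tau>\<in>configs. E \<tau> \<le> E \<sigma>"
    using continuous_attains_sup[OF compact_configs configs_ne energies_cont[OF assms]] by blast
  then show thesis using that maxE_ge[OF assms] maxE_le[of E "E \<sigma>"] by (meson antisym)
qed

lemma maxE_cong: "(\<And>\<sigma>. \<sigma> \<in> configs \<Longrightarrow> E \<sigma> = F \<sigma>) \<Longrightarrow> maxE E = maxE F"
  unfolding maxE_def by (rule SUP_cong) auto

lemma maxE_const [simp]: "maxE (\<lambda>_. c) = c"
  unfolding maxE_def using configs_ne by simp

lemma maxE_0 [simp]: "maxE 0 = 0"
  by (simp add: zero_fun_def)

lemma maxE_diff: assumes "E \<in> energies" "F \<in> energies" shows "maxE E - maxE F \<le> maxE (E - F)"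
proof -
  have "maxE E \<le> maxE F + maxE (E - F)"
  proof (rule maxE_le)
    fix \<sigma> assume "\<sigma> \<in> configs"
    with maxE_ge[OF assms(2)] maxE_ge[of "E-F"] assms
    have "F \<sigma> \<le> maxE F" "(E - F) \<sigma> \<le> maxE (E-F)" by auto
    then show "E \<sigma> \<le> maxE F + maxE (E - F)" by (simp add: fun_diff_def)
  qed
  then show ?thesis by simp
qed

lemma nrm_ge: "E \<in> energies \<Longrightarrow> \<sigma> \<in> configs \<Longrightarrow> \<bar>E \<sigma>\<bar> \<le> nrm E"
  unfolding nrm_def using maxE_ge[OF energies_abs] by blast

lemma nrm_le: "(\<And>\<sigma>. \<sigma> \<in> configs \<Longrightarrow> \<bar>E \<sigma>\<bar> \<le> c) \<Longrightarrow> nrm E \<le> c"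
  unfolding nrm_def by (rule maxE_le)

lemma nrm_nonneg [simp]: "E \<in> energies \<Longrightarrow> 0 \<le> nrm E"
  using configs_ne nrm_ge[of E] by force

lemma nrm_0 [simp]: "nrm 0 = 0"
  by (simp add: nrm_def)

lemma nrm_triangle: assumes "E \<in> energies" "F \<in> energies" shows "nrm (E + F) \<le> nrm E + nrm F"
  by (rule nrm_le) (use nrm_ge[OF assms(1)] nrm_ge[OF assms(2)] in \<open>force\<close>)

lemma nrm_sum: "(\<And>i. i \<in> A \<Longrightarrow> E i \<in> energies) \<Longrightarrow> nrm (\<Sum>i\<in>A. E i) \<le> (\<Sum>i\<in>A. nrm (E i))"
proof (induct A rule: infinite_finite_induct)
  case (insert x A)
  have "nrm (\<Sum>i\<in>insert x A. E i) = nrm (E x + (\<Sum>i\<in>A. E i))" by (subst sum.insert) (use insert in auto)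
  also have "\<dots> \<le> nrm (E x) + nrm (\<Sum>i\<in>A. E i)" by (rule nrm_triangle) (use insert.prems in \<open>auto intro!: energies_sum\<close>)
  also have "\<dots> \<le> nrm (E x) + (\<Sum>i\<in>A. nrm (E i))" using insert by simp
  finally show ?case by (simp only: sum.insert[OF insert(1,2)])
qed auto

lemma maxE_le_nrm: "E \<in> energies \<Longrightarrow> maxE E \<le> nrm E"
  by (rule maxE_le) (use nrm_ge in force)

lemma nrm_commute: "nrm (E - F) = nrm (F - E)"
  unfolding nrm_def by (rule maxE_cong) (simp add: abs_minus_commute)

definition dense_configs :: "(nat \<Rightarrow> real) set" where
  "dense_configs = (SOME D. countable D \<and> D \<subseteq> configs \<and> configs \<subseteq> closure D)"

lemma dense_configs: "countable dense_configs" "dense_configs \<subseteq> configs" "closure dense_configs = configs" "dense_configs \<noteq> {}"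
proof -
  have "\<exists>D. countable D \<and> D \<subseteq> configs \<and> configs \<subseteq> closure D"
    by (metis separable)
  then have "countable dense_configs \<and> dense_configs \<subseteq> configs \<and> configs \<subseteq> closure dense_configs"
    unfolding dense_configs_def by (rule someI_ex)
  then have D: "countable dense_configs" "dense_configs \<subseteq> configs" "configs \<subseteq> closure dense_configs" by blast+
  show "countable dense_configs" "dense_configs \<subseteq> configs" and *: "closure dense_configs = configs"
    by (fact D(1), fact D(2), rule antisym[OF closure_minimal[OF D(2) closed_configs] D(3)])
  show "dense_configs \<noteq> {}" using * configs_ne by (metis closure_empty)
qed

lemma space_energy_space [simp]: "space energy_space = energies"
  by (simp add: energy_space_def)

lemma measurable_energy_space [intro]:
  assumes "\<And>x. x \<in> space N \<Longrightarrow> F x \<in> energies" "\<And>\<sigma>. \<sigma> \<in> configs \<Longrightarrow> (\<lambda>x. F x \<sigma>) \<in> borel_measurable N"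
  shows "F \<in> measurable N energy_space"
  unfolding energy_space_def using assms
  by (intro measurable_vimage_algebra2 measurable_restrict) auto

lemma eval_measurable: assumes "\<sigma> \<in> configs" shows "(\<lambda>E. E \<sigma>) \<in> borel_measurable energy_space"
proof -
  have "(\<lambda>E. restrict E configs) \<in> measurable energy_space (PiM configs (\<lambda>_. borel))"
    unfolding energy_space_def by (rule measurable_vimage_algebra1) (auto simp: space_PiM)
  from measurable_compose[OF this measurable_component_singleton[OF assms]] show ?thesis
    using assms by simp
qed

lemma eval_measurable' [measurable (raw)]:
  assumes "F \<in> measurable N energy_space" "\<sigma> \<in> configs" shows "(\<lambda>x. F x \<sigma>) \<in> borel_measurable N"
  using measurable_compose[OF assms(1) eval_measurable[OF assms(2)]] .

lemma le_on_dense: assumes "continuous_on configs E" "\<And>\<sigma>. \<sigma> \<in> dense_configs \<Longrightarrow> E \<sigma> \<le> (c::real)" "\<sigma> \<in> configs" shows "E \<sigma> \<le> c"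
  using continuous_le_on_closure[of dense_configs E \<sigma> c] assms by (simp add: dense_configs(3))

lemma SUP_dense: assumes "continuous_on configs E" shows "(SUP \<sigma>\<in>configs. E \<sigma>) = (SUP \<sigma>\<in>dense_configs. (E \<sigma>::real))"
proof (rule antisym)
  have b: "bdd_above (E ` configs)" using assms energies_bdd by (simp add: energies_def)
  then have b': "bdd_above (E ` dense_configs)" using dense_configs(2) by (meson bdd_above_mono image_mono)
  show "(SUP \<sigma>\<in>configs. E \<sigma>) \<le> (SUP \<sigma>\<in>dense_configs. E \<sigma>)"
    by (rule cSUP_least[OF configs_ne], rule le_on_dense[OF assms]) (simp_all add: cSUP_upper b')
  show "(SUP \<sigma>\<in>dense_configs. E \<sigma>) \<le> (SUP \<sigma>\<in>configs. E \<sigma>)"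
    by (rule cSUP_subset_mono) (auto simp: dense_configs b)
qed

text \<open>
  By continuity the supremum may be taken over a countable dense set.
\<close>

lemma SUP_measurable:
  assumes "\<And>x. x \<in> space N \<Longrightarrow> continuous_on configs (F x)" "\<And>\<sigma>. \<sigma> \<in> configs \<Longrightarrow> (\<lambda>x. F x \<sigma>) \<in> borel_measurable N"
  shows "(\<lambda>x. SUP \<sigma>\<in>configs. (F x \<sigma>::real)) \<in> borel_measurable N"
proof -
  have "(\<lambda>x. SUP \<sigma>\<in>dense_configs. F x \<sigma>) \<in> borel_measurable N"
  proof (rule borel_measurable_cSUP[OF dense_configs(1)])
    show "\<sigma> \<in> dense_configs \<Longrightarrow> (\<lambda>x. F x \<sigma>) \<in> borel_measurable N" for \<sigma> using dense_configs assms(2) by blast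
    show "bdd_above ((\<lambda>\<sigma>. F x \<sigma>) ` dense_configs)" if "x \<in> space N" for x
      using energies_bdd[of "F x"] assms(1)[OF that] image_mono[OF dense_configs(2), of "F x"] bdd_above_mono[of "F x ` configs"] unfolding energies_def by simp
  qed
  then show ?thesis by (subst measurable_cong[OF SUP_dense]) (auto intro: assms(1))
qed

lemma maxE_measurable [measurable]: "maxE \<in> borel_measurable energy_space"
  unfolding maxE_def[abs_def] by (rule SUP_measurable) (auto simp: energies_def intro: eval_measurable)

lemma nrm_measurable [measurable]: "nrm \<in> borel_measurable energy_space"
proof -
  have "(\<lambda>E \<sigma>. \<bar>E \<sigma>\<bar>) \<in> measurable energy_space energy_space"
    by (rule measurable_energy_space) (auto intro: eval_measurable)
  from measurable_compose[OF this maxE_measurable] show ?thesis by (simp add: nrm_def[abs_def])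
qed

lemma energy_space_add_measurable [measurable (raw)]:
  assumes "F \<in> measurable N energy_space" "G \<in> measurable N energy_space" shows "(\<lambda>x. F x + G x) \<in> measurable N energy_space"
proof (rule measurable_energy_space)
  show "F x + G x \<in> energies" if "x \<in> space N" for x using measurable_space[OF assms(1) that] measurable_space[OF assms(2) that] by simp
  show "(\<lambda>x. (F x + G x) \<sigma>) \<in> borel_measurable N" if "\<sigma> \<in> configs" for \<sigma>
    using assms that by simp measurable
qed

lemma energy_space_const_measurable [intro]: "E \<in> energies \<Longrightarrow> (\<lambda>x. E) \<in> measurable N energy_space"
  by simp

lemma energy_space_sum_measurable [measurable (raw)]:
  "(\<And>i. i \<in> A \<Longrightarrow> F i \<in> measurable N energy_space) \<Longrightarrow> (\<lambda>x. \<Sum>i\<in>A. F i x) \<in> measurable N energy_space"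
  by (induct A rule: infinite_finite_induct) (auto intro!: energy_space_add_measurable)

text \<open>
  By uniform continuity on the compact product, nearby \<open>\<sigma>\<close> have uniformly close sections and hence
  close suprema.
\<close>

lemma continuous_partial_SUP:
  assumes "continuous_on (configs \<times> configs) (\<lambda>(\<sigma>, \<tau>). g \<sigma> \<tau> :: real)"
  shows "continuous_on configs (\<lambda>\<sigma>. SUP \<tau>\<in>configs. g \<sigma> \<tau>)"
proof -
  have sec: "(\<lambda>\<tau>. g \<sigma> \<tau>) \<in> energies" if "\<sigma> \<in> configs" for \<sigma>
  proof -
    have "continuous_on configs (\<lambda>\<tau>. case (\<sigma>, \<tau>) of (\<sigma>, \<tau>) \<Rightarrow> g \<sigma> \<tau>)"
      by (rule continuous_on_compose2[OF assms]) (use that in \<open>auto intro!: continuous_on_Pair continuous_on_const continuous_on_id\<close>)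
    then show ?thesis by (simp add: energies_def)
  qed
  have "uniformly_continuous_on (configs \<times> configs) (\<lambda>(\<sigma>, \<tau>). g \<sigma> \<tau>)"
    by (rule compact_uniformly_continuous[OF assms]) (simp add: compact_Times compact_configs)
  note uc = this[unfolded uniformly_continuous_on_def]
  show ?thesis
    unfolding continuous_on_iff
  proof (intro ballI allI impI)
    fix \<sigma> and e :: real assume s: "\<sigma> \<in> configs" and "0 < e"
    then have e2: "e / 2 > 0" by simp
    from uc[rule_format, OF this] obtain d where d: "d > 0"
      "\<And>x y. x \<in> configs \<times> configs \<Longrightarrow> y \<in> configs \<times> configs \<Longrightarrow> dist y x < d \<Longrightarrow> dist (case y of (\<sigma>, \<tau>) \<Rightarrow> g \<sigma> \<tau>) (case x of (\<sigma>, \<tau>) \<Rightarrow> g \<sigma> \<tau>) < e/2"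
      by blast
    show "\<exists>d>0. \<forall>\<sigma>'\<in>configs. dist \<sigma>' \<sigma> < d \<longrightarrow> dist (SUP \<tau>\<in>configs. g \<sigma>' \<tau>) (SUP \<tau>\<in>configs. g \<sigma> \<tau>) < e"
    proof (intro exI[of _ d] conjI ballI impI d(1))
      fix \<sigma>' assume s': "\<sigma>' \<in> configs" "dist \<sigma>' \<sigma> < d"
      have cl: "\<bar>g \<sigma>' \<tau> - g \<sigma> \<tau>\<bar> < e/2" if "\<tau> \<in> configs" for \<tau>
        using d(2)[of "(\<sigma>, \<tau>)" "(\<sigma>', \<tau>)"] s s' that by (simp add: dist_Pair_Pair dist_real_def)
      have "maxE (g \<sigma>') \<le> maxE (g \<sigma>) + e/2"
      proof (rule maxE_le)
        fix \<tau> assume "\<tau> \<in> configs"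
        then show "g \<sigma>' \<tau> \<le> maxE (g \<sigma>) + e/2" using cl[of \<tau>] maxE_ge[OF sec[OF s], of \<tau>] by linarith
      qed
      moreover have "maxE (g \<sigma>) \<le> maxE (g \<sigma>') + e/2"
      proof (rule maxE_le)
        fix \<tau> assume "\<tau> \<in> configs"
        then show "g \<sigma> \<tau> \<le> maxE (g \<sigma>') + e/2" using cl[of \<tau>] maxE_ge[OF sec[OF s'(1)], of \<tau>] by linarith
      qed
      ultimately have "\<bar>maxE (g \<sigma>') - maxE (g \<sigma>)\<bar> \<le> e/2" by linarith
      then show "dist (SUP \<tau>\<in>configs. g \<sigma>' \<tau>) (SUP \<tau>\<in>configs. g \<sigma> \<tau>) < e"
        using \<open>0 < e\<close> by (simp add: dist_real_def maxE_def)
    qed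
  qed
qed

definition overwrite :: "nat set \<Rightarrow> (nat \<Rightarrow> real) \<Rightarrow> (nat \<Rightarrow> real) \<Rightarrow> nat \<Rightarrow> real" where
  "overwrite J \<sigma> \<tau> = (\<lambda>i. if i \<in> J then \<tau> i else \<sigma> i)"

definition partial_max :: "nat set \<Rightarrow> ((nat \<Rightarrow> real) \<Rightarrow> real) \<Rightarrow> (nat \<Rightarrow> real) \<Rightarrow> real" where
  "partial_max J W \<sigma> = (SUP \<tau>\<in>configs. W (overwrite J \<sigma> \<tau>))"

definition depends_on :: "nat set \<Rightarrow> ((nat \<Rightarrow> real) \<Rightarrow> real) \<Rightarrow> bool" where
  "depends_on J U \<longleftrightarrow> (\<forall>\<sigma>\<in>configs. \<forall>\<tau>\<in>configs. (\<forall>i\<in>J. \<sigma> i = \<tau> i) \<longrightarrow> U \<sigma> = U \<tau>)"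

lemma overwrite_configs: "\<sigma> \<in> configs \<Longrightarrow> \<tau> \<in> configs \<Longrightarrow> overwrite J \<sigma> \<tau> \<in> configs"
  by (simp add: overwrite_def configs_iff)

lemma continuous_overwrite: "continuous_on (configs \<times> configs) (\<lambda>(\<sigma>, \<tau>). overwrite J \<sigma> \<tau>)"
proof -
  have "continuous_on (configs \<times> configs) (\<lambda>x. overwrite J (fst x) (snd x) i)" for i
  proof -
    have "continuous_on (configs \<times> configs) (\<lambda>x. fst x i)" "continuous_on (configs \<times> configs) (\<lambda>x. snd x i)"
      by (rule continuous_on_product_then_coordinatewise, intro continuous_intros)+
    then show ?thesis by (cases "i \<in> J") (simp_all add: overwrite_def)
  qed
  then show ?thesis unfolding split_beta by (rule continuous_on_coordinatewise_then_product)
qed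

lemma partial_max_energies: assumes "W \<in> energies" shows "partial_max J W \<in> energies"
proof -
  have "continuous_on (configs \<times> configs) (\<lambda>x. W (case x of (\<sigma>, \<tau>) \<Rightarrow> overwrite J \<sigma> \<tau>))"
    by (rule continuous_on_compose2[OF energies_cont[OF assms] continuous_overwrite]) (auto simp: overwrite_configs)
  then have "continuous_on configs (\<lambda>\<sigma>. SUP \<tau>\<in>configs. W (overwrite J \<sigma> \<tau>))"
    by (intro continuous_partial_SUP) (simp add: split_beta)
  then show ?thesis by (simp add: energies_def partial_max_def[abs_def])
qed

lemma sec_energies: assumes "W \<in> energies" "\<sigma> \<in> configs" shows "(\<lambda>\<tau>. W (overwrite J \<sigma> \<tau>)) \<in> energies"
proof -
  have c: "continuous_on configs (\<lambda>\<tau>. overwrite J \<sigma> \<tau>)"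
  proof -
    have "continuous_on configs (\<lambda>\<tau>. case (\<sigma>, \<tau>) of (\<sigma>, \<tau>) \<Rightarrow> overwrite J \<sigma> \<tau>)"
      by (rule continuous_on_compose2[OF continuous_overwrite]) (use assms(2) in \<open>auto intro!: continuous_on_Pair continuous_on_const continuous_on_id\<close>)
    then show ?thesis by simp
  qed
  have "continuous_on configs (\<lambda>\<tau>. W (overwrite J \<sigma> \<tau>))"
    by (rule continuous_on_compose2[OF energies_cont[OF assms(1)] c]) (use assms(2) in \<open>auto simp: overwrite_configs\<close>)
  then show ?thesis by (simp add: energies_def)
qed

lemma partial_max_eq_maxE: "partial_max J W \<sigma> = maxE (\<lambda>\<tau>. W (overwrite J \<sigma> \<tau>))"
  by (simp add: partial_max_def maxE_def)

lemma partial_max_ge: "W \<in> energies \<Longrightarrow> \<sigma> \<in> configs \<Longrightarrow> \<tau> \<in> configs \<Longrightarrow> W (overwrite J \<sigma> \<tau>) \<le> partial_max J W \<sigma>"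
  unfolding partial_max_eq_maxE by (rule maxE_ge[OF sec_energies])

lemma partial_max_ge_self: assumes "W \<in> energies" "\<sigma> \<in> configs" shows "W \<sigma> \<le> partial_max J W \<sigma>"
  using partial_max_ge[OF assms assms(2), of J] by (simp add: overwrite_def cong: if_cong)

lemma maxE_partial_max: assumes "W \<in> energies" shows "maxE (partial_max J W) = maxE W"
proof (rule antisym)
  show "maxE (partial_max J W) \<le> maxE W"
    by (intro maxE_le) (auto simp: partial_max_eq_maxE intro!: maxE_le maxE_ge overwrite_configs assms)
  show "maxE W \<le> maxE (partial_max J W)"
    using order_trans[OF partial_max_ge_self[OF assms] maxE_ge[OF partial_max_energies[OF assms]]] by (intro maxE_le)
qed

lemma maxE_add_const: assumes "W \<in> energies" shows "maxE (\<lambda>\<sigma>. W \<sigma> + c) = maxE W + c"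
proof (rule antisym)
  show "maxE (\<lambda>\<sigma>. W \<sigma> + c) \<le> maxE W + c" by (rule maxE_le) (simp add: maxE_ge assms)
  have cc: "(\<lambda>\<sigma>. W \<sigma> + c) \<in> energies" using energies_add[OF assms energies_const[of c]] by (simp add: plus_fun_def)
  obtain \<sigma> where "\<sigma> \<in> configs" "W \<sigma> = maxE W" using maxE_attained[OF assms] .
  then show "maxE W + c \<le> maxE (\<lambda>\<sigma>. W \<sigma> + c)" using maxE_ge[OF cc] by metis
qed

lemma depends_onD: "depends_on J U \<Longrightarrow> \<sigma> \<in> configs \<Longrightarrow> \<tau> \<in> configs \<Longrightarrow> (\<And>i. i \<in> J \<Longrightarrow> \<sigma> i = \<tau> i) \<Longrightarrow> U \<sigma> = U \<tau>"
  unfolding depends_on_def by blast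

lemma depends_on_mono: "depends_on J U \<Longrightarrow> J \<subseteq> J' \<Longrightarrow> depends_on J' U"
  unfolding depends_on_def by blast

lemma depends_on_add: "depends_on J U \<Longrightarrow> depends_on J W \<Longrightarrow> depends_on J (U + W)"
  unfolding depends_on_def plus_fun_apply by metis

lemma depends_on_0 [simp]: "depends_on J 0" by (simp add: depends_on_def)

text \<open>
  Maximising over the coordinates in \<open>J\<close> treats a term that ignores them as a constant.
\<close>

lemma partial_max_add_depends_on: assumes "W \<in> energies" "depends_on J' U" "J' \<inter> J = {}" "\<sigma> \<in> configs"
  shows "partial_max J (W + U) \<sigma> = partial_max J W \<sigma> + U \<sigma>"
proof -
  have "partial_max J (W + U) \<sigma> = maxE (\<lambda>\<tau>. W (overwrite J \<sigma> \<tau>) + U \<sigma>)"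
    unfolding partial_max_eq_maxE
  proof (rule maxE_cong)
    fix \<tau> assume "\<tau> \<in> configs"
    then have "U (overwrite J \<sigma> \<tau>) = U \<sigma>" using assms by (intro depends_onD[OF assms(2)]) (auto simp: overwrite_configs, auto simp: overwrite_def)
    then show "(W + U) (overwrite J \<sigma> \<tau>) = W (overwrite J \<sigma> \<tau>) + U \<sigma>" by simp
  qed
  also have "\<dots> = partial_max J W \<sigma> + U \<sigma>" by (simp add: maxE_add_const sec_energies assms partial_max_eq_maxE)
  finally show ?thesis .
qed

end

section \<open>Infinite products and Poisson moments\<close>

abbreviation iid :: "'a measure \<Rightarrow> (nat \<Rightarrow> 'a) measure" where "iid M \<equiv> PiM UNIV (\<lambda>_. M)"

lemma (in prob_space) integrable_pair_fst:
  assumes "prob_space N" "integrable M f"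
  shows "integrable (M \<Otimes>\<^sub>M N) (\<lambda>x. f (fst x) :: real)"
proof -
  interpret N: prob_space N by fact
  have "distr (M \<Otimes>\<^sub>M N) M fst = M" by (rule N.distr_pair_fst)
  then have "integrable (distr (M \<Otimes>\<^sub>M N) M fst) f" using assms by simp
  then show ?thesis by (subst (asm) integrable_distr_eq) (use assms in auto)
qed

lemma (in prob_space) integrable_pair_snd:
  assumes "prob_space N" "integrable N f"
  shows "integrable (M \<Otimes>\<^sub>M N) (\<lambda>x. f (snd x) :: real)"
proof -
  interpret N: prob_space N by fact
  interpret P: pair_prob_space N M ..
  have "integrable (N \<Otimes>\<^sub>M M) (\<lambda>x. f (fst x))" by (rule N.integrable_pair_fst[OF prob_space_axioms assms(2)])
  then have "integrable (M \<Otimes>\<^sub>M N) (\<lambda>(x, y). (\<lambda>x. f (fst x)) (y, x))"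
    by (rule P.integrable_product_swap)
  then show ?thesis by (simp add: case_prod_beta')
qed

lemma sequence_space_prob: assumes "prob_space M" shows "sequence_space M"
proof -
  interpret prob_space M by fact
  show ?thesis by unfold_locales
qed

lemma nn_integral_PiM_iter:
  assumes "prob_space M" "f \<in> borel_measurable (iid M)"
  shows "(\<integral>\<^sup>+z. f z \<partial>iid M) = (\<integral>\<^sup>+x. \<integral>\<^sup>+z. f (case_nat x z) \<partial>iid M \<partial>M)"
proof -
  interpret sequence_space M by (rule sequence_space_prob) fact
  note [measurable] = assms(2)
  have "(\<integral>\<^sup>+z. f z \<partial>S) = (\<integral>\<^sup>+z. f z \<partial>distr (M \<Otimes>\<^sub>M S) S (\<lambda>(s, \<omega>). case_nat s \<omega>))" by (simp add: PiM_iter)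
  also have "\<dots> = (\<integral>\<^sup>+x. f (case_nat (fst x) (snd x)) \<partial>(M \<Otimes>\<^sub>M S))"
    by (subst nn_integral_distr) (auto simp: split_beta)
  also have "\<dots> = (\<integral>\<^sup>+x. \<integral>\<^sup>+z. f (case_nat x z) \<partial>S \<partial>M)"
    by (subst P.nn_integral_fst[symmetric]) auto
  finally show ?thesis .
qed

lemma nn_integral_PiM_comb_seq:
  assumes "prob_space M" "f \<in> borel_measurable (iid M)"
  shows "(\<integral>\<^sup>+z. f z \<partial>iid M) =
    (\<integral>\<^sup>+x. \<integral>\<^sup>+z. f (comb_seq n x z) \<partial>iid M \<partial>iid M)"
proof -
  interpret sequence_space M by (rule sequence_space_prob) fact
  note [measurable] = assms(2)
  have "(\<integral>\<^sup>+z. f z \<partial>S) = (\<integral>\<^sup>+z. f z \<partial>distr (S \<Otimes>\<^sub>M S) S (\<lambda>(s, \<omega>). comb_seq n s \<omega>))" by (simp add: PiM_comb_seq)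
  also have "\<dots> = (\<integral>\<^sup>+x. f (comb_seq n (fst x) (snd x)) \<partial>(S \<Otimes>\<^sub>M S))"
    by (subst nn_integral_distr) (auto simp: split_beta)
  also have "\<dots> = (\<integral>\<^sup>+x. \<integral>\<^sup>+z. f (comb_seq n x z) \<partial>S \<partial>S)"
    by (subst P.nn_integral_fst[symmetric]) auto
  finally show ?thesis .
qed

lemma measure_eqI_nn_integral:
  assumes "sets M = sets N" "\<And>F. F \<in> borel_measurable M \<Longrightarrow> (\<integral>\<^sup>+x. F x \<partial>M) = (\<integral>\<^sup>+x. F x \<partial>N)"
  shows "M = N"
proof (rule measure_eqI[OF assms(1)])
  fix A assume A: "A \<in> sets M"
  then have "emeasure M A = (\<integral>\<^sup>+x. indicator A x \<partial>M)" by simp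
  also have "\<dots> = (\<integral>\<^sup>+x. indicator A x \<partial>N)" by (rule assms(2)) (use A in simp)
  also have "\<dots> = emeasure N A" using A assms(1) by simp
  finally show "emeasure M A = emeasure N A" .
qed

lemma nn_integral_poisson:
  assumes "0 < m"
  shows "(\<integral>\<^sup>+r. f r \<partial>measure_pmf (poisson_pmf m)) = (\<Sum>r. ennreal (m ^ r / fact r * exp (- m)) * f r)"
  using assms by (simp add: nn_integral_measure_pmf nn_integral_count_space_nat)

text \<open>
  Shifting the index in the Poisson series absorbs one factor \<open>r\<close>. The first two moments follow.
\<close>

lemma poisson_falling_moment:
  assumes "0 < m" and that: "\<And>r. 0 \<le> g r"
  shows "(\<integral>\<^sup>+r. ennreal (real r * g (r - 1)) \<partial>measure_pmf (poisson_pmf m)) = ennreal m * (\<integral>\<^sup>+r. ennreal (g r) \<partial>measure_pmf (poisson_pmf m))"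
proof -
  have "(\<Sum>r. ennreal (m ^ r / fact r * exp (- m)) * ennreal (real r * g (r - 1)))
     = (\<Sum>r. ennreal (m ^ Suc r / fact (Suc r) * exp (- m)) * ennreal (real (Suc r) * g r))"
    by (subst suminf_offset[of _ 1]) (auto intro!: summableI)
  also have "\<dots> = (\<Sum>r. ennreal m * (ennreal (m ^ r / fact r * exp (- m)) * ennreal (g r)))"
  proof (rule suminf_cong)
    fix r
    have "m ^ Suc r / fact (Suc r) * exp (- m) * (real (Suc r) * g r) = m * (m ^ r / fact r * exp (- m) * g r)"
      by (simp add: field_simps del: of_nat_Suc)
    then show "ennreal (m ^ Suc r / fact (Suc r) * exp (- m)) * ennreal (real (Suc r) * g r) =
      ennreal m * (ennreal (m ^ r / fact r * exp (- m)) * ennreal (g r))"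
      using that assms by (simp add: ennreal_mult[symmetric] del: of_nat_Suc)
  qed
  finally show ?thesis using assms by (simp add: nn_integral_poisson)
qed

lemma poisson_mean_nn:
  assumes "0 < m" shows "(\<integral>\<^sup>+r. ennreal (real r) \<partial>measure_pmf (poisson_pmf m)) = ennreal m"
  using poisson_falling_moment[OF assms, of "\<lambda>_. 1"] by simp

lemma poisson_integrable: assumes "0 < m" shows "integrable (measure_pmf (poisson_pmf m)) real"
  by (rule integrableI_nonneg) (auto simp: poisson_mean_nn assms)

lemma poisson_mean: assumes "0 < m" shows "(\<integral>r. real r \<partial>measure_pmf (poisson_pmf m)) = m"
  by (rule integral_eq_nn_integral[THEN trans]) (auto simp: poisson_mean_nn assms order_less_imp_le)

lemma poisson_second_moment:
  assumes "0 < m" shows "(\<integral>\<^sup>+r. ennreal ((real r)\<^sup>2) \<partial>measure_pmf (poisson_pmf m)) = ennreal (m\<^sup>2 + m)"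
proof -
  have "(\<integral>\<^sup>+r. ennreal ((real r)\<^sup>2) \<partial>measure_pmf (poisson_pmf m)) =
    (\<integral>\<^sup>+r. ennreal (real r * (real (r - 1) + 1)) \<partial>measure_pmf (poisson_pmf m))"
    by (rule nn_integral_cong) (simp add: power2_eq_square of_nat_diff split: nat_diff_split)
  also have "\<dots> = ennreal m * (\<integral>\<^sup>+r. ennreal (real r) + 1 \<partial>measure_pmf (poisson_pmf m))"
    by (subst poisson_falling_moment[OF assms, of "\<lambda>r. real r + 1"]) (auto simp: ennreal_plus)
  also have "\<dots> = ennreal m * (ennreal m + 1)"
    by (subst nn_integral_add) (auto simp: poisson_mean_nn assms)
  also have "\<dots> = ennreal (m\<^sup>2 + m)"
    using assms by (simp add: ennreal_mult[symmetric] ennreal_1[symmetric] ennreal_plus[symmetric] algebra_simps power2_eq_square del: ennreal_1 ennreal_plus)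
  finally show ?thesis .
qed

section \<open>Averaging over random increments\<close>

context spin_space
begin

text \<open>
  The inequality with \<open>maxE (E - F)\<close> packs two properties into one: being 1-Lipschitz, and commuting
  with the addition of constants.
\<close>

definition observables :: "(((nat \<Rightarrow> real) \<Rightarrow> real) \<Rightarrow> real) set" where
  "observables = {\<Phi> \<in> borel_measurable energy_space. \<forall>E\<in>energies. \<forall>F\<in>energies. \<Phi> E - \<Phi> F \<le> maxE (E - F)}"

definition increment :: "((nat \<Rightarrow> real) \<Rightarrow> real) measure \<Rightarrow> bool" where
  "increment \<mu> \<longleftrightarrow> prob_space \<mu> \<and> sets \<mu> = sets energy_space \<and> integrable \<mu> nrm"

definition mean_nrm :: "((nat \<Rightarrow> real) \<Rightarrow> real) measure \<Rightarrow> real" where "mean_nrm \<mu> = (\<integral>Z. nrm Z \<partial>\<mu>)"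

definition avg :: "((nat \<Rightarrow> real) \<Rightarrow> real) measure \<Rightarrow> (((nat \<Rightarrow> real) \<Rightarrow> real) \<Rightarrow> real) \<Rightarrow> ((nat \<Rightarrow> real) \<Rightarrow> real) \<Rightarrow> real" where
  "avg \<mu> \<Phi> E = (\<integral>Z. \<Phi> (E + Z) \<partial>\<mu>)"

lemma observables_meas: "\<Phi> \<in> observables \<Longrightarrow> \<Phi> \<in> borel_measurable energy_space"
  by (simp add: observables_def)

lemma observables_diff: "\<Phi> \<in> observables \<Longrightarrow> E \<in> energies \<Longrightarrow> F \<in> energies \<Longrightarrow> \<Phi> E - \<Phi> F \<le> maxE (E - F)"
  by (simp add: observables_def)

lemma observables_abs: assumes "\<Phi> \<in> observables" "E \<in> energies" "F \<in> energies" shows "\<bar>\<Phi> E - \<Phi> F\<bar> \<le> nrm (E - F)"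
  using observables_diff[OF assms] observables_diff[OF assms(1,3,2)] maxE_le_nrm[of "E - F"] maxE_le_nrm[of "F - E"] assms
  by (simp add: nrm_commute[of F E])

lemma observables_eq_on_configs: assumes "\<Phi> \<in> observables" "E \<in> energies" "F \<in> energies" "\<And>\<sigma>. \<sigma> \<in> configs \<Longrightarrow> E \<sigma> = F \<sigma>" shows "\<Phi> E = \<Phi> F"
proof -
  have "nrm (E - F) \<le> 0" by (rule nrm_le) (simp add: assms(4) fun_diff_def)
  then show ?thesis using observables_abs[OF assms(1-3)] by linarith
qed

lemma observables_shift: assumes "\<Phi> \<in> observables" "E \<in> energies" shows "\<Phi> (E + (\<lambda>_. c)) = \<Phi> E + c"
proof -
  have "E + (\<lambda>_. c) - E = (\<lambda>_. c)" "E - (E + (\<lambda>_. c)) = (\<lambda>_. - c)" by (auto simp: fun_diff_def)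
  then show ?thesis using observables_diff[OF assms(1), of "E + (\<lambda>_. c)" E] observables_diff[OF assms(1), of E "E + (\<lambda>_. c)"] assms
    by simp
qed

lemma maxE_observables: "maxE \<in> observables"
  by (simp add: observables_def maxE_measurable maxE_diff)

lemma observables_translate: assumes "\<Phi> \<in> observables" "A \<in> energies" shows "(\<lambda>E. \<Phi> (E + A)) \<in> observables"
proof -
  have "(\<lambda>E. \<Phi> (E + A)) \<in> borel_measurable energy_space"
    by (rule measurable_compose[OF _ observables_meas[OF assms(1)]], intro energy_space_add_measurable energy_space_const_measurable) (use assms in auto)
  moreover have "\<Phi> (E + A) - \<Phi> (F + A) \<le> maxE (E - F)" if "E \<in> energies" "F \<in> energies" for E F
    using observables_diff[OF assms(1), of "E + A" "F + A"] that assms by (simp add: fun_diff_def)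
  ultimately show ?thesis by (simp add: observables_def)
qed

lemma shiftL_measurable: "E \<in> energies \<Longrightarrow> F \<in> measurable N energy_space \<Longrightarrow> (\<lambda>x. E + F x) \<in> measurable N energy_space"
  by (intro energy_space_add_measurable energy_space_const_measurable)

lemma shift_energy_space: "E \<in> energies \<Longrightarrow> sets N = sets energy_space \<Longrightarrow> (\<lambda>Z. E + Z) \<in> measurable N energy_space"
  by (rule shiftL_measurable) auto

lemma incrementD: "increment \<mu> \<Longrightarrow> prob_space \<mu>" "increment \<mu> \<Longrightarrow> sets \<mu> = sets energy_space" "increment \<mu> \<Longrightarrow> integrable \<mu> nrm"
  by (auto simp: increment_def)

lemma increment_space: "increment \<mu> \<Longrightarrow> space \<mu> = energies"
  using sets_eq_imp_space_eq[OF incrementD(2)] by simp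

lemma mean_nrm_nonneg: "increment \<mu> \<Longrightarrow> 0 \<le> mean_nrm \<mu>"
  unfolding mean_nrm_def by (rule integral_nonneg_AE, rule AE_I2) (simp add: increment_space)

lemma avg_integrable: assumes "increment \<mu>" "\<Phi> \<in> observables" "E \<in> energies" shows "integrable \<mu> (\<lambda>Z. \<Phi> (E + Z))"
proof -
  interpret prob_space \<mu> using incrementD assms by auto
  note [measurable_cong] = incrementD(2)[OF assms(1)]
  note [measurable] = observables_meas[OF assms(2)] incrementD(3)[OF assms(1)]
  have [measurable]: "(\<lambda>Z. E + Z) \<in> measurable \<mu> energy_space" using assms by (intro shift_energy_space incrementD)
  show ?thesis
  proof (rule Bochner_Integration.integrable_bound[of _ "\<lambda>Z. \<bar>\<Phi> E\<bar> + nrm Z"])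
    show "integrable \<mu> (\<lambda>Z. \<bar>\<Phi> E\<bar> + nrm Z)" using incrementD(3)[OF assms(1)] by simp
    show "(\<lambda>Z. \<Phi> (E + Z)) \<in> borel_measurable \<mu>" by measurable
    show "AE Z in \<mu>. norm (\<Phi> (E + Z)) \<le> norm (\<bar>\<Phi> E\<bar> + nrm Z)"
    proof (rule AE_I2)
      fix Z assume "Z \<in> space \<mu>" then have "Z \<in> energies" using increment_space assms by auto
      with observables_abs[OF assms(2), of "E + Z" E] assms(3) show "norm (\<Phi> (E + Z)) \<le> norm (\<bar>\<Phi> E\<bar> + nrm Z)"
        by (simp add: fun_diff_def)
    qed
  qed
qed

text \<open>
  Observables are closed under averaging, so successive random increments can be treated one at a time.
\<close>

lemma avg_observables: assumes "increment \<mu>" "\<Phi> \<in> observables" shows "avg \<mu> \<Phi> \<in> observables"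
proof -
  interpret prob_space \<mu> using incrementD assms by auto
  note [measurable_cong] = incrementD(2)[OF assms(1)]
  note [measurable] = observables_meas[OF assms(2)]
  have "avg \<mu> \<Phi> \<in> borel_measurable energy_space"
    unfolding avg_def[abs_def] by measurable
  moreover have "avg \<mu> \<Phi> E - avg \<mu> \<Phi> F \<le> maxE (E - F)" if "E \<in> energies" "F \<in> energies" for E F
  proof -
    have "avg \<mu> \<Phi> E - avg \<mu> \<Phi> F = (\<integral>Z. \<Phi> (E + Z) - \<Phi> (F + Z) \<partial>\<mu>)"
      unfolding avg_def using that assms by (intro Bochner_Integration.integral_diff[symmetric] avg_integrable)
    also have "\<dots> \<le> (\<integral>Z. maxE (E - F) \<partial>\<mu>)"
    proof (rule integral_mono)
      show "integrable \<mu> (\<lambda>Z. \<Phi> (E + Z) - \<Phi> (F + Z))" using that assms by (intro Bochner_Integration.integrable_diff avg_integrable)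
      fix Z assume "Z \<in> space \<mu>"
      then have "Z \<in> energies" using increment_space assms by auto
      with observables_diff[OF assms(2), of "E + Z" "F + Z"] that show "\<Phi> (E + Z) - \<Phi> (F + Z) \<le> maxE (E - F)"
        by (simp add: fun_diff_def)
    qed simp
    also have "\<dots> = maxE (E - F)" using prob_space by simp
    finally show ?thesis .
  qed
  ultimately show ?thesis by (simp add: observables_def)
qed

lemma avg_cong: assumes "increment \<mu>" "E \<in> energies" "\<And>E. E \<in> energies \<Longrightarrow> \<Phi> E = \<Psi> E" shows "avg \<mu> \<Phi> E = avg \<mu> \<Psi> E"
  unfolding avg_def by (rule Bochner_Integration.integral_cong) (use assms increment_space in auto)

lemma avg_bound: assumes "increment \<mu>" "\<Phi> \<in> observables" "E \<in> energies" shows "\<bar>avg \<mu> \<Phi> E - \<Phi> E\<bar> \<le> mean_nrm \<mu>"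
proof -
  interpret prob_space \<mu> using incrementD assms by auto
  have "avg \<mu> \<Phi> E - \<Phi> E = (\<integral>Z. \<Phi> (E + Z) - \<Phi> E \<partial>\<mu>)"
    unfolding avg_def using avg_integrable[OF assms] prob_space by (subst Bochner_Integration.integral_diff) auto
  also have "\<bar>\<dots>\<bar> \<le> (\<integral>Z. nrm Z \<partial>\<mu>)"
  proof (rule integral_abs_bound[THEN order_trans], rule integral_mono)
    show "integrable \<mu> (\<lambda>Z. \<bar>\<Phi> (E + Z) - \<Phi> E\<bar>)" using avg_integrable[OF assms] by auto
    show "integrable \<mu> nrm" using incrementD assms by auto
    fix Z assume "Z \<in> space \<mu>"
    then have "Z \<in> energies" using increment_space assms by auto
    with observables_abs[OF assms(2), of "E + Z" E] assms(3) show "\<bar>\<Phi> (E + Z) - \<Phi> E\<bar> \<le> nrm Z" by (simp add: fun_diff_def)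
  qed
  finally show ?thesis by (simp add: mean_nrm_def)
qed

lemma avg_translate: "avg \<mu> (\<lambda>E. \<Phi> (E + A)) E = avg \<mu> \<Phi> (E + A)"
  by (simp add: avg_def add.commute add.left_commute)

lemma avg_pair: assumes "increment \<mu>" "increment \<nu>" "\<Phi> \<in> observables" "E \<in> energies"
  shows "avg \<mu> (avg \<nu> \<Phi>) E = (\<integral>x. \<Phi> (E + (fst x + snd x)) \<partial>(\<mu> \<Otimes>\<^sub>M \<nu>))"
    "integrable (\<mu> \<Otimes>\<^sub>M \<nu>) (\<lambda>x. \<Phi> (E + (fst x + snd x)))"
proof -
  interpret M: prob_space \<mu> using incrementD assms by auto
  interpret N: prob_space \<nu> using incrementD assms by auto
  interpret P: pair_prob_space \<mu> \<nu> ..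
  note [measurable_cong] = incrementD(2)[OF assms(1)] incrementD(2)[OF assms(2)]
  note [measurable] = observables_meas[OF assms(3)]
  have [measurable]: "(\<lambda>x. E + (fst x + snd x)) \<in> measurable (\<mu> \<Otimes>\<^sub>M \<nu>) energy_space"
    by (rule shiftL_measurable[OF assms(4)]) measurable
  show int: "integrable (\<mu> \<Otimes>\<^sub>M \<nu>) (\<lambda>x. \<Phi> (E + (fst x + snd x)))"
  proof (rule Bochner_Integration.integrable_bound[of _ "\<lambda>x. \<bar>\<Phi> E\<bar> + (nrm (fst x) + nrm (snd x))"])
    show "integrable (\<mu> \<Otimes>\<^sub>M \<nu>) (\<lambda>x. \<bar>\<Phi> E\<bar> + (nrm (fst x) + nrm (snd x)))"
      using M.integrable_pair_fst[OF N.prob_space_axioms incrementD(3)[OF assms(1)]]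
        M.integrable_pair_snd[OF N.prob_space_axioms incrementD(3)[OF assms(2)]] by simp
    show "AE x in \<mu> \<Otimes>\<^sub>M \<nu>. norm (\<Phi> (E + (fst x + snd x))) \<le> norm (\<bar>\<Phi> E\<bar> + (nrm (fst x) + nrm (snd x)))"
    proof (rule AE_I2)
      fix x assume "x \<in> space (\<mu> \<Otimes>\<^sub>M \<nu>)"
      then have x: "fst x \<in> energies" "snd x \<in> energies" using increment_space assms by (auto simp: space_pair_measure)
      then have "\<bar>\<Phi> (E + (fst x + snd x)) - \<Phi> E\<bar> \<le> nrm (fst x + snd x)"
        using observables_abs[OF assms(3), of "E + (fst x + snd x)" E] assms(4) by (simp del: plus_fun_apply)
      with nrm_triangle[OF x] x show "norm (\<Phi> (E + (fst x + snd x))) \<le> norm (\<bar>\<Phi> E\<bar> + (nrm (fst x) + nrm (snd x)))"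
        by simp
    qed
  qed measurable
  have "avg \<mu> (avg \<nu> \<Phi>) E = (\<integral>Z. \<integral>W. (\<lambda>x. \<Phi> (E + (fst x + snd x))) (Z, W) \<partial>\<nu> \<partial>\<mu>)"
    by (simp add: avg_def add.assoc)
  also have "\<dots> = (\<integral>x. \<Phi> (E + (fst x + snd x)) \<partial>(\<mu> \<Otimes>\<^sub>M \<nu>))"
    by (rule P.integral_fst'[OF int])
  finally show "avg \<mu> (avg \<nu> \<Phi>) E = (\<integral>x. \<Phi> (E + (fst x + snd x)) \<partial>(\<mu> \<Otimes>\<^sub>M \<nu>))" .
qed

lemma avg_commute: assumes "increment \<mu>" "increment \<nu>" "\<Phi> \<in> observables" "E \<in> energies"
  shows "avg \<mu> (avg \<nu> \<Phi>) E = avg \<nu> (avg \<mu> \<Phi>) E"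
proof -
  interpret M: prob_space \<mu> using incrementD assms by auto
  interpret N: prob_space \<nu> using incrementD assms by auto
  interpret P: pair_prob_space \<mu> \<nu> ..
  have "(\<integral>x. \<Phi> (E + (fst x + snd x)) \<partial>(\<mu> \<Otimes>\<^sub>M \<nu>)) = (\<integral>x. \<Phi> (E + (snd x + fst x)) \<partial>(\<nu> \<Otimes>\<^sub>M \<mu>))"
    by (subst P.integral_product_swap[OF borel_measurable_integrable[OF avg_pair(2)[OF assms]], symmetric]) (simp add: case_prod_beta')
  then show ?thesis
    unfolding avg_pair(1)[OF assms] avg_pair(1)[OF assms(2,1,3,4)] by (simp only: add.commute)
qed

section \<open>Compound Poisson sums\<close>

definition convolve where "convolve \<mu> \<nu> = distr (\<mu> \<Otimes>\<^sub>M \<nu>) energy_space (\<lambda>x. fst x + snd x)"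

lemma nn_integral_convolve: assumes "increment \<mu>" "increment \<nu>" and [measurable]: "F \<in> borel_measurable energy_space"
  shows "(\<integral>\<^sup>+Z. F Z \<partial>convolve \<mu> \<nu>) = (\<integral>\<^sup>+Z. \<integral>\<^sup>+W. F (Z + W) \<partial>\<nu> \<partial>\<mu>)"
proof -
  interpret N: prob_space \<nu> using incrementD assms by auto
  note [measurable_cong] = incrementD(2)[OF assms(1)] incrementD(2)[OF assms(2)]
  show ?thesis unfolding convolve_def by (simp add: nn_integral_distr N.nn_integral_fst[symmetric])
qed

lemma avg_convolve: assumes "increment \<mu>" "increment \<nu>" "\<Phi> \<in> observables" "E \<in> energies"
  shows "avg (convolve \<mu> \<nu>) \<Phi> E = avg \<mu> (avg \<nu> \<Phi>) E"
proof -
  note [measurable_cong] = incrementD(2)[OF assms(1)] incrementD(2)[OF assms(2)]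
  note [measurable] = observables_meas[OF assms(3)]
  have [measurable]: "(\<lambda>Z. E + Z) \<in> measurable energy_space energy_space" using assms(4) by (intro shift_energy_space) auto
  have "avg (convolve \<mu> \<nu>) \<Phi> E = (\<integral>x. \<Phi> (E + (fst x + snd x)) \<partial>(\<mu> \<Otimes>\<^sub>M \<nu>))"
    unfolding avg_def convolve_def by (subst integral_distr) auto
  then show ?thesis using avg_pair[OF assms] by simp
qed

definition iid_sum where "iid_sum \<mu> r = distr (iid \<mu>) energy_space (\<lambda>z. \<Sum>k<r. z k)"

definition cpoisson where
  "cpoisson \<mu> m = distr (measure_pmf (poisson_pmf m) \<Otimes>\<^sub>M iid \<mu>) energy_space (\<lambda>(r, z). \<Sum>k<r. z k)"

lemma partial_sum_measurable: assumes [measurable_cong]: "sets \<mu> = sets energy_space"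
  shows "(\<lambda>z. \<Sum>k<r. z k) \<in> measurable (iid \<mu>) energy_space"
  by measurable

lemma partial_sum_pair_measurable: assumes [measurable_cong]: "sets \<mu> = sets energy_space"
  shows "(\<lambda>(r, z). \<Sum>k<r. z k) \<in> measurable (measure_pmf w \<Otimes>\<^sub>M iid \<mu>) energy_space"
proof -
  have "(\<lambda>(r, z). \<Sum>k<r. z k) \<in> measurable (count_space UNIV \<Otimes>\<^sub>M iid \<mu>) energy_space"
    by (rule measurable_pair_measure_countable1) (auto intro!: partial_sum_measurable assms)
  then show ?thesis by (subst measurable_cong_sets[OF sets_pair_measure_cong[OF sets_measure_pmf_count_space refl] refl])
qed

lemma sets_iid_sum [simp, measurable_cong]: "sets (iid_sum \<mu> r) = sets energy_space" by (simp add: iid_sum_def)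
lemma sets_cpoisson [simp, measurable_cong]: "sets (cpoisson \<mu> m) = sets energy_space" by (simp add: cpoisson_def)

lemma prob_iid_sum: assumes "increment \<mu>" shows "prob_space (iid_sum \<mu> r)"
  unfolding iid_sum_def by (rule prob_space.prob_space_distr) (auto intro!: prob_space_PiM partial_sum_measurable incrementD assms)

lemma nn_integral_iid_sum: assumes "increment \<mu>" and [measurable]: "F \<in> borel_measurable energy_space"
  shows "(\<integral>\<^sup>+Z. F Z \<partial>iid_sum \<mu> r) = (\<integral>\<^sup>+z. F (\<Sum>k<r. z k) \<partial>iid \<mu>)"
  unfolding iid_sum_def by (subst nn_integral_distr) (auto intro!: partial_sum_measurable incrementD assms)

lemma nn_integral_iid_sum_0: assumes "increment \<mu>" and [measurable]: "F \<in> borel_measurable energy_space"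
  shows "(\<integral>\<^sup>+Z. F Z \<partial>iid_sum \<mu> 0) = F 0"
proof -
  interpret prob_space "iid \<mu>" using incrementD assms by (auto intro!: prob_space_PiM)
  show ?thesis by (simp add: nn_integral_iid_sum[OF assms] emeasure_space_1)
qed

lemma nn_integral_iid_sum_Suc: assumes "increment \<mu>" and [measurable]: "F \<in> borel_measurable energy_space"
  shows "(\<integral>\<^sup>+Z. F Z \<partial>iid_sum \<mu> (Suc r)) = (\<integral>\<^sup>+Z. \<integral>\<^sup>+W. F (Z + W) \<partial>iid_sum \<mu> r \<partial>\<mu>)"
proof -
  note [measurable_cong] = incrementD(2)[OF assms(1)]
  note [measurable] = partial_sum_measurable[OF incrementD(2)[OF assms(1)]]
  have "(\<integral>\<^sup>+Z. F Z \<partial>iid_sum \<mu> (Suc r)) = (\<integral>\<^sup>+x. \<integral>\<^sup>+z. F (\<Sum>k<Suc r. case_nat x z k) \<partial>iid \<mu> \<partial>\<mu>)"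
    by (simp only: nn_integral_iid_sum[OF assms], subst nn_integral_PiM_iter) (auto intro: incrementD assms)
  also have "\<dots> = (\<integral>\<^sup>+x. \<integral>\<^sup>+z. F (x + (\<Sum>k<r. z k)) \<partial>iid \<mu> \<partial>\<mu>)"
    by (simp only: sum.lessThan_Suc_shift nat.case)
  also have "\<dots> = (\<integral>\<^sup>+Z. \<integral>\<^sup>+W. F (Z + W) \<partial>iid_sum \<mu> r \<partial>\<mu>)"
  proof (rule nn_integral_cong)
    fix x assume "x \<in> space \<mu>"
    then have "x \<in> energies" using increment_space assms by auto
    then have "(\<lambda>W. F (x + W)) \<in> borel_measurable energy_space" by (intro measurable_compose[OF shift_energy_space assms(2)]) auto
    then show "(\<integral>\<^sup>+z. F (x + (\<Sum>k<r. z k)) \<partial>iid \<mu>) = (\<integral>\<^sup>+W. F (x + W) \<partial>iid_sum \<mu> r)"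
      by (subst nn_integral_iid_sum[OF assms(1)]) auto
  qed
  finally show ?thesis .
qed

lemma increment_iid_sum: assumes "increment \<mu>" shows "increment (iid_sum \<mu> r)" "mean_nrm (iid_sum \<mu> r) \<le> real r * mean_nrm \<mu>"
proof -
  interpret prob_space \<mu> using incrementD assms by auto
  have bound: "(\<integral>\<^sup>+Z. ennreal (nrm Z) \<partial>iid_sum \<mu> r) \<le> ennreal (real r * mean_nrm \<mu>)"
  proof (induct r)
    case 0
    then show ?case by (simp add: nn_integral_iid_sum_0[OF assms])
  next
    case (Suc r)
    interpret C: prob_space "iid_sum \<mu> r" by (rule prob_iid_sum[OF assms])
    have "(\<integral>\<^sup>+Z. ennreal (nrm Z) \<partial>iid_sum \<mu> (Suc r)) = (\<integral>\<^sup>+Z. \<integral>\<^sup>+W. ennreal (nrm (Z + W)) \<partial>iid_sum \<mu> r \<partial>\<mu>)"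
      by (rule nn_integral_iid_sum_Suc[OF assms]) simp
    also have "\<dots> \<le> (\<integral>\<^sup>+Z. \<integral>\<^sup>+W. ennreal (nrm Z) + ennreal (nrm W) \<partial>iid_sum \<mu> r \<partial>\<mu>)"
    proof (intro nn_integral_mono)
      fix Z W assume "Z \<in> space \<mu>" "W \<in> space (iid_sum \<mu> r)"
      then have "Z \<in> energies" "W \<in> energies" using increment_space[OF assms] by (auto simp: iid_sum_def)
      then show "ennreal (nrm (Z + W)) \<le> ennreal (nrm Z) + ennreal (nrm W)"
        using nrm_triangle[of Z W] by (simp add: ennreal_plus[symmetric] ennreal_leI del: ennreal_plus plus_fun_apply)
    qed
    also have "\<dots> = (\<integral>\<^sup>+Z. ennreal (nrm Z) + (\<integral>\<^sup>+W. ennreal (nrm W) \<partial>iid_sum \<mu> r) \<partial>\<mu>)"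
      by (subst nn_integral_add) (auto simp: C.emeasure_space_1)
    also have "\<dots> = (\<integral>\<^sup>+Z. ennreal (nrm Z) \<partial>\<mu>) + (\<integral>\<^sup>+W. ennreal (nrm W) \<partial>iid_sum \<mu> r)"
      using incrementD(3)[OF assms] by (subst nn_integral_add) (auto simp: emeasure_space_1)
    also have "(\<integral>\<^sup>+Z. ennreal (nrm Z) \<partial>\<mu>) = ennreal (mean_nrm \<mu>)"
      unfolding mean_nrm_def using incrementD(3)[OF assms] by (intro nn_integral_eq_integral) (auto simp: increment_space[OF assms])
    also have "ennreal (mean_nrm \<mu>) + (\<integral>\<^sup>+W. ennreal (nrm W) \<partial>iid_sum \<mu> r) \<le> ennreal (mean_nrm \<mu>) + ennreal (real r * mean_nrm \<mu>)"
      by (rule add_left_mono[OF Suc])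
    also have "\<dots> = ennreal (real (Suc r) * mean_nrm \<mu>)"
      using mean_nrm_nonneg[OF assms] by (simp add: ennreal_plus[symmetric] algebra_simps del: ennreal_plus)
    finally show ?case .
  qed
  have meas: "nrm \<in> borel_measurable (iid_sum \<mu> r)" by measurable
  have nn: "AE Z in iid_sum \<mu> r. 0 \<le> nrm Z" by (rule AE_I2) (simp add: iid_sum_def)
  have int: "integrable (iid_sum \<mu> r) nrm"
    by (rule integrableI_nonneg[OF meas nn]) (use bound in \<open>auto intro: le_less_trans\<close>)
  then show "increment (iid_sum \<mu> r)" by (simp add: increment_def prob_iid_sum[OF assms])
  show "mean_nrm (iid_sum \<mu> r) \<le> real r * mean_nrm \<mu>"
    unfolding mean_nrm_def using bound mean_nrm_nonneg[OF assms]
    by (subst integral_eq_nn_integral[OF meas nn]) (auto intro: enn2real_leI simp: mean_nrm_def)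
qed

lemma avg_iid_sum_0: assumes "increment \<mu>" "\<Phi> \<in> observables" "E \<in> energies" shows "avg (iid_sum \<mu> 0) \<Phi> E = \<Phi> E"
proof -
  have "mean_nrm (iid_sum \<mu> 0) \<le> 0" using increment_iid_sum(2)[OF assms(1), of 0] by simp
  with avg_bound[OF increment_iid_sum(1)[OF assms(1)] assms(2,3), of 0] show ?thesis by linarith
qed

lemma iid_sum_Suc: assumes "increment \<mu>" shows "iid_sum \<mu> (Suc r) = convolve \<mu> (iid_sum \<mu> r)"
  by (rule measure_eqI_nn_integral)
    (auto simp: convolve_def[of _ "iid_sum \<mu> r", THEN arg_cong, of sets] nn_integral_iid_sum_Suc nn_integral_convolve increment_iid_sum assms)

lemma avg_iid_sum_Suc: assumes "increment \<mu>" "\<Phi> \<in> observables" "E \<in> energies"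
  shows "avg (iid_sum \<mu> (Suc r)) \<Phi> E = avg \<mu> (avg (iid_sum \<mu> r) \<Phi>) E"
  by (simp add: iid_sum_Suc avg_convolve increment_iid_sum assms)

lemma nn_integral_cpoisson: assumes "increment \<mu>" and [measurable]: "F \<in> borel_measurable energy_space"
  shows "(\<integral>\<^sup>+Z. F Z \<partial>cpoisson \<mu> m) = (\<integral>\<^sup>+r. \<integral>\<^sup>+Z. F Z \<partial>iid_sum \<mu> r \<partial>measure_pmf (poisson_pmf m))"
proof -
  interpret prob_space "iid \<mu>" using incrementD assms by (auto intro!: prob_space_PiM)
  note [measurable] = partial_sum_pair_measurable[OF incrementD(2)[OF assms(1)], of "poisson_pmf m"]
  have "(\<integral>\<^sup>+Z. F Z \<partial>cpoisson \<mu> m) = (\<integral>\<^sup>+x. F ((\<lambda>(r, z). \<Sum>k<r. z k) x) \<partial>(measure_pmf (poisson_pmf m) \<Otimes>\<^sub>M iid \<mu>))"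
    unfolding cpoisson_def by (rule nn_integral_distr) auto
  also have "\<dots> = (\<integral>\<^sup>+r. \<integral>\<^sup>+z. F (\<Sum>k<r. z k) \<partial>iid \<mu> \<partial>measure_pmf (poisson_pmf m))"
    by (subst nn_integral_fst[symmetric]) (auto intro: measurable_compose[OF partial_sum_pair_measurable[OF incrementD(2)[OF assms(1)]] assms(2)])
  finally show ?thesis by (simp add: nn_integral_iid_sum[OF assms])
qed

lemma increment_cpoisson: assumes "increment \<mu>" "0 < m" shows "increment (cpoisson \<mu> m)"
proof -
  have p: "prob_space (cpoisson \<mu> m)"
    unfolding cpoisson_def
    by (rule prob_space.prob_space_distr)
      (auto intro!: partial_sum_pair_measurable incrementD assms prob_space_pair prob_space_PiM prob_space_measure_pmf)
  have "(\<integral>\<^sup>+Z. ennreal (nrm Z) \<partial>cpoisson \<mu> m) \<le> (\<integral>\<^sup>+r. ennreal (real r) * ennreal (mean_nrm \<mu>) \<partial>measure_pmf (poisson_pmf m))"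
  proof (subst nn_integral_cpoisson[OF assms(1)], simp, rule nn_integral_mono)
    fix r
    have "(\<integral>\<^sup>+Z. ennreal (nrm Z) \<partial>iid_sum \<mu> r) = ennreal (mean_nrm (iid_sum \<mu> r))"
      unfolding mean_nrm_def by (rule nn_integral_eq_integral[OF incrementD(3)[OF increment_iid_sum(1)[OF assms(1)]]])
        (rule AE_I2, simp add: iid_sum_def)
    also have "\<dots> \<le> ennreal (real r * mean_nrm \<mu>)" by (intro ennreal_leI increment_iid_sum assms)
    finally show "(\<integral>\<^sup>+Z. ennreal (nrm Z) \<partial>iid_sum \<mu> r) \<le> ennreal (real r) * ennreal (mean_nrm \<mu>)"
      by (simp add: ennreal_mult mean_nrm_nonneg assms)
  qed
  also have "\<dots> = ennreal m * ennreal (mean_nrm \<mu>)"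
    by (subst nn_integral_multc) (auto simp: poisson_mean_nn assms)
  also have "\<dots> < \<infinity>" by (simp add: ennreal_mult_less_top)
  finally have "integrable (cpoisson \<mu> m) nrm"
    by (intro integrableI_nonneg) (auto simp: cpoisson_def)
  with p show ?thesis by (simp add: increment_def)
qed

lemma avg_cpoisson: assumes "increment \<mu>" "0 < m" "\<Phi> \<in> observables" "E \<in> energies"
  shows "avg (cpoisson \<mu> m) \<Phi> E = (\<integral>r. avg (iid_sum \<mu> r) \<Phi> E \<partial>measure_pmf (poisson_pmf m))"
    "integrable (measure_pmf (poisson_pmf m)) (\<lambda>r. avg (iid_sum \<mu> r) \<Phi> E)"
proof -
  let ?P = "iid \<mu>"
  interpret Q: prob_space ?P using incrementD assms by (auto intro!: prob_space_PiM)
  interpret W: prob_space "measure_pmf (poisson_pmf m)" by (rule prob_space_measure_pmf)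
  interpret P: pair_prob_space "measure_pmf (poisson_pmf m)" ?P ..
  note [measurable] = observables_meas[OF assms(3)] 
  have shiftm: "(\<lambda>Z. \<Phi> (E + Z)) \<in> borel_measurable energy_space"
    by (rule measurable_compose[OF shift_energy_space observables_meas]) (use assms in auto)
  note m1 = partial_sum_pair_measurable[OF incrementD(2)[OF assms(1)], of "poisson_pmf m"]
  have int: "integrable (measure_pmf (poisson_pmf m) \<Otimes>\<^sub>M ?P) (\<lambda>x. \<Phi> (E + (\<lambda>(r, z). \<Sum>k<r. z k) x))"
    using avg_integrable[OF increment_cpoisson[OF assms(1,2)] assms(3,4)] unfolding cpoisson_def
    by (subst (asm) integrable_distr_eq[OF m1 shiftm])
  have eq: "avg (iid_sum \<mu> r) \<Phi> E = (\<integral>z. \<Phi> (E + (\<lambda>(r, z). \<Sum>k<r. z k) (r, z)) \<partial>?P)" for r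
    unfolding avg_def iid_sum_def by (subst integral_distr) (auto intro!: partial_sum_measurable incrementD assms shiftm)
  show "integrable (measure_pmf (poisson_pmf m)) (\<lambda>r. avg (iid_sum \<mu> r) \<Phi> E)"
    using P.integrable_fst'[OF int] by (simp only: eq)
  have "avg (cpoisson \<mu> m) \<Phi> E = (\<integral>x. \<Phi> (E + (\<lambda>(r, z). \<Sum>k<r. z k) x) \<partial>(measure_pmf (poisson_pmf m) \<Otimes>\<^sub>M ?P))"
    unfolding avg_def cpoisson_def by (rule integral_distr[OF m1 shiftm])
  also have "\<dots> = (\<integral>r. avg (iid_sum \<mu> r) \<Phi> E \<partial>measure_pmf (poisson_pmf m))"
    by (simp only: eq P.integral_fst'[OF int])
  finally show "avg (cpoisson \<mu> m) \<Phi> E = (\<integral>r. avg (iid_sum \<mu> r) \<Phi> E \<partial>measure_pmf (poisson_pmf m))" .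
qed

end

section \<open>Poisson thinning\<close>

text \<open>
  From here on sums of energies are handled as elements of a vector space. The pointwise rule is used
  explicitly where values at a configuration matter.
\<close>

declare plus_fun_apply [simp del]

lemma suminf_triangle:
  fixes f :: "nat \<Rightarrow> nat \<Rightarrow> ennreal"
  shows "(\<Sum>j. \<Sum>l. f j l) = (\<Sum>r. \<Sum>j\<le>r. f j (r - j))"
proof -
  have "(\<Sum>j. \<Sum>l. f j l) = (\<Sum>j. \<Sum>r. if j \<le> r then f j (r - j) else 0)"
  proof (rule suminf_cong)
    fix j
    have "(\<Sum>r. if j \<le> r then f j (r - j) else 0) = (\<Sum>r. if j \<le> r + j then f j (r + j - j) else 0)"
      by (subst suminf_offset[of _ j]) (auto intro!: summableI)
    then show "(\<Sum>l. f j l) = (\<Sum>r. if j \<le> r then f j (r - j) else 0)" by simp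
  qed
  also have "\<dots> = (\<Sum>r. \<Sum>j. if j \<le> r then f j (r - j) else 0)"
    using nn_integral_suminf[of "\<lambda>j r. if j \<le> r then f j (r - j) else 0" "count_space (UNIV::nat set)"]
    by (simp add: nn_integral_count_space_nat)
  also have "\<dots> = (\<Sum>r. \<Sum>j\<le>r. f j (r - j))"
    by (rule suminf_cong, subst suminf_finite[of "{.._}"]) auto
  finally show ?thesis .
qed

lemma pascal_step:
  fixes t s :: "'a::comm_semiring_1" and g :: "nat \<Rightarrow> nat \<Rightarrow> 'a"
  shows "t * (\<Sum>j\<le>r. of_nat (r choose j) * t ^ j * s ^ (r - j) * g (Suc j) (r - j))
    + s * (\<Sum>j\<le>r. of_nat (r choose j) * t ^ j * s ^ (r - j) * g j (Suc (r - j)))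
    = (\<Sum>j\<le>Suc r. of_nat (Suc r choose j) * t ^ j * s ^ (Suc r - j) * g j (Suc r - j))"
proof -
  define h where "h j = t ^ j * s ^ (Suc r - j) * g j (Suc r - j)" for j
  have 1: "t * (\<Sum>j\<le>r. of_nat (r choose j) * t ^ j * s ^ (r - j) * g (Suc j) (r - j)) = (\<Sum>j\<le>r. of_nat (r choose j) * h (Suc j))"
    unfolding sum_distrib_left h_def by (rule sum.cong) (simp_all add: mult_ac)
  have "s * (\<Sum>j\<le>r. of_nat (r choose j) * t ^ j * s ^ (r - j) * g j (Suc (r - j))) = (\<Sum>j\<le>r. of_nat (r choose j) * h j)"
    unfolding sum_distrib_left h_def by (rule sum.cong) (simp_all add: mult_ac Suc_diff_le)
  also have "\<dots> = (\<Sum>j\<le>Suc r. of_nat (r choose j) * h j)"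
    by (simp add: binomial_eq_0)
  also have "\<dots> = h 0 + (\<Sum>j\<le>r. of_nat (r choose Suc j) * h (Suc j))"
    by (subst sum.atMost_Suc_shift) simp
  finally have 2: "s * (\<Sum>j\<le>r. of_nat (r choose j) * t ^ j * s ^ (r - j) * g j (Suc (r - j))) = \<dots>" .
  have "(\<Sum>j\<le>Suc r. of_nat (Suc r choose j) * t ^ j * s ^ (Suc r - j) * g j (Suc r - j)) = (\<Sum>j\<le>Suc r. of_nat (Suc r choose j) * h j)"
    unfolding h_def by (simp only: mult.assoc)
  also have "\<dots> = h 0 + (\<Sum>j\<le>r. of_nat (r choose j) * h (Suc j) + of_nat (r choose Suc j) * h (Suc j))"
    by (subst sum.atMost_Suc_shift) (simp add: distrib_right)
  finally show ?thesis unfolding 1 2 by (simp add: sum.distrib add_ac)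
qed

lemma poisson_split:
  fixes m t :: real assumes "0 < m" "0 < t" "t < 1" "j \<le> r"
  shows "m ^ r / fact r * exp (- m) * (real (r choose j) * t ^ j * (1 - t) ^ (r - j))
    = ((t * m) ^ j / fact j * exp (- (t * m))) * (((1 - t) * m) ^ (r - j) / fact (r - j) * exp (- ((1 - t) * m)))"
proof -
  have e: "exp (- (t * m)) * exp (- ((1 - t) * m)) = exp (- m)"
    by (subst exp_add[symmetric]) (simp add: algebra_simps)
  have "m ^ r = m ^ j * m ^ (r - j)" using assms(4) by (simp add: power_add[symmetric])
  moreover have "real (r choose j) / fact r = 1 / (fact j * fact (r - j))" by (simp add: binomial_fact[OF assms(4)])
  ultimately have "m ^ r * (real (r choose j) / fact r) * t ^ j * (1 - t) ^ (r - j) * exp (- m)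
    = (m ^ j * m ^ (r - j)) * (1 / (fact j * fact (r - j))) * t ^ j * (1 - t) ^ (r - j) * (exp (- (t * m)) * exp (- ((1 - t) * m)))"
    by (simp only: e)
  then show ?thesis by (simp add: power_mult_distrib mult_ac)
qed

lemma integral_diff4:
  fixes a b c d :: "'a \<Rightarrow> real"
  assumes "integrable M a" "integrable M b" "integrable M c" "integrable M d"
  shows "(\<integral>x. (a x - b x) - (c x - d x) \<partial>M) = ((\<integral>x. a x \<partial>M) - (\<integral>x. b x \<partial>M)) - ((\<integral>x. c x \<partial>M) - (\<integral>x. d x \<partial>M))"
    "integrable M (\<lambda>x. (a x - b x) - (c x - d x))"
  using assms by simp_all

context spin_space
begin

text \<open>
  If every increment is drawn from \<open>B\<close> with probability \<open>t\<close> and from \<open>C\<close> otherwise, then the two kinds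
  are independent compound Poisson sums. For \<open>r\<close> increments the binomial formula counts how many come
  from \<open>B\<close>; the Poisson weights then factorise.
\<close>

lemma cpoisson_thinning:
  assumes k: "increment \<mu>" "increment B" "increment C" and t: "0 < t" "t < 1" and m: "0 < m"
    and mix: "\<And>F. F \<in> borel_measurable energy_space \<Longrightarrow>
      (\<integral>\<^sup>+Z. F Z \<partial>\<mu>) = ennreal t * (\<integral>\<^sup>+Z. F Z \<partial>B) + ennreal (1 - t) * (\<integral>\<^sup>+Z. F Z \<partial>C)"
  shows "cpoisson \<mu> m = convolve (cpoisson B (t * m)) (cpoisson C ((1 - t) * m))"
proof (rule measure_eqI_nn_integral)
  note [measurable_cong] = incrementD(2)[OF k(1)] incrementD(2)[OF k(2)] incrementD(2)[OF k(3)]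
  interpret B: prob_space B using k(2) by (rule incrementD)
  interpret C: prob_space C using k(3) by (rule incrementD)
  interpret Bj: prob_space "iid_sum B j" for j by (rule prob_iid_sum[OF k(2)])
  interpret Cj: prob_space "iid_sum C j" for j by (rule prob_iid_sum[OF k(3)])
  have kB: "increment (cpoisson B (t * m))" using k t m by (intro increment_cpoisson) auto
  have kC: "increment (cpoisson C ((1 - t) * m))" using k t m by (intro increment_cpoisson) auto
  show "sets (cpoisson \<mu> m) = sets (convolve (cpoisson B (t * m)) (cpoisson C ((1 - t) * m)))" by (simp add: convolve_def)
  define G where "G F j l = (\<integral>\<^sup>+Z. \<integral>\<^sup>+W. F (Z + W) \<partial>iid_sum C l \<partial>iid_sum B j)" for F :: "_ \<Rightarrow> ennreal" and j l
  have shiftm: "(\<lambda>W. F (Z + W)) \<in> borel_measurable energy_space" if "F \<in> borel_measurable energy_space" "Z \<in> energies" for F :: "_ \<Rightarrow> ennreal" and Z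
    by (rule measurable_compose[OF shift_energy_space that(1)]) (use that in auto)
  have GB: "(\<integral>\<^sup>+Z. G (\<lambda>W. F (Z + W)) j l \<partial>B) = G F (Suc j) l" if [measurable]: "F \<in> borel_measurable energy_space" for F j l
  proof -
    have "G F (Suc j) l = (\<integral>\<^sup>+Z. \<integral>\<^sup>+Z'. \<integral>\<^sup>+W. F ((Z + Z') + W) \<partial>iid_sum C l \<partial>iid_sum B j \<partial>B)"
      unfolding G_def by (subst nn_integral_iid_sum_Suc[OF k(2)]) auto
    then show ?thesis by (simp only: G_def add.assoc)
  qed
  have GC: "(\<integral>\<^sup>+Z. G (\<lambda>W. F (Z + W)) j l \<partial>C) = G F j (Suc l)" if [measurable]: "F \<in> borel_measurable energy_space" for F j l
  proof -
    interpret P: pair_prob_space C "iid_sum B j" ..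
    have "(\<integral>\<^sup>+Z. G (\<lambda>W. F (Z + W)) j l \<partial>C) = (\<integral>\<^sup>+Z'. \<integral>\<^sup>+Z. \<integral>\<^sup>+W. F (Z + (Z' + W)) \<partial>iid_sum C l \<partial>C \<partial>iid_sum B j)"
      unfolding G_def by (rule P.Fubini'[symmetric]) measurable
    also have "\<dots> = G F j (Suc l)"
      unfolding G_def
    proof (rule nn_integral_cong)
      fix Z' assume "Z' \<in> space (iid_sum B j)"
      then have "Z' \<in> energies" by (simp add: iid_sum_def)
      note [measurable] = shiftm[OF that this]
      show "(\<integral>\<^sup>+Z. \<integral>\<^sup>+W. F (Z + (Z' + W)) \<partial>iid_sum C l \<partial>C) = (\<integral>\<^sup>+W. F (Z' + W) \<partial>iid_sum C (Suc l))"
        by (subst nn_integral_iid_sum_Suc[OF k(3) shiftm[OF that \<open>Z' \<in> energies\<close>]]) (simp only: add.left_commute)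
    qed
    finally show ?thesis .
  qed
  have Gm: "(\<lambda>Z. G (\<lambda>W. F (Z + W)) j l) \<in> borel_measurable energy_space" if [measurable]: "F \<in> borel_measurable energy_space" for F j l
    unfolding G_def by measurable
  have step1: "(\<integral>\<^sup>+Z. F Z \<partial>iid_sum \<mu> r) = (\<Sum>j\<le>r. of_nat (r choose j) * ennreal t ^ j * ennreal (1 - t) ^ (r - j) * G F j (r - j))"
    if "F \<in> borel_measurable energy_space" for F r
    using that
  proof (induct r arbitrary: F)
    case 0
    then show ?case by (simp add: nn_integral_iid_sum_0 k G_def cong: nn_integral_cong)
  next
    case (Suc r)
    note [measurable] = Suc.prems Gm[OF Suc.prems]
    let ?c = "\<lambda>j. of_nat (r choose j) * ennreal t ^ j * ennreal (1 - t) ^ (r - j) :: ennreal"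
    have sumI: "(\<integral>\<^sup>+Z. (\<Sum>j\<le>r. ?c j * G (\<lambda>W. F (Z + W)) j (r - j)) \<partial>N) = (\<Sum>j\<le>r. ?c j * (\<integral>\<^sup>+Z. G (\<lambda>W. F (Z + W)) j (r - j) \<partial>N))"
      if [measurable_cong]: "sets N = sets energy_space" for N
      by (subst nn_integral_sum) (auto simp: nn_integral_cmult)
    have "(\<integral>\<^sup>+Z. F Z \<partial>iid_sum \<mu> (Suc r)) = (\<integral>\<^sup>+Z. \<integral>\<^sup>+W. F (Z + W) \<partial>iid_sum \<mu> r \<partial>\<mu>)"
      by (rule nn_integral_iid_sum_Suc[OF k(1)]) fact
    also have "\<dots> = (\<integral>\<^sup>+Z. (\<Sum>j\<le>r. ?c j * G (\<lambda>W. F (Z + W)) j (r - j)) \<partial>\<mu>)"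
      by (rule nn_integral_cong) (use Suc.hyps[OF shiftm[OF Suc.prems]] increment_space[OF k(1)] in simp)
    also have "\<dots> = ennreal t * (\<Sum>j\<le>r. ?c j * G F (Suc j) (r - j)) + ennreal (1 - t) * (\<Sum>j\<le>r. ?c j * G F j (Suc (r - j)))"
      by (subst mix) (auto simp: sumI incrementD k GB[OF Suc.prems] GC[OF Suc.prems])
    also have "\<dots> = (\<Sum>j\<le>Suc r. of_nat (Suc r choose j) * ennreal t ^ j * ennreal (1 - t) ^ (Suc r - j) * G F j (Suc r - j))"
      by (rule pascal_step)
    finally show ?case .
  qed
  fix F :: "_ \<Rightarrow> ennreal" assume "F \<in> borel_measurable (cpoisson \<mu> m)"
  then have F[measurable]: "F \<in> borel_measurable energy_space" by simp
  let ?p = "\<lambda>m r. ennreal (m ^ r / fact r * exp (- m))"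
  have tm: "0 < t * m" "0 < (1 - t) * m" using t m by auto
  have "(\<integral>\<^sup>+Z. F Z \<partial>cpoisson \<mu> m) = (\<Sum>r. ?p m r * (\<Sum>j\<le>r. of_nat (r choose j) * ennreal t ^ j * ennreal (1 - t) ^ (r - j) * G F j (r - j)))"
    by (simp add: nn_integral_cpoisson k nn_integral_poisson m step1)
  also have "\<dots> = (\<Sum>r. \<Sum>j\<le>r. ?p (t * m) j * ?p ((1 - t) * m) (r - j) * G F j (r - j))"
  proof (rule suminf_cong)
    fix r
    show "?p m r * (\<Sum>j\<le>r. of_nat (r choose j) * ennreal t ^ j * ennreal (1 - t) ^ (r - j) * G F j (r - j))
      = (\<Sum>j\<le>r. ?p (t * m) j * ?p ((1 - t) * m) (r - j) * G F j (r - j))"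
      unfolding sum_distrib_left
    proof (rule sum.cong[OF refl])
      fix j assume "j \<in> {..r}" then have j: "j \<le> r" by simp
      have "?p m r * (of_nat (r choose j) * ennreal t ^ j * ennreal (1 - t) ^ (r - j))
        = ennreal (m ^ r / fact r * exp (- m) * (real (r choose j) * t ^ j * (1 - t) ^ (r - j)))"
        using m t by (simp add: ennreal_mult[symmetric] ennreal_power ennreal_of_nat_eq_real_of_nat)
      also have "\<dots> = ?p (t * m) j * ?p ((1 - t) * m) (r - j)"
        unfolding poisson_split[OF m t j] using m t by (intro ennreal_mult) auto
      finally show "?p m r * (of_nat (r choose j) * ennreal t ^ j * ennreal (1 - t) ^ (r - j) * G F j (r - j))
        = ?p (t * m) j * ?p ((1 - t) * m) (r - j) * G F j (r - j)"
        by (simp add: mult.assoc[symmetric])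
    qed
  qed
  also have "\<dots> = (\<Sum>j. \<Sum>l. ?p (t * m) j * ?p ((1 - t) * m) l * G F j l)"
    by (rule suminf_triangle[symmetric])
  also have "\<dots> = (\<Sum>j. ?p (t * m) j * (\<Sum>l. ?p ((1 - t) * m) l * G F j l))"
    by (simp add: mult.assoc)
  also have "\<dots> = (\<Sum>j. ?p (t * m) j * (\<integral>\<^sup>+Z. \<integral>\<^sup>+W. F (Z + W) \<partial>cpoisson C ((1 - t) * m) \<partial>iid_sum B j))"
  proof (intro suminf_cong arg_cong2[where f="(*)"] refl)
    fix j
    have "(\<integral>\<^sup>+Z. \<integral>\<^sup>+W. F (Z + W) \<partial>cpoisson C ((1 - t) * m) \<partial>iid_sum B j)
      = (\<integral>\<^sup>+Z. (\<Sum>l. ?p ((1 - t) * m) l * (\<integral>\<^sup>+W. F (Z + W) \<partial>iid_sum C l)) \<partial>iid_sum B j)"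
    proof (rule nn_integral_cong)
      fix Z assume "Z \<in> space (iid_sum B j)"
      then have "Z \<in> energies" by (simp add: iid_sum_def)
      from shiftm[OF F this] show "(\<integral>\<^sup>+W. F (Z + W) \<partial>cpoisson C ((1 - t) * m)) = (\<Sum>l. ?p ((1 - t) * m) l * (\<integral>\<^sup>+W. F (Z + W) \<partial>iid_sum C l))"
        by (simp add: nn_integral_cpoisson k nn_integral_poisson tm)
    qed
    also have "\<dots> = (\<Sum>l. ?p ((1 - t) * m) l * G F j l)"
      by (subst nn_integral_suminf) (auto simp: nn_integral_cmult G_def)
    finally show "(\<Sum>l. ?p ((1 - t) * m) l * G F j l) = (\<integral>\<^sup>+Z. \<integral>\<^sup>+W. F (Z + W) \<partial>cpoisson C ((1 - t) * m) \<partial>iid_sum B j)" ..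
  qed
  also have "\<dots> = (\<integral>\<^sup>+Z. F Z \<partial>convolve (cpoisson B (t * m)) (cpoisson C ((1 - t) * m)))"
  proof -
    interpret P: prob_space "cpoisson C ((1 - t) * m)" using kC by (rule incrementD)
    show ?thesis by (subst nn_integral_convolve[OF kB kC F], subst nn_integral_cpoisson[OF k(2)]) (auto simp: nn_integral_poisson tm)
  qed
  finally show "(\<integral>\<^sup>+Z. F Z \<partial>cpoisson \<mu> m) = (\<integral>\<^sup>+Z. F Z \<partial>convolve (cpoisson B (t * m)) (cpoisson C ((1 - t) * m)))" .
qed

lemma avg_thinning:
  assumes "increment \<mu>" "increment B" "increment C" "0 < t" "t < 1" "0 < m"
    "\<And>F. F \<in> borel_measurable energy_space \<Longrightarrow>
      (\<integral>\<^sup>+Z. F Z \<partial>\<mu>) = ennreal t * (\<integral>\<^sup>+Z. F Z \<partial>B) + ennreal (1 - t) * (\<integral>\<^sup>+Z. F Z \<partial>C)"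
    and "\<Phi> \<in> observables" "E \<in> energies"
  shows "avg (cpoisson \<mu> m) \<Phi> E = avg (cpoisson B (t * m)) (avg (cpoisson C ((1 - t) * m)) \<Phi>) E"
proof -
  have "cpoisson \<mu> m = convolve (cpoisson B (t * m)) (cpoisson C ((1 - t) * m))" by (rule cpoisson_thinning; fact)
  moreover have "increment (cpoisson B (t * m))" "increment (cpoisson C ((1 - t) * m))" by (intro increment_cpoisson mult_pos_pos; use assms in simp)+
  ultimately show ?thesis using avg_convolve assms(8,9) by simp
qed

text \<open>
  Thinning with both alternatives equal to \<open>\<mu>\<close> splits the rate.
\<close>

lemma avg_cpoisson_add:
  assumes "increment \<mu>" "0 < a" "0 < b" "\<Phi> \<in> observables" "E \<in> energies"
  shows "avg (cpoisson \<mu> (a + b)) \<Phi> E = avg (cpoisson \<mu> a) (avg (cpoisson \<mu> b) \<Phi>) E"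
proof -
  have "a + b \<noteq> 0" using assms by simp
  then have eq: "a / (a + b) * (a + b) = a" "(1 - a / (a + b)) * (a + b) = b" by (simp_all add: left_diff_distrib)
  have "avg (cpoisson \<mu> (a + b)) \<Phi> E = avg (cpoisson \<mu> (a / (a + b) * (a + b))) (avg (cpoisson \<mu> ((1 - a / (a + b)) * (a + b))) \<Phi>) E"
  proof (rule avg_thinning[OF assms(1,1,1) _ _ _ _ assms(4,5)])
    fix F :: "_ \<Rightarrow> ennreal"
    have "ennreal (a / (a + b)) + ennreal (1 - a / (a + b)) = 1"
      using assms by (subst ennreal_plus[symmetric]) (simp_all add: divide_le_eq_1)
    then show "(\<integral>\<^sup>+Z. F Z \<partial>\<mu>) = ennreal (a / (a + b)) * (\<integral>\<^sup>+Z. F Z \<partial>\<mu>) + ennreal (1 - a / (a + b)) * (\<integral>\<^sup>+Z. F Z \<partial>\<mu>)"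
      by (simp add: distrib_right[symmetric])
  qed (use assms in auto)
  then show ?thesis unfolding eq .
qed

lemma avg_lipschitz: assumes "increment \<mu>" "\<Phi> \<in> observables" "U \<in> energies" "V \<in> energies" shows "\<bar>avg \<mu> \<Phi> U - avg \<mu> \<Phi> V\<bar> \<le> nrm (U - V)"
  by (rule observables_abs[OF avg_observables]) fact+

text \<open>
  The larger rate is the smaller one plus an independent Poisson number with mean \<open>b - a\<close> of extra
  increments. If there are none, nothing changes; otherwise the difference of two differences is at
  most \<open>2 nrm (U - V)\<close>, and the probability of this is at most \<open>b - a\<close>.
\<close>

lemma avg_cpoisson_change_aux:
  assumes k: "increment \<mu>" and ab: "0 < a" "a < b" and P: "\<Phi> \<in> observables" and UV: "U \<in> energies" "V \<in> energies"
  shows "\<bar>(avg (cpoisson \<mu> b) \<Phi> U - avg (cpoisson \<mu> b) \<Phi> V) - (avg (cpoisson \<mu> a) \<Phi> U - avg (cpoisson \<mu> a) \<Phi> V)\<bar> \<le> 2 * (b - a) * nrm (U - V)"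
proof -
  define d where "d = b - a"
  have d: "0 < d" "b = a + d" using ab by (auto simp: d_def)
  define H where "H = avg (cpoisson \<mu> d) \<Phi>"
  have ka: "increment (cpoisson \<mu> a)" "increment (cpoisson \<mu> d)" using k ab d by (auto intro: increment_cpoisson)
  have H: "H \<in> observables" unfolding H_def by (rule avg_observables[OF ka(2) P])
  have ptw: "\<bar>(H U - H V) - (\<Phi> U - \<Phi> V)\<bar> \<le> 2 * d * nrm (U - V)" if UV: "U \<in> energies" "V \<in> energies" for U V
  proof -
    let ?g = "\<lambda>r. (avg (iid_sum \<mu> r) \<Phi> U - avg (iid_sum \<mu> r) \<Phi> V) - (\<Phi> U - \<Phi> V)"
    note I = avg_cpoisson(2)[OF k d(1) P]
    have "(H U - H V) - (\<Phi> U - \<Phi> V) = (\<integral>r. ?g r \<partial>measure_pmf (poisson_pmf d))"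
      unfolding H_def avg_cpoisson(1)[OF k d(1) P UV(1)] avg_cpoisson(1)[OF k d(1) P UV(2)] using I[OF UV(1)] I[OF UV(2)]
      by (simp add: Bochner_Integration.integral_diff measure_pmf.prob_space)
    also have "\<bar>\<dots>\<bar> \<le> (\<integral>r. real r * (2 * nrm (U - V)) \<partial>measure_pmf (poisson_pmf d))"
    proof (rule integral_abs_bound[THEN order_trans], rule integral_mono)
      show "integrable (measure_pmf (poisson_pmf d)) (\<lambda>r. \<bar>?g r\<bar>)" using I[OF UV(1)] I[OF UV(2)] by auto
      show "integrable (measure_pmf (poisson_pmf d)) (\<lambda>r. real r * (2 * nrm (U - V)))" using poisson_integrable[OF d(1)] by auto
      fix r :: nat
      show "\<bar>?g r\<bar> \<le> real r * (2 * nrm (U - V))"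
      proof (cases "r = 0")
        case True
        then show ?thesis by (simp add: avg_iid_sum_0 k P UV)
      next
        case False
        have "\<bar>avg (iid_sum \<mu> r) \<Phi> U - avg (iid_sum \<mu> r) \<Phi> V\<bar> \<le> nrm (U - V)" by (intro avg_lipschitz increment_iid_sum k P UV)
        moreover have "\<bar>\<Phi> U - \<Phi> V\<bar> \<le> nrm (U - V)" by (intro observables_abs P UV)
        ultimately have "\<bar>?g r\<bar> \<le> 1 * (2 * nrm (U - V))" by linarith
        also have "\<dots> \<le> real r * (2 * nrm (U - V))" using False UV by (intro mult_right_mono) auto
        finally show ?thesis .
      qed
    qed
    also have "\<dots> = 2 * d * nrm (U - V)" by (simp add: poisson_mean[OF d(1)])
    finally show ?thesis .
  qed
  have KI: "integrable (cpoisson \<mu> a) (\<lambda>Z. \<Psi> (W + Z))" if "\<Psi> \<in> observables" "W \<in> energies" for \<Psi> W by (rule avg_integrable[OF ka(1) that])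
  let ?f = "\<lambda>Z. (H (U + Z) - H (V + Z)) - (\<Phi> (U + Z) - \<Phi> (V + Z))"
  interpret prob_space "cpoisson \<mu> a" using ka(1) by (rule incrementD)
  have ci: "(\<integral>Z. c \<partial>cpoisson \<mu> a) = c" for c :: real using prob_space by simp
  have eq: "(avg (cpoisson \<mu> b) \<Phi> U - avg (cpoisson \<mu> b) \<Phi> V) - (avg (cpoisson \<mu> a) \<Phi> U - avg (cpoisson \<mu> a) \<Phi> V) = (\<integral>Z. ?f Z \<partial>cpoisson \<mu> a)"
    unfolding d(2) avg_cpoisson_add[OF k ab(1) d(1) P UV(1)] avg_cpoisson_add[OF k ab(1) d(1) P UV(2)] H_def[symmetric]
    unfolding avg_def[of "cpoisson \<mu> a"] by (rule integral_diff4(1)[symmetric]; intro KI H P UV)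
  have "\<bar>\<integral>Z. ?f Z \<partial>cpoisson \<mu> a\<bar> \<le> (\<integral>Z. 2 * d * nrm (U - V) \<partial>cpoisson \<mu> a)"
  proof (rule integral_abs_bound[THEN order_trans], rule integral_mono)
    have "integrable (cpoisson \<mu> a) ?f" by (rule integral_diff4(2); intro KI H P UV)
    then show "integrable (cpoisson \<mu> a) (\<lambda>Z. \<bar>?f Z\<bar>)" by (rule integrable_abs)
    fix Z assume "Z \<in> space (cpoisson \<mu> a)"
    then have "Z \<in> energies" by (simp add: cpoisson_def)
    then show "\<bar>?f Z\<bar> \<le> 2 * d * nrm (U - V)" using ptw[of "U + Z" "V + Z"] UV by (simp del: plus_fun_apply)
  qed (rule integrable_const)
  then show ?thesis unfolding eq[symmetric] ci unfolding d_def .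
qed

lemma avg_cpoisson_change:
  assumes "increment \<mu>" "0 < a" "0 < b" "\<Phi> \<in> observables" "U \<in> energies" "V \<in> energies"
  shows "\<bar>(avg (cpoisson \<mu> b) \<Phi> U - avg (cpoisson \<mu> b) \<Phi> V) - (avg (cpoisson \<mu> a) \<Phi> U - avg (cpoisson \<mu> a) \<Phi> V)\<bar> \<le> 2 * \<bar>b - a\<bar> * nrm (U - V)"
proof -
  consider "a < b" | "a = b" | "b < a" by linarith
  then show ?thesis
    using avg_cpoisson_change_aux[OF assms(1) assms(2) _ assms(4-6), of b] avg_cpoisson_change_aux[OF assms(1) assms(3) _ assms(4-6), of a]
    by cases (auto simp: abs_minus_commute)
qed

end

section \<open>Borel sets of continuous functions\<close>

lemma space_cont_borel: "space (cont_borel X) = mspace (cfunspace X euclidean_metric)"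
  by (simp add: cont_borel_def Let_def space_measure_of_conv)

lemma openin_cfun:
  assumes "topspace X \<noteq> {}"
  shows "openin (mtopology_of (cfunspace X euclidean_metric)) U \<longleftrightarrow>
    U \<subseteq> space (cont_borel X) \<and>
    (\<forall>f\<in>U. \<exists>r>0. \<forall>g\<in>space (cont_borel X). (\<forall>x\<in>topspace X. \<bar>f x - g x\<bar> \<le> (r::real)) \<longrightarrow> g \<in> U)"
proof -
  let ?m = "cfunspace X (euclidean_metric :: real metric)"
  interpret Metric_space "mspace ?m" "mdist ?m" by (rule Metric_space_mspace_mdist)
  have le: "mdist ?m f g \<le> r \<longleftrightarrow> (\<forall>x\<in>topspace X. \<bar>f x - g x\<bar> \<le> r)" if "f \<in> mspace ?m" "g \<in> mspace ?m" for f g r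
    using cfunspace_mdist_le[OF that assms, of r] by (simp add: dist_real_def)
  have "(\<exists>r>0. mball f r \<subseteq> U) \<longleftrightarrow> (\<exists>r>0. \<forall>g\<in>mspace ?m. (\<forall>x\<in>topspace X. \<bar>f x - g x\<bar> \<le> r) \<longrightarrow> g \<in> U)"
    if U: "U \<subseteq> mspace ?m" "f \<in> U" for f
  proof -
    show "(\<exists>r>0. mball f r \<subseteq> U) \<longleftrightarrow> (\<exists>r>0. \<forall>g\<in>mspace ?m. (\<forall>x\<in>topspace X. \<bar>f x - g x\<bar> \<le> r) \<longrightarrow> g \<in> U)" (is "?L \<longleftrightarrow> ?R")
    proof
      assume ?L
      then obtain r where r: "r > 0" "mball f r \<subseteq> U" by blast
      show ?R
      proof (intro exI[of _ "r/2"] conjI ballI impI)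
        fix g assume g: "g \<in> mspace ?m" "\<forall>x\<in>topspace X. \<bar>f x - g x\<bar> \<le> r/2"
        then have "mdist ?m f g \<le> r/2" using le U by blast
        then have "mdist ?m f g < r" using r by linarith
        then have "g \<in> mball f r" using g(1) U by (simp only: in_mball subsetD)
        then show "g \<in> U" using r by blast
      qed (use r in simp)
    next
      assume ?R
      then obtain r where r: "r > 0" "\<And>g. g \<in> mspace ?m \<Longrightarrow> (\<forall>x\<in>topspace X. \<bar>f x - g x\<bar> \<le> r) \<Longrightarrow> g \<in> U" by blast
      have "g \<in> U" if "g \<in> mball f r" for g
      proof -
        from that have g: "g \<in> mspace ?m" "mdist ?m f g \<le> r" by (simp_all only: in_mball less_imp_le)
        then show "g \<in> U" using le[of f g r] r(2)[of g] U by blast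
      qed
      then show ?L using r(1) by blast
    qed
  qed
  then show ?thesis
    unfolding space_cont_borel mtopology_of_def openin_mtopology by metis
qed

lemma measurable_cont_borelI:
  assumes "\<And>x. x \<in> space N \<Longrightarrow> F x \<in> space (cont_borel X)"
    and "\<And>U. openin (mtopology_of (cfunspace X euclidean_metric)) U \<Longrightarrow> F -` U \<inter> space N \<in> sets N"
  shows "F \<in> measurable N (cont_borel X)"
  unfolding cont_borel_def Let_def
  by (rule measurable_measure_of)
    (use assms openin_subset[of "mtopology_of (cfunspace X euclidean_metric)"] in \<open>auto simp: space_cont_borel simp del: mspace_cfunspace\<close>)

lemma cont_borel_open: "openin (mtopology_of (cfunspace X euclidean_metric)) U \<Longrightarrow> U \<in> sets (cont_borel X)"
  unfolding cont_borel_def Let_def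
  by (subst sets_measure_of)
    (use openin_subset[of "mtopology_of (cfunspace X euclidean_metric)"] in \<open>auto simp del: mspace_cfunspace topspace_mtopology_of\<close>)

lemma cont_borel_eval:
  assumes "x \<in> topspace X" shows "(\<lambda>f. f x) \<in> borel_measurable (cont_borel X)"
proof (rule borel_measurableI)
  fix A :: "real set" assume A: "open A"
  have "openin (mtopology_of (cfunspace X euclidean_metric)) ((\<lambda>f. f x) -` A \<inter> space (cont_borel X))"
  proof (subst openin_cfun, use assms in blast, intro conjI ballI)
    fix f assume f: "f \<in> (\<lambda>f. f x) -` A \<inter> space (cont_borel X)"
    then obtain e where e: "e > 0" "cball (f x) e \<subseteq> A" using A open_contains_cball[of A] by blast
    show "\<exists>r>0. \<forall>g\<in>space (cont_borel X). (\<forall>x\<in>topspace X. \<bar>f x - g x\<bar> \<le> r) \<longrightarrow> g \<in> (\<lambda>f. f x) -` A \<inter> space (cont_borel X)"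
      using e assms by (intro exI[of _ e]) (auto simp: dist_real_def)
  qed simp
  then show "(\<lambda>f. f x) -` A \<inter> space (cont_borel X) \<in> sets (cont_borel X)" by (rule cont_borel_open)
qed

text \<open>
  A step function of mesh \<open>1 / n\<close> on the interval that starts at \<open>- R\<close>, with rational values. There
  are only countably many of them.
\<close>

definition step_fun :: "real \<Rightarrow> nat \<Rightarrow> rat list \<Rightarrow> real \<Rightarrow> real" where
  "step_fun R n q t = of_rat (q ! nat \<lfloor>real n * (t + R)\<rfloor>)"

lemma step_fun_approx:
  assumes S: "compact S" "S \<subseteq> {-R..R}" and f: "continuous_on S f" and e: "0 < (e::real)"
  shows "\<exists>n q. \<forall>t\<in>S. \<bar>f t - step_fun R n q t\<bar> \<le> e"
proof -
  have "uniformly_continuous_on S f" using f S(1) by (rule compact_uniformly_continuous)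
  moreover have "e / 2 > 0" using e by simp
  ultimately obtain d where d: "d > 0" "\<And>x y. x \<in> S \<Longrightarrow> y \<in> S \<Longrightarrow> dist y x < d \<Longrightarrow> dist (f y) (f x) < e/2"
    unfolding uniformly_continuous_on_def by metis
  obtain n where n: "n > 0" "1 / real n < d"
    using reals_Archimedean[OF d(1)] by (metis inverse_eq_divide zero_less_Suc)
  let ?i = "\<lambda>t. nat \<lfloor>real n * (t + R)\<rfloor>"
  have "\<exists>c::rat. \<forall>t\<in>S. ?i t = i \<longrightarrow> \<bar>f t - of_rat c\<bar> \<le> e" for i
  proof (cases "\<exists>s\<in>S. ?i s = i")
    case True
    then obtain s where s: "s \<in> S" "?i s = i" by auto
    obtain c where c: "f s - e/2 < of_rat c" "of_rat c < f s + e/2"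
      using of_rat_dense[of "f s - e/2" "f s + e/2"] e by auto
    show ?thesis
    proof (intro exI[of _ c] ballI impI)
      fix t assume t: "t \<in> S" "?i t = i"
      have nn: "0 \<le> real n * (t + R)" "0 \<le> real n * (s + R)" using t(1) s(1) S(2) by auto
      then have fl: "\<lfloor>real n * (t + R)\<rfloor> = \<lfloor>real n * (s + R)\<rfloor>"
        using t(2) s(2) by (metis eq_nat_nat_iff zero_le_floor)
      have "\<bar>real n * (t + R) - real n * (s + R)\<bar> < 1"
        using fl by linarith
      moreover have "real n * (t + R) - real n * (s + R) = real n * (t - s)" by (simp add: algebra_simps)
      ultimately have "real n * \<bar>t - s\<bar> < 1" by (simp add: abs_mult)
      then have "\<bar>t - s\<bar> < 1 / real n" using n by (simp add: field_simps)
      then have "dist s t < d" using n by (simp add: dist_real_def abs_minus_commute)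
      then have "\<bar>f s - f t\<bar> < e/2" using d(2)[OF t(1) s(1)] by (simp add: dist_real_def)
      then show "\<bar>f t - of_rat c\<bar> \<le> e" using c by linarith
    qed
  qed auto
  then obtain c :: "nat \<Rightarrow> rat" where c: "\<And>i t. t \<in> S \<Longrightarrow> ?i t = i \<Longrightarrow> \<bar>f t - of_rat (c i)\<bar> \<le> e" by metis
  define N where "N = Suc (nat \<lfloor>real n * (R + R)\<rfloor>)"
  show ?thesis
  proof (intro exI[of _ n] exI[of _ "map c [0..<N]"] ballI)
    fix t assume t: "t \<in> S"
    have "?i t < N" unfolding N_def using S(2) t by (auto intro!: nat_mono floor_mono mult_left_mono simp: less_Suc_eq_le)
    then have "step_fun R n (map c [0..<N]) t = of_rat (c (?i t))" by (simp add: step_fun_def)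
    then show "\<bar>f t - step_fun R n (map c [0..<N]) t\<bar> \<le> e" using c[OF t refl] by simp
  qed
qed

context spin_space
begin

abbreviation "spin_borel \<equiv> cont_borel (top_of_set S)"

lemma space_spin_borel: "space spin_borel = {f. f \<in> extensional S \<and> continuous_on S f}"
  unfolding space_cont_borel using S_compact by (subst compactin_mspace_cfunspace) (auto simp: compactin_subtopology)

lemma spin_borel_eval: "t \<in> S \<Longrightarrow> (\<lambda>f. f t) \<in> borel_measurable spin_borel"
  using cont_borel_eval[of t "top_of_set S"] by simp

text \<open>
  The evaluations generate the Borel sets. By approximation with step functions an open set is a
  countable union of sets of functions that are within \<open>1 / (k + 1)\<close> of a step function, and by
  continuity such a bound needs to hold on a countable dense set only.
\<close>

lemma measurable_spin_borel:
  assumes sp: "\<And>x. x \<in> space N \<Longrightarrow> F x \<in> space spin_borel" and ev: "\<And>t. t \<in> S \<Longrightarrow> (\<lambda>x. F x t) \<in> borel_measurable N"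
  shows "F \<in> measurable N spin_borel"
proof (rule measurable_cont_borelI[OF sp])
  obtain R where R: "S \<subseteq> {-R..R}"
    using compact_imp_bounded[OF S_compact] by (metis bounded_real atLeastAtMost_iff abs_le_iff minus_le_iff subsetI)
  obtain D where D: "countable D" "D \<subseteq> S" "S \<subseteq> closure D" using separable[of S] by metis
  have clD: "closure D = S"
    by (rule antisym[OF closure_minimal[OF D(2) compact_imp_closed[OF S_compact]] D(3)])
  fix U :: "(real \<Rightarrow> real) set" assume U: "openin (mtopology_of (cfunspace (top_of_set S) euclidean_metric)) U"
  have "topspace (top_of_set S) \<noteq> {}" using S_ne by simp
  from U[unfolded openin_cfun[OF this] topspace_euclidean_subtopology] have U': "U \<subseteq> space spin_borel" "\<And>f. f \<in> U \<Longrightarrow> \<exists>r>0. \<forall>g\<in>space spin_borel. (\<forall>x\<in>S. \<bar>f x - g x\<bar> \<le> r) \<longrightarrow> g \<in> U"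
    by blast+
  define W where "W = (\<lambda>(n, q, k). {f \<in> space spin_borel. \<forall>t\<in>D. \<bar>f t - step_fun R n q t\<bar> \<le> 1 / real (Suc k)})"
  define I where "I = {i. W i \<subseteq> U}"
  have "U \<subseteq> (\<Union>i\<in>I. W i)"
  proof
    fix f assume f: "f \<in> U"
    then obtain r where r: "r > 0" "\<And>g. g \<in> space spin_borel \<Longrightarrow> (\<forall>x\<in>S. \<bar>f x - g x\<bar> \<le> r) \<Longrightarrow> g \<in> U" using U'(2) by metis
    then obtain k where k: "1 / real (Suc k) < r / 2" using reals_Archimedean[of "r/2"] by (auto simp: inverse_eq_divide)
    have fc: "continuous_on S f" "f \<in> space spin_borel" using f U'(1) by (auto simp: space_spin_borel)
    obtain n q where nq: "\<forall>t\<in>S. \<bar>f t - step_fun R n q t\<bar> \<le> 1 / real (Suc k)"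
      using step_fun_approx[OF S_compact R fc(1), of "1 / real (Suc k)"] by auto
    have "f \<in> W (n, q, k)" using nq fc D(2) by (auto simp: W_def)
    moreover have "W (n, q, k) \<subseteq> U"
    proof
      fix g assume g: "g \<in> W (n, q, k)"
      then have gc: "g \<in> space spin_borel" "continuous_on S g" by (auto simp: W_def space_spin_borel)
      have D': "\<bar>f t - g t\<bar> \<le> r" if "t \<in> D" for t
      proof -
        have "\<bar>g t - step_fun R n q t\<bar> \<le> 1 / real (Suc k)" "\<bar>f t - step_fun R n q t\<bar> \<le> 1 / real (Suc k)"
          using g that nq D(2) by (auto simp: W_def)
        then show ?thesis using k by linarith
      qed
      have "\<bar>f t - g t\<bar> \<le> r" if "t \<in> S" for t
        by (rule continuous_le_on_closure[of D "\<lambda>t. \<bar>f t - g t\<bar>"]) (use that D' clD fc gc in \<open>auto intro!: continuous_intros\<close>)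
      then show "g \<in> U" using r(2) gc by blast
    qed
    ultimately show "f \<in> (\<Union>i\<in>I. W i)" by (auto simp: I_def)
  qed
  then have UW: "U = (\<Union>i\<in>I. W i)" by (auto simp: I_def)
  have "F -` U \<inter> space N = (\<Union>i\<in>I. {x \<in> space N. F x \<in> W i})" unfolding UW by auto
  also have "\<dots> \<in> sets N"
  proof (rule sets.countable_UN'')
    show "countable I" by simp
    fix i assume "i \<in> I"
    obtain n q k where i: "i = (n, q, k)" by (cases i) auto
    have "{x \<in> space N. F x \<in> W i} = {x \<in> space N. \<forall>t\<in>D. \<bar>F x t - step_fun R n q t\<bar> \<le> 1 / real (Suc k)}"
      using sp by (auto simp: W_def i)
    also have "\<dots> \<in> sets N"
    proof (rule sets.sets_Collect_countable_All'[OF _ D(1)])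
      fix t assume "t \<in> D"
      then have [measurable]: "(\<lambda>x. F x t) \<in> borel_measurable N" using ev D(2) by auto
      show "{x \<in> space N. \<bar>F x t - step_fun R n q t\<bar> \<le> 1 / real (Suc k)} \<in> sets N" by measurable
    qed
    finally show "{x \<in> space N. F x \<in> W i} \<in> sets N" .
  qed
  finally show "F -` U \<inter> space N \<in> sets N" .
qed

definition site :: "nat \<Rightarrow> (real \<Rightarrow> real) \<Rightarrow> (nat \<Rightarrow> real) \<Rightarrow> real" where "site i x \<sigma> = x (\<sigma> i)"

lemma continuous_coord: "continuous_on A (\<lambda>\<sigma>::nat \<Rightarrow> real. \<sigma> i)"
  by (rule continuous_on_product_then_coordinatewise) (rule continuous_on_id)

lemma site_energies: assumes "continuous_on S x" shows "site i x \<in> energies"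
  unfolding energies_def site_def[abs_def]
  by (auto intro!: continuous_on_compose2[OF assms continuous_coord] simp: configs_iff)

lemma site_measurable [measurable]: "site i \<in> measurable spin_borel energy_space"
proof (rule measurable_energy_space)
  show "x \<in> space spin_borel \<Longrightarrow> site i x \<in> energies" for x by (rule site_energies) (simp add: space_spin_borel)
  show "(\<lambda>x. site i x \<sigma>) \<in> borel_measurable spin_borel" if "\<sigma> \<in> configs" for \<sigma>
    unfolding site_def by (rule spin_borel_eval) (use that in \<open>simp add: configs_iff\<close>)
qed

lemma site_depends_on: "depends_on {i} (site i x)"
  by (simp add: depends_on_def site_def)

definition spin_norm :: "(real \<Rightarrow> real) \<Rightarrow> real" where "spin_norm x = nrm (site 0 x)"

lemma maxE_site: "maxE (site i x) = (SUP t\<in>S. x t)"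
proof -
  have "(site i x) ` configs = x ` S"
  proof
    show "x ` S \<subseteq> site i x ` configs"
    proof
      fix y assume "y \<in> x ` S"
      then obtain t where "t \<in> S" "y = x t" by auto
      then show "y \<in> site i x ` configs" by (intro image_eqI[of _ _ "\<lambda>_. t"]) (auto simp: site_def configs_iff)
    qed
  qed (auto simp: site_def configs_iff)
  then show ?thesis by (simp add: maxE_def)
qed

lemma nrm_site: "nrm (site i x) = spin_norm x"
  using maxE_site[of i "\<lambda>t. \<bar>x t\<bar>"] maxE_site[of 0 "\<lambda>t. \<bar>x t\<bar>"] by (simp add: spin_norm_def nrm_def site_def[abs_def])

lemma spin_norm_measurable [measurable]: "spin_norm \<in> borel_measurable spin_borel"
  unfolding spin_norm_def[abs_def] by measurable

lemma spin_norm_ge: assumes "x \<in> space spin_borel" "t \<in> S" shows "\<bar>x t\<bar> \<le> spin_norm x"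
proof -
  have "site 0 x \<in> energies" using assms by (intro site_energies) (simp add: space_spin_borel)
  then show ?thesis using nrm_ge[of "site 0 x" "\<lambda>_. t"] assms by (simp add: spin_norm_def site_def configs_iff)
qed

lemma spin_norm_nonneg: "x \<in> space spin_borel \<Longrightarrow> 0 \<le> spin_norm x"
  unfolding spin_norm_def by (rule nrm_nonneg, rule site_energies) (simp add: space_spin_borel)

lemma SUP_ennreal: assumes "A \<noteq> {}" "bdd_above (f ` A)" "\<And>x. x \<in> A \<Longrightarrow> 0 \<le> f x"
  shows "(SUP x\<in>A. ennreal (f x)) = ennreal (SUP x\<in>A. f x)"
proof (rule antisym)
  show "(SUP x\<in>A. ennreal (f x)) \<le> ennreal (SUP x\<in>A. f x)"
    by (rule SUP_least) (auto intro!: ennreal_leI cSUP_upper assms)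
  obtain x0 where x0: "x0 \<in> A" using assms by auto
  show "ennreal (SUP x\<in>A. f x) \<le> (SUP x\<in>A. ennreal (f x))"
  proof (cases "(SUP x\<in>A. ennreal (f x)) = \<top>")
    case False
    then obtain c where c: "c \<ge> 0" "(SUP x\<in>A. ennreal (f x)) = ennreal c" by (metis ennreal_cases)
    have "(SUP x\<in>A. f x) \<le> c"
    proof (rule cSUP_least[OF assms(1)])
      fix x assume "x \<in> A"
      then have "ennreal (f x) \<le> ennreal c" unfolding c(2)[symmetric] by (rule SUP_upper)
      then show "f x \<le> c" using c(1) by (simp add: ennreal_le_iff)
    qed
    then show ?thesis unfolding c(2) by (rule ennreal_leI)
  next
    case True
    show ?thesis unfolding True by (rule top_greatest)
  qed
qed

lemma sup_norm_spin_borel: assumes "x \<in> space spin_borel" shows "sup_norm S x = ennreal (spin_norm x)"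
proof -
  have "bdd_above ((\<lambda>t. \<bar>x t\<bar>) ` S)" using spin_norm_ge[OF assms] by (auto simp: bdd_above_def)
  then have "sup_norm S x = ennreal (SUP t\<in>S. \<bar>x t\<bar>)"
    unfolding sup_norm_def using S_ne by (intro SUP_ennreal) auto
  also have "(SUP t\<in>S. \<bar>x t\<bar>) = spin_norm x"
    using maxE_site[of 0 "\<lambda>t. \<bar>x t\<bar>"] by (simp add: spin_norm_def nrm_def site_def[abs_def])
  finally show ?thesis .
qed

lemma Pr1D: assumes "L \<in> Pr1 S" shows "prob_space L" "sets L = sets spin_borel" "space L = space spin_borel" "integrable L spin_norm"
proof -
  show "prob_space L" and s: "sets L = sets spin_borel" using assms by (auto simp: Pr1_def)
  show sp: "space L = space spin_borel" by (rule sets_eq_imp_space_eq[OF s])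
  note [measurable_cong] = s
  have "(\<integral>\<^sup>+x. ennreal (spin_norm x) \<partial>L) = (\<integral>\<^sup>+x. sup_norm S x \<partial>L)"
    by (rule nn_integral_cong) (simp add: sp sup_norm_spin_borel)
  also have "\<dots> < \<infinity>" using assms by (simp add: Pr1_def)
  finally show "integrable L spin_norm" by (intro integrableI_nonneg) (auto simp: sp spin_norm_nonneg)
qed

lemma Pr1I: assumes "prob_space L" "sets L = sets spin_borel" "(\<integral>\<^sup>+x. ennreal (spin_norm x) \<partial>L) < \<infinity>" shows "L \<in> Pr1 S"
proof -
  have "(\<integral>\<^sup>+x. sup_norm S x \<partial>L) = (\<integral>\<^sup>+x. ennreal (spin_norm x) \<partial>L)"
    by (rule nn_integral_cong) (simp add: sets_eq_imp_space_eq[OF assms(2)] sup_norm_spin_borel)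
  then show ?thesis using assms by (simp add: Pr1_def)
qed

definition site_law where "site_law L i = distr L energy_space (site i)"

lemma increment_site_law: assumes "L \<in> Pr1 S" shows "increment (site_law L i)"
proof -
  note [measurable_cong] = Pr1D(2)[OF assms]
  interpret prob_space L by (rule Pr1D[OF assms])
  show ?thesis unfolding increment_def site_law_def
    using Pr1D(4)[OF assms] by (auto intro!: prob_space_distr simp: integrable_distr_eq nrm_site[abs_def])
qed

end

section \<open>Clauses\<close>

locale model = spin_space S for S :: "real set" +
  fixes p :: nat and Q :: "((nat \<Rightarrow> real) \<Rightarrow> real) measure"
  assumes p_ge: "2 \<le> p" and clause: "clause_law S p Q" and symm: "symmetric_law S p Q"
begin

abbreviation "clause_borel \<equiv> cont_borel (cube_top S p)"

abbreviation "cube \<equiv> {..<p} \<rightarrow>\<^sub>E S"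

lemma topspace_cube: "topspace (cube_top S p) = cube"
  by (simp add: cube_top_def)

lemma space_clause_borel: "space clause_borel = {f. f \<in> extensional cube \<and> continuous_map (cube_top S p) euclidean f}"
proof -
  have "compact_space (cube_top S p)" unfolding cube_top_def
    using S_compact by (simp add: compact_space_product_topology compact_space_subtopology)
  then show ?thesis unfolding space_cont_borel
    by (subst compactin_mspace_cfunspace) (auto simp: compact_space_def topspace_cube)
qed

lemma clause_borel_eval: "y \<in> cube \<Longrightarrow> (\<lambda>f. f y) \<in> borel_measurable clause_borel"
  using cont_borel_eval[of y "cube_top S p"] by (simp add: topspace_cube)

lemma prob_Q: "prob_space Q" and sets_Q [measurable_cong]: "sets Q = sets clause_borel"
  using clause by (auto simp: clause_law_def)

lemma space_Q: "space Q = space clause_borel"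
  by (rule sets_eq_imp_space_eq[OF sets_Q])

sublocale Q: prob_space Q by (rule prob_Q)

lemma clause_continuous:
  assumes f: "f \<in> space clause_borel" and h: "\<And>j. j < p \<Longrightarrow> continuous_on T (\<lambda>x. h x j)" "\<And>x j. x \<in> T \<Longrightarrow> j < p \<Longrightarrow> h x j \<in> S"
  shows "continuous_on T (\<lambda>x. f (\<lambda>j\<in>{..<p}. h x j))"
proof -
  have "continuous_map (top_of_set T) (cube_top S p) (\<lambda>x. \<lambda>j\<in>{..<p}. h x j)"
    unfolding cube_top_def continuous_map_componentwise using h by (auto simp: Pi_iff)
  then have "continuous_map (top_of_set T) euclidean (f \<circ> (\<lambda>x. \<lambda>j\<in>{..<p}. h x j))"
    by (rule continuous_map_compose) (use f in \<open>simp add: space_clause_borel\<close>)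
  then show ?thesis by (simp add: o_def)
qed

text \<open>
  The energy of a clause whose variables are the spins at the vertices listed in \<open>l\<close>.
\<close>

definition lift :: "nat list \<Rightarrow> ((nat \<Rightarrow> real) \<Rightarrow> real) \<Rightarrow> (nat \<Rightarrow> real) \<Rightarrow> real" where
  "lift l f \<sigma> = f (\<lambda>j\<in>{..<p}. \<sigma> (l ! j))"

lemma lift_energies: "f \<in> space clause_borel \<Longrightarrow> lift l f \<in> energies"
  unfolding energies_def lift_def[abs_def] by (auto intro!: clause_continuous continuous_coord simp: configs_iff)

lemma lift_measurable [measurable]: "lift l \<in> measurable clause_borel energy_space"
proof (rule measurable_energy_space[OF lift_energies])
  show "(\<lambda>f. lift l f \<sigma>) \<in> borel_measurable clause_borel" if "\<sigma> \<in> configs" for \<sigma>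
    unfolding lift_def by (rule clause_borel_eval) (use that in \<open>auto simp: configs_iff\<close>)
qed

lemma lift_depends_on: "length l = p \<Longrightarrow> depends_on (set l) (lift l f)"
  unfolding depends_on_def lift_def by (intro ballI impI arg_cong[of _ _ f] restrict_ext) auto

definition clause_norm :: "((nat \<Rightarrow> real) \<Rightarrow> real) \<Rightarrow> real" where "clause_norm f = nrm (lift [0..<p] f)"

lemma clause_norm_measurable [measurable]: "clause_norm \<in> borel_measurable clause_borel"
  unfolding clause_norm_def[abs_def] by measurable

lemma cube_lift: assumes "y \<in> cube" obtains \<sigma> where "\<sigma> \<in> configs" "\<And>f. lift [0..<p] f \<sigma> = f y"
proof -
  obtain s where s: "s \<in> S" using S_ne by auto
  let ?s = "\<lambda>j. if j < p then y j else s"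
  have "?s \<in> configs" using assms s by (auto simp: configs_iff PiE_iff)
  moreover have "(\<lambda>j\<in>{..<p}. ?s ([0..<p] ! j)) = y" using assms by (auto simp: PiE_iff extensional_def fun_eq_iff)
  ultimately show thesis using that by (simp add: lift_def)
qed

lemma lift_cube: "\<sigma> \<in> configs \<Longrightarrow> (\<lambda>j\<in>{..<p}. \<sigma> (l ! j)) \<in> cube"
  by (auto simp: configs_iff)

lemma clause_norm_ge: assumes "f \<in> space clause_borel" "y \<in> cube" shows "\<bar>f y\<bar> \<le> clause_norm f"
  by (rule cube_lift[OF assms(2)]) (use nrm_ge[OF lift_energies[OF assms(1)], of _ "[0..<p]"] in \<open>force simp: clause_norm_def\<close>)

lemma nrm_lift: "f \<in> space clause_borel \<Longrightarrow> nrm (lift l f) \<le> clause_norm f"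
  by (rule nrm_le) (auto simp: lift_def intro!: clause_norm_ge lift_cube)

lemma clause_norm_nonneg: "f \<in> space clause_borel \<Longrightarrow> 0 \<le> clause_norm f"
  unfolding clause_norm_def by (rule nrm_nonneg, rule lift_energies)

lemma cube_ne: "cube \<noteq> {}"
  using S_ne by (simp add: PiE_eq_empty_iff)

lemma sup_norm_clause_borel: assumes "f \<in> space clause_borel" shows "sup_norm cube f = ennreal (clause_norm f)"
proof -
  have "bdd_above ((\<lambda>t. \<bar>f t\<bar>) ` cube)" using clause_norm_ge[OF assms] by (auto simp: bdd_above_def)
  then have "sup_norm cube f = ennreal (SUP t\<in>cube. \<bar>f t\<bar>)"
    unfolding sup_norm_def using cube_ne by (intro SUP_ennreal) auto
  also have "(SUP t\<in>cube. \<bar>f t\<bar>) = clause_norm f"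
  proof (rule antisym)
    show "(SUP t\<in>cube. \<bar>f t\<bar>) \<le> clause_norm f" by (rule cSUP_least) (auto simp: cube_ne clause_norm_ge assms)
    show "clause_norm f \<le> (SUP t\<in>cube. \<bar>f t\<bar>)"
      unfolding clause_norm_def
    proof (rule nrm_le)
      fix \<sigma> assume "\<sigma> \<in> configs"
      from cSUP_upper[OF lift_cube[OF this, of "[0..<p]"] \<open>bdd_above ((\<lambda>t. \<bar>f t\<bar>) ` cube)\<close>]
      show "\<bar>lift [0..<p] f \<sigma>\<bar> \<le> (SUP t\<in>cube. \<bar>f t\<bar>)" by (simp only: lift_def)
    qed
  qed
  finally show ?thesis .
qed

lemma clause_norm_square_integrable: "integrable Q (\<lambda>f. (clause_norm f)\<^sup>2)"
proof -
  have "(\<integral>\<^sup>+f. ennreal ((clause_norm f)\<^sup>2) \<partial>Q) = (\<integral>\<^sup>+f. (sup_norm cube f)\<^sup>2 \<partial>Q)"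
    by (rule nn_integral_cong) (simp add: space_Q sup_norm_clause_borel ennreal_power clause_norm_nonneg)
  also have "\<dots> < \<infinity>" using clause by (simp add: clause_law_def)
  finally show ?thesis by (intro integrableI_nonneg) auto
qed

lemma clause_norm_integrable: "integrable Q clause_norm"
proof (rule Bochner_Integration.integrable_bound[of _ "\<lambda>f. 1 + (clause_norm f)\<^sup>2"])
  show "AE f in Q. norm (clause_norm f) \<le> norm (1 + (clause_norm f)\<^sup>2)"
  proof (rule AE_I2)
    fix f
    have "2 * \<bar>clause_norm f\<bar> \<le> 1 + (clause_norm f)\<^sup>2" using sum_squares_bound[of 1 "\<bar>clause_norm f\<bar>"] by (simp add: power2_eq_square)
    then show "norm (clause_norm f) \<le> norm (1 + (clause_norm f)\<^sup>2)" by simp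
  qed
qed (use clause_norm_square_integrable in auto)

definition mean_clause_norm where "mean_clause_norm = (\<integral>f. clause_norm f \<partial>Q)"

lemma mean_clause_norm_nonneg: "0 \<le> mean_clause_norm"
  unfolding mean_clause_norm_def by (rule integral_nonneg_AE, rule AE_I2) (simp add: space_Q clause_norm_nonneg)

definition clause_law_at where "clause_law_at l = distr Q energy_space (lift l)"

lemma increment_clause_law_at: "increment (clause_law_at l)" "mean_nrm (clause_law_at l) \<le> mean_clause_norm"
proof -
  have int: "integrable Q (\<lambda>f. nrm (lift l f))"
    by (rule Bochner_Integration.integrable_bound[OF clause_norm_integrable])
      (auto intro!: AE_I2 simp: space_Q nrm_lift clause_norm_nonneg lift_energies)
  then show "increment (clause_law_at l)"
    unfolding increment_def clause_law_at_def by (auto intro!: Q.prob_space_distr simp: integrable_distr_eq)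
  show "mean_nrm (clause_law_at l) \<le> mean_clause_norm"
    unfolding mean_nrm_def clause_law_at_def mean_clause_norm_def by (subst integral_distr) (auto intro!: integral_mono int clause_norm_integrable nrm_lift simp: space_Q)
qed

lemma energy_space_sets_eq: assumes "A \<in> sets energy_space" "E \<in> energies" "F \<in> energies" "\<And>\<sigma>. \<sigma> \<in> configs \<Longrightarrow> E \<sigma> = F \<sigma>"
  shows "E \<in> A \<longleftrightarrow> F \<in> A"
proof -
  obtain B where "A = (\<lambda>E. restrict E configs) -` B \<inter> energies"
    using assms(1) unfolding energy_space_def by (subst (asm) sets_vimage_algebra2) (auto simp: space_PiM)
  moreover have "restrict E configs = restrict F configs" using assms(4) by (simp add: restrict_def fun_eq_iff)
  ultimately show ?thesis using assms(2,3) by simp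
qed

definition permute_args where "permute_args \<tau> f = (\<lambda>x\<in>cube. f (x \<circ> \<tau>))"

lemma cube_perm: assumes "\<tau> permutes {..<p}" "x \<in> cube" shows "x \<circ> \<tau> \<in> cube"
proof (rule PiE_I)
  show "j \<in> {..<p} \<Longrightarrow> (x \<circ> \<tau>) j \<in> S" for j using assms permutes_in_image[OF assms(1), of j] by (auto simp: PiE_iff)
  show "j \<notin> {..<p} \<Longrightarrow> (x \<circ> \<tau>) j = undefined" for j using assms by (auto simp: permutes_def PiE_iff extensional_def)
qed

lemma permute_args_space: assumes "\<tau> permutes {..<p}" "f \<in> space clause_borel" shows "permute_args \<tau> f \<in> space clause_borel"
proof -
  have c: "continuous_map (cube_top S p) (cube_top S p) (\<lambda>x. x \<circ> \<tau>)"
    unfolding cube_top_def continuous_map_componentwise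
  proof (intro conjI ballI)
    show "(\<lambda>x. x \<circ> \<tau>) ` topspace (product_topology (\<lambda>_. top_of_set S) {..<p}) \<subseteq> extensional {..<p}"
      using cube_perm[OF assms(1)] by (auto simp: PiE_iff)
    fix k assume "k \<in> {..<p}"
    then have "\<tau> k \<in> {..<p}" using permutes_in_image[OF assms(1), of k] by simp
    then show "continuous_map (product_topology (\<lambda>_. top_of_set S) {..<p}) (top_of_set S) (\<lambda>x. (x \<circ> \<tau>) k)"
      using continuous_map_product_projection[of "\<tau> k" "{..<p}" "\<lambda>_. top_of_set S"] by (simp add: o_def)
  qed
  have "continuous_map (cube_top S p) euclidean (f \<circ> (\<lambda>x. x \<circ> \<tau>))"
    by (rule continuous_map_compose[OF c]) (use assms in \<open>simp add: space_clause_borel\<close>)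
  then have "continuous_map (cube_top S p) euclidean (permute_args \<tau> f)"
    by (rule continuous_map_eq) (simp add: permute_args_def topspace_cube)
  then show ?thesis by (simp add: space_clause_borel permute_args_def)
qed

text \<open>
  Permuting the arguments is an isometry of the space of clauses, so preimages of open sets are open.
\<close>

lemma permute_args_measurable: assumes "\<tau> permutes {..<p}" shows "permute_args \<tau> \<in> measurable clause_borel clause_borel"
proof (rule measurable_cont_borelI[OF permute_args_space[OF assms]])
  fix U :: "((nat \<Rightarrow> real) \<Rightarrow> real) set" assume "openin (mtopology_of (cfunspace (cube_top S p) euclidean_metric)) U"
  then have U: "U \<subseteq> space clause_borel" "\<And>f. f \<in> U \<Longrightarrow> \<exists>r>0. \<forall>g\<in>space clause_borel. (\<forall>x\<in>cube. \<bar>f x - g x\<bar> \<le> r) \<longrightarrow> g \<in> U"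
    using openin_cfun[of "cube_top S p" U] cube_ne by (auto simp: topspace_cube)
  have "openin (mtopology_of (cfunspace (cube_top S p) euclidean_metric)) (permute_args \<tau> -` U \<inter> space clause_borel)"
  proof (subst openin_cfun, use cube_ne topspace_cube in simp, intro conjI ballI)
    fix f assume f: "f \<in> permute_args \<tau> -` U \<inter> space clause_borel"
    then obtain r where r: "r > 0" "\<And>g. g \<in> space clause_borel \<Longrightarrow> (\<forall>x\<in>cube. \<bar>permute_args \<tau> f x - g x\<bar> \<le> r) \<Longrightarrow> g \<in> U"
      using U(2)[of "permute_args \<tau> f"] by auto
    show "\<exists>r>0. \<forall>g\<in>space clause_borel. (\<forall>x\<in>topspace (cube_top S p). \<bar>f x - g x\<bar> \<le> r) \<longrightarrow> g \<in> permute_args \<tau> -` U \<inter> space clause_borel"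
    proof (intro exI[of _ r] conjI ballI impI r(1))
      fix g assume g: "g \<in> space clause_borel" "\<forall>x\<in>topspace (cube_top S p). \<bar>f x - g x\<bar> \<le> r"
      have "permute_args \<tau> g \<in> U"
        by (rule r(2)[OF permute_args_space[OF assms g(1)]]) (use g(2) cube_perm[OF assms] in \<open>simp add: permute_args_def topspace_cube\<close>)
      then show "g \<in> permute_args \<tau> -` U \<inter> space clause_borel" using g(1) by simp
    qed
  qed simp
  then show "permute_args \<tau> -` U \<inter> space clause_borel \<in> sets clause_borel" by (rule cont_borel_open)
qed

text \<open>
  Two enumerations of the same vertices differ by a permutation of the arguments, and the law of a
  clause is symmetric.
\<close>

lemma clause_law_at_symm: assumes l: "distinct l" "distinct l'" "length l = p" "set l = set l'" shows "clause_law_at l = clause_law_at l'"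
proof -
  have ml: "mset l = mset l'" using l by (simp add: set_eq_iff_mset_eq_distinct)
  have len: "length l' = p" using ml l(3) by (metis size_mset)
  obtain \<tau> where \<tau>: "\<tau> permutes {..<length l}" "permute_list \<tau> l = l'"
    using mset_eq_permutation[OF ml[symmetric]] by blast
  then have \<tau>p: "\<tau> permutes {..<p}" using l by simp
  have nth: "l' ! j = l ! \<tau> j" if "j < p" for j using permute_list_nth[OF \<tau>(1), of j] \<tau>(2) that l(3) by simp
  have lp: "lift l' f \<sigma> = lift l (permute_args \<tau> f) \<sigma>" if "\<sigma> \<in> configs" for f \<sigma>
  proof -
    have "(\<lambda>j\<in>{..<p}. \<sigma> (l' ! j)) = (\<lambda>j\<in>{..<p}. \<sigma> (l ! j)) \<circ> \<tau>"
    proof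
      fix j
      show "(\<lambda>j\<in>{..<p}. \<sigma> (l' ! j)) j = ((\<lambda>j\<in>{..<p}. \<sigma> (l ! j)) \<circ> \<tau>) j"
        using nth[of j] permutes_in_image[OF \<tau>p, of j] permutes_not_in[OF \<tau>p, of j] by (auto simp: restrict_def)
    qed
    then show ?thesis using lift_cube[OF that] by (simp add: lift_def permute_args_def)
  qed
  have dq: "distr Q clause_borel (permute_args \<tau>) = Q" using symm \<tau>p unfolding symmetric_law_def permute_args_def[abs_def] by blast
  have [measurable]: "permute_args \<tau> \<in> measurable clause_borel clause_borel" by (rule permute_args_measurable[OF \<tau>p])
  show ?thesis
  proof (rule measure_eqI)
    fix A assume "A \<in> sets (clause_law_at l)"
    then have A[measurable]: "A \<in> sets energy_space" by (simp add: clause_law_at_def)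
    have "emeasure (clause_law_at l) A = emeasure (distr Q clause_borel (permute_args \<tau>)) (lift l -` A \<inter> space clause_borel)"
      unfolding dq clause_law_at_def by (subst emeasure_distr) (auto simp: space_Q)
    also have "\<dots> = emeasure Q (permute_args \<tau> -` (lift l -` A \<inter> space clause_borel) \<inter> space Q)"
      by (rule emeasure_distr) measurable
    also have "permute_args \<tau> -` (lift l -` A \<inter> space clause_borel) \<inter> space Q = lift l' -` A \<inter> space Q"
      using permute_args_space[OF \<tau>p] energy_space_sets_eq[OF A lift_energies lift_energies lp] by (auto simp: space_Q)
    also have "emeasure Q \<dots> = emeasure (clause_law_at l') A" unfolding clause_law_at_def by (subst emeasure_distr) auto
    finally show "emeasure (clause_law_at l) A = emeasure (clause_law_at l') A" .
  qed (simp add: clause_law_at_def)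
qed

end

section \<open>Independent fields and messages of clauses\<close>

lemma integral_PiM_iter:
  fixes f :: "(nat \<Rightarrow> 'a) \<Rightarrow> real"
  assumes "prob_space M" "integrable (iid M) f"
  shows "(\<integral>z. f z \<partial>iid M) = (\<integral>x. \<integral>z. f (case_nat x z) \<partial>iid M \<partial>M)"
proof -
  interpret sequence_space M by (rule sequence_space_prob) fact
  note [measurable] = borel_measurable_integrable[OF assms(2)]
  have m: "(\<lambda>(s, \<omega>). case_nat s \<omega>) \<in> measurable (M \<Otimes>\<^sub>M S) S" by measurable
  interpret P2: pair_prob_space M S ..
  have "integrable (distr (M \<Otimes>\<^sub>M S) S (\<lambda>(s, \<omega>). case_nat s \<omega>)) f" using assms(2) by (simp add: PiM_iter)
  then have int: "integrable (M \<Otimes>\<^sub>M S) (\<lambda>x. f ((\<lambda>(s, \<omega>). case_nat s \<omega>) x))"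
    by (subst (asm) integrable_distr_eq[OF m]) auto
  have "(\<integral>z. f z \<partial>S) = (\<integral>z. f z \<partial>distr (M \<Otimes>\<^sub>M S) S (\<lambda>(s, \<omega>). case_nat s \<omega>))" by (simp add: PiM_iter)
  also have "\<dots> = (\<integral>x. f ((\<lambda>(s, \<omega>). case_nat s \<omega>) x) \<partial>(M \<Otimes>\<^sub>M S))"
    by (rule integral_distr[OF m]) measurable
  also have "\<dots> = (\<integral>x. \<integral>z. f (case_nat x z) \<partial>S \<partial>M)"
    using P2.integral_fst'[OF int] by simp
  finally show ?thesis .
qed

lemma integrable_PiM_component:
  assumes "prob_space M" "integrable M (f :: _ \<Rightarrow> real)"
  shows "integrable (iid M) (\<lambda>x. f (x j))"
proof -
  have "distr (iid M) M (\<lambda>x. x j) = M" by (rule distr_PiM_component) (use assms in auto)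
  then have "integrable (distr (iid M) M (\<lambda>x. x j)) f" using assms by simp
  then show ?thesis by (subst (asm) integrable_distr_eq) (use assms in auto)
qed

context spin_space
begin

text \<open>
  The observable does not notice whether the spins in \<open>J\<close> have already been chosen optimally.
\<close>

definition max_out :: "nat set \<Rightarrow> (((nat \<Rightarrow> real) \<Rightarrow> real) \<Rightarrow> real) \<Rightarrow> bool" where
  "max_out J \<Phi> \<longleftrightarrow> (\<forall>W\<in>energies. \<Phi> (partial_max J W) = \<Phi> W)"

lemma max_out_maxE: "max_out J maxE"
  by (simp add: max_out_def maxE_partial_max)

lemma avg_distr:
  assumes "\<Phi> \<in> observables" "E \<in> energies" "Y \<in> measurable N energy_space"
  shows "avg (distr N energy_space Y) \<Phi> E = (\<integral>\<omega>. \<Phi> (E + Y \<omega>) \<partial>N)"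
  unfolding avg_def by (rule integral_distr[OF assms(3)]) (rule measurable_compose[OF shift_energy_space[OF assms(2)] observables_meas[OF assms(1)]], simp)

lemma avg_distr_integrable:
  assumes "increment (distr N energy_space Y)" "\<Phi> \<in> observables" "E \<in> energies" "Y \<in> measurable N energy_space"
  shows "integrable N (\<lambda>\<omega>. \<Phi> (E + Y \<omega>))"
proof -
  have "(\<lambda>Z. \<Phi> (E + Z)) \<in> borel_measurable energy_space" by (rule measurable_compose[OF shift_energy_space[OF assms(3)] observables_meas[OF assms(2)]], simp)
  with avg_integrable[OF assms(1-3)] show ?thesis by (subst (asm) integrable_distr_eq[OF assms(4)])
qed

lemma max_out_avg_distr:
  assumes "\<Phi> \<in> observables" "max_out J \<Phi>" "Y \<in> measurable N energy_space" "\<And>\<omega>. \<omega> \<in> space N \<Longrightarrow> depends_on J' (Y \<omega>)" "J' \<inter> J = {}"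
  shows "max_out J (avg (distr N energy_space Y) \<Phi>)"
  unfolding max_out_def
proof
  fix W assume W: "W \<in> energies"
  have "avg (distr N energy_space Y) \<Phi> (partial_max J W) = (\<integral>\<omega>. \<Phi> (partial_max J W + Y \<omega>) \<partial>N)"
    by (rule avg_distr[OF assms(1) partial_max_energies[OF W] assms(3)])
  also have "\<dots> = (\<integral>\<omega>. \<Phi> (W + Y \<omega>) \<partial>N)"
  proof (rule Bochner_Integration.integral_cong[OF refl])
    fix \<omega> assume \<omega>: "\<omega> \<in> space N"
    then have Y: "Y \<omega> \<in> energies" using measurable_space[OF assms(3)] by auto
    have "\<Phi> (partial_max J W + Y \<omega>) = \<Phi> (partial_max J (W + Y \<omega>))"
      by (rule observables_eq_on_configs[OF assms(1)]) (auto intro!: partial_max_energies W Y simp: partial_max_add_depends_on[OF W assms(4)[OF \<omega>] assms(5)] plus_fun_apply)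
    also have "\<dots> = \<Phi> (W + Y \<omega>)" using assms(2) W Y by (simp add: max_out_def)
    finally show "\<Phi> (partial_max J W + Y \<omega>) = \<Phi> (W + Y \<omega>)" .
  qed
  also have "\<dots> = avg (distr N energy_space Y) \<Phi> W" by (rule avg_distr[OF assms(1) W assms(3), symmetric])
  finally show "avg (distr N energy_space Y) \<Phi> (partial_max J W) = avg (distr N energy_space Y) \<Phi> W" .
qed

lemma max_out_cong: assumes "max_out J \<Phi>" "\<And>E. E \<in> energies \<Longrightarrow> \<Psi> E = \<Phi> E" shows "max_out J \<Psi>"
  using assms by (auto simp: max_out_def partial_max_energies)

lemma max_out_iid_sum:
  assumes "increment \<mu>" "\<And>\<Phi>. \<Phi> \<in> observables \<Longrightarrow> max_out J \<Phi> \<Longrightarrow> max_out J (avg \<mu> \<Phi>)" "\<Phi> \<in> observables" "max_out J \<Phi>"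
  shows "max_out J (avg (iid_sum \<mu> r) \<Phi>)"
proof (induct r)
  case 0 show ?case by (rule max_out_cong[OF assms(4)]) (rule avg_iid_sum_0[OF assms(1,3)])
next
  case (Suc r)
  show ?case by (rule max_out_cong[OF assms(2)[OF avg_observables[OF increment_iid_sum(1)[OF assms(1)] assms(3)] Suc]])
      (rule avg_iid_sum_Suc[OF assms(1,3)])
qed

lemma max_out_cpoisson:
  assumes "increment \<mu>" "\<And>\<Phi>. \<Phi> \<in> observables \<Longrightarrow> max_out J \<Phi> \<Longrightarrow> max_out J (avg \<mu> \<Phi>)" "\<Phi> \<in> observables" "max_out J \<Phi>" "0 < m"
  shows "max_out J (avg (cpoisson \<mu> m) \<Phi>)"
  unfolding max_out_def
proof
  fix W assume W: "W \<in> energies"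
  show "avg (cpoisson \<mu> m) \<Phi> (partial_max J W) = avg (cpoisson \<mu> m) \<Phi> W"
    unfolding avg_cpoisson(1)[OF assms(1,5,3) W] avg_cpoisson(1)[OF assms(1,5,3) partial_max_energies[OF W]]
    using max_out_iid_sum[OF assms(1-4)] W by (simp add: max_out_def)
qed

lemma avg_site_law: assumes "L \<in> Pr1 S" "\<Phi> \<in> observables" "E \<in> energies" shows "avg (site_law L i) \<Phi> E = (\<integral>x. \<Phi> (E + site i x) \<partial>L)"
proof -
  note [measurable_cong] = Pr1D(2)[OF assms(1)]
  show ?thesis unfolding site_law_def by (rule avg_distr[OF assms(2,3)]) measurable
qed

lemma max_out_site_law: assumes "L \<in> Pr1 S" "\<Phi> \<in> observables" "max_out J \<Phi>" "i \<notin> J" shows "max_out J (avg (site_law L i) \<Phi>)"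
proof -
  note [measurable_cong] = Pr1D(2)[OF assms(1)]
  show ?thesis unfolding site_law_def by (rule max_out_avg_distr[OF assms(2,3) _ site_depends_on]) (use assms(4) in auto)
qed

fun avg_fields where
  "avg_fields L [] \<Phi> = \<Phi>"
| "avg_fields L (i # is) \<Phi> = avg (site_law L i) (avg_fields L is \<Phi>)"

lemma avg_fields_observables: "L \<in> Pr1 S \<Longrightarrow> \<Phi> \<in> observables \<Longrightarrow> avg_fields L js \<Phi> \<in> observables"
  by (induct js) (auto intro: avg_observables increment_site_law)

lemma avg_fields_append: "avg_fields L (js @ bs) \<Phi> = avg_fields L js (avg_fields L bs \<Phi>)"
  by (induct js) auto

lemma max_out_avg_fields: "L \<in> Pr1 S \<Longrightarrow> \<Phi> \<in> observables \<Longrightarrow> max_out J \<Phi> \<Longrightarrow> set js \<inter> J = {} \<Longrightarrow> max_out J (avg_fields L js \<Phi>)"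
  by (induct js) (auto intro: max_out_site_law avg_fields_observables)

lemma avg_fields_avg_commute:
  assumes "L \<in> Pr1 S" "increment \<mu>" "\<Phi> \<in> observables" "E \<in> energies" shows "avg_fields L js (avg \<mu> \<Phi>) E = avg \<mu> (avg_fields L js \<Phi>) E"
  using assms(4)
proof (induct js arbitrary: E)
  case (Cons i js)
  have "avg_fields L (i # js) (avg \<mu> \<Phi>) E = avg (site_law L i) (avg \<mu> (avg_fields L js \<Phi>)) E"
    by simp (rule avg_cong[OF increment_site_law[OF assms(1)] Cons.prems Cons.hyps])
  also have "\<dots> = avg \<mu> (avg (site_law L i) (avg_fields L js \<Phi>)) E"
    by (rule avg_commute) (auto intro: increment_site_law avg_fields_observables assms Cons.prems)
  finally show ?case by simp
qed simp

lemma L_seq_space: "L \<in> Pr1 S \<Longrightarrow> x \<in> space (iid L) \<Longrightarrow> x j \<in> space spin_borel"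
  using Pr1D(3)[of L] by (auto simp: space_PiM)

lemma avg_fields_integral:
  assumes L: "L \<in> Pr1 S" and \<Phi>: "\<Phi> \<in> observables" and "E \<in> energies"
  shows "avg_fields L js \<Phi> E = (\<integral>x. \<Phi> (E + (\<Sum>i<length js. site (js ! i) (x i))) \<partial>iid L)"
    "integrable (iid L) (\<lambda>x. \<Phi> (E + (\<Sum>i<length js. site (js ! i) (x i))))"
proof -
  note [measurable_cong] = Pr1D(2)[OF L]
  note [measurable] = observables_meas[OF \<Phi>]
  interpret L: prob_space L by (rule Pr1D(1)[OF L])
  let ?P = "iid L"
  interpret P: prob_space ?P by (intro prob_space_PiM Pr1D(1)[OF L])
  have int: "integrable ?P (\<lambda>x. \<Phi> (E + (\<Sum>i<length js. site (js ! i) (x i))))" if E: "E \<in> energies" for E js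
  proof (rule Bochner_Integration.integrable_bound[of _ "\<lambda>x. \<bar>\<Phi> E\<bar> + (\<Sum>i<length js. spin_norm (x i))"])
    have "integrable ?P (\<lambda>x. spin_norm (x i))" for i by (rule integrable_PiM_component) (use Pr1D[OF L] in auto)
    then show "integrable ?P (\<lambda>x. \<bar>\<Phi> E\<bar> + (\<Sum>i<length js. spin_norm (x i)))" by simp
    show "(\<lambda>x. \<Phi> (E + (\<Sum>i<length js. site (js ! i) (x i)))) \<in> borel_measurable ?P"
      by (rule measurable_compose[OF shiftL_measurable[OF E] observables_meas[OF \<Phi>]]) measurable
    show "AE x in ?P. norm (\<Phi> (E + (\<Sum>i<length js. site (js ! i) (x i)))) \<le> norm (\<bar>\<Phi> E\<bar> + (\<Sum>i<length js. spin_norm (x i)))"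
    proof (rule AE_I2)
      fix x assume x: "x \<in> space ?P"
      have s: "site (js ! i) (x i) \<in> energies" for i using L_seq_space[OF L x, of i] by (intro site_energies) (simp add: space_spin_borel)
      have "\<bar>\<Phi> (E + (\<Sum>i<length js. site (js ! i) (x i))) - \<Phi> E\<bar> \<le> nrm (\<Sum>i<length js. site (js ! i) (x i))"
        using observables_abs[OF \<Phi>, of "E + (\<Sum>i<length js. site (js ! i) (x i))" E] E s energies_sum[of "{..<length js}" "\<lambda>i. site (js ! i) (x i)"] by simp
      also have "\<dots> \<le> (\<Sum>i<length js. spin_norm (x i))"
        using nrm_sum[of "{..<length js}" "\<lambda>i. site (js ! i) (x i)"] s by (simp add: nrm_site)
      finally show "norm (\<Phi> (E + (\<Sum>i<length js. site (js ! i) (x i)))) \<le> norm (\<bar>\<Phi> E\<bar> + (\<Sum>i<length js. spin_norm (x i)))"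
        by simp
    qed
  qed
  then show "integrable ?P (\<lambda>x. \<Phi> (E + (\<Sum>i<length js. site (js ! i) (x i))))" using assms(3) .
  show "avg_fields L js \<Phi> E = (\<integral>x. \<Phi> (E + (\<Sum>i<length js. site (js ! i) (x i))) \<partial>?P)"
    using assms(3)
  proof (induct js arbitrary: E)
    case Nil
    then show ?case by (simp add: P.prob_space del: zero_fun_apply)
  next
    case (Cons j js)
    have "(\<integral>x. \<Phi> (E + (\<Sum>i<length (j # js). site ((j # js) ! i) (x i))) \<partial>?P)
      = (\<integral>y. \<integral>x. \<Phi> (E + (\<Sum>i<length (j # js). site ((j # js) ! i) (case_nat y x i))) \<partial>?P \<partial>L)"
      by (rule integral_PiM_iter[OF L.prob_space_axioms int[OF Cons.prems]])
    also have "\<dots> = (\<integral>y. \<integral>x. \<Phi> ((E + site j y) + (\<Sum>i<length js. site (js ! i) (x i))) \<partial>?P \<partial>L)"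
      by (simp only: list.size add_Suc_right add_0_right sum.lessThan_Suc_shift nth_Cons_0 nth_Cons_Suc nat.case add.assoc)
    also have "\<dots> = (\<integral>y. avg_fields L js \<Phi> (E + site j y) \<partial>L)"
    proof (rule Bochner_Integration.integral_cong[OF refl])
      fix y assume "y \<in> space L"
      then have "site j y \<in> energies" using Pr1D(3)[OF L] by (intro site_energies) (simp add: space_spin_borel)
      then show "(\<integral>x. \<Phi> ((E + site j y) + (\<Sum>i<length js. site (js ! i) (x i))) \<partial>?P) = avg_fields L js \<Phi> (E + site j y)"
        by (intro Cons.hyps[symmetric] energies_add Cons.prems)
    qed
    also have "\<dots> = avg_fields L (j # js) \<Phi> E" by (simp add: avg_site_law[OF L avg_fields_observables[OF L \<Phi>] Cons.prems])
    finally show ?case ..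
  qed
qed

lemma partial_max_depends_on_full: assumes "depends_on J W" "W \<in> energies" "\<sigma> \<in> configs" shows "partial_max J W \<sigma> = maxE W"
  unfolding partial_max_eq_maxE
  by (rule maxE_cong, rule depends_onD[OF assms(1)]) (auto simp: overwrite_configs assms, auto simp: overwrite_def)

text \<open>
  An energy on spins that are maximised over contributes its maximum, provided that nothing else
  depends on these spins.
\<close>

lemma max_out_depends_on_const:
  assumes "\<Phi> \<in> observables" "max_out J \<Phi>" "depends_on J' U" "J' \<inter> J = {}" "U \<in> energies" "depends_on J W" "W \<in> energies"
  shows "\<Phi> (U + W) = \<Phi> U + maxE W"
proof -
  have "\<Phi> (U + W) = \<Phi> (partial_max J (W + U))" using assms by (simp add: max_out_def add.commute)
  also have "\<dots> = \<Phi> (U + (\<lambda>_. maxE W))"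
    by (rule observables_eq_on_configs[OF assms(1)])
      (auto intro!: partial_max_energies assms simp: partial_max_add_depends_on[OF assms(7,3,4)] partial_max_depends_on_full[OF assms(6,7)] plus_fun_apply)
  also have "\<dots> = \<Phi> U + maxE W" by (rule observables_shift[OF assms(1,5)])
  finally show ?thesis .
qed

text \<open>
  Fields with maximum 0 at vertices that carry nothing else contribute 0. So vertices outside the
  current energy may be given such fields at no cost.
\<close>

lemma avg_fields_normalised:
  assumes L: "L \<in> Pr1 S" and N: "AE x in L. maxE (site 0 x) = 0" and F: "F \<in> observables" and U: "U \<in> energies"
    and "distinct js" "\<And>j. j \<in> set js \<Longrightarrow> max_out {j} F" "depends_on (- set js) U"
  shows "avg_fields L js F U = F U"
  using assms(5-)
proof (induct js)
  case (Cons j js)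
  interpret L: prob_space L by (rule Pr1D(1)[OF L])
  have XF: "avg_fields L js F \<in> observables" by (rule avg_fields_observables[OF L F])
  have el: "max_out {j} (avg_fields L js F)" by (rule max_out_avg_fields[OF L F Cons.prems(2)]) (use Cons.prems in auto)
  have "avg_fields L (j # js) F U = (\<integral>x. avg_fields L js F (U + site j x) \<partial>L)"
    by (simp add: avg_site_law[OF L XF U])
  also have "\<dots> = (\<integral>x. avg_fields L js F U \<partial>L)"
  proof (rule integral_cong_AE)
    note [measurable_cong] = Pr1D(2)[OF L]
    show "(\<lambda>x. avg_fields L js F (U + site j x)) \<in> borel_measurable L"
      by (rule measurable_compose[OF shiftL_measurable[OF U] observables_meas[OF XF]]) measurable
    show "AE x in L. avg_fields L js F (U + site j x) = avg_fields L js F U"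
      using N AE_space
    proof eventually_elim
      fix x assume x: "maxE (site 0 x) = 0" "x \<in> space L"
      then have s: "site j x \<in> energies" using Pr1D(3)[OF L] by (intro site_energies) (simp add: space_spin_borel)
      have "maxE (site j x) = 0" using x(1) by (simp add: maxE_site)
      moreover have "avg_fields L js F (U + site j x) = avg_fields L js F U + maxE (site j x)"
        by (rule max_out_depends_on_const[OF XF el depends_on_mono[OF Cons.prems(3)] _ U site_depends_on s, of "- set (j # js)"]) auto
      ultimately show "avg_fields L js F (U + site j x) = avg_fields L js F U" by simp
    qed
  qed simp
  also have "\<dots> = avg_fields L js F U" by (simp add: L.prob_space)
  also have "\<dots> = F U" by (rule Cons.hyps) (use Cons.prems in \<open>auto intro: depends_on_mono\<close>)
  finally show ?case .
qed simp

end

context model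
begin

text \<open>
  The first \<open>q\<close> arguments of the clause \<open>f\<close> are free spins \<open>\<tau>\<close> in the fields \<open>x\<close>; the others are the
  spins of \<open>\<sigma>\<close> at the vertices \<open>\<rho>\<close>.
\<close>

definition clause_gain where
  "clause_gain q \<rho> f x \<sigma> \<tau> = f (\<lambda>j\<in>{..<p}. if j < q then \<tau> j else \<sigma> (\<rho> ! (j - q))) + (\<Sum>j<q. x j (\<tau> j))"
  for q :: nat and \<rho> :: "nat list" and f :: "(nat \<Rightarrow> real) \<Rightarrow> real" and x :: "nat \<Rightarrow> real \<Rightarrow> real" and \<sigma> \<tau> :: "nat \<Rightarrow> real"

text \<open>
  The message of a clause: the energy that its remaining vertices \<open>\<rho>\<close> see after the free spins have
  been chosen optimally.
\<close>

definition clause_field where "clause_field q \<rho> f x \<sigma> = (SUP \<tau>\<in>configs. clause_gain q \<rho> f x \<sigma> \<tau>)"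

lemma clause_gain_continuous:
  assumes "f \<in> space clause_borel" "\<And>j. x j \<in> space spin_borel"
  shows "continuous_on (configs \<times> configs) (\<lambda>(\<sigma>, \<tau>). clause_gain q \<rho> f x \<sigma> \<tau>)"
proof -
  have c1: "continuous_on (configs \<times> configs) (\<lambda>y. snd y j)" "continuous_on (configs \<times> configs) (\<lambda>y. fst y j)" for j
    by (rule continuous_on_product_then_coordinatewise, intro continuous_intros)+
  have "continuous_on (configs \<times> configs) (\<lambda>y. f (\<lambda>j\<in>{..<p}. if j < q then snd y j else fst y (\<rho> ! (j - q))))"
  proof (rule clause_continuous[OF assms(1)])
    show "continuous_on (configs \<times> configs) (\<lambda>y. if j < q then snd y j else fst y (\<rho> ! (j - q)))" for j
      by (cases "j < q") (simp_all add: c1)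
  qed (auto simp: configs_iff)
  moreover have "continuous_on (configs \<times> configs) (\<lambda>y. \<Sum>j<q. x j (snd y j))"
  proof (rule continuous_on_sum)
    fix j
    have "continuous_on S (x j)" using assms(2)[of j] by (simp add: space_spin_borel)
    then show "continuous_on (configs \<times> configs) (\<lambda>y. x j (snd y j))"
      by (rule continuous_on_compose2[OF _ c1(1)]) (auto simp: configs_iff)
  qed
  ultimately show ?thesis unfolding clause_gain_def split_beta by (rule continuous_on_add)
qed

lemma clause_gain_energies:
  assumes "f \<in> space clause_borel" "\<And>j. x j \<in> space spin_borel" "\<sigma> \<in> configs" shows "clause_gain q \<rho> f x \<sigma> \<in> energies"
proof -
  have "continuous_on configs (\<lambda>\<tau>. case (\<sigma>, \<tau>) of (\<sigma>, \<tau>) \<Rightarrow> clause_gain q \<rho> f x \<sigma> \<tau>)"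
    by (rule continuous_on_compose2[OF clause_gain_continuous[OF assms(1,2)]])
      (use assms(3) in \<open>auto intro!: continuous_on_Pair continuous_on_const continuous_on_id\<close>)
  then show ?thesis by (simp add: energies_def)
qed

lemma clause_field_energies:
  assumes "f \<in> space clause_borel" "\<And>j. x j \<in> space spin_borel" shows "clause_field q \<rho> f x \<in> energies"
  using continuous_partial_SUP[OF clause_gain_continuous[OF assms]] by (simp add: energies_def clause_field_def[abs_def])

lemma clause_field_eq_maxE: "clause_field q \<rho> f x \<sigma> = maxE (clause_gain q \<rho> f x \<sigma>)"
  by (simp add: clause_field_def maxE_def)

lemma clause_gain_arg: "\<sigma> \<in> configs \<Longrightarrow> \<tau> \<in> configs \<Longrightarrow> (\<lambda>j\<in>{..<p}. if j < q then \<tau> j else \<sigma> (\<rho> ! (j - q))) \<in> cube"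
  by (auto simp: configs_iff)

lemma clause_field_measurable [measurable (raw)]:
  assumes F: "F \<in> measurable N clause_borel" and X: "X \<in> measurable N (iid spin_borel)"
  shows "(\<lambda>\<omega>. clause_field q \<rho> (F \<omega>) (X \<omega>)) \<in> measurable N energy_space"
proof (rule measurable_energy_space)
  have Fs: "F \<omega> \<in> space clause_borel" and Xs: "X \<omega> j \<in> space spin_borel" if "\<omega> \<in> space N" for \<omega> j
    using measurable_space[OF F that] measurable_space[OF X that] by (auto simp: space_PiM)
  show "clause_field q \<rho> (F \<omega>) (X \<omega>) \<in> energies" if "\<omega> \<in> space N" for \<omega> by (rule clause_field_energies) (use Fs Xs that in auto)
  show "(\<lambda>\<omega>. clause_field q \<rho> (F \<omega>) (X \<omega>) \<sigma>) \<in> borel_measurable N" if \<sigma>: "\<sigma> \<in> configs" for \<sigma>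
    unfolding clause_field_def
  proof (rule SUP_measurable)
    show "continuous_on configs (clause_gain q \<rho> (F \<omega>) (X \<omega>) \<sigma>)" if "\<omega> \<in> space N" for \<omega>
      using clause_gain_energies[OF Fs Xs \<sigma>] that by (simp add: energies_def)
    show "(\<lambda>\<omega>. clause_gain q \<rho> (F \<omega>) (X \<omega>) \<sigma> \<tau>) \<in> borel_measurable N" if \<tau>: "\<tau> \<in> configs" for \<tau>
      unfolding clause_gain_def
    proof (rule borel_measurable_add, goal_cases)
      case 1 show ?case by (rule measurable_compose[OF F clause_borel_eval[OF clause_gain_arg[OF \<sigma> \<tau>]]])
      case 2 show ?case
        by (rule borel_measurable_sum, rule measurable_compose[OF measurable_compose[OF X measurable_component_singleton]], simp, rule spin_borel_eval)
          (use \<tau> in \<open>simp add: configs_iff\<close>)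
    qed
  qed
qed

lemma clause_field_bound:
  assumes "f \<in> space clause_borel" "\<And>j. x j \<in> space spin_borel" shows "nrm (clause_field q \<rho> f x) \<le> clause_norm f + (\<Sum>j<q. spin_norm (x j))"
proof (rule nrm_le)
  fix \<sigma> assume s: "\<sigma> \<in> configs"
  have g: "\<bar>clause_gain q \<rho> f x \<sigma> \<tau>\<bar> \<le> clause_norm f + (\<Sum>j<q. spin_norm (x j))" if "\<tau> \<in> configs" for \<tau>
  proof -
    have "\<bar>\<Sum>j<q. x j (\<tau> j)\<bar> \<le> (\<Sum>j<q. spin_norm (x j))"
      by (rule order_trans[OF sum_abs]) (intro sum_mono spin_norm_ge assms configs_D[OF that])
    then show ?thesis unfolding clause_gain_def using clause_norm_ge[OF assms(1) clause_gain_arg[OF s that, of q \<rho>]] by linarith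
  qed
  obtain \<tau> where "\<tau> \<in> configs" "clause_gain q \<rho> f x \<sigma> \<tau> = maxE (clause_gain q \<rho> f x \<sigma>)"
    by (rule maxE_attained[OF clause_gain_energies[OF assms s, of q \<rho>]])
  with g[of \<tau>] show "\<bar>clause_field q \<rho> f x \<sigma>\<bar> \<le> clause_norm f + (\<Sum>j<q. spin_norm (x j))" by (simp add: clause_field_eq_maxE)
qed

text \<open>
  The fields \<open>x\<close> shift all gains alike, so the oscillation is controlled by the clause alone.
\<close>

lemma clause_field_osc:
  assumes "f \<in> space clause_borel" "\<And>j. x j \<in> space spin_borel" "\<sigma> \<in> configs" "\<sigma>' \<in> configs"
  shows "clause_field q \<rho> f x \<sigma> - clause_field q \<rho> f x \<sigma>' \<le> 2 * clause_norm f"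
proof -
  have "maxE (clause_gain q \<rho> f x \<sigma>) \<le> maxE (clause_gain q \<rho> f x \<sigma>') + 2 * clause_norm f"
  proof (rule maxE_le)
    fix \<tau> assume t: "\<tau> \<in> configs"
    have "clause_gain q \<rho> f x \<sigma> \<tau> \<le> clause_gain q \<rho> f x \<sigma>' \<tau> + 2 * clause_norm f"
      unfolding clause_gain_def using clause_norm_ge[OF assms(1) clause_gain_arg[OF assms(3) t, of q \<rho>]] clause_norm_ge[OF assms(1) clause_gain_arg[OF assms(4) t, of q \<rho>]]
      by linarith
    then show "clause_gain q \<rho> f x \<sigma> \<tau> \<le> maxE (clause_gain q \<rho> f x \<sigma>') + 2 * clause_norm f"
      using maxE_ge[OF clause_gain_energies[where x = x and q = q and \<rho> = \<rho>, OF assms(1,2,4)] t] by linarith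
  qed
  then show ?thesis by (simp add: clause_field_eq_maxE)
qed

lemma clause_field_depends_on: assumes "q + length \<rho> = p" shows "depends_on (set \<rho>) (clause_field q \<rho> f x)"
  unfolding depends_on_def
proof (intro ballI impI)
  fix \<sigma> \<sigma>' :: "nat \<Rightarrow> real" assume "\<forall>i\<in>set \<rho>. \<sigma> i = \<sigma>' i"
  then have "(\<lambda>j\<in>{..<p}. if j < q then \<tau> j else \<sigma> (\<rho> ! (j - q))) = (\<lambda>j\<in>{..<p}. if j < q then \<tau> j else \<sigma>' (\<rho> ! (j - q)))" for \<tau>
    using assms by (intro restrict_ext) auto
  then show "clause_field q \<rho> f x \<sigma> = clause_field q \<rho> f x \<sigma>'" by (simp add: clause_field_def clause_gain_def)
qed

definition field_law where
  "field_law L \<rho> = distr (Q \<Otimes>\<^sub>M iid L) energy_space (\<lambda>y. clause_field (p - length \<rho>) \<rho> (fst y) (snd y))"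

lemma field_law_meas: assumes "sets L = sets spin_borel"
  shows "(\<lambda>y. clause_field q \<rho> (fst y) (snd y)) \<in> measurable (Q \<Otimes>\<^sub>M iid L) energy_space"
proof -
  note [measurable_cong] = assms
  show ?thesis by measurable
qed

lemma increment_field_law: assumes L: "L \<in> Pr1 S" shows "increment (field_law L \<rho>)"
proof -
  let ?P = "iid L"
  interpret P: prob_space ?P by (intro prob_space_PiM Pr1D(1)[OF L])
  interpret QP: pair_prob_space Q ?P ..
  let ?q = "p - length \<rho>"
  have "integrable (Q \<Otimes>\<^sub>M ?P) (\<lambda>y. nrm (clause_field ?q \<rho> (fst y) (snd y)))"
  proof (rule Bochner_Integration.integrable_bound[of _ "\<lambda>y. clause_norm (fst y) + (\<Sum>j<?q. spin_norm (snd y j))"])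
    have i1: "integrable (Q \<Otimes>\<^sub>M ?P) (\<lambda>y. clause_norm (fst y))" by (rule Q.integrable_pair_fst[OF P.prob_space_axioms clause_norm_integrable])
    have i2: "integrable (Q \<Otimes>\<^sub>M ?P) (\<lambda>y. spin_norm (snd y j))" for j
      by (rule Q.integrable_pair_snd[OF P.prob_space_axioms integrable_PiM_component[OF Pr1D(1,4)[OF L], of j]])
    show "integrable (Q \<Otimes>\<^sub>M ?P) (\<lambda>y. clause_norm (fst y) + (\<Sum>j<?q. spin_norm (snd y j)))"
      using i1 i2 by simp
    show "(\<lambda>y. nrm (clause_field ?q \<rho> (fst y) (snd y))) \<in> borel_measurable (Q \<Otimes>\<^sub>M ?P)"
      by (rule measurable_compose[OF field_law_meas[OF Pr1D(2)[OF L]] nrm_measurable])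
    show "AE y in Q \<Otimes>\<^sub>M ?P. norm (nrm (clause_field ?q \<rho> (fst y) (snd y))) \<le> norm (clause_norm (fst y) + (\<Sum>j<?q. spin_norm (snd y j)))"
    proof (rule AE_I2)
      fix y assume "y \<in> space (Q \<Otimes>\<^sub>M ?P)"
      then have y: "fst y \<in> space clause_borel" "\<And>j. snd y j \<in> space spin_borel" using L_seq_space[OF L] by (auto simp: space_pair_measure space_Q)
      show "norm (nrm (clause_field ?q \<rho> (fst y) (snd y))) \<le> norm (clause_norm (fst y) + (\<Sum>j<?q. spin_norm (snd y j)))"
        using clause_field_bound[where x = "snd y" and q = ?q and \<rho> = \<rho>, OF y] nrm_nonneg[OF clause_field_energies[where x = "snd y" and q = ?q and \<rho> = \<rho>, OF y]] by simp
    qed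
  qed
  then show ?thesis
    unfolding increment_def field_law_def using field_law_meas[OF Pr1D(2)[OF L]]
    by (auto intro!: QP.prob_space_distr simp: integrable_distr_eq)
qed

lemma max_out_field_law:
  assumes L: "L \<in> Pr1 S" and "length \<rho> \<le> p" "set \<rho> \<inter> J = {}" "\<Phi> \<in> observables" "max_out J \<Phi>"
  shows "max_out J (avg (field_law L \<rho>) \<Phi>)"
  unfolding field_law_def
  by (rule max_out_avg_distr[OF assms(4,5) field_law_meas[OF Pr1D(2)[OF L]] clause_field_depends_on]) (use assms in auto)

lemma max_out_clause_law_at: assumes "length l = p" "set l \<inter> J = {}" "\<Phi> \<in> observables" "max_out J \<Phi>" shows "max_out J (avg (clause_law_at l) \<Phi>)"
  unfolding clause_law_at_def by (rule max_out_avg_distr[OF assms(3,4) _ lift_depends_on[OF assms(1)] assms(2)]) measurable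

text \<open>
  The free spins are the coordinates in \<open>js\<close>. The maximum over all of \<open>configs\<close> is compared with the
  clause's own free spins by the enumeration of \<open>js\<close> and its inverse.
\<close>

lemma partial_max_clause:
  assumes "distinct js" "length js = q" "q + length \<rho> = p" "set js \<inter> set \<rho> = {}" "\<sigma> \<in> configs"
  shows "partial_max (set js) (lift (js @ \<rho>) f + (\<Sum>i<q. site (js ! i) (x i))) \<sigma> = clause_field q \<rho> f x \<sigma>"
proof -
  let ?W = "lift (js @ \<rho>) f + (\<Sum>i<q. site (js ! i) (x i))"
  have eq: "?W (overwrite (set js) \<sigma> \<tau>) = clause_gain q \<rho> f x \<sigma> \<tau>'" if "\<And>j. j < q \<Longrightarrow> \<tau>' j = \<tau> (js ! j)" for \<tau> \<tau>'
  proof -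
    have "(\<lambda>j\<in>{..<p}. overwrite (set js) \<sigma> \<tau> ((js @ \<rho>) ! j)) = (\<lambda>j\<in>{..<p}. if j < q then \<tau>' j else \<sigma> (\<rho> ! (j - q)))"
    proof (rule restrict_ext)
      fix j assume "j \<in> {..<p}"
      show "overwrite (set js) \<sigma> \<tau> ((js @ \<rho>) ! j) = (if j < q then \<tau>' j else \<sigma> (\<rho> ! (j - q)))"
      proof (cases "j < q")
        case True
        then show ?thesis using assms(2) that by (simp add: nth_append overwrite_def)
      next
        case False
        then have "\<rho> ! (j - q) \<in> set \<rho>" using assms(3) \<open>j \<in> {..<p}\<close> by simp
        then have "\<rho> ! (j - q) \<notin> set js" using assms(4) by blast
        then show ?thesis using False assms(2) by (simp add: nth_append overwrite_def)
      qed
    qed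
    moreover have "(\<Sum>i<q. site (js ! i) (x i)) (overwrite (set js) \<sigma> \<tau>) = (\<Sum>j<q. x j (\<tau>' j))"
      unfolding sum_fun_apply by (rule sum.cong) (auto simp: site_def overwrite_def that assms(2))
    ultimately show ?thesis by (simp add: plus_fun_apply lift_def clause_gain_def)
  qed
  have "(\<lambda>\<tau>. ?W (overwrite (set js) \<sigma> \<tau>)) ` configs = clause_gain q \<rho> f x \<sigma> ` configs"
  proof
    show "(\<lambda>\<tau>. ?W (overwrite (set js) \<sigma> \<tau>)) ` configs \<subseteq> clause_gain q \<rho> f x \<sigma> ` configs"
    proof
      fix y assume "y \<in> (\<lambda>\<tau>. ?W (overwrite (set js) \<sigma> \<tau>)) ` configs"
      then obtain \<tau> where \<tau>: "\<tau> \<in> configs" "y = ?W (overwrite (set js) \<sigma> \<tau>)" by blast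
      show "y \<in> clause_gain q \<rho> f x \<sigma> ` configs"
        by (rule image_eqI[of _ _ "\<lambda>j. \<tau> (js ! j)"]) (use \<tau> eq in \<open>auto simp: configs_iff\<close>)
    qed
    show "clause_gain q \<rho> f x \<sigma> ` configs \<subseteq> (\<lambda>\<tau>. ?W (overwrite (set js) \<sigma> \<tau>)) ` configs"
    proof
      fix y assume "y \<in> clause_gain q \<rho> f x \<sigma> ` configs"
      then obtain \<tau>' where \<tau>': "\<tau>' \<in> configs" "y = clause_gain q \<rho> f x \<sigma> \<tau>'" by blast
      let ?e = "inv_into {..<q} ((!) js)"
      have "?e (js ! j) = j" if "j < q" for j
        by (rule inv_into_f_f) (use that assms(1,2) in \<open>auto intro: inj_on_nth\<close>)
      then have "?W (overwrite (set js) \<sigma> (\<lambda>i. \<tau>' (?e i))) = y" unfolding \<tau>'(2) by (intro eq) simp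
      then show "y \<in> (\<lambda>\<tau>. ?W (overwrite (set js) \<sigma> \<tau>)) ` configs"
        by (intro image_eqI[of _ _ "\<lambda>i. \<tau>' (?e i)"]) (use \<tau>' in \<open>auto simp: configs_iff\<close>)
    qed
  qed
  then show ?thesis by (simp add: partial_max_def clause_field_def)
qed

text \<open>
  For vertices \<open>js\<close> that meet nothing but this clause and their own fields, maximising over their
  spins turns the clause into its message to \<open>\<rho>\<close>. This is the step from the graph to the tree.
\<close>

lemma fresh_clause:
  assumes L: "L \<in> Pr1 S" and F: "F \<in> observables" "max_out (set js) F" and js: "distinct js" "length js = q" "q + length \<rho> = p" "set js \<inter> set \<rho> = {}"
    and U: "U \<in> energies" "depends_on (- set js) U"
  shows "(\<integral>f. avg_fields L js F (U + lift (js @ \<rho>) f) \<partial>Q) = avg (field_law L \<rho>) F U"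
proof -
  let ?P = "iid L"
  interpret P: prob_space ?P by (intro prob_space_PiM Pr1D(1)[OF L])
  interpret QP: pair_prob_space Q ?P ..
  have q: "p - length \<rho> = q" using js by simp
  have int: "integrable (Q \<Otimes>\<^sub>M ?P) (\<lambda>y. F (U + clause_field q \<rho> (fst y) (snd y)))"
    using avg_distr_integrable[OF increment_field_law[OF L, unfolded field_law_def] F(1) U(1) field_law_meas[OF Pr1D(2)[OF L]], of \<rho>] by (simp add: q)
  have "avg (field_law L \<rho>) F U = (\<integral>y. F (U + clause_field q \<rho> (fst y) (snd y)) \<partial>(Q \<Otimes>\<^sub>M ?P))"
    unfolding field_law_def q by (rule avg_distr[OF F(1) U(1) field_law_meas[OF Pr1D(2)[OF L]]])
  also have "\<dots> = (\<integral>f. \<integral>x. F (U + clause_field q \<rho> f x) \<partial>?P \<partial>Q)"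
    using QP.integral_fst'[OF int] by simp
  also have "\<dots> = (\<integral>f. avg_fields L js F (U + lift (js @ \<rho>) f) \<partial>Q)"
  proof (rule Bochner_Integration.integral_cong[OF refl])
    fix f assume "f \<in> space Q"
    then have f: "f \<in> space clause_borel" by (simp add: space_Q)
    have "avg_fields L js F (U + lift (js @ \<rho>) f) = (\<integral>x. F (U + lift (js @ \<rho>) f + (\<Sum>i<length js. site (js ! i) (x i))) \<partial>?P)"
      by (rule avg_fields_integral(1)[OF L F(1)]) (use U lift_energies[OF f] in auto)
    also have "\<dots> = (\<integral>x. F (U + clause_field q \<rho> f x) \<partial>?P)"
    proof (rule Bochner_Integration.integral_cong[OF refl])
      fix x assume "x \<in> space ?P"
      then have x: "\<And>j. x j \<in> space spin_borel" by (rule L_seq_space[OF L])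
      let ?W = "lift (js @ \<rho>) f + (\<Sum>i<q. site (js ! i) (x i))"
      have W: "?W \<in> energies" using x by (intro energies_add lift_energies f energies_sum site_energies) (simp add: space_spin_borel)
      have "F (U + lift (js @ \<rho>) f + (\<Sum>i<length js. site (js ! i) (x i))) = F (partial_max (set js) (?W + U))"
        using F(2) W U(1) by (simp add: max_out_def ac_simps js(2))
      also have "\<dots> = F (U + clause_field q \<rho> f x)"
        by (rule observables_eq_on_configs[OF F(1)]) (auto intro!: partial_max_energies W U clause_field_energies f x energies_add
            simp: partial_max_add_depends_on[OF W U(2)] partial_max_clause[OF js] plus_fun_apply)
      finally show "F (U + lift (js @ \<rho>) f + (\<Sum>i<length js. site (js ! i) (x i))) = F (U + clause_field q \<rho> f x)" .
    qed
    finally show "(\<integral>x. F (U + clause_field q \<rho> f x) \<partial>?P) = avg_fields L js F (U + lift (js @ \<rho>) f)" ..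
  qed
  finally show ?thesis ..
qed

end

section \<open>Clauses on random vertices\<close>

definition ksubsets :: "nat set \<Rightarrow> nat \<Rightarrow> nat set set" where "ksubsets V q = {J. J \<subseteq> V \<and> card J = q}"

lemma finite_ksubsets: "finite V \<Longrightarrow> finite (ksubsets V q)"
  by (simp add: ksubsets_def)

lemma card_ksubsets: "finite V \<Longrightarrow> card (ksubsets V q) = card V choose q"
  by (simp add: ksubsets_def n_subsets)

lemma ksubsets_ne: assumes "finite V" "q \<le> card V" shows "ksubsets V q \<noteq> {}"
  using card_ksubsets[OF assms(1), of q] assms(2) by (metis card.empty binomial_eq_0_iff not_le)

lemma ksubsets_insert:
  assumes "finite V" "a \<notin> V"
  shows "ksubsets (insert a V) (Suc q) = insert a ` ksubsets V q \<union> ksubsets V (Suc q)" "insert a ` ksubsets V q \<inter> ksubsets V (Suc q) = {}"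
    "inj_on (insert a) (ksubsets V q)"
proof -
  show "insert a ` ksubsets V q \<inter> ksubsets V (Suc q) = {}" using assms(2) by (auto simp: ksubsets_def)
  show "inj_on (insert a) (ksubsets V q)" using assms(2) by (auto simp: inj_on_def ksubsets_def insert_ident subset_iff)
  show "ksubsets (insert a V) (Suc q) = insert a ` ksubsets V q \<union> ksubsets V (Suc q)"
  proof (intro set_eqI iffI)
    fix J assume J: "J \<in> ksubsets (insert a V) (Suc q)"
    then have fJ: "finite J" using assms(1) by (auto simp: ksubsets_def intro: finite_subset)
    show "J \<in> insert a ` ksubsets V q \<union> ksubsets V (Suc q)"
    proof (cases "a \<in> J")
      case True
      then have "J = insert a (J - {a})" "J - {a} \<in> ksubsets V q" using J fJ by (auto simp: ksubsets_def)
      then show ?thesis by blast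
    next
      case False
      then show ?thesis using J by (auto simp: ksubsets_def)
    qed
  next
    fix J assume "J \<in> insert a ` ksubsets V q \<union> ksubsets V (Suc q)"
    then show "J \<in> ksubsets (insert a V) (Suc q)"
    proof
      assume "J \<in> insert a ` ksubsets V q"
      then obtain I where I: "J = insert a I" "I \<subseteq> V" "card I = q" by (auto simp: ksubsets_def)
      have "finite I" "a \<notin> I" using I assms by (auto intro: finite_subset)
      then show ?thesis using I by (auto simp: ksubsets_def)
    qed (auto simp: ksubsets_def)
  qed
qed

lemma card_ksubsets_hit:
  assumes "finite V" "b \<in> V" "1 \<le> q"
  shows "real (card {J \<in> ksubsets V q. b \<in> J}) * real (card V) = real q * real (card (ksubsets V q))"
proof -
  obtain q' where q: "q = Suc q'" using assms(3) by (cases q) auto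
  obtain n where n: "card V = Suc n" using assms by (cases "card V") auto
  have V: "V = insert b (V - {b})" using assms(2) by auto
  have f: "finite (V - {b})" "b \<notin> V - {b}" using assms by auto
  have "{J \<in> ksubsets V q. b \<in> J} = insert b ` ksubsets (V - {b}) q'"
    using ksubsets_insert(1)[OF f, of q'] V unfolding q by (auto simp: ksubsets_def)
  then have "card {J \<in> ksubsets V q. b \<in> J} = n choose q'"
    using ksubsets_insert(3)[OF f, of q'] by (simp add: card_image card_ksubsets f n assms)
  moreover have "card (ksubsets V q) = Suc n choose Suc q'" by (simp add: card_ksubsets assms n q)
  ultimately show ?thesis unfolding n q of_nat_mult[symmetric]
    by (simp only: mult.commute[of "n choose q'"] Suc_times_binomial_eq mult.commute[of _ "Suc q'"])
qed

lemma card_ksubsets_meet: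
  assumes "finite V" "B \<subseteq> V" "1 \<le> q"
  shows "real (card {J \<in> ksubsets V q. J \<inter> B \<noteq> {}}) * real (card V) \<le> real (card B) * real q * real (card (ksubsets V q))"
proof -
  have fB: "finite B" using assms by (auto intro: finite_subset)
  have "{J \<in> ksubsets V q. J \<inter> B \<noteq> {}} = (\<Union>b\<in>B. {J \<in> ksubsets V q. b \<in> J})" by auto
  then have "card {J \<in> ksubsets V q. J \<inter> B \<noteq> {}} \<le> (\<Sum>b\<in>B. card {J \<in> ksubsets V q. b \<in> J})"
    using card_UN_le[OF fB] by metis
  then have "real (card {J \<in> ksubsets V q. J \<inter> B \<noteq> {}}) * real (card V) \<le> (\<Sum>b\<in>B. real (card {J \<in> ksubsets V q. b \<in> J})) * real (card V)"
    by (intro mult_right_mono) (simp_all flip: of_nat_sum)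
  also have "\<dots> = (\<Sum>b\<in>B. real q * real (card (ksubsets V q)))"
    unfolding sum_distrib_right by (rule sum.cong) (use assms card_ksubsets_hit in auto)
  finally show ?thesis by simp
qed

context spin_space
begin

lemma incrementI_nn:
  assumes "prob_space \<mu>" "sets \<mu> = sets energy_space" "(\<integral>\<^sup>+Z. ennreal (nrm Z) \<partial>\<mu>) \<le> ennreal b" "0 \<le> b"
  shows "increment \<mu>" "mean_nrm \<mu> \<le> b"
proof -
  note [measurable_cong] = assms(2)
  have nn: "AE Z in \<mu>. 0 \<le> nrm Z" by (rule AE_I2) (simp add: sets_eq_imp_space_eq[OF assms(2)])
  have int: "integrable \<mu> nrm" by (rule integrableI_nonneg[OF _ nn]) (use assms(3) in \<open>auto intro: le_less_trans\<close>)
  then show "increment \<mu>" using assms by (simp add: increment_def)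
  show "mean_nrm \<mu> \<le> b" unfolding mean_nrm_def by (subst integral_eq_nn_integral[OF _ nn]) (auto intro: enn2real_leI assms)
qed

lemma max_out_translate:
  assumes "\<Phi> \<in> observables" "max_out J \<Phi>" "A \<in> energies" "depends_on J' A" "J' \<inter> J = {}" shows "max_out J (\<lambda>E. \<Phi> (E + A))"
  unfolding max_out_def
proof
  fix W assume W: "W \<in> energies"
  have "\<Phi> (partial_max J W + A) = \<Phi> (partial_max J (W + A))"
    by (rule observables_eq_on_configs[OF assms(1)]) (auto intro!: partial_max_energies W assms simp: partial_max_add_depends_on[OF W assms(4,5)] plus_fun_apply)
  then show "\<Phi> (partial_max J W + A) = \<Phi> (W + A)" using assms(2) W assms(3) by (simp add: max_out_def)
qed

lemma depends_on_sum: "(\<And>i. i \<in> A \<Longrightarrow> depends_on J (E i)) \<Longrightarrow> depends_on J (\<Sum>i\<in>A. E i)"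
  by (induct A rule: infinite_finite_induct) (auto intro: depends_on_add)

end

context model
begin

text \<open>
  A random clause through the vertices \<open>\<rho>\<close> whose other vertices form a uniform subset of \<open>V\<close>.
\<close>

definition random_clause where
  "random_clause V \<rho> = distr (measure_pmf (pmf_of_set (ksubsets V (p - length \<rho>))) \<Otimes>\<^sub>M Q) energy_space
     (\<lambda>y. lift (sorted_list_of_set (fst y) @ \<rho>) (snd y))"

lemma random_clause_meas: "(\<lambda>y. lift (sorted_list_of_set (fst y) @ \<rho>) (snd y)) \<in> measurable (measure_pmf w \<Otimes>\<^sub>M Q) energy_space"
proof -
  have "(\<lambda>y. lift (sorted_list_of_set (fst y) @ \<rho>) (snd y)) \<in> measurable (count_space UNIV \<Otimes>\<^sub>M Q) energy_space"
  proof (rule measurable_compose_countable[where f = "\<lambda>l y. lift (l @ \<rho>) (snd y)" and g = "\<lambda>y. sorted_list_of_set (fst y)"])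
    show "(\<lambda>y. sorted_list_of_set (fst y)) \<in> measurable (count_space UNIV \<Otimes>\<^sub>M Q) (count_space UNIV)"
      by (rule measurable_compose[OF measurable_fst]) simp
  qed measurable
  then show ?thesis by (subst measurable_cong_sets[OF sets_pair_measure_cong[OF sets_measure_pmf_count_space refl] refl])
qed

abbreviation (input) "clause_at J \<rho> \<equiv> sorted_list_of_set J @ \<rho>"

lemma sets_random_clause [simp, measurable_cong]: "sets (random_clause V \<rho>) = sets energy_space"
  by (simp add: random_clause_def)

lemma nn_random_clause:
  assumes V: "finite V" "p - length \<rho> \<le> card V" and [measurable]: "F \<in> borel_measurable energy_space"
  shows "(\<integral>\<^sup>+Z. F Z \<partial>random_clause V \<rho>) =
    (\<Sum>J\<in>ksubsets V (p - length \<rho>). \<integral>\<^sup>+Z. F Z \<partial>clause_law_at (clause_at J \<rho>)) / of_nat (card (ksubsets V (p - length \<rho>)))"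
proof -
  let ?S = "ksubsets V (p - length \<rho>)"
  note [measurable] = random_clause_meas
  have "(\<integral>\<^sup>+Z. F Z \<partial>random_clause V \<rho>) = (\<integral>\<^sup>+y. F (lift (clause_at (fst y) \<rho>) (snd y)) \<partial>(measure_pmf (pmf_of_set ?S) \<Otimes>\<^sub>M Q))"
    unfolding random_clause_def by (rule nn_integral_distr[OF random_clause_meas]) measurable
  also have "\<dots> = (\<integral>\<^sup>+J. \<integral>\<^sup>+f. F (lift (clause_at J \<rho>) f) \<partial>Q \<partial>measure_pmf (pmf_of_set ?S))"
    by (subst Q.nn_integral_fst[symmetric]) (auto intro: measurable_compose[OF random_clause_meas assms(3)])
  also have "\<dots> = (\<Sum>J\<in>?S. \<integral>\<^sup>+f. F (lift (clause_at J \<rho>) f) \<partial>Q) / of_nat (card ?S)"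
    using finite_ksubsets[OF V(1)] ksubsets_ne[OF V] by (subst nn_integral_pmf_of_set) auto
  also have "(\<lambda>J. \<integral>\<^sup>+f. F (lift (clause_at J \<rho>) f) \<partial>Q) = (\<lambda>J. \<integral>\<^sup>+Z. F Z \<partial>clause_law_at (clause_at J \<rho>))"
    unfolding clause_law_at_def by (subst nn_integral_distr) auto
  finally show ?thesis .
qed

lemma prob_random_clause: "prob_space (random_clause V \<rho>)"
  unfolding random_clause_def
  by (rule prob_space.prob_space_distr[OF _ random_clause_meas]) (intro prob_space_pair prob_space_measure_pmf prob_Q)

lemma increment_random_clause:
  assumes V: "finite V" "p - length \<rho> \<le> card V" shows "increment (random_clause V \<rho>)" "mean_nrm (random_clause V \<rho>) \<le> mean_clause_norm"
proof -
  let ?S = "ksubsets V (p - length \<rho>)"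
  have c: "card ?S \<noteq> 0" using ksubsets_ne[OF V] finite_ksubsets[OF V(1)] by simp
  have "(\<integral>\<^sup>+Z. ennreal (nrm Z) \<partial>random_clause V \<rho>) = (\<Sum>J\<in>?S. \<integral>\<^sup>+Z. ennreal (nrm Z) \<partial>clause_law_at (clause_at J \<rho>)) / of_nat (card ?S)"
    by (rule nn_random_clause[OF V]) measurable
  also have "\<dots> = (\<Sum>J\<in>?S. ennreal (mean_nrm (clause_law_at (clause_at J \<rho>)))) / of_nat (card ?S)"
    unfolding mean_nrm_def
    by (subst nn_integral_eq_integral[OF incrementD(3)[OF increment_clause_law_at(1)]]) (auto intro!: AE_I2 simp: clause_law_at_def)
  also have "\<dots> \<le> (\<Sum>J\<in>?S. ennreal mean_clause_norm) / of_nat (card ?S)"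
    by (intro divide_right_mono_ennreal sum_mono ennreal_leI increment_clause_law_at)
  also have "\<dots> = ennreal mean_clause_norm"
    using c by (simp add: mult.commute[of "of_nat _"] mult_divide_eq_ennreal of_nat_eq_0_iff[where 'a = ennreal])
  finally have *: "(\<integral>\<^sup>+Z. ennreal (nrm Z) \<partial>random_clause V \<rho>) \<le> ennreal mean_clause_norm" .
  show "increment (random_clause V \<rho>)" "mean_nrm (random_clause V \<rho>) \<le> mean_clause_norm"
    by (rule incrementI_nn[OF prob_random_clause sets_random_clause * mean_clause_norm_nonneg])+
qed

lemma avg_random_clause:
  assumes V: "finite V" "p - length \<rho> \<le> card V" and F: "\<Phi> \<in> observables" "E \<in> energies"
  shows "avg (random_clause V \<rho>) \<Phi> E =
    (\<Sum>J\<in>ksubsets V (p - length \<rho>). \<integral>f. \<Phi> (E + lift (clause_at J \<rho>) f) \<partial>Q) / real (card (ksubsets V (p - length \<rho>)))"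
proof -
  let ?S = "ksubsets V (p - length \<rho>)"
  interpret W: prob_space "measure_pmf (pmf_of_set ?S)" by (rule prob_space_measure_pmf)
  interpret P: pair_prob_space "measure_pmf (pmf_of_set ?S)" Q ..
  have int: "integrable (measure_pmf (pmf_of_set ?S) \<Otimes>\<^sub>M Q) (\<lambda>y. \<Phi> (E + lift (clause_at (fst y) \<rho>) (snd y)))"
    by (rule avg_distr_integrable[OF increment_random_clause(1)[OF V, unfolded random_clause_def] F random_clause_meas])
  have "avg (random_clause V \<rho>) \<Phi> E = (\<integral>y. \<Phi> (E + lift (clause_at (fst y) \<rho>) (snd y)) \<partial>(measure_pmf (pmf_of_set ?S) \<Otimes>\<^sub>M Q))"
    unfolding random_clause_def by (rule avg_distr[OF F random_clause_meas])
  also have "\<dots> = (\<integral>J. \<integral>f. \<Phi> (E + lift (clause_at J \<rho>) f) \<partial>Q \<partial>measure_pmf (pmf_of_set ?S))"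
    using P.integral_fst'[OF int] by simp
  also have "\<dots> = (\<Sum>J\<in>?S. \<integral>f. \<Phi> (E + lift (clause_at J \<rho>) f) \<partial>Q) / real (card ?S)"
    by (rule integral_pmf_of_set) (use finite_ksubsets[OF V(1)] ksubsets_ne[OF V] in auto)
  finally show ?thesis .
qed

lemma avg_clause_law_at: "\<Phi> \<in> observables \<Longrightarrow> E \<in> energies \<Longrightarrow> avg (clause_law_at l) \<Phi> E = (\<integral>f. \<Phi> (E + lift l f) \<partial>Q)"
  unfolding clause_law_at_def by (rule avg_distr) measurable

lemma clause_law_at_integrable: "\<Phi> \<in> observables \<Longrightarrow> E \<in> energies \<Longrightarrow> integrable Q (\<lambda>f. \<Phi> (E + lift l f))"
  by (rule avg_distr_integrable[OF increment_clause_law_at(1)[unfolded clause_law_at_def]]) measurable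

lemma length_clause_at: "J \<in> ksubsets V (p - length \<rho>) \<Longrightarrow> length \<rho> \<le> p \<Longrightarrow> length (clause_at J \<rho>) = p"
  by (simp add: ksubsets_def)

lemma set_clause_at: "J \<in> ksubsets V q \<Longrightarrow> finite V \<Longrightarrow> set (sorted_list_of_set J) = J"
  using finite_subset[of J V] by (auto simp: ksubsets_def)

lemma max_out_random_clause:
  assumes V: "finite V" "p - length \<rho> \<le> card V" and r: "length \<rho> \<le> p" and J: "(V \<union> set \<rho>) \<inter> J = {}"
    and F: "\<Phi> \<in> observables" "max_out J \<Phi>"
  shows "max_out J (avg (random_clause V \<rho>) \<Phi>)"
  unfolding max_out_def
proof
  fix W assume W: "W \<in> energies"
  have "(\<integral>f. \<Phi> (partial_max J W + lift (clause_at I \<rho>) f) \<partial>Q) = (\<integral>f. \<Phi> (W + lift (clause_at I \<rho>) f) \<partial>Q)" if I: "I \<in> ksubsets V (p - length \<rho>)" for I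
  proof -
    have "set (clause_at I \<rho>) \<inter> J = {}" using set_clause_at[OF I V(1)] I J by (auto simp: ksubsets_def)
    from max_out_clause_law_at[OF length_clause_at[OF I r] this F] W show ?thesis by (simp add: max_out_def avg_clause_law_at F partial_max_energies)
  qed
  then show "avg (random_clause V \<rho>) \<Phi> (partial_max J W) = avg (random_clause V \<rho>) \<Phi> W"
    by (simp add: avg_random_clause[OF V F(1)] W partial_max_energies)
qed

text \<open>
  A uniform \<open>p\<close>-subset of \<open>insert a V\<close> contains \<open>a\<close> with probability \<open>t\<close>, and then the rest is uniform
  in \<open>V\<close>. By symmetry of the clause law \<open>a\<close> may be taken as its last argument.
\<close>

lemma random_clause_mixture:
  assumes V: "finite V" "a \<notin> V" "p \<le> card V" and F[measurable]: "F \<in> borel_measurable energy_space"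
  defines "t \<equiv> real p / real (Suc (card V))"
  shows "(\<integral>\<^sup>+Z. F Z \<partial>random_clause (insert a V) []) = ennreal t * (\<integral>\<^sup>+Z. F Z \<partial>random_clause V [a]) + ennreal (1 - t) * (\<integral>\<^sup>+Z. F Z \<partial>random_clause V [])"
proof -
  obtain q where q: "p = Suc q" using p_ge by (cases p) auto
  define n where "n = card V"
  let ?I = "\<lambda>l. \<integral>\<^sup>+Z. F Z \<partial>clause_law_at l"
  have cV: "card (insert a V) = Suc n" using V by (simp add: n_def)
  define A where "A = (\<Sum>J\<in>ksubsets V q. ?I (clause_at J [a]))"
  define B where "B = (\<Sum>J\<in>ksubsets V p. ?I (clause_at J []))"
  have "(\<Sum>J\<in>ksubsets (insert a V) p. ?I (clause_at J [])) = (\<Sum>J\<in>insert a ` ksubsets V q. ?I (clause_at J [])) + B"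
    unfolding q B_def ksubsets_insert(1)[OF V(1,2)]
    by (rule sum.union_disjoint) (auto intro: finite_ksubsets V ksubsets_insert(2)[OF V(1,2), THEN equalityD1, THEN subsetD])
  also have "(\<Sum>J\<in>insert a ` ksubsets V q. ?I (clause_at J [])) = (\<Sum>J\<in>ksubsets V q. ?I (clause_at (insert a J) []))"
    by (subst sum.reindex[OF ksubsets_insert(3)[OF V(1,2)]]) simp
  also have "\<dots> = A"
    unfolding A_def
  proof (rule sum.cong[OF refl])
    fix J assume J: "J \<in> ksubsets V q"
    have fJ: "finite J" "a \<notin> J" "card J = q" using J V by (auto simp: ksubsets_def intro: finite_subset)
    have "clause_law_at (clause_at (insert a J) []) = clause_law_at (clause_at J [a])"
    proof (rule clause_law_at_symm)
      show "distinct (clause_at (insert a J) [])" unfolding append_Nil2 by (rule distinct_sorted_list_of_set)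
    qed (use fJ q set_sorted_list_of_set[of "insert a J"] in auto)
    then show "?I (clause_at (insert a J) []) = ?I (clause_at J [a])" by simp
  qed
  finally have sum: "(\<Sum>J\<in>ksubsets (insert a V) p. ?I (clause_at J [])) = A + B" .
  have L: "(\<integral>\<^sup>+Z. F Z \<partial>random_clause (insert a V) []) = (A + B) / of_nat (Suc n choose p)"
    using nn_random_clause[of "insert a V" "[]" F] V sum cV by (simp add: card_ksubsets n_def)
  have 1: "(\<integral>\<^sup>+Z. F Z \<partial>random_clause V [a]) = A / of_nat (n choose q)"
    using nn_random_clause[of V "[a]" F] V by (simp add: card_ksubsets n_def q A_def)
  have 2: "(\<integral>\<^sup>+Z. F Z \<partial>random_clause V []) = B / of_nat (n choose p)"
    using nn_random_clause[of V "[]" F] V by (simp add: card_ksubsets n_def B_def)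
  have pn: "p \<le> n" "q \<le> n" using V q by (auto simp: n_def)
  define c c1 c2 where "c = real (Suc n choose p)" and "c1 = real (n choose q)" and "c2 = real (n choose p)"
  have cpos: "0 < c" "0 < c1" "0 < c2" using pn by (auto simp: c_def c1_def c2_def)
  have "Suc n * (n choose q) = (Suc n choose p) * p" unfolding q by (simp only: Suc_times_binomial_eq)
  then have r1: "real (Suc n) * c1 = c * real p" unfolding c_def c1_def by (simp only: of_nat_mult[symmetric])
  have "t * c = (c * real p) / real (Suc n)" by (simp add: t_def n_def[symmetric])
  also have "\<dots> = c1" unfolding r1[symmetric] by (simp del: of_nat_Suc)
  finally have e0: "t * c = c1" .
  then have e1: "t / c1 = 1 / c" using cpos by (simp add: divide_eq_eq eq_divide_eq)
  have "c = c1 + c2" unfolding c_def c1_def c2_def q by simp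
  then have "(1 - t) * c = c2" using e0 by (simp add: left_diff_distrib)
  then have e2: "(1 - t) / c2 = 1 / c" using cpos by (simp add: divide_eq_eq eq_divide_eq)
  have t01: "0 \<le> t" "0 \<le> 1 - t" using pn by (auto simp: t_def n_def[symmetric])
  have r: "ennreal t * (A / ennreal c1) = A / ennreal c" "ennreal (1 - t) * (B / ennreal c2) = B / ennreal c"
  proof -
    have "ennreal s * (X / ennreal d) = X / ennreal c" if "s / d = 1 / c" "0 \<le> s" "0 < d" for s d X
    proof -
      have "ennreal s * (X / ennreal d) = X * (ennreal s * inverse (ennreal d))" by (simp add: divide_ennreal_def mult_ac)
      also have "ennreal s * inverse (ennreal d) = ennreal (s / d)"
        using that by (simp add: inverse_ennreal ennreal_mult[symmetric] divide_inverse)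
      also have "ennreal (s / d) = inverse (ennreal c)" using that cpos by (simp add: inverse_ennreal divide_inverse)
      finally show ?thesis by (simp add: divide_ennreal_def)
    qed
    then show "ennreal t * (A / ennreal c1) = A / ennreal c" "ennreal (1 - t) * (B / ennreal c2) = B / ennreal c"
      using e1 e2 t01 cpos by auto
  qed
  show ?thesis
    unfolding L 1 2 using r
    by (simp add: c_def c1_def c2_def ennreal_of_nat_eq_real_of_nat divide_ennreal_def distrib_right del: binomial_Suc_Suc)
qed

end

section \<open>Critical branching\<close>

text \<open>
  A bound for the probability that a branching process with \<open>c r\<close> children, where \<open>r\<close> is Poisson with
  mean \<open>x\<close>, reaches generation \<open>j\<close>: the union bound over the children.
\<close>

primrec survival_seq :: "real \<Rightarrow> real \<Rightarrow> nat \<Rightarrow> real" where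
  "survival_seq c x 0 = 1"
| "survival_seq c x (Suc j) = (\<integral>r. min 1 (c * real r * survival_seq c x j) \<partial>measure_pmf (poisson_pmf x))"

lemma pmf_integral_ge_atom:
  fixes g :: "nat \<Rightarrow> real"
  assumes "integrable (measure_pmf w) g" "\<And>r. 0 \<le> g r"
  shows "pmf w r0 * g r0 \<le> (\<integral>r. g r \<partial>measure_pmf w)"
proof -
  have i: "integrable (measure_pmf w) (\<lambda>r. indicator {r0} r * g r0)"
    by (rule measure_pmf.integrable_const_bound[of _ "\<bar>g r0\<bar>"]) (auto simp: indicator_def)
  have "pmf w r0 * g r0 = (\<integral>r. indicator {r0} r * g r0 \<partial>measure_pmf w)"
    by (simp add: measure_pmf_single)
  also have "\<dots> \<le> (\<integral>r. g r \<partial>measure_pmf w)"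
    by (rule integral_mono[OF i assms(1)]) (use assms in \<open>auto simp: indicator_def\<close>)
  finally show ?thesis .
qed

text \<open>
  The sequence decreases because the mean offspring \<open>c x\<close> is at most 1. Its limit \<open>q\<close> satisfies
  \<open>q = E min 1 (c r q)\<close>. Since \<open>r\<close> is unbounded, the truncation strictly lowers the mean \<open>c x q \<le> q\<close>
  unless \<open>q = 0\<close>.
\<close>

lemma survival_seq_props:
  assumes c: "0 < c" and x: "0 < x" and cx: "c * x \<le> 1"
  shows "0 \<le> survival_seq c x j" "survival_seq c x j \<le> 1" "survival_seq c x (Suc j) \<le> survival_seq c x j" "survival_seq c x \<longlonglongrightarrow> 0"
proof -
  let ?w = "measure_pmf (poisson_pmf x)"
  have int: "integrable ?w (\<lambda>r. min 1 (c * real r * q))" if "0 \<le> q" for q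
    by (rule measure_pmf.integrable_const_bound[of _ 1]) (use that c in auto)
  have b01: "0 \<le> survival_seq c x j \<and> survival_seq c x j \<le> 1" for j
  proof (induct j)
    case (Suc j)
    have "0 \<le> survival_seq c x (Suc j)" unfolding survival_seq.simps using c Suc by (intro integral_nonneg_AE AE_I2) auto
    moreover have "survival_seq c x (Suc j) \<le> (\<integral>r. 1 \<partial>?w)"
      unfolding survival_seq.simps by (rule integral_mono) (use int Suc in auto)
    ultimately show ?case by simp
  qed simp
  then show "0 \<le> survival_seq c x j" "survival_seq c x j \<le> 1" by blast+
  have dec: "survival_seq c x (Suc j) \<le> survival_seq c x j" for j
  proof -
    let ?q = "survival_seq c x j"
    have q: "0 \<le> ?q" using b01 by blast
    have "survival_seq c x (Suc j) \<le> (\<integral>r. real r * (c * ?q) \<partial>?w)"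
      unfolding survival_seq.simps
      by (rule integral_mono) (use int[OF q] poisson_integrable[OF x] in \<open>auto simp: mult_ac\<close>)
    also have "\<dots> = (c * x) * ?q" using poisson_mean[OF x] by simp
    also have "\<dots> \<le> 1 * ?q" by (rule mult_right_mono[OF cx q])
    finally show ?thesis by simp
  qed
  then show "survival_seq c x (Suc j) \<le> survival_seq c x j" .
  have "decseq (survival_seq c x)" using dec by (rule decseq_SucI)
  then obtain q where q: "survival_seq c x \<longlonglongrightarrow> q" "\<And>j. q \<le> survival_seq c x j"
    using decseq_convergent[of "survival_seq c x" 0] b01 by blast
  have q0: "0 \<le> q" by (rule LIMSEQ_le_const[OF q(1)]) (use b01 in auto)
  have "(\<lambda>j. \<integral>r. min 1 (c * real r * survival_seq c x j) \<partial>?w) \<longlonglongrightarrow> (\<integral>r. min 1 (c * real r * q) \<partial>?w)"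
  proof (rule integral_dominated_convergence[where w = "\<lambda>_. 1"])
    show "AE r in ?w. (\<lambda>j. min 1 (c * real r * survival_seq c x j)) \<longlonglongrightarrow> min 1 (c * real r * q)"
      by (intro AE_I2 tendsto_intros q)
    show "AE r in ?w. norm (min 1 (c * real r * survival_seq c x j)) \<le> 1" for j
      using b01[of j] c by (intro AE_I2) auto
  qed auto
  then have "(\<lambda>j. survival_seq c x (Suc j)) \<longlonglongrightarrow> (\<integral>r. min 1 (c * real r * q) \<partial>?w)" by simp
  with LIMSEQ_Suc[OF q(1)] have fixq: "q = (\<integral>r. min 1 (c * real r * q) \<partial>?w)" by (rule LIMSEQ_unique)
  have "q = 0"
  proof (rule ccontr)
    assume "q \<noteq> 0"
    with q0 have "0 < q" by simp
    then obtain r0 where r0: "1 < real r0 * (c * q)" using reals_Archimedean3[of "c * q"] c by auto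
    \<comment> \<open>The loss by truncation is nonnegative with mean at most 0, but it is positive at \<open>r0\<close>.\<close>
    let ?g = "\<lambda>r. real r * (c * q) - min 1 (c * real r * q)"
    have gi: "integrable ?w ?g" using int[OF q0] poisson_integrable[OF x] by auto
    have "pmf (poisson_pmf x) r0 * ?g r0 \<le> (\<integral>r. ?g r \<partial>?w)"
      by (rule pmf_integral_ge_atom[OF gi]) (simp add: mult_ac)
    also have "\<dots> = x * (c * q) - q"
      using int[OF q0] poisson_integrable[OF x] fixq[symmetric] poisson_mean[OF x] by simp
    also have "\<dots> \<le> 0" using mult_right_mono[OF cx q0] by (simp add: mult_ac)
    finally have "pmf (poisson_pmf x) r0 * ?g r0 \<le> 0" .
    moreover have "0 < pmf (poisson_pmf x) r0" using x by simp
    moreover have "0 < ?g r0" using r0 by (simp add: mult_ac min_def)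
    ultimately show False using mult_pos_pos[of "pmf (poisson_pmf x) r0" "?g r0"] by linarith
  qed
  then show "survival_seq c x \<longlonglongrightarrow> 0" using q(1) by simp
qed

lemma cesaro:
  fixes a :: "nat \<Rightarrow> real"
  assumes "(\<lambda>n. a (Suc n) - a n) \<longlonglongrightarrow> l"
  shows "(\<lambda>n. a n / real n) \<longlonglongrightarrow> l"
proof (rule LIMSEQ_I)
  fix e :: real assume e: "0 < e"
  then obtain N where N: "\<And>n. n \<ge> N \<Longrightarrow> norm (a (Suc n) - a n - l) < e / 2"
    using LIMSEQ_D[OF assms, of "e/2"] by auto
  have st: "\<bar>a (N + k) - a N - real k * l\<bar> \<le> real k * (e/2)" for k
  proof (induct k)
    case (Suc k)
    have 1: "a (N + Suc k) - a N - real (Suc k) * l = (a (N + k) - a N - real k * l) + (a (Suc (N + k)) - a (N + k) - l)"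
      by (simp add: algebra_simps)
    have 2: "real (Suc k) * (e/2) = real k * (e/2) + e/2" by (simp add: algebra_simps)
    have "\<bar>a (Suc (N + k)) - a (N + k) - l\<bar> \<le> e/2" using N[of "N + k"] by simp
    then show ?case unfolding 1 2 using Suc by linarith
  qed simp
  define C where "C = \<bar>a N\<bar> + real N * \<bar>l\<bar>"
  obtain M where M: "2 * C / e < real M" using reals_Archimedean2 by blast
  show "\<exists>n0. \<forall>n\<ge>n0. norm (a n / real n - l) < e"
  proof (intro exI[of _ "max (Suc N) (Suc M)"] allI impI)
    fix n assume n: "n \<ge> max (Suc N) (Suc M)"
    then obtain k where k: "n = N + k" by (metis le_Suc_ex max.bounded_iff Suc_leD)
    have n0: "0 < real n" using n by simp
    have "\<bar>a n - real n * l\<bar> \<le> \<bar>a (N + k) - a N - real k * l\<bar> + \<bar>a N\<bar> + \<bar>real N * l\<bar>"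
      unfolding k by (simp add: algebra_simps)
    also have "\<dots> \<le> real k * (e/2) + C" using st[of k] by (simp add: C_def abs_mult)
    also have "\<dots> \<le> real n * (e/2) + C" using e by (simp add: k)
    also have "C < real n * (e / 2)"
    proof -
      have "2 * C / e < real n" using M n by linarith
      then show ?thesis using e by (simp add: field_simps)
    qed
    finally have "\<bar>a n - real n * l\<bar> < real n * e" by (simp add: mult.commute)
    moreover have "a n / real n - l = (a n - real n * l) / real n" using n0 by (simp add: field_simps)
    ultimately show "norm (a n / real n - l) < e" using n0 by (simp add: field_simps)
  qed
qed

locale critical_model = model S p Q for S p Q +
  fixes \<psi> :: "real \<Rightarrow> real" and \<alpha> :: real
  assumes psi_cont: "continuous_on S \<psi>" and alpha_pos: "0 < \<alpha>" and critical: "\<alpha> * real p * (real p - 1) \<le> 1"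
begin

lemma psi_energies: "site i \<psi> \<in> energies"
  by (rule site_energies[OF psi_cont])

abbreviation "mean_degree \<equiv> \<alpha> * real p"

abbreviation "survival \<equiv> survival_seq (real (p - 1)) mean_degree"

lemma mean_degree_pos: "0 < mean_degree" using alpha_pos p_ge by simp

lemma survival_props: "0 \<le> survival j" "survival j \<le> 1" "survival \<longlonglongrightarrow> 0"
proof -
  have "real (p - 1) * mean_degree \<le> 1" using critical p_ge by (simp add: of_nat_diff mult_ac)
  then show "0 \<le> survival j" "survival j \<le> 1" "survival \<longlonglongrightarrow> 0" using survival_seq_props[OF _ mean_degree_pos] p_ge by auto
qed

end

section \<open>Locality\<close>

text \<open>
  The properties of the fixed point that locality needs. The last one is the fixed point equation in
  the form in which the normalisation cancels: a difference of two values of an observable.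
\<close>

locale cavity = critical_model S p Q \<psi> \<alpha> for S p Q \<psi> \<alpha> +
  fixes L :: "(real \<Rightarrow> real) measure"
  assumes L: "L \<in> Pr1 S" and L_norm: "AE x in L. maxE (site 0 x) = 0"
    and L_fix: "\<And>\<Phi> U U' a. \<Phi> \<in> observables \<Longrightarrow> U \<in> energies \<Longrightarrow> U' \<in> energies \<Longrightarrow>
      avg (site_law L a) \<Phi> U - avg (site_law L a) \<Phi> U' =
      avg (cpoisson (field_law L [a]) mean_degree) \<Phi> (U + site a \<psi>) - avg (cpoisson (field_law L [a]) mean_degree) \<Phi> (U' + site a \<psi>)"
begin

text \<open>
  The expected ground state energy of a random system on \<open>V\<close> that is perturbed by the energy \<open>E\<close>.
\<close>

definition graph_max where "graph_max V m E = avg (cpoisson (random_clause V []) m) maxE (E + (\<Sum>i\<in>V. site i \<psi>))" for V m E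

text \<open>
  The counterpart of \<open>graph_max\<close> on the tree: the vertices \<open>bs\<close> carry independent fields of law \<open>L\<close>.
\<close>

definition field_max where "field_max bs = avg_fields L bs maxE" for bs

lemma field_max_observables: "field_max bs \<in> observables"
  unfolding field_max_def by (rule avg_fields_observables[OF L maxE_observables])

lemma graph_max_observables: assumes "finite V" "p \<le> card V" "0 < m" shows "graph_max V m \<in> observables"
proof -
  have "increment (random_clause V [])" by (rule increment_random_clause) (use assms in auto)
  then show ?thesis unfolding graph_max_def
    by (intro observables_translate[of "avg (cpoisson (random_clause V []) m) maxE"] avg_observables increment_cpoisson maxE_observables assms energies_sum psi_energies)
qed

lemma graph_max_max_out: assumes "finite V" "p \<le> card V" "0 < m" shows "max_out (- V) (graph_max V m)"
proof -
  have k: "increment (random_clause V [])" by (rule increment_random_clause) (use assms in auto)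
  have "max_out (- V) (avg (cpoisson (random_clause V []) m) maxE)"
    by (rule max_out_cpoisson[OF k max_out_random_clause maxE_observables max_out_maxE assms(3)]) (use assms in auto)
  then show ?thesis unfolding graph_max_def
    by (rule max_out_translate[OF avg_observables[OF increment_cpoisson[OF k assms(3)] maxE_observables], of "- V" _ V])
      (auto intro!: energies_sum psi_energies depends_on_sum depends_on_mono[OF site_depends_on])
qed

text \<open>
  Thinning separates the clauses through \<open>a\<close> from those that avoid it.
\<close>

lemma graph_max_remove:
  assumes V: "finite V" "a \<notin> V" "p \<le> card V" and m: "0 < m" and E: "E \<in> energies"
  defines "t \<equiv> real p / real (Suc (card V))"
  shows "graph_max (insert a V) m E = avg (cpoisson (random_clause V [a]) (t * m)) (graph_max V ((1 - t) * m)) (E + site a \<psi>)"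
proof -
  have k: "increment (random_clause (insert a V) [])" "increment (random_clause V [a])" "increment (random_clause V [])"
    using V by (auto intro!: increment_random_clause)
  have t: "0 < t" "t < 1" using V p_ge by (auto simp: t_def)
  let ?P = "\<Sum>i\<in>V. site i \<psi>"
  have "(\<Sum>i\<in>insert a V. site i \<psi>) = site a \<psi> + ?P" using V by simp
  then have "graph_max (insert a V) m E = avg (cpoisson (random_clause (insert a V) []) m) maxE ((E + site a \<psi>) + ?P)"
    by (simp only: graph_max_def add.assoc)
  also have "\<dots> = avg (cpoisson (random_clause V [a]) (t * m)) (avg (cpoisson (random_clause V []) ((1 - t) * m)) maxE) ((E + site a \<psi>) + ?P)"
    by (rule avg_thinning[OF k(1) k(2,3) t m _ maxE_observables])
      (auto intro!: energies_add E psi_energies energies_sum random_clause_mixture[OF V, folded t_def])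
  also have "\<dots> = avg (cpoisson (random_clause V [a]) (t * m)) (\<lambda>E. avg (cpoisson (random_clause V []) ((1 - t) * m)) maxE (E + ?P)) (E + site a \<psi>)"
    by (rule avg_translate[symmetric])
  finally show ?thesis by (simp add: graph_max_def[abs_def])
qed

text \<open>
  The energies \<open>U\<close> and \<open>U'\<close> may depend on the \<open>k\<close> distinguished vertices \<open>bs\<close> and on vertices outside
  of \<open>V\<close>. The latter are needed because vertices are removed from \<open>V\<close> one after the other while \<open>U\<close>
  still depends on them.
\<close>

definition close_within where
  "close_within k n m \<delta> \<longleftrightarrow> (\<forall>V bs U U'. finite V \<longrightarrow> card V = n \<longrightarrow> distinct bs \<longrightarrow> set bs \<subseteq> V \<longrightarrow> length bs = k \<longrightarrow>
     U \<in> energies \<longrightarrow> U' \<in> energies \<longrightarrow> depends_on (set bs \<union> - V) U \<longrightarrow> depends_on (set bs \<union> - V) U' \<longrightarrow>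
     \<bar>graph_max V m U - graph_max V m U' - (field_max bs U - field_max bs U')\<bar> \<le> \<delta> * nrm (U - U'))" for k n m and \<delta> :: real

definition discrepancy where "discrepancy k n m = Inf {\<delta>. 0 \<le> \<delta> \<and> close_within k n m \<delta>}"

lemma close_within_two: assumes "p \<le> n" "0 < m" shows "close_within k n m 2"
  unfolding close_within_def
proof (intro allI impI)
  fix V :: "nat set" and bs and U U' :: "(nat \<Rightarrow> real) \<Rightarrow> real" assume "finite V" "card V = n" "U \<in> energies" "U' \<in> energies"
  then have "\<bar>graph_max V m U - graph_max V m U'\<bar> \<le> nrm (U - U')" "\<bar>field_max bs U - field_max bs U'\<bar> \<le> nrm (U - U')"
    using assms by (auto intro!: observables_abs graph_max_observables field_max_observables)
  then show "\<bar>graph_max V m U - graph_max V m U' - (field_max bs U - field_max bs U')\<bar> \<le> 2 * nrm (U - U')" by linarith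
qed

lemma discrepancy_le: "0 \<le> \<delta> \<Longrightarrow> close_within k n m \<delta> \<Longrightarrow> discrepancy k n m \<le> \<delta>"
  unfolding discrepancy_def by (rule cInf_lower) (auto simp: bdd_below_def)

lemma discrepancy_nonneg: "p \<le> n \<Longrightarrow> 0 < m \<Longrightarrow> 0 \<le> discrepancy k n m"
  unfolding discrepancy_def
proof (rule cInf_greatest)
  assume "p \<le> n" "0 < m"
  then have "2 \<in> {\<delta>. 0 \<le> \<delta> \<and> close_within k n m \<delta>}" using close_within_two[of n m k] by simp
  then show "{\<delta>. 0 \<le> \<delta> \<and> close_within k n m \<delta>} \<noteq> {}" by blast
qed simp

lemma close_within_discrepancy: assumes "p \<le> n" "0 < m" shows "close_within k n m (discrepancy k n m)"
  unfolding close_within_def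
proof (intro allI impI)
  fix V :: "nat set" and bs and U U' :: "(nat \<Rightarrow> real) \<Rightarrow> real"
  assume *: "finite V" "card V = n" "distinct bs" "set bs \<subseteq> V" "length bs = k" "U \<in> energies" "U' \<in> energies"
    "depends_on (set bs \<union> - V) U" "depends_on (set bs \<union> - V) U'"
  let ?x = "\<bar>graph_max V m U - graph_max V m U' - (field_max bs U - field_max bs U')\<bar>" and ?N = "nrm (U - U')"
  have b: "?x \<le> \<delta> * ?N" if "close_within k n m \<delta>" for \<delta> using that * unfolding close_within_def by blast
  have N: "0 \<le> ?N" using * by simp
  show "?x \<le> discrepancy k n m * ?N"
  proof (cases "?N = 0")
    case True
    then show ?thesis using b[OF close_within_two[OF assms]] by simp
  next
    case False
    have "?x / ?N \<le> discrepancy k n m"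
      unfolding discrepancy_def
    proof (rule cInf_greatest)
      show "{\<delta>. 0 \<le> \<delta> \<and> close_within k n m \<delta>} \<noteq> {}" using close_within_two[OF assms, of k] by (metis (mono_tags, lifting) empty_iff mem_Collect_eq zero_le_numeral)
      fix \<delta> assume "\<delta> \<in> {\<delta>. 0 \<le> \<delta> \<and> close_within k n m \<delta>}"
      then have "?x \<le> \<delta> * ?N" using b by blast
      then show "?x / ?N \<le> \<delta>" using False N by (subst pos_divide_le_eq) linarith+
    qed
    moreover have "0 < ?N" using False N by linarith
    ultimately show ?thesis by (simp only: pos_divide_le_eq)
  qed
qed

text \<open>
  Without distinguished vertices \<open>U\<close> and the system on \<open>V\<close> share no spins: both sides are the
  difference of the maxima of \<open>U\<close> and \<open>U'\<close>.
\<close>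

lemma discrepancy_0: assumes "p \<le> n" "0 < m" shows "discrepancy 0 n m = 0"
proof -
  have "close_within 0 n m 0"
    unfolding close_within_def
  proof (intro allI impI)
    fix V :: "nat set" and bs and U U' :: "(nat \<Rightarrow> real) \<Rightarrow> real"
    assume *: "finite V" "card V = n" "length bs = 0" "U \<in> energies" "U' \<in> energies" "depends_on (set bs \<union> - V) U" "depends_on (set bs \<union> - V) U'"
    have G: "graph_max V m \<in> observables" "max_out (- V) (graph_max V m)" using * assms by (auto intro: graph_max_observables graph_max_max_out)
    have W: "graph_max V m W = graph_max V m 0 + maxE W" if "W \<in> energies" "depends_on (- V) W" for W
      using max_out_depends_on_const[OF G, of "{}" 0 W] that by simp
    have "bs = []" using * by simp
    moreover from this have "graph_max V m U = graph_max V m 0 + maxE U" "graph_max V m U' = graph_max V m 0 + maxE U'"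
      using * by (auto intro!: W)
    ultimately show "\<bar>graph_max V m U - graph_max V m U' - (field_max bs U - field_max bs U')\<bar> \<le> 0 * nrm (U - U')"
      by (simp add: field_max_def)
  qed
  then show ?thesis using discrepancy_le[of 0 0 n m] discrepancy_nonneg[OF assms, of 0] by simp
qed

lemma avg_bound_two:
  assumes "increment \<mu>" "\<Phi> \<in> observables" "W \<in> energies" "W' \<in> energies" "mean_nrm \<mu> \<le> b" "0 \<le> b"
  shows "\<bar>avg (iid_sum \<mu> r) \<Phi> W - avg (iid_sum \<mu> (if \<epsilon> then r else 0)) \<Phi> W'\<bar> \<le> nrm (W - W') + (if \<epsilon> then 0 else real r * b)"
proof (cases \<epsilon>)
  case True
  then show ?thesis using observables_abs[OF avg_observables[OF increment_iid_sum(1)[OF assms(1)] assms(2)] assms(3,4)] by simp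
next
  case False
  have "\<bar>avg (iid_sum \<mu> r) \<Phi> W - \<Phi> W\<bar> \<le> mean_nrm (iid_sum \<mu> r)" by (rule avg_bound[OF increment_iid_sum(1)[OF assms(1)] assms(2,3)])
  also have "\<dots> \<le> real r * b" using increment_iid_sum(2)[OF assms(1), of r] mult_left_mono[OF assms(5), of "real r"] by simp
  finally show ?thesis using False observables_abs[OF assms(2-4)] avg_iid_sum_0[OF assms(1,2,4)] by simp
qed

text \<open>
  The error of \<open>r\<close> clauses with \<open>q\<close> new vertices each, starting from \<open>k\<close> distinguished vertices. The
  second summand is twice a bound for the probability that the next clause hits one of the \<open>k\<close>
  vertices that are already exposed.
\<close>

primrec attach_err :: "nat \<Rightarrow> nat \<Rightarrow> real \<Rightarrow> nat \<Rightarrow> nat \<Rightarrow> real" where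
  "attach_err q n m 0 k = discrepancy k n m"
| "attach_err q n m (Suc r) k = attach_err q n m r (k + q) + 2 * real k * real q / real n"

lemma attach_err_nonneg: "p \<le> n \<Longrightarrow> 0 < m \<Longrightarrow> 0 \<le> attach_err q n m r k"
  by (induct r arbitrary: k) (auto simp: discrepancy_nonneg)

text \<open>
  Attaching \<open>r\<close> random clauses through \<open>\<rho>\<close> to the graph, compared with attaching \<open>r\<close> independent
  messages to the tree. With \<open>\<epsilon>\<close> true the clauses are added to both \<open>U\<close> and \<open>U'\<close>; with \<open>\<epsilon>\<close> false only
  to \<open>U\<close>, and \<open>r b\<close> accounts for their size. By induction on \<open>r\<close>, exposing the first clause: if its
  vertices avoid \<open>bs\<close>, then they join \<open>bs\<close> as new distinguished vertices, while on the tree side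
  \<open>fresh_clause\<close> replaces the message by the clause together with fields at its vertices. If they meet
  \<open>bs\<close>, which has probability at most \<open>k q / n\<close>, both sides are bounded trivially.
\<close>

lemma attach_clauses:
  assumes V: "finite V" "card V = n" "p \<le> n" and m: "0 < m"
    and \<rho>: "distinct \<rho>" "length \<rho> < p" "set \<rho> \<inter> V = {}" and b: "mean_clause_norm \<le> b" "mean_nrm (field_law L \<rho>) \<le> b"
    and "distinct bs" "set bs \<subseteq> V" "U \<in> energies" "U' \<in> energies" "depends_on (set bs \<union> - V) U" "depends_on (set bs \<union> - V) U'"
  shows "\<bar>(avg (iid_sum (random_clause V \<rho>) r) (graph_max V m) U - avg (iid_sum (random_clause V \<rho>) (if \<epsilon> then r else 0)) (graph_max V m) U')
     - (avg (iid_sum (field_law L \<rho>) r) (field_max bs) U - avg (iid_sum (field_law L \<rho>) (if \<epsilon> then r else 0)) (field_max bs) U')\<bar>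
    \<le> (nrm (U - U') + (if \<epsilon> then 0 else real r * b)) * attach_err (p - length \<rho>) n m r (length bs)"
  using assms(10-)
proof (induct r arbitrary: bs U U')
  case 0
  have k: "increment (random_clause V \<rho>)" "increment (field_law L \<rho>)" using V by (auto intro!: increment_random_clause increment_field_law L)
  have G: "graph_max V m \<in> observables" using V m by (auto intro: graph_max_observables)
  have "close_within (length bs) n m (discrepancy (length bs) n m)" by (rule close_within_discrepancy[OF V(3) m])
  then have "\<bar>graph_max V m U - graph_max V m U' - (field_max bs U - field_max bs U')\<bar> \<le> discrepancy (length bs) n m * nrm (U - U')"
    unfolding close_within_def using V 0 by blast
  then show ?case using 0 by (simp add: avg_iid_sum_0 k G field_max_observables mult.commute del: minus_apply)
next
  case (Suc r)
  let ?q = "p - length \<rho>"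
  let ?S = "ksubsets V ?q"
  let ?\<mu> = "random_clause V \<rho>" and ?\<kappa> = "field_law L \<rho>"
  define R where "R = (if \<epsilon> then r else 0)"
  define \<Phi> where "\<Phi> = graph_max V m"
  \<comment> \<open>A bound for the change of every observable in question; it is reproduced by the induction.\<close>
  define N where "N = nrm (U - U') + (if \<epsilon> then 0 else real (Suc r) * b)"
  have k: "increment ?\<mu>" "increment ?\<kappa>" using V by (auto intro!: increment_random_clause increment_field_law L)
  have F: "\<Phi> \<in> observables" unfolding \<Phi>_def using V m by (auto intro: graph_max_observables)
  have P: "field_max bs \<in> observables" for bs by (rule field_max_observables)
  note A_observables = avg_observables[OF increment_iid_sum(1)[OF k(1)] F] and C_observables = avg_observables[OF increment_iid_sum(1)[OF k(2)] P]
  have qV: "?q \<le> card V" using V by simp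
  have b0: "0 \<le> b" using b(1) mean_clause_norm_nonneg by linarith
  have mnb: "mean_nrm ?\<mu> \<le> b" using increment_random_clause(2)[OF V(1) qV] b by linarith
  have N0: "0 \<le> N" using b0 Suc.prems by (simp add: N_def)
  define e where "e f = (if \<epsilon> then f else 0)" for f :: "(nat \<Rightarrow> real) \<Rightarrow> real"
  have e_energies: "e f \<in> energies" if "f \<in> energies" for f using that by (simp add: e_def)
  define X where "X = avg (iid_sum ?\<kappa> (Suc r)) (field_max bs) U - avg (iid_sum ?\<kappa> (if \<epsilon> then Suc r else 0)) (field_max bs) U'"
  define T where "T J = (\<integral>f. avg (iid_sum ?\<mu> r) \<Phi> (U + lift (clause_at J \<rho>) f) - avg (iid_sum ?\<mu> R) \<Phi> (U' + e (lift (clause_at J \<rho>) f)) \<partial>Q)" for J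
  have i1: "integrable Q (\<lambda>f. \<Psi> (U + lift l f))" and i2: "integrable Q (\<lambda>f. \<Psi> (U' + e (lift l f)))"
    and i3: "(\<integral>f. \<Psi> (U' + e (lift l f)) \<partial>Q) = (if \<epsilon> then \<integral>f. \<Psi> (U' + lift l f) \<partial>Q else \<Psi> U')" if "\<Psi> \<in> observables" for \<Psi> l
    using clause_law_at_integrable[OF that Suc.prems(3)] clause_law_at_integrable[OF that Suc.prems(4)]
    by (cases \<epsilon>; auto simp: e_def Q.prob_space simp del: zero_fun_apply)+
  have Teq: "T J = (\<integral>f. avg (iid_sum ?\<mu> r) \<Phi> (U + lift (clause_at J \<rho>) f) \<partial>Q) - (\<integral>f. avg (iid_sum ?\<mu> R) \<Phi> (U' + e (lift (clause_at J \<rho>) f)) \<partial>Q)" for J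
    unfolding T_def by (rule Bochner_Integration.integral_diff[OF i1[OF A_observables] i2[OF A_observables]])
  have c: "0 < card ?S" using ksubsets_ne[OF V(1) qV] finite_ksubsets[OF V(1)] by (simp add: card_gt_0_iff)
  have avg: "avg (iid_sum ?\<mu> (Suc r)) \<Phi> U - avg (iid_sum ?\<mu> (if \<epsilon> then Suc r else 0)) \<Phi> U' = (\<Sum>J\<in>?S. T J) / real (card ?S)"
  proof -
    have 1: "avg (iid_sum ?\<mu> (Suc r)) \<Phi> U = (\<Sum>J\<in>?S. \<integral>f. avg (iid_sum ?\<mu> r) \<Phi> (U + lift (clause_at J \<rho>) f) \<partial>Q) / real (card ?S)"
      by (simp add: avg_iid_sum_Suc[OF k(1) F Suc.prems(3)] avg_random_clause[OF V(1) qV A_observables Suc.prems(3)])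
    have 2: "avg (iid_sum ?\<mu> (if \<epsilon> then Suc r else 0)) \<Phi> U' = (\<Sum>J\<in>?S. \<integral>f. avg (iid_sum ?\<mu> R) \<Phi> (U' + e (lift (clause_at J \<rho>) f)) \<partial>Q) / real (card ?S)"
      using c by (cases \<epsilon>) (simp_all add: avg_iid_sum_Suc[OF k(1) F Suc.prems(4)] avg_random_clause[OF V(1) qV A_observables Suc.prems(4)] i3[OF A_observables] R_def)
    show ?thesis unfolding 1 2 Teq sum_subtractf diff_divide_distrib ..
  qed
  have nbound: "nrm (U + lift l f - (U' + e (lift l f))) + (if \<epsilon> then 0 else real r * b) \<le> nrm (U - U') + (if \<epsilon> then 0 else clause_norm f + real r * b)"
    if "f \<in> space Q" for f l
  proof -
    have f: "f \<in> space clause_borel" using that by (simp add: space_Q)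
    have "nrm (U + lift l f - U') \<le> nrm (U - U') + nrm (lift l f)"
      using nrm_triangle[of "U - U'" "lift l f"] Suc.prems lift_energies[OF f] by (simp add: algebra_simps)
    then show ?thesis using nrm_lift[OF f, of l] by (simp add: e_def del: zero_fun_apply)
  qed
  have Nint: "integrable Q (\<lambda>f. nrm (U - U') + (if \<epsilon> then 0 else clause_norm f + real r * b))"
    "(\<integral>f. nrm (U - U') + (if \<epsilon> then 0 else clause_norm f + real r * b) \<partial>Q) \<le> N"
    using clause_norm_integrable b(1) by (cases \<epsilon>; simp add: Q.prob_space N_def mean_clause_norm_def distrib_right del: minus_apply)+
  have Tbound: "\<bar>T J\<bar> \<le> N" for J
  proof -
    have "\<bar>T J\<bar> \<le> (\<integral>f. nrm (U - U') + (if \<epsilon> then 0 else clause_norm f + real r * b) \<partial>Q)"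
      unfolding T_def
    proof (rule integral_abs_bound[THEN order_trans], rule integral_mono)
      show "integrable Q (\<lambda>f. \<bar>avg (iid_sum ?\<mu> r) \<Phi> (U + lift (clause_at J \<rho>) f) - avg (iid_sum ?\<mu> R) \<Phi> (U' + e (lift (clause_at J \<rho>) f))\<bar>)"
        by (intro integrable_abs Bochner_Integration.integrable_diff i1 i2 A_observables)
      fix f assume f: "f \<in> space Q"
      then have "lift (clause_at J \<rho>) f \<in> energies" by (intro lift_energies) (simp add: space_Q)
      then show "\<bar>avg (iid_sum ?\<mu> r) \<Phi> (U + lift (clause_at J \<rho>) f) - avg (iid_sum ?\<mu> R) \<Phi> (U' + e (lift (clause_at J \<rho>) f))\<bar>
        \<le> nrm (U - U') + (if \<epsilon> then 0 else clause_norm f + real r * b)"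
        unfolding R_def
        by (intro order_trans[OF avg_bound_two[OF k(1) F _ _ mnb b0] nbound[OF f]]) (auto intro!: energies_add e_energies Suc.prems)
    qed (rule Nint)
    then show ?thesis using Nint(2) by linarith
  qed
  have Xbound: "\<bar>X\<bar> \<le> N"
    unfolding X_def N_def by (rule avg_bound_two[OF k(2) P Suc.prems(3,4) b(2) b0])
  have fresh: "\<bar>T J - X\<bar> \<le> N * attach_err ?q n m r (length bs + ?q)" if J: "J \<in> ?S" "J \<inter> set bs = {}" for J
  proof -
    define js where "js = sorted_list_of_set J"
    have sjs: "set js = J" "distinct js" "length js = ?q" "J \<subseteq> V"
      using set_clause_at[OF J(1) V(1)] J(1) by (auto simp: js_def ksubsets_def)
    have qr: "?q + length \<rho> = p" using \<rho> by simp
    have jr: "set js \<inter> set \<rho> = {}" using sjs \<rho> by auto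
    define \<Psi> where "\<Psi> r' = avg (iid_sum ?\<kappa> r') (field_max bs)" for r'
    have Psi_observables: "\<Psi> r' \<in> observables" for r' unfolding \<Psi>_def by (rule C_observables)
    have Psi_max_out: "max_out I (\<Psi> r')" if "I \<inter> (set bs \<union> set \<rho>) = {}" for I r'
      unfolding \<Psi>_def field_max_def
      by (rule max_out_iid_sum[OF k(2) max_out_field_law[OF L] avg_fields_observables[OF L maxE_observables] max_out_avg_fields[OF L maxE_observables max_out_maxE]]) (use that \<rho> in auto)
    have depjs: "depends_on (- set js) W" if "depends_on (set bs \<union> - V) W" for W
      by (rule depends_on_mono[OF that]) (use sjs J in auto)
    have XP: "avg_fields L js (\<Psi> r') W = avg (iid_sum ?\<kappa> r') (field_max (js @ bs)) W" if "W \<in> energies" for r' W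
      unfolding \<Psi>_def by (subst avg_fields_avg_commute[OF L increment_iid_sum(1)[OF k(2)] P that]) (simp add: field_max_def avg_fields_append)
    have e1: "avg (iid_sum ?\<kappa> (Suc r)) (field_max bs) U = (\<integral>f. avg (iid_sum ?\<kappa> r) (field_max (js @ bs)) (U + lift (js @ \<rho>) f) \<partial>Q)"
    proof -
      have "avg (iid_sum ?\<kappa> (Suc r)) (field_max bs) U = avg ?\<kappa> (\<Psi> r) U" by (simp add: avg_iid_sum_Suc[OF k(2) P Suc.prems(3)] \<Psi>_def)
      also have "\<dots> = (\<integral>f. avg_fields L js (\<Psi> r) (U + lift (js @ \<rho>) f) \<partial>Q)"
        by (rule fresh_clause[OF L Psi_observables Psi_max_out sjs(2,3) qr jr Suc.prems(3) depjs[OF Suc.prems(5)], symmetric]) (use J sjs jr in auto)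
      also have "\<dots> = (\<integral>f. avg (iid_sum ?\<kappa> r) (field_max (js @ bs)) (U + lift (js @ \<rho>) f) \<partial>Q)"
        by (rule Bochner_Integration.integral_cong[OF refl], rule XP) (auto intro!: energies_add Suc.prems lift_energies simp: space_Q)
      finally show ?thesis .
    qed
    have e2: "avg (iid_sum ?\<kappa> (if \<epsilon> then Suc r else 0)) (field_max bs) U' = (\<integral>f. avg (iid_sum ?\<kappa> R) (field_max (js @ bs)) (U' + e (lift (js @ \<rho>) f)) \<partial>Q)"
    proof (cases \<epsilon>)
      case True
      have "avg (iid_sum ?\<kappa> (Suc r)) (field_max bs) U' = avg ?\<kappa> (\<Psi> r) U'" by (simp add: avg_iid_sum_Suc[OF k(2) P Suc.prems(4)] \<Psi>_def)
      also have "\<dots> = (\<integral>f. avg_fields L js (\<Psi> r) (U' + lift (js @ \<rho>) f) \<partial>Q)"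
        by (rule fresh_clause[OF L Psi_observables Psi_max_out sjs(2,3) qr jr Suc.prems(4) depjs[OF Suc.prems(6)], symmetric]) (use J sjs jr in auto)
      also have "\<dots> = (\<integral>f. avg (iid_sum ?\<kappa> r) (field_max (js @ bs)) (U' + lift (js @ \<rho>) f) \<partial>Q)"
        by (rule Bochner_Integration.integral_cong[OF refl], rule XP) (auto intro!: energies_add Suc.prems lift_energies simp: space_Q)
      finally show ?thesis using True by (simp add: e_def R_def)
    next
      case False
      have "avg (iid_sum ?\<kappa> 0) (field_max (js @ bs)) U' = avg_fields L js (\<Psi> 0) U'" using XP[OF Suc.prems(4)] by simp
      also have "\<dots> = \<Psi> 0 U'"
        by (rule avg_fields_normalised[OF L L_norm Psi_observables Suc.prems(4) sjs(2) Psi_max_out depjs[OF Suc.prems(6)]]) (use J sjs jr in auto)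
      finally show ?thesis using False by (simp add: e_def R_def \<Psi>_def Q.prob_space del: zero_fun_apply)
    qed
    let ?h = "\<lambda>f. (avg (iid_sum ?\<mu> r) \<Phi> (U + lift (js @ \<rho>) f) - avg (iid_sum ?\<mu> R) \<Phi> (U' + e (lift (js @ \<rho>) f)))
        - (avg (iid_sum ?\<kappa> r) (field_max (js @ bs)) (U + lift (js @ \<rho>) f) - avg (iid_sum ?\<kappa> R) (field_max (js @ bs)) (U' + e (lift (js @ \<rho>) f)))"
    have hint: "integrable Q ?h"
      by (intro Bochner_Integration.integrable_diff i1 i2 A_observables C_observables)
    have TX: "T J - X = (\<integral>f. ?h f \<partial>Q)"
      unfolding Teq X_def e1 e2 js_def[symmetric]
      by (rule integral_diff4(1)[symmetric]; intro i1 i2 A_observables C_observables)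
    let ?E = "attach_err ?q n m r (length bs + ?q)"
    have E0: "0 \<le> ?E" by (rule attach_err_nonneg[OF V(3) m])
    have "\<bar>\<integral>f. ?h f \<partial>Q\<bar> \<le> (\<integral>f. (nrm (U - U') + (if \<epsilon> then 0 else clause_norm f + real r * b)) * ?E \<partial>Q)"
    proof (rule integral_abs_bound[THEN order_trans], rule integral_mono)
      show "integrable Q (\<lambda>f. \<bar>?h f\<bar>)" by (rule integrable_abs[OF hint])
      show "integrable Q (\<lambda>f. (nrm (U - U') + (if \<epsilon> then 0 else clause_norm f + real r * b)) * ?E)"
        by (rule integrable_mult_left[OF Nint(1)])
      fix f assume f: "f \<in> space Q"
      then have l: "lift (js @ \<rho>) f \<in> energies" by (intro lift_energies) (simp add: space_Q)
      have ld: "depends_on (set (js @ bs) \<union> - V) (lift (js @ \<rho>) f)"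
        by (rule depends_on_mono[OF lift_depends_on]) (use sjs qr \<rho> in auto)
      have d1: "depends_on (set (js @ bs) \<union> - V) (U + lift (js @ \<rho>) f)"
        by (intro depends_on_add ld depends_on_mono[OF Suc.prems(5)]) auto
      have d2: "depends_on (set (js @ bs) \<union> - V) (U' + e (lift (js @ \<rho>) f))"
        by (intro depends_on_add depends_on_mono[OF Suc.prems(6)]) (use ld in \<open>auto simp: e_def simp del: zero_fun_apply\<close>)
      have "\<bar>?h f\<bar> \<le> (nrm (U + lift (js @ \<rho>) f - (U' + e (lift (js @ \<rho>) f))) + (if \<epsilon> then 0 else real r * b)) * attach_err ?q n m r (length (js @ bs))"
        unfolding \<Phi>_def R_def
        by (rule Suc.hyps[OF _ _ _ _ d1 d2]) (use sjs J Suc.prems l e_energies in auto)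
      also have "\<dots> \<le> (nrm (U - U') + (if \<epsilon> then 0 else clause_norm f + real r * b)) * ?E"
        using mult_right_mono[OF nbound[OF f, of "js @ \<rho>"] E0] sjs(3) by (simp add: add.commute)
      finally show "\<bar>?h f\<bar> \<le> (nrm (U - U') + (if \<epsilon> then 0 else clause_norm f + real r * b)) * ?E" .
    qed
    also have "\<dots> = (\<integral>f. nrm (U - U') + (if \<epsilon> then 0 else clause_norm f + real r * b) \<partial>Q) * ?E"
      by (rule integral_mult_left_zero)
    also have "\<dots> \<le> N * ?E" by (rule mult_right_mono[OF Nint(2) E0])
    finally show ?thesis unfolding TX .
  qed
  let ?E = "attach_err ?q n m r (length bs + ?q)"
  let ?B = "{J \<in> ?S. J \<inter> set bs \<noteq> {}}"
  have E0: "0 \<le> ?E" by (rule attach_err_nonneg[OF V(3) m])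
  have "\<bar>(\<Sum>J\<in>?S. T J) / real (card ?S) - X\<bar> = \<bar>\<Sum>J\<in>?S. T J - X\<bar> / real (card ?S)"
    using c by (simp add: sum_subtractf field_simps)
  also have "\<dots> \<le> (\<Sum>J\<in>?S. N * ?E + (if J \<inter> set bs \<noteq> {} then 2 * N else 0)) / real (card ?S)"
  proof (intro divide_right_mono order_trans[OF sum_abs] sum_mono)
    fix J assume J: "J \<in> ?S"
    show "\<bar>T J - X\<bar> \<le> N * ?E + (if J \<inter> set bs \<noteq> {} then 2 * N else 0)"
    proof (cases "J \<inter> set bs = {}")
      case True
      then show ?thesis using fresh[OF J] by simp
    next
      case False
      have "\<bar>T J - X\<bar> \<le> 2 * N" using Tbound[of J] Xbound by linarith
      moreover have "0 \<le> N * ?E" using N0 E0 by simp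
      ultimately show ?thesis using False by simp
    qed
  qed simp
  also have "\<dots> = N * ?E + 2 * N * (real (card ?B) / real (card ?S))"
    using c ksubsets_ne[OF V(1) qV] finite_ksubsets[OF V(1), of ?q] by (simp add: sum.distrib sum.If_cases Int_def add_divide_distrib)
  also have "\<dots> \<le> N * ?E + 2 * N * (real (length bs) * real ?q / real n)"
  proof -
    have "real (card ?B) * real n \<le> real (length bs) * real ?q * real (card ?S)"
      using card_ksubsets_meet[OF V(1) Suc.prems(2), of ?q] \<rho>(2) V(2) distinct_card[OF Suc.prems(1)] by simp
    then have "real (card ?B) / real (card ?S) \<le> real (length bs) * real ?q / real n"
      using c V(3) p_ge by (simp add: field_simps)
    then show ?thesis using N0 by (intro add_left_mono mult_left_mono) auto
  qed
  also have "\<dots> = N * attach_err ?q n m (Suc r) (length bs)" by (simp add: algebra_simps)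
  finally show ?case unfolding avg[unfolded \<Phi>_def] X_def[symmetric] N_def .
qed

definition gain_bound where "gain_bound = mean_clause_norm + real p * (\<integral>x. spin_norm x \<partial>L)"

lemma gain_bound: "mean_clause_norm \<le> gain_bound" "mean_nrm (field_law L \<rho>) \<le> gain_bound" "0 \<le> gain_bound"
proof -
  have nn: "0 \<le> (\<integral>x. spin_norm x \<partial>L)" by (rule integral_nonneg_AE, rule AE_I2) (simp add: Pr1D(3)[OF L] spin_norm_nonneg)
  then show 1: "mean_clause_norm \<le> gain_bound" by (simp add: gain_bound_def)
  then show "0 \<le> gain_bound" using mean_clause_norm_nonneg by linarith
  let ?P = "iid L"
  interpret P: prob_space ?P by (intro prob_space_PiM Pr1D(1)[OF L])
  interpret QP: pair_prob_space Q ?P ..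
  let ?q = "p - length \<rho>"
  have m: "(\<lambda>y. clause_field ?q \<rho> (fst y) (snd y)) \<in> measurable (Q \<Otimes>\<^sub>M ?P) energy_space" by (rule field_law_meas[OF Pr1D(2)[OF L]])
  have i1: "integrable (Q \<Otimes>\<^sub>M ?P) (\<lambda>y. clause_norm (fst y))" by (rule Q.integrable_pair_fst[OF P.prob_space_axioms clause_norm_integrable])
  have i2: "integrable (Q \<Otimes>\<^sub>M ?P) (\<lambda>y. spin_norm (snd y j))" for j
    by (rule Q.integrable_pair_snd[OF P.prob_space_axioms integrable_PiM_component[OF Pr1D(1,4)[OF L], of j]])
  have e1: "(\<integral>y. clause_norm (fst y) \<partial>(Q \<Otimes>\<^sub>M ?P)) = mean_clause_norm"
    using QP.integral_fst'[OF i1] by (simp add: mean_clause_norm_def P.prob_space)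
  have e2: "(\<integral>y. spin_norm (snd y j) \<partial>(Q \<Otimes>\<^sub>M ?P)) = (\<integral>x. spin_norm x \<partial>L)" for j
  proof -
    note [measurable_cong] = Pr1D(2)[OF L]
    have "(\<integral>y. spin_norm (snd y j) \<partial>(Q \<Otimes>\<^sub>M ?P)) = (\<integral>x. spin_norm (x j) \<partial>?P)"
      using QP.integral_fst'[OF i2, of j] by (simp add: Q.prob_space)
    also have "\<dots> = (\<integral>x. spin_norm x \<partial>distr ?P L (\<lambda>x. x j))"
      by (subst integral_distr) auto
    also have "distr ?P L (\<lambda>x. x j) = L" by (rule distr_PiM_component) (auto intro: Pr1D(1)[OF L])
    finally show ?thesis .
  qed
  have "mean_nrm (field_law L \<rho>) = (\<integral>y. nrm (clause_field ?q \<rho> (fst y) (snd y)) \<partial>(Q \<Otimes>\<^sub>M ?P))"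
    unfolding mean_nrm_def field_law_def by (rule integral_distr[OF m nrm_measurable])
  also have "\<dots> \<le> (\<integral>y. clause_norm (fst y) + (\<Sum>j<?q. spin_norm (snd y j)) \<partial>(Q \<Otimes>\<^sub>M ?P))"
  proof (rule integral_mono)
    show "integrable (Q \<Otimes>\<^sub>M ?P) (\<lambda>y. nrm (clause_field ?q \<rho> (fst y) (snd y)))"
      using incrementD(3)[OF increment_field_law[OF L, of \<rho>]] unfolding field_law_def by (subst (asm) integrable_distr_eq[OF m nrm_measurable])
    show "integrable (Q \<Otimes>\<^sub>M ?P) (\<lambda>y. clause_norm (fst y) + (\<Sum>j<?q. spin_norm (snd y j)))" using i1 i2 by simp
    fix y assume "y \<in> space (Q \<Otimes>\<^sub>M ?P)"
    then have y: "fst y \<in> space clause_borel" "\<And>j. snd y j \<in> space spin_borel" using L_seq_space[OF L] by (auto simp: space_pair_measure space_Q)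
    show "nrm (clause_field ?q \<rho> (fst y) (snd y)) \<le> clause_norm (fst y) + (\<Sum>j<?q. spin_norm (snd y j))"
      by (rule clause_field_bound[where x = "snd y", OF y])
  qed
  also have "\<dots> = mean_clause_norm + real ?q * (\<integral>x. spin_norm x \<partial>L)"
    using i1 i2 by (simp add: e1 e2)
  also have "\<dots> \<le> gain_bound" unfolding gain_bound_def using nn by (intro add_left_mono mult_right_mono) auto
  finally show "mean_nrm (field_law L \<rho>) \<le> gain_bound" .
qed

lemma attach_err_alt: "\<exists>C. \<forall>n m. attach_err q n m r k = discrepancy (k + r * q) n m + C / real n"
proof (induct r arbitrary: k)
  case 0
  show ?case by (intro exI[of _ 0]) simp
next
  case (Suc r)
  from Suc[of "k + q"] obtain C where C: "\<And>n m. attach_err q n m r (k + q) = discrepancy (k + q + r * q) n m + C / real n" by blast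
  show ?case by (intro exI[of _ "C + 2 * real k * real q"]) (simp add: C add_divide_distrib add_ac)
qed

text \<open>
  Removing a distinguished vertex \<open>a\<close> exposes a Poisson number of clauses through it on the graph side,
  and the fixed point equation does the same on the tree side. The rates \<open>t m\<close> and \<open>\<alpha> p\<close> differ
  slightly, which costs the first term.
\<close>

lemma discrepancy_step:
  assumes n: "p \<le> n" and m: "0 < m"
  defines "t \<equiv> real p / real (Suc n)"
  shows "discrepancy (Suc k) (Suc n) m \<le> 2 * \<bar>t * m - mean_degree\<bar> +
    (\<integral>r. min 2 (attach_err (p - 1) n ((1 - t) * m) r k) \<partial>measure_pmf (poisson_pmf mean_degree))"
proof (rule discrepancy_le)
  let ?w = "measure_pmf (poisson_pmf mean_degree)"
  let ?m = "(1 - t) * m"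
  have t: "0 < t" "t < 1" using n p_ge by (auto simp: t_def)
  have m': "0 < ?m" "0 < t * m" using t m by auto
  let ?g = "\<lambda>r. min 2 (attach_err (p - 1) n ?m r k)"
  have g0: "0 \<le> ?g r" for r using attach_err_nonneg[OF n m'(1)] by simp
  have gi: "integrable ?w ?g" by (rule measure_pmf.integrable_const_bound[of _ 2]) (use g0 in auto)
  show "0 \<le> 2 * \<bar>t * m - mean_degree\<bar> + (\<integral>r. ?g r \<partial>?w)"
    by (intro add_nonneg_nonneg integral_nonneg_AE AE_I2 g0) simp
  show "close_within (Suc k) (Suc n) m (2 * \<bar>t * m - mean_degree\<bar> + (\<integral>r. ?g r \<partial>?w))"
    unfolding close_within_def
  proof (intro allI impI)
    fix V0 :: "nat set" and bs0 and U U' :: "(nat \<Rightarrow> real) \<Rightarrow> real"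
    assume *: "finite V0" "card V0 = Suc n" "distinct bs0" "set bs0 \<subseteq> V0" "length bs0 = Suc k" "U \<in> energies" "U' \<in> energies"
      "depends_on (set bs0 \<union> - V0) U" "depends_on (set bs0 \<union> - V0) U'"
    obtain a bs where bs0: "bs0 = a # bs" using *(5) by (cases bs0) auto
    define V where "V = V0 - {a}"
    have V0: "V0 = insert a V" using * bs0 by (auto simp: V_def)
    have V: "finite V" "a \<notin> V" "card V = n" using * bs0 by (auto simp: V_def)
    have bs: "distinct bs" "set bs \<subseteq> V" "length bs = k" using * bs0 by (auto simp: V_def)
    let ?U = "U + site a \<psi>" and ?U' = "U' + site a \<psi>"
    have UC: "?U \<in> energies" "?U' \<in> energies" using * psi_energies by auto
    have sd: "depends_on (set bs \<union> - V) (site a \<psi>)" by (rule depends_on_mono[OF site_depends_on]) (use V in auto)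
    have Ud: "depends_on (set bs \<union> - V) ?U" "depends_on (set bs \<union> - V) ?U'"
    proof -
      have "set bs0 \<union> - V0 \<subseteq> set bs \<union> - V" using V by (auto simp: V0 bs0)
      then show "depends_on (set bs \<union> - V) ?U" "depends_on (set bs \<union> - V) ?U'"
        by (intro depends_on_add sd depends_on_mono[OF *(8)], assumption, intro depends_on_add sd depends_on_mono[OF *(9)])
    qed
    have nU: "nrm (?U - ?U') = nrm (U - U')" by simp
    let ?N = "nrm (U - U')"
    have N0: "0 \<le> ?N" using * by simp
    let ?\<mu> = "random_clause V [a]" and ?\<kappa> = "field_law L [a]" and ?\<Phi> = "graph_max V ?m"
    have k: "increment ?\<mu>" "increment ?\<kappa>" using V n by (auto intro!: increment_random_clause increment_field_law L)
    have F: "?\<Phi> \<in> observables" "field_max bs \<in> observables" using V n m' by (auto intro: graph_max_observables field_max_observables)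
    have pV: "p \<le> card V" using V n by simp
    have "graph_max V0 m U = avg (cpoisson ?\<mu> (t * m)) ?\<Phi> ?U" "graph_max V0 m U' = avg (cpoisson ?\<mu> (t * m)) ?\<Phi> ?U'"
      unfolding V0 t_def using graph_max_remove[OF V(1,2) pV m *(6)] graph_max_remove[OF V(1,2) pV m *(7)] V(3) by simp_all
    moreover have "field_max bs0 U - field_max bs0 U' = avg (cpoisson ?\<kappa> mean_degree) (field_max bs) ?U - avg (cpoisson ?\<kappa> mean_degree) (field_max bs) ?U'"
      unfolding bs0 using L_fix[OF F(2) *(6,7), of a] by (simp add: field_max_def)
    moreover have "\<bar>(avg (cpoisson ?\<mu> (t * m)) ?\<Phi> ?U - avg (cpoisson ?\<mu> (t * m)) ?\<Phi> ?U') - (avg (cpoisson ?\<mu> mean_degree) ?\<Phi> ?U - avg (cpoisson ?\<mu> mean_degree) ?\<Phi> ?U')\<bar>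
      \<le> 2 * \<bar>t * m - mean_degree\<bar> * ?N"
      using avg_cpoisson_change[OF k(1) mean_degree_pos m'(2) F(1) UC] unfolding nU .
    moreover have "\<bar>(avg (cpoisson ?\<mu> mean_degree) ?\<Phi> ?U - avg (cpoisson ?\<mu> mean_degree) ?\<Phi> ?U') - (avg (cpoisson ?\<kappa> mean_degree) (field_max bs) ?U - avg (cpoisson ?\<kappa> mean_degree) (field_max bs) ?U')\<bar>
      \<le> (\<integral>r. ?g r \<partial>?w) * ?N"
    proof -
      let ?h = "\<lambda>r. (avg (iid_sum ?\<mu> r) ?\<Phi> ?U - avg (iid_sum ?\<mu> r) ?\<Phi> ?U') - (avg (iid_sum ?\<kappa> r) (field_max bs) ?U - avg (iid_sum ?\<kappa> r) (field_max bs) ?U')"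
      have I: "integrable ?w (\<lambda>r. avg (iid_sum ?\<mu> r) ?\<Phi> W)" "integrable ?w (\<lambda>r. avg (iid_sum ?\<kappa> r) (field_max bs) W)" if "W \<in> energies" for W
        by (rule avg_cpoisson(2)[OF k(1) mean_degree_pos F(1) that], rule avg_cpoisson(2)[OF k(2) mean_degree_pos F(2) that])
      have E: "avg (cpoisson ?\<mu> mean_degree) ?\<Phi> W = (\<integral>r. avg (iid_sum ?\<mu> r) ?\<Phi> W \<partial>?w)" "avg (cpoisson ?\<kappa> mean_degree) (field_max bs) W = (\<integral>r. avg (iid_sum ?\<kappa> r) (field_max bs) W \<partial>?w)" if "W \<in> energies" for W
        by (rule avg_cpoisson(1)[OF k(1) mean_degree_pos F(1) that], rule avg_cpoisson(1)[OF k(2) mean_degree_pos F(2) that])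
      have "(avg (cpoisson ?\<mu> mean_degree) ?\<Phi> ?U - avg (cpoisson ?\<mu> mean_degree) ?\<Phi> ?U') - (avg (cpoisson ?\<kappa> mean_degree) (field_max bs) ?U - avg (cpoisson ?\<kappa> mean_degree) (field_max bs) ?U') = (\<integral>r. ?h r \<partial>?w)"
        unfolding E[OF UC(1)] E[OF UC(2)] by (rule integral_diff4(1)[symmetric]; intro I UC)
      moreover have "\<bar>\<integral>r. ?h r \<partial>?w\<bar> \<le> (\<integral>r. ?g r * ?N \<partial>?w)"
      proof (rule integral_abs_bound[THEN order_trans], rule integral_mono)
        have "integrable ?w ?h" by (rule integral_diff4(2); intro I UC)
        then show "integrable ?w (\<lambda>r. \<bar>?h r\<bar>)" by (rule integrable_abs)
        show "integrable ?w (\<lambda>r. ?g r * ?N)" by (rule integrable_mult_left[OF gi])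
        fix r
        have "\<bar>?h r\<bar> \<le> ?N * attach_err (p - 1) n ?m r k"
          using attach_clauses[where r = r and \<epsilon> = True and \<rho> = "[a]", OF V(1,3) n m'(1) _ _ _ gain_bound(1) gain_bound(2) bs(1,2) UC Ud] V p_ge bs(3) nU by (simp del: minus_apply)
        moreover have "\<bar>?h r\<bar> \<le> 2 * ?N"
        proof -
          have "\<bar>avg (iid_sum ?\<mu> r) ?\<Phi> ?U - avg (iid_sum ?\<mu> r) ?\<Phi> ?U'\<bar> \<le> ?N" "\<bar>avg (iid_sum ?\<kappa> r) (field_max bs) ?U - avg (iid_sum ?\<kappa> r) (field_max bs) ?U'\<bar> \<le> ?N"
            unfolding nU[symmetric] by (intro avg_lipschitz increment_iid_sum k F UC)+
          then show ?thesis by linarith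
        qed
        ultimately show "\<bar>?h r\<bar> \<le> ?g r * ?N" by (simp add: min_def mult.commute del: minus_apply)
      qed
      ultimately show ?thesis by simp
    qed
    ultimately show "\<bar>graph_max V0 m U - graph_max V0 m U' - (field_max bs0 U - field_max bs0 U')\<bar> \<le> (2 * \<bar>t * m - mean_degree\<bar> + (\<integral>r. ?g r \<partial>?w)) * ?N"
      by (simp only: distrib_right)
  qed
qed

text \<open>
  The mean number of clauses changes when vertices are removed, but stays asymptotically \<open>\<alpha>\<close> per vertex.
\<close>

definition edge_rate where "edge_rate m \<longleftrightarrow> (\<lambda>n. m n / real n) \<longlonglongrightarrow> \<alpha>" for m :: "nat \<Rightarrow> real"

lemma edge_rate_pos: assumes "edge_rate m" shows "eventually (\<lambda>n. 0 < m n) sequentially"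
proof -
  have "eventually (\<lambda>n. 0 < m n / real n) sequentially"
    using order_tendstoD(1)[OF assms[unfolded edge_rate_def] alpha_pos] .
  then show ?thesis by eventually_elim (simp add: zero_less_divide_iff)
qed

lemma edge_rate_shift: assumes "edge_rate m" shows "edge_rate (\<lambda>n. (1 - real p / real (Suc n)) * m (Suc n))"
proof -
  have 1: "(\<lambda>n. m (Suc n) / real (Suc n)) \<longlonglongrightarrow> \<alpha>" using assms unfolding edge_rate_def by (rule LIMSEQ_Suc)
  have 2: "(\<lambda>n. 1 + 1 / real n - real p / real n) \<longlonglongrightarrow> 1 + 0 - 0"
    by (intro tendsto_intros lim_const_over_n)
  have "(\<lambda>n. (1 + 1 / real n - real p / real n) * (m (Suc n) / real (Suc n))) \<longlonglongrightarrow> (1 + 0 - 0) * \<alpha>"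
    by (rule tendsto_mult[OF 2 1])
  then have lim: "(\<lambda>n. (1 + 1 / real n - real p / real n) * (m (Suc n) / real (Suc n))) \<longlonglongrightarrow> \<alpha>" by simp
  show ?thesis
    unfolding edge_rate_def
  proof (rule Lim_transform_eventually[OF lim])
    show "eventually (\<lambda>n. (1 + 1 / real n - real p / real n) * (m (Suc n) / real (Suc n)) = (1 - real p / real (Suc n)) * m (Suc n) / real n) sequentially"
      using eventually_gt_at_top[of 0]
    proof eventually_elim
      fix n :: nat assume n: "0 < n"
      have "1 - real p / real (Suc n) = (real (Suc n) - real p) / real (Suc n)" by (simp add: diff_divide_distrib)
      moreover have "1 + 1 / real n - real p / real n = (real (Suc n) - real p) / real n" using n by (simp add: diff_divide_distrib add_divide_distrib)
      ultimately show "(1 + 1 / real n - real p / real n) * (m (Suc n) / real (Suc n)) = (1 - real p / real (Suc n)) * m (Suc n) / real n" by simp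
    qed
  qed
qed

lemma edge_rate_degree: assumes "edge_rate m" shows "(\<lambda>n. real p / real (Suc n) * m (Suc n)) \<longlonglongrightarrow> mean_degree"
proof -
  have "(\<lambda>n. real p * (m (Suc n) / real (Suc n))) \<longlonglongrightarrow> real p * \<alpha>"
    by (intro tendsto_intros) (use assms LIMSEQ_Suc in \<open>auto simp: edge_rate_def simp del: of_nat_Suc\<close>)
  then show ?thesis by (simp add: mult.commute)
qed

lemma attach_err_limsup:
  assumes "\<And>e. 0 < e \<Longrightarrow> eventually (\<lambda>n. discrepancy (k + r * q) n (m n) \<le> B + e) sequentially" "0 < e"
  shows "eventually (\<lambda>n. attach_err q n (m n) r k \<le> B + e) sequentially"
proof -
  obtain C where C: "\<And>n m. attach_err q n m r k = discrepancy (k + r * q) n m + C / real n" using attach_err_alt by blast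
  have "(\<lambda>n. C / real n) \<longlonglongrightarrow> 0" by (rule lim_const_over_n)
  then have "eventually (\<lambda>n. C / real n < e/2) sequentially" using assms(2) by (intro order_tendstoD(2)) auto
  moreover have "eventually (\<lambda>n. discrepancy (k + r * q) n (m n) \<le> B + e/2) sequentially" using assms by simp
  ultimately show ?thesis unfolding C by eventually_elim linarith
qed

text \<open>
  By induction on the depth \<open>j\<close> of the exploration. Inside, \<open>a\<close> of the distinguished vertices already
  have the weight \<open>s(j + 1)\<close> and \<open>b\<close> still have the weight \<open>s(j)\<close>. Each step removes one of the \<open>a\<close>
  vertices and adds \<open>(p - 1) r\<close> vertices to the \<open>b\<close> others. Taking the mean over \<open>r\<close> turns these into
  one summand \<open>E min 1 ((p - 1) r s(j)) = s(j + 1)\<close>.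
\<close>

lemma discrepancy_limsup:
  "\<forall>m k e. edge_rate m \<longrightarrow> 0 < e \<longrightarrow> eventually (\<lambda>n. discrepancy k n (m n) \<le> 2 * min 1 (real k * survival j) + e) sequentially"
proof (induct j)
  case 0
  show ?case
  proof (intro allI impI)
    fix m k and e :: real assume m: "edge_rate m" and e: "0 < e"
    show "eventually (\<lambda>n. discrepancy k n (m n) \<le> 2 * min 1 (real k * survival 0) + e) sequentially"
      using edge_rate_pos[OF m] eventually_ge_at_top[of p]
    proof eventually_elim
      fix n assume n: "0 < m n" "p \<le> n"
      show "discrepancy k n (m n) \<le> 2 * min 1 (real k * survival 0) + e"
      proof (cases k)
        case 0
        then show ?thesis using discrepancy_0[OF n(2,1)] e by simp
      next
        case (Suc k')
        then show ?thesis using discrepancy_le[OF _ close_within_two[OF n(2,1)], of k] e by simp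
      qed
    qed
  qed
next
  case (Suc j)
  let ?w = "measure_pmf (poisson_pmf mean_degree)"
  let ?c = "real (p - 1)"
  have inner: "\<forall>m b e. edge_rate m \<longrightarrow> 0 < e \<longrightarrow> eventually (\<lambda>n. discrepancy (a + b) n (m n) \<le> 2 * min 1 (real a * survival (Suc j) + real b * survival j) + e) sequentially" for a
  proof (induct a)
    case 0
    show ?case using Suc by simp
  next
    case (Suc a)
    show ?case
    proof (intro allI impI)
      fix m b and e :: real assume m: "edge_rate m" and e: "0 < e"
      define x where "x = real a * survival (Suc j) + real b * survival j"
      have x0: "0 \<le> x" unfolding x_def by (intro add_nonneg_nonneg mult_nonneg_nonneg survival_props) auto
      define y where "y r = ?c * real r * survival j" for r :: nat
      have y0: "0 \<le> y r" for r unfolding y_def by (intro mult_nonneg_nonneg survival_props) auto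
      define m' where "m' n = (1 - real p / real (Suc n)) * m (Suc n)" for n
      have am: "edge_rate m'" unfolding m'_def by (rule edge_rate_shift[OF m])
      \<comment> \<open>The excess over the bound of the induction hypothesis. Each \<open>g n r\<close> tends to 0, and the bound 2 allows
         dominated convergence in \<open>r\<close>.\<close>
      define g where "g n r = max 0 (min 2 (attach_err (p - 1) n (m' n) r (a + b)) - 2 * min 1 (x + y r))" for n r
      have g_lim: "(\<lambda>n. g n r) \<longlonglongrightarrow> 0" for r
      proof (rule tendstoI)
        fix d :: real assume d: "0 < d"
        have "eventually (\<lambda>n. attach_err (p - 1) n (m' n) r (a + b) \<le> 2 * min 1 (x + y r) + d/2) sequentially"
        proof (rule attach_err_limsup)
          fix e :: real assume "0 < e"
          with Suc am have "eventually (\<lambda>n. discrepancy (a + (b + r * (p - 1))) n (m' n) \<le> 2 * min 1 (real a * survival (Suc j) + real (b + r * (p - 1)) * survival j) + e) sequentially"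
            by blast
          moreover have "real a * survival (Suc j) + real (b + r * (p - 1)) * survival j = x + y r"
            unfolding x_def y_def by (simp only: of_nat_add of_nat_mult distrib_right mult_ac add.assoc)
          ultimately show "eventually (\<lambda>n. discrepancy (a + b + r * (p - 1)) n (m' n) \<le> 2 * min 1 (x + y r) + e) sequentially"
            by (simp only: add.assoc)
        qed (use d in simp)
        then show "eventually (\<lambda>n. dist (g n r) 0 < d) sequentially"
          by eventually_elim (use d in \<open>auto simp: g_def\<close>)
      qed
      have gb: "0 \<le> g n r" "g n r \<le> 2" for n r
      proof -
        have b: "0 \<le> min 1 (x + y r)" "min 2 (attach_err (p - 1) n (m' n) r (a + b)) \<le> 2" using x0 y0[of r] by auto
        show "0 \<le> g n r" by (simp add: g_def)
        have "u - 2 * v \<le> 2" if "u \<le> 2" "0 \<le> v" for u v :: real using that by linarith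
        from this[OF b(2,1)] show "g n r \<le> 2" unfolding g_def by (simp only: max.bounded_iff zero_le_numeral simp_thms)
      qed
      have gI: "(\<lambda>n. \<integral>r. g n r \<partial>?w) \<longlonglongrightarrow> (\<integral>r. 0 \<partial>?w)"
        by (rule integral_dominated_convergence[where w = "\<lambda>_. 2"]) (use g_lim gb in auto)
      have r0: "(\<lambda>n. 2 * \<bar>real p / real (Suc n) * m (Suc n) - mean_degree\<bar>) \<longlonglongrightarrow> 2 * \<bar>mean_degree - mean_degree\<bar>"
        by (intro tendsto_intros edge_rate_degree m)
      have "(\<lambda>n. 2 * \<bar>real p / real (Suc n) * m (Suc n) - mean_degree\<bar> + (\<integral>r. g n r \<partial>?w)) \<longlonglongrightarrow> 2 * \<bar>mean_degree - mean_degree\<bar> + (\<integral>r. 0 \<partial>?w)"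
        by (rule tendsto_add[OF r0 gI])
      then have "eventually (\<lambda>n. 2 * \<bar>real p / real (Suc n) * m (Suc n) - mean_degree\<bar> + (\<integral>r. g n r \<partial>?w) < e) sequentially"
        using e by (intro order_tendstoD(2)) auto
      moreover have "eventually (\<lambda>n. 0 < m (Suc n)) sequentially" using edge_rate_pos[OF m] eventually_sequentially_Suc[of "\<lambda>n. 0 < m n"] by simp
      ultimately have "eventually (\<lambda>n. discrepancy (Suc (a + b)) (Suc n) (m (Suc n)) \<le> 2 * min 1 (real (Suc a) * survival (Suc j) + real b * survival j) + e) sequentially"
        using eventually_ge_at_top[of p] edge_rate_pos[OF am]
      proof eventually_elim
        fix n assume *: "2 * \<bar>real p / real (Suc n) * m (Suc n) - mean_degree\<bar> + (\<integral>r. g n r \<partial>?w) < e" "0 < m (Suc n)" "p \<le> n" "0 < m' n"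
        note e1 = *(1)
        have i1: "integrable ?w (g n)" by (rule measure_pmf.integrable_const_bound[of _ 2]) (use gb in auto)
        have i2: "integrable ?w (\<lambda>r. min 1 (x + y r))" by (rule measure_pmf.integrable_const_bound[of _ 1]) (use x0 y0 in auto)
        have i3: "integrable ?w (\<lambda>r. min 1 (y r))" by (rule measure_pmf.integrable_const_bound[of _ 1]) (use y0 in auto)
        have "discrepancy (Suc (a + b)) (Suc n) (m (Suc n)) \<le> 2 * \<bar>real p / real (Suc n) * m (Suc n) - mean_degree\<bar> + (\<integral>r. min 2 (attach_err (p - 1) n (m' n) r (a + b)) \<partial>?w)"
          using discrepancy_step[OF *(3,2), of "a + b"] unfolding m'_def .
        moreover have "(\<integral>r. min 2 (attach_err (p - 1) n (m' n) r (a + b)) \<partial>?w) \<le> (\<integral>r. g n r + 2 * min 1 (x + y r) \<partial>?w)"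
        proof (rule integral_mono)
          have "0 \<le> attach_err (p - 1) n (m' n) r (a + b)" for r by (rule attach_err_nonneg[OF *(3,4)])
          then show "integrable ?w (\<lambda>r. min 2 (attach_err (p - 1) n (m' n) r (a + b)))"
            by (intro measure_pmf.integrable_const_bound[of _ 2]) auto
          show "integrable ?w (\<lambda>r. g n r + 2 * min 1 (x + y r))" using i1 i2 by simp
        qed (simp add: g_def)
        moreover have "(\<integral>r. g n r + 2 * min 1 (x + y r) \<partial>?w) = (\<integral>r. g n r \<partial>?w) + 2 * (\<integral>r. min 1 (x + y r) \<partial>?w)"
          using i1 i2 by simp
        moreover define z where "z = min 1 (x + survival (Suc j))"
        moreover have "(\<integral>r. min 1 (x + y r) \<partial>?w) \<le> z"
        proof -
          have "(\<integral>r. min 1 (x + y r) \<partial>?w) \<le> (\<integral>r. 1 \<partial>?w)" by (rule integral_mono) (use i2 in auto)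
          moreover have "(\<integral>r. min 1 (x + y r) \<partial>?w) \<le> (\<integral>r. x + min 1 (y r) \<partial>?w)"
            by (rule integral_mono) (use i2 i3 x0 in auto)
          moreover have "(\<integral>r. x + min 1 (y r) \<partial>?w) = x + survival (Suc j)" using i3 by (simp add: y_def)
          ultimately show ?thesis by (simp add: z_def)
        qed
        moreover have *: "x + survival (Suc j) = real (Suc a) * survival (Suc j) + real b * survival j"
          unfolding x_def by (simp only: of_nat_Suc distrib_right mult_1_left)
        ultimately show "discrepancy (Suc (a + b)) (Suc n) (m (Suc n)) \<le> 2 * min 1 (real (Suc a) * survival (Suc j) + real b * survival j) + e"
          unfolding *[symmetric] z_def[symmetric] using e1 by linarith
      qed
      then show "eventually (\<lambda>n. discrepancy (Suc a + b) n (m n) \<le> 2 * min 1 (real (Suc a) * survival (Suc j) + real b * survival j) + e) sequentially"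
        by (simp only: add_Suc eventually_sequentially_Suc[of "\<lambda>n. discrepancy (Suc (a + b)) n (m n) \<le> 2 * min 1 (real (Suc a) * survival (Suc j) + real b * survival j) + e"])
    qed
  qed
  show ?case
  proof (intro allI impI)
    fix m k and e :: real assume "edge_rate m" "0 < e"
    with inner[of k] have "eventually (\<lambda>n. discrepancy (k + 0) n (m n) \<le> 2 * min 1 (real k * survival (Suc j) + real 0 * survival j) + e) sequentially" by blast
    then show "eventually (\<lambda>n. discrepancy k n (m n) \<le> 2 * min 1 (real k * survival (Suc j)) + e) sequentially" by (simp del: survival_seq.simps)
  qed
qed

lemma discrepancy_tendsto_0: assumes "edge_rate m" "0 < e" shows "eventually (\<lambda>n. discrepancy k n (m n) \<le> 0 + e) sequentially"
proof -
  have "(\<lambda>j. 2 * (real k * survival j)) \<longlonglongrightarrow> 2 * (real k * 0)" by (intro tendsto_intros survival_props)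
  from order_tendstoD(2)[OF this, of "e/2"] assms(2) have "eventually (\<lambda>j. 2 * (real k * survival j) < e / 2) sequentially" by simp
  then obtain j where j: "2 * (real k * survival j) < e / 2" by (auto simp: eventually_sequentially)
  have "eventually (\<lambda>n. discrepancy k n (m n) \<le> 2 * min 1 (real k * survival j) + e/2) sequentially" using discrepancy_limsup assms by simp
  then show ?thesis
  proof eventually_elim
    fix n assume "discrepancy k n (m n) \<le> 2 * min 1 (real k * survival j) + e/2"
    moreover have "min 1 (real k * survival j) \<le> real k * survival j" by simp
    ultimately show "discrepancy k n (m n) \<le> 0 + e" using j by linarith
  qed
qed

section \<open>Increments of the ground state energy\<close>

text \<open>
  The effect of adding clauses (and the energy \<open>U\<close>) to a graph on which nothing is distinguished. Here
  \<open>attach_clauses\<close> is used with clauses on one side only.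
\<close>

lemma added_clauses:
  assumes V: "finite V" "card V = n" "p \<le> n" and m: "0 < m" and x: "0 < x"
    and \<rho>: "distinct \<rho>" "length \<rho> < p" "set \<rho> \<inter> V = {}" and U: "U \<in> energies" "depends_on (- V) U"
  shows "\<bar>(avg (cpoisson (random_clause V \<rho>) x) (graph_max V m) U - graph_max V m 0) - avg (cpoisson (field_law L \<rho>) x) maxE U\<bar>
    \<le> (\<integral>r. (nrm U + real r * gain_bound) * min 2 (attach_err (p - length \<rho>) n m r 0) \<partial>measure_pmf (poisson_pmf x))"
proof -
  let ?w = "measure_pmf (poisson_pmf x)"
  let ?\<mu> = "random_clause V \<rho>" and ?\<kappa> = "field_law L \<rho>" and ?\<Phi> = "graph_max V m"
  let ?E = "\<lambda>r. attach_err (p - length \<rho>) n m r 0"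
  have k: "increment ?\<mu>" "increment ?\<kappa>" using V by (auto intro!: increment_random_clause increment_field_law L)
  have F: "?\<Phi> \<in> observables" using V m by (auto intro: graph_max_observables)
  have P0: "field_max [] = maxE" by (simp add: field_max_def fun_eq_iff)
  let ?h = "\<lambda>r. (avg (iid_sum ?\<mu> r) ?\<Phi> U - ?\<Phi> 0) - (avg (iid_sum ?\<kappa> r) maxE U - 0)"
  have I: "integrable ?w (\<lambda>r. avg (iid_sum ?\<mu> r) ?\<Phi> U)" "integrable ?w (\<lambda>r. avg (iid_sum ?\<kappa> r) maxE U)"
    by (rule avg_cpoisson(2)[OF k(1) x F U(1)], rule avg_cpoisson(2)[OF k(2) x maxE_observables U(1)])
  have E0: "0 \<le> ?E r" for r by (rule attach_err_nonneg[OF V(3) m])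
  have eq: "(avg (cpoisson ?\<mu> x) ?\<Phi> U - ?\<Phi> 0) - avg (cpoisson ?\<kappa> x) maxE U = (\<integral>r. ?h r \<partial>?w)"
    unfolding avg_cpoisson(1)[OF k(1) x F U(1)] avg_cpoisson(1)[OF k(2) x maxE_observables U(1)]
    by (subst integral_diff4(1)[OF I(1) _ I(2)]) auto
  have hb: "\<bar>?h r\<bar> \<le> (nrm U + real r * gain_bound) * ?E r" for r
    using attach_clauses[where r = r and \<epsilon> = False and \<rho> = \<rho> and bs = "[]", OF V m \<rho> gain_bound(1) gain_bound(2) _ _ U(1) energies_0] U(2) F
    by (simp add: avg_iid_sum_0[OF k(1) F] avg_iid_sum_0[OF k(2) maxE_observables] P0 del: minus_apply zero_fun_apply)
  have mb: "mean_nrm ?\<mu> \<le> gain_bound" using increment_random_clause(2)[of V \<rho>] V gain_bound(1) by linarith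
  have hb2: "\<bar>?h r\<bar> \<le> (nrm U + real r * gain_bound) * 2" for r
    using avg_bound_two[where r = r and \<epsilon> = False, OF k(1) F U(1) energies_0 mb gain_bound(3)] avg_bound_two[where r = r and \<epsilon> = False, OF k(2) maxE_observables U(1) energies_0 gain_bound(2) gain_bound(3)]
    by (simp add: avg_iid_sum_0[OF k(1) F] avg_iid_sum_0[OF k(2) maxE_observables] del: minus_apply zero_fun_apply)
  have N0: "0 \<le> nrm U + real r * gain_bound" for r using U gain_bound(3) by simp
  have gi: "integrable ?w (\<lambda>r. (nrm U + real r * gain_bound) * min 2 (?E r))"
  proof (rule Bochner_Integration.integrable_bound[of _ "\<lambda>r. (nrm U + real r * gain_bound) * 2"])
    show "integrable ?w (\<lambda>r. (nrm U + real r * gain_bound) * 2)" using poisson_integrable[OF x] by simp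
    show "AE r in ?w. norm ((nrm U + real r * gain_bound) * min 2 (?E r)) \<le> norm ((nrm U + real r * gain_bound) * 2)"
      unfolding norm_mult by (intro AE_I2 mult_left_mono) (use E0 in auto)
  qed simp
  have "\<bar>\<integral>r. ?h r \<partial>?w\<bar> \<le> (\<integral>r. (nrm U + real r * gain_bound) * min 2 (?E r) \<partial>?w)"
  proof (rule integral_abs_bound[THEN order_trans], rule integral_mono[OF _ gi])
    have "integrable ?w ?h" by (rule integral_diff4(2)[OF I(1) _ I(2)]) auto
    then show "integrable ?w (\<lambda>r. \<bar>?h r\<bar>)" by (rule integrable_abs)
    fix r show "\<bar>?h r\<bar> \<le> (nrm U + real r * gain_bound) * min 2 (?E r)"
      using hb[of r] hb2[of r] by (simp add: min_def)
  qed
  then show ?thesis unfolding eq .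
qed

lemma added_clauses_limit:
  assumes m: "edge_rate m" and x: "0 < x"
    and \<rho>: "\<And>n. distinct (\<rho> n)" "\<And>n. length (\<rho> n) = l" "\<And>n. set (\<rho> n) \<inter> {..<n} = {}" and l: "l < p"
    and U: "\<And>n. U n \<in> energies" "\<And>n. depends_on (- {..<n}) (U n)" "\<And>n. nrm (U n) = u"
    and c: "\<And>n. avg (cpoisson (field_law L (\<rho> n)) x) maxE (U n) = c"
  shows "(\<lambda>n. avg (cpoisson (random_clause {..<n} (\<rho> n)) x) (graph_max {..<n} (m n)) (U n) - graph_max {..<n} (m n) 0) \<longlonglongrightarrow> c"
proof -
  let ?w = "measure_pmf (poisson_pmf x)"
  define g where "g n r = (u + real r * gain_bound) * max 0 (min 2 (attach_err (p - l) n (m n) r 0))" for n r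
  have u0: "0 \<le> u" using U(1,3)[of 0] nrm_nonneg by metis
  have glim: "(\<lambda>n. g n r) \<longlonglongrightarrow> 0" for r
  proof -
    have "(\<lambda>n. max 0 (min 2 (attach_err (p - l) n (m n) r 0))) \<longlonglongrightarrow> 0"
    proof (rule tendstoI)
      fix d :: real assume d: "0 < d"
      have "eventually (\<lambda>n. attach_err (p - l) n (m n) r 0 \<le> 0 + d/2) sequentially"
        by (rule attach_err_limsup[OF discrepancy_tendsto_0[OF m]]) (use d in auto)
      then show "eventually (\<lambda>n. dist (max 0 (min 2 (attach_err (p - l) n (m n) r 0))) 0 < d) sequentially"
        by eventually_elim (use d in auto)
    qed
    from tendsto_mult[OF tendsto_const this] show ?thesis unfolding g_def by simp
  qed
  have "(\<lambda>n. \<integral>r. g n r \<partial>?w) \<longlonglongrightarrow> (\<integral>r. 0 \<partial>?w)"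
  proof (rule integral_dominated_convergence[where w = "\<lambda>r. (u + real r * gain_bound) * 2"])
    show "integrable ?w (\<lambda>r. (u + real r * gain_bound) * 2)" using poisson_integrable[OF x] by simp
    show "AE r in ?w. norm (g n r) \<le> (u + real r * gain_bound) * 2" for n
      unfolding g_def norm_mult using u0 gain_bound(3) by (intro AE_I2 mult_mono) auto
  qed (use glim in auto)
  then have lim: "(\<lambda>n. \<integral>r. g n r \<partial>?w) \<longlonglongrightarrow> 0" by simp
  have "(\<lambda>n. (avg (cpoisson (random_clause {..<n} (\<rho> n)) x) (graph_max {..<n} (m n)) (U n) - graph_max {..<n} (m n) 0) - c) \<longlonglongrightarrow> 0"
  proof (rule Lim_null_comparison[OF _ lim])
    show "eventually (\<lambda>n. norm ((avg (cpoisson (random_clause {..<n} (\<rho> n)) x) (graph_max {..<n} (m n)) (U n) - graph_max {..<n} (m n) 0) - c) \<le> (\<integral>r. g n r \<partial>?w)) sequentially"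
      using edge_rate_pos[OF m] eventually_ge_at_top[of p]
    proof eventually_elim
      fix n assume n: "0 < m n" "p \<le> n"
      have "g n r = (u + real r * gain_bound) * min 2 (attach_err (p - l) n (m n) r 0)" for r
        using attach_err_nonneg[OF n(2,1), of "p - l" r 0] by (simp add: g_def)
      then show "norm ((avg (cpoisson (random_clause {..<n} (\<rho> n)) x) (graph_max {..<n} (m n)) (U n) - graph_max {..<n} (m n) 0) - c) \<le> (\<integral>r. g n r \<partial>?w)"
        using added_clauses[where V = "{..<n}" and n = n and \<rho> = "\<rho> n", OF _ _ n(2,1) x \<rho>(1) _ \<rho>(3) U(1,2)] \<rho>(2)[of n] l c[of n] U(3)[of n] by simp
    qed
  qed
  then show ?thesis by (simp add: LIM_zero_iff)
qed

text \<open>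
  The increment from \<open>N\<close> to \<open>N + 1\<close> is the difference of two extensions of the same graph with mean number
  \<open>\<alpha> (N + 1 - p)\<close> of clauses, which is what remains of the \<open>N + 1\<close> graph without its last vertex.
\<close>

lemma graph_max_limit:
  assumes c1: "\<And>a. avg (cpoisson (field_law L [a]) mean_degree) maxE (site a \<psi>) = c1"
    and c2: "avg (cpoisson (field_law L []) (\<alpha> * real (p - 1))) maxE 0 = c2"
  shows "(\<lambda>N. graph_max {..<N} (\<alpha> * real N) 0 / real N) \<longlonglongrightarrow> c1 - c2"
proof (rule cesaro)
  \<comment> \<open>The mean number of clauses among the first \<open>N\<close> vertices in the system with \<open>N + 1\<close> vertices:
     \<open>(1 - p / (N + 1)) \<alpha> (N + 1)\<close>.\<close>
  define m where "m N = \<alpha> * (real N + 1 - real p)" for N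
  have edge_rate: "edge_rate m"
  proof -
    have "(\<lambda>n. \<alpha> * (1 + 1 / real n - real p / real n)) \<longlonglongrightarrow> \<alpha> * (1 + 0 - 0)"
      by (intro tendsto_intros lim_const_over_n)
    then have lim: "(\<lambda>n. \<alpha> * (1 + 1 / real n - real p / real n)) \<longlonglongrightarrow> \<alpha>" by simp
    show ?thesis unfolding edge_rate_def m_def
      by (rule Lim_transform_eventually[OF lim], rule eventually_mono[OF eventually_gt_at_top[of 0]])
        (simp add: field_simps)
  qed
  have ap: "0 < \<alpha> * real (p - 1)" using alpha_pos p_ge by simp
  have 1: "(\<lambda>N. avg (cpoisson (random_clause {..<N} [N]) mean_degree) (graph_max {..<N} (m N)) (site N \<psi>) - graph_max {..<N} (m N) 0) \<longlonglongrightarrow> c1"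
    by (rule added_clauses_limit[OF edge_rate mean_degree_pos, where \<rho> = "\<lambda>N. [N]" and l = 1 and u = "spin_norm \<psi>"])
      (use p_ge in \<open>auto intro: psi_energies depends_on_mono[OF site_depends_on] simp: nrm_site c1\<close>)
  have 2: "(\<lambda>N. avg (cpoisson (random_clause {..<N} []) (\<alpha> * real (p - 1))) (graph_max {..<N} (m N)) 0 - graph_max {..<N} (m N) 0) \<longlonglongrightarrow> c2"
    by (rule added_clauses_limit[OF edge_rate ap, where \<rho> = "\<lambda>N. []" and l = 0 and u = 0])
      (use p_ge in \<open>auto simp: c2[unfolded One_nat_def] simp del: zero_fun_apply of_nat_diff\<close>)
  show "(\<lambda>N. graph_max {..<Suc N} (\<alpha> * real (Suc N)) 0 - graph_max {..<N} (\<alpha> * real N) 0) \<longlonglongrightarrow> c1 - c2"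
  proof (rule Lim_transform_eventually[OF tendsto_diff[OF 1 2]])
    show "eventually (\<lambda>N. avg (cpoisson (random_clause {..<N} [N]) mean_degree) (graph_max {..<N} (m N)) (site N \<psi>) - graph_max {..<N} (m N) 0 -
       (avg (cpoisson (random_clause {..<N} []) (\<alpha> * real (p - 1))) (graph_max {..<N} (m N)) 0 - graph_max {..<N} (m N) 0)
       = graph_max {..<Suc N} (\<alpha> * real (Suc N)) 0 - graph_max {..<N} (\<alpha> * real N) 0) sequentially"
      using eventually_ge_at_top[of p]
    proof eventually_elim
      fix N assume N: "p \<le> N"
      have mpos: "0 < m N" unfolding m_def using N alpha_pos by simp
      have r: "real p / real (Suc N) * (\<alpha> * real (Suc N)) = mean_degree" by simp
      have r2: "(1 - real p / real (Suc N)) * (\<alpha> * real (Suc N)) = m N"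
        unfolding left_diff_distrib r by (simp add: m_def algebra_simps)
      have "graph_max (insert N {..<N}) (\<alpha> * real (Suc N)) 0 = avg (cpoisson (random_clause {..<N} [N]) mean_degree) (graph_max {..<N} (m N)) (0 + site N \<psi>)"
        using graph_max_remove[of "{..<N}" N "\<alpha> * real (Suc N)" 0] N alpha_pos unfolding card_lessThan r r2 by simp
      then have A: "graph_max {..<Suc N} (\<alpha> * real (Suc N)) 0 = avg (cpoisson (random_clause {..<N} [N]) mean_degree) (graph_max {..<N} (m N)) (site N \<psi>)"
        by (simp add: lessThan_Suc)
      have aN: "\<alpha> * real N = \<alpha> * real (p - 1) + m N"
        using p_ge by (simp add: m_def algebra_simps of_nat_diff)
      let ?P = "\<Sum>i\<in>{..<N}. site i \<psi>"
      have k: "increment (random_clause {..<N} [])" using N by (intro increment_random_clause) auto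
      have "graph_max {..<N} (\<alpha> * real N) 0 = avg (cpoisson (random_clause {..<N} []) (\<alpha> * real (p - 1))) (avg (cpoisson (random_clause {..<N} []) (m N)) maxE) (0 + ?P)"
        unfolding graph_max_def aN by (rule avg_cpoisson_add[OF k ap mpos maxE_observables]) (auto intro!: energies_add energies_sum psi_energies)
      also have "\<dots> = avg (cpoisson (random_clause {..<N} []) (\<alpha> * real (p - 1))) (\<lambda>E. avg (cpoisson (random_clause {..<N} []) (m N)) maxE (E + ?P)) 0"
        by (rule avg_translate[symmetric])
      finally have B: "graph_max {..<N} (\<alpha> * real N) 0 = avg (cpoisson (random_clause {..<N} []) (\<alpha> * real (p - 1))) (graph_max {..<N} (m N)) 0"
        by (simp only: graph_max_def[abs_def])
      show "avg (cpoisson (random_clause {..<N} [N]) mean_degree) (graph_max {..<N} (m N)) (site N \<psi>) - graph_max {..<N} (m N) 0 -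
       (avg (cpoisson (random_clause {..<N} []) (\<alpha> * real (p - 1))) (graph_max {..<N} (m N)) 0 - graph_max {..<N} (m N) 0)
       = graph_max {..<Suc N} (\<alpha> * real (Suc N)) 0 - graph_max {..<N} (\<alpha> * real N) 0"
        unfolding A B by simp
    qed
  qed
qed

end

section \<open>The cavity operator\<close>

lemma sum_blocks:
  fixes f :: "nat \<Rightarrow> 'a::comm_monoid_add"
  shows "(\<Sum>i<q * r. f i) = (\<Sum>k<r. \<Sum>j<q. f (k * q + j))"
proof (induct r)
  case (Suc r)
  have "q * Suc r = r * q + q" by simp
  then have "(\<Sum>i<q * Suc r. f i) = (\<Sum>i<r * q + q. f i)" by (simp only:)
  also have "\<dots> = (\<Sum>i<r * q. f i) + (\<Sum>j<q. f (r * q + j))"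
  proof -
    have "(\<Sum>i<a + b. f i) = (\<Sum>i<a. f i) + (\<Sum>j<b. f (a + j))" for a b
      by (induct b) (simp_all add: add.assoc)
    then show ?thesis .
  qed
  finally show ?case using Suc by (simp add: mult.commute)
qed simp

context critical_model
begin

definition block :: "nat \<Rightarrow> (nat \<Rightarrow> 'b) \<Rightarrow> nat \<Rightarrow> nat \<Rightarrow> 'b" where "block q X k = (\<lambda>j. X (k * q + j))"

definition field_sum where
  "field_sum \<rho> r \<theta> X = (\<Sum>k<r. clause_field (p - length \<rho>) \<rho> (\<theta> k) (block (p - length \<rho>) X k))"

text \<open>
  The energy of the root spin, with all other spins chosen optimally, as an energy on \<open>configs\<close> that
  depends on coordinate 0 only.
\<close>

definition root_energy where "root_energy r \<theta> X = site 0 \<psi> + field_sum [0] r \<theta> X"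

lemma field_sum_energies: assumes "\<And>k. \<theta> k \<in> space clause_borel" "\<And>k. X k \<in> space spin_borel" shows "field_sum \<rho> r \<theta> X \<in> energies"
  unfolding field_sum_def by (intro energies_sum clause_field_energies assms) (simp add: block_def assms)

lemma root_energy_energies: assumes "\<And>k. \<theta> k \<in> space clause_borel" "\<And>k. X k \<in> space spin_borel" shows "root_energy r \<theta> X \<in> energies"
  unfolding root_energy_def by (intro energies_add psi_energies field_sum_energies assms)

lemma const_configs: "t \<in> S \<Longrightarrow> (\<lambda>_. t) \<in> configs" by (simp add: configs_iff)

lemma clause_field_coord: "clause_field (p - 1) [a] f x \<sigma> = clause_field (p - 1) [0] f x (\<lambda>_. \<sigma> a)"
proof -
  have "(\<lambda>j\<in>{..<p}. if j < p - 1 then \<tau> j else \<sigma> ([a] ! (j - (p - 1)))) = (\<lambda>j\<in>{..<p}. if j < p - 1 then \<tau> j else \<sigma> a)" for \<tau>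
  proof (rule restrict_ext)
    fix j assume "j \<in> {..<p}"
    then have "j < p - 1 \<or> j - (p - 1) = 0" by auto
    then show "(if j < p - 1 then \<tau> j else \<sigma> ([a] ! (j - (p - 1)))) = (if j < p - 1 then \<tau> j else \<sigma> a)" by auto
  qed
  then show ?thesis by (simp add: clause_field_def clause_gain_def del: One_nat_def cong: if_cong)
qed

lemma root_energy_coord: "(site a \<psi> + field_sum [a] r \<theta> X) \<sigma> = root_energy r \<theta> X (\<lambda>_. \<sigma> a)"
  unfolding root_energy_def field_sum_def plus_fun_apply sum_fun_apply
  using clause_field_coord[of a] by (simp add: site_def)

lemma root_energy_self: "root_energy r \<theta> X \<sigma> = root_energy r \<theta> X (\<lambda>_. \<sigma> 0)"
  using root_energy_coord[of 0 r \<theta> X \<sigma>] by (simp add: root_energy_def)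

lemma maxE_root_energy_coord: assumes "\<And>k. \<theta> k \<in> space clause_borel" "\<And>k. X k \<in> space spin_borel"
  shows "maxE (site a \<psi> + field_sum [a] r \<theta> X) = maxE (root_energy r \<theta> X)"
proof (rule antisym)
  show "maxE (site a \<psi> + field_sum [a] r \<theta> X) \<le> maxE (root_energy r \<theta> X)"
  proof (rule maxE_le)
    fix \<sigma> assume \<sigma>: "\<sigma> \<in> configs"
    show "(site a \<psi> + field_sum [a] r \<theta> X) \<sigma> \<le> maxE (root_energy r \<theta> X)"
      unfolding root_energy_coord by (rule maxE_ge[OF root_energy_energies[where \<theta> = \<theta> and X = X, OF assms]]) (use \<sigma> in \<open>simp add: configs_iff\<close>)
  qed
  show "maxE (root_energy r \<theta> X) \<le> maxE (site a \<psi> + field_sum [a] r \<theta> X)"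
  proof (rule maxE_le)
    fix \<sigma> assume \<sigma>: "\<sigma> \<in> configs"
    have "root_energy r \<theta> X \<sigma> = (site a \<psi> + field_sum [a] r \<theta> X) (\<lambda>_. \<sigma> 0)" unfolding root_energy_coord by (rule root_energy_self)
    also have "\<dots> \<le> maxE (site a \<psi> + field_sum [a] r \<theta> X)"
      by (rule maxE_ge[OF energies_add[OF psi_energies field_sum_energies]]) (use assms \<sigma> in \<open>auto simp: configs_iff\<close>)
    finally show "root_energy r \<theta> X \<sigma> \<le> maxE (site a \<psi> + field_sum [a] r \<theta> X)" .
  qed
qed

text \<open>The suprema over blocks of spins split into one supremum per clause.\<close>

lemma cavity_energy_eq:
  assumes "\<And>k j. k < r \<Longrightarrow> j < p - 1 \<Longrightarrow> \<tau> k j = \<sigma> (k * (p - 1) + j)"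
  shows "cavity_energy p \<psi> r \<theta> X \<sigma> t = \<psi> t + (\<Sum>k<r. clause_gain (p - 1) [0] (\<theta> k) (block (p - 1) X k) (\<lambda>_. t) (\<tau> k))"
proof -
  have "(\<Sum>k<r. clause_gain (p - 1) [0] (\<theta> k) (block (p - 1) X k) (\<lambda>_. t) (\<tau> k))
    = (\<Sum>k<r. \<theta> k (\<lambda>j\<in>{..<p}. if j < p - 1 then \<sigma> (k * (p - 1) + j) else t) + (\<Sum>j<p - 1. X (k * (p - 1) + j) (\<sigma> (k * (p - 1) + j))))"
  proof (rule sum.cong[OF refl])
    fix k assume k: "k \<in> {..<r}"
    have "(\<lambda>j\<in>{..<p}. if j < p - 1 then \<tau> k j else t) = (\<lambda>j\<in>{..<p}. if j < p - 1 then \<sigma> (k * (p - 1) + j) else t)"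
      by (rule restrict_ext) (use assms k in auto)
    moreover have "(\<Sum>j<p - 1. X (k * (p - 1) + j) (\<tau> k j)) = (\<Sum>j<p - 1. X (k * (p - 1) + j) (\<sigma> (k * (p - 1) + j)))"
      by (rule sum.cong) (use assms k in auto)
    ultimately show "clause_gain (p - 1) [0] (\<theta> k) (block (p - 1) X k) (\<lambda>_. t) (\<tau> k)
      = \<theta> k (\<lambda>j\<in>{..<p}. if j < p - 1 then \<sigma> (k * (p - 1) + j) else t) + (\<Sum>j<p - 1. X (k * (p - 1) + j) (\<sigma> (k * (p - 1) + j)))"
      unfolding clause_gain_def block_def by simp
  qed
  then show ?thesis
    unfolding cavity_energy_def cavity_interaction_def sum_blocks by (simp add: sum.distrib)
qed

lemma root_energy_const: "root_energy r \<theta> X (\<lambda>_. t) = \<psi> t + (\<Sum>k<r. maxE (clause_gain (p - 1) [0] (\<theta> k) (block (p - 1) X k) (\<lambda>_. t)))"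
  by (simp add: root_energy_def field_sum_def plus_fun_apply sum_fun_apply site_def clause_field_eq_maxE)

lemma cavity_energy_le:
  assumes sp: "\<And>k. \<theta> k \<in> space clause_borel" "\<And>k. X k \<in> space spin_borel" and t: "t \<in> S" and \<sigma>: "\<sigma> \<in> {..<(p - 1) * r} \<rightarrow>\<^sub>E S"
  shows "cavity_energy p \<psi> r \<theta> X \<sigma> t \<le> root_energy r \<theta> X (\<lambda>_. t)"
proof -
  define \<tau> where "\<tau> k j = (if k * (p - 1) + j < (p - 1) * r then \<sigma> (k * (p - 1) + j) else t)" for k j
  have lt: "k * (p - 1) + j < (p - 1) * r" if "k < r" "j < p - 1" for k j
  proof -
    have "k * (p - 1) + j < Suc k * (p - 1)" using that by simp
    also have "\<dots> \<le> r * (p - 1)" using that by (intro mult_le_mono1) simp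
    finally show ?thesis by (simp add: mult.commute)
  qed
  have \<tau>: "\<tau> k \<in> configs" for k using \<sigma> t by (auto simp: configs_iff \<tau>_def PiE_iff)
  have "cavity_energy p \<psi> r \<theta> X \<sigma> t = \<psi> t + (\<Sum>k<r. clause_gain (p - 1) [0] (\<theta> k) (block (p - 1) X k) (\<lambda>_. t) (\<tau> k))"
    by (rule cavity_energy_eq) (simp add: \<tau>_def lt del: One_nat_def)
  also have "\<dots> \<le> root_energy r \<theta> X (\<lambda>_. t)"
    unfolding root_energy_const
    by (intro add_left_mono sum_mono maxE_ge clause_gain_energies sp const_configs t \<tau>) (simp add: block_def sp)
  finally show ?thesis .
qed

lemma cavity_energy_attained:
  assumes sp: "\<And>k. \<theta> k \<in> space clause_borel" "\<And>k. X k \<in> space spin_borel" and t: "t \<in> S"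
  obtains \<sigma> where "\<sigma> \<in> {..<(p - 1) * r} \<rightarrow>\<^sub>E S" "cavity_energy p \<psi> r \<theta> X \<sigma> t = root_energy r \<theta> X (\<lambda>_. t)"
proof -
  have "\<exists>\<tau>\<in>configs. clause_gain (p - 1) [0] (\<theta> k) (block (p - 1) X k) (\<lambda>_. t) \<tau> = maxE (clause_gain (p - 1) [0] (\<theta> k) (block (p - 1) X k) (\<lambda>_. t))" for k
    by (rule maxE_attained[OF clause_gain_energies[where x = "block (p - 1) X k" and \<sigma> = "\<lambda>_. t" and q = "p - 1" and \<rho> = "[0]", OF sp(1)[of k]]])
      (use sp t in \<open>auto simp: block_def configs_iff\<close>)
  then obtain \<tau> where \<tau>: "\<And>k. \<tau> k \<in> configs"
    "\<And>k. clause_gain (p - 1) [0] (\<theta> k) (block (p - 1) X k) (\<lambda>_. t) (\<tau> k) = maxE (clause_gain (p - 1) [0] (\<theta> k) (block (p - 1) X k) (\<lambda>_. t))" by metis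
  define \<sigma> where "\<sigma> = (\<lambda>i\<in>{..<(p - 1) * r}. \<tau> (i div (p - 1)) (i mod (p - 1)))"
  have lt: "k * (p - 1) + j < (p - 1) * r" if "k < r" "j < p - 1" for k j
  proof -
    have "k * (p - 1) + j < Suc k * (p - 1)" using that by simp
    also have "\<dots> \<le> r * (p - 1)" using that by (intro mult_le_mono1) simp
    finally show ?thesis by (simp add: mult.commute)
  qed
  have "\<tau> k j = \<sigma> (k * (p - 1) + j)" if "k < r" "j < p - 1" for k j
  proof -
    have "(k * (p - 1) + j) div (p - 1) = k" "(k * (p - 1) + j) mod (p - 1) = j" using that by auto
    then show ?thesis using lt[OF that] by (simp add: \<sigma>_def)
  qed
  then have "cavity_energy p \<psi> r \<theta> X \<sigma> t = \<psi> t + (\<Sum>k<r. clause_gain (p - 1) [0] (\<theta> k) (block (p - 1) X k) (\<lambda>_. t) (\<tau> k))"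
    by (rule cavity_energy_eq)
  moreover have "\<sigma> \<in> {..<(p - 1) * r} \<rightarrow>\<^sub>E S" using \<tau>(1) by (auto simp: \<sigma>_def configs_iff)
  ultimately show thesis using that by (simp add: \<tau>(2) root_energy_const del: One_nat_def)
qed

lemma cavity_SUP:
  assumes sp: "\<And>k. \<theta> k \<in> space clause_borel" "\<And>k. X k \<in> space spin_borel" and t: "t \<in> S"
  shows "(SUP \<sigma>\<in>({..<(p - 1) * r} \<rightarrow>\<^sub>E S). cavity_energy p \<psi> r \<theta> X \<sigma> t) = root_energy r \<theta> X (\<lambda>_. t)"
proof (rule cSup_eq_maximum)
  obtain \<sigma> where "\<sigma> \<in> {..<(p - 1) * r} \<rightarrow>\<^sub>E S" "cavity_energy p \<psi> r \<theta> X \<sigma> t = root_energy r \<theta> X (\<lambda>_. t)"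
    by (rule cavity_energy_attained[where r = r and \<theta> = \<theta> and X = X, OF sp t])
  then show "root_energy r \<theta> X (\<lambda>_. t) \<in> (\<lambda>\<sigma>. cavity_energy p \<psi> r \<theta> X \<sigma> t) ` ({..<(p - 1) * r} \<rightarrow>\<^sub>E S)" by force
next
  fix y assume "y \<in> (\<lambda>\<sigma>. cavity_energy p \<psi> r \<theta> X \<sigma> t) ` ({..<(p - 1) * r} \<rightarrow>\<^sub>E S)"
  then obtain \<sigma> where *: "\<sigma> \<in> {..<(p - 1) * r} \<rightarrow>\<^sub>E S" "y = cavity_energy p \<psi> r \<theta> X \<sigma> t" by blast
  show "y \<le> root_energy r \<theta> X (\<lambda>_. t)" unfolding *(2) by (rule cavity_energy_le[where \<theta> = \<theta> and X = X, OF sp t *(1)])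
qed

lemma cavity_max_eq:
  assumes sp: "\<And>k. \<theta> k \<in> space clause_borel" "\<And>k. X k \<in> space spin_borel"
  shows "cavity_max S p \<psi> r \<theta> X = maxE (root_energy r \<theta> X)"
  unfolding cavity_max_def
proof (rule cSup_eq_maximum)
  obtain \<sigma>0 where s0: "\<sigma>0 \<in> configs" "root_energy r \<theta> X \<sigma>0 = maxE (root_energy r \<theta> X)"
    by (rule maxE_attained[OF root_energy_energies[where r = r and \<theta> = \<theta> and X = X, OF sp]])
  then have t: "\<sigma>0 0 \<in> S" by (simp add: configs_iff)
  obtain \<sigma> where "\<sigma> \<in> {..<(p - 1) * r} \<rightarrow>\<^sub>E S" "cavity_energy p \<psi> r \<theta> X \<sigma> (\<sigma>0 0) = root_energy r \<theta> X (\<lambda>_. \<sigma>0 0)"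
    by (rule cavity_energy_attained[where r = r and \<theta> = \<theta> and X = X, OF sp t])
  then show "maxE (root_energy r \<theta> X) \<in> (\<lambda>(s, \<sigma>). cavity_energy p \<psi> r \<theta> X \<sigma> s) ` (S \<times> ({..<(p - 1) * r} \<rightarrow>\<^sub>E S))"
    using t s0(2) root_energy_self[of r \<theta> X \<sigma>0] by (intro image_eqI[of _ _ "(\<sigma>0 0, \<sigma>)"]) auto
next
  fix y assume "y \<in> (\<lambda>(s, \<sigma>). cavity_energy p \<psi> r \<theta> X \<sigma> s) ` (S \<times> ({..<(p - 1) * r} \<rightarrow>\<^sub>E S))"
  then obtain s \<sigma> where *: "s \<in> S" "\<sigma> \<in> {..<(p - 1) * r} \<rightarrow>\<^sub>E S" "y = cavity_energy p \<psi> r \<theta> X \<sigma> s" by auto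
  show "y \<le> maxE (root_energy r \<theta> X)"
    unfolding *(3) by (rule order_trans[OF cavity_energy_le[where \<theta> = \<theta> and X = X, OF sp *(1,2)] maxE_ge[OF root_energy_energies[where r = r and \<theta> = \<theta> and X = X, OF sp] const_configs[OF *(1)]]])
qed

definition normalise where "normalise W = (\<lambda>t\<in>S. W (\<lambda>_. t) - maxE W)"

lemma continuous_diag: "continuous_on S (\<lambda>t. (\<lambda>_::nat. t))"
  by (rule continuous_on_coordinatewise_then_product) (rule continuous_on_id)

lemma normalise_space: assumes "W \<in> energies" shows "normalise W \<in> space spin_borel"
proof -
  have "continuous_on S (\<lambda>t. W (\<lambda>_. t))"
    by (rule continuous_on_compose2[OF energies_cont[OF assms] continuous_diag]) (auto simp: configs_iff)
  then have "continuous_on S (\<lambda>t. W (\<lambda>_. t) - maxE W)" by (intro continuous_intros)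
  then have "continuous_on S (normalise W)" by (rule continuous_on_eq) (simp add: normalise_def)
  then show ?thesis by (simp add: space_spin_borel normalise_def)
qed

lemma normalise_measurable: "normalise \<in> measurable energy_space spin_borel"
proof (rule measurable_spin_borel)
  show "(\<lambda>W. normalise W t) \<in> borel_measurable energy_space" if "t \<in> S" for t
    unfolding normalise_def using that eval_measurable[OF const_configs[OF that]] by simp
qed (simp add: normalise_space)

definition spin_law where "spin_law L \<longleftrightarrow> prob_space L \<and> sets L = sets spin_borel" for L :: "(real \<Rightarrow> real) measure"

lemma Pr1_spin_law: "L \<in> Pr1 S \<Longrightarrow> spin_law L" by (simp add: spin_law_def Pr1D)

lemma spin_law_space: "spin_law L \<Longrightarrow> space L = space spin_borel"
  unfolding spin_law_def using sets_eq_imp_space_eq by blast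

abbreviation (input) "QX L \<equiv> iid Q \<Otimes>\<^sub>M iid L"

lemma prob_QX: "spin_law L \<Longrightarrow> prob_space (QX L)" "prob_space (iid Q)" "spin_law L \<Longrightarrow> prob_space (iid L)"
  by (auto intro!: prob_space_pair prob_space_PiM prob_Q simp: spin_law_def)

lemma QX_space: assumes "spin_law L" "y \<in> space (QX L)" shows "fst y k \<in> space clause_borel" "snd y k \<in> space spin_borel"
  using assms(2) spin_law_space[OF assms(1)] by (auto simp: space_pair_measure space_PiM space_Q)

lemma field_sum_measurable: assumes "spin_law L" shows "(\<lambda>y. field_sum \<rho> r (fst y) (snd y)) \<in> measurable (QX L) energy_space"
proof -
  have [measurable_cong]: "sets L = sets spin_borel" using assms by (simp add: spin_law_def)
  show ?thesis unfolding field_sum_def block_def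
    by (intro energy_space_sum_measurable clause_field_measurable measurable_abs_UNIV) measurable
qed

lemma cavity_law_alt: "cavity_law p \<alpha> Q L = measure_pmf (poisson_pmf mean_degree) \<Otimes>\<^sub>M QX L"
  by (simp add: cavity_law_def)

lemma pmf_pair_measurable:
  assumes "\<And>r. (\<lambda>y. f (r, y)) \<in> measurable N M" shows "f \<in> measurable (measure_pmf (w :: nat pmf) \<Otimes>\<^sub>M N) M"
proof -
  have "f \<in> measurable (count_space UNIV \<Otimes>\<^sub>M N) M"
    by (rule measurable_pair_measure_countable1) (auto intro: assms)
  then show ?thesis by (subst measurable_cong_sets[OF sets_pair_measure_cong[OF sets_measure_pmf_count_space refl] refl])
qed

lemma field_sum_measurable': assumes "spin_law L" shows "(\<lambda>z. field_sum \<rho> (fst z) (fst (snd z)) (snd (snd z))) \<in> measurable (cavity_law p \<alpha> Q L) energy_space"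
  unfolding cavity_law_alt by (rule pmf_pair_measurable) (use field_sum_measurable[OF assms] in simp)

lemma root_energy_measurable: assumes "spin_law L" shows "(\<lambda>z. root_energy (fst z) (fst (snd z)) (snd (snd z))) \<in> measurable (cavity_law p \<alpha> Q L) energy_space"
  unfolding root_energy_def by (intro shiftL_measurable psi_energies field_sum_measurable' assms)

lemma cavity_space: assumes "spin_law L" "z \<in> space (cavity_law p \<alpha> Q L)"
  shows "fst (snd z) k \<in> space clause_borel" "snd (snd z) k \<in> space spin_borel"
  using QX_space[OF assms(1), of "snd z"] assms(2) by (auto simp: cavity_law_alt space_pair_measure)

definition T_map where "T_map z = normalise (root_energy (fst z) (fst (snd z)) (snd (snd z)))"

lemma T_map_measurable: assumes "spin_law L" shows "T_map \<in> measurable (cavity_law p \<alpha> Q L) spin_borel"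
  unfolding T_map_def by (rule measurable_compose[OF root_energy_measurable[OF assms] normalise_measurable])

lemma T_infty_eq: assumes "spin_law L" shows "T_infty S p \<alpha> \<psi> Q L = distr (cavity_law p \<alpha> Q L) spin_borel T_map"
  unfolding T_infty_def
proof (rule distr_cong[OF refl refl])
  fix z assume z: "z \<in> space (cavity_law p \<alpha> Q L)"
  obtain r \<theta> X where [simp]: "z = (r, \<theta>, X)" by (cases z) auto
  have sp: "\<theta> k \<in> space clause_borel" "X k \<in> space spin_borel" for k using cavity_space[OF assms z] by simp_all
  show "(case z of (r, \<theta>, X) \<Rightarrow> \<lambda>t\<in>S. (SUP \<sigma>\<in>({..<(p - 1) * r} \<rightarrow>\<^sub>E S). cavity_energy p \<psi> r \<theta> X \<sigma> t) - cavity_max S p \<psi> r \<theta> X) = T_map z"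
    by (simp add: T_map_def normalise_def cavity_SUP[where \<theta> = \<theta> and X = X, OF sp] cavity_max_eq[where \<theta> = \<theta> and X = X, OF sp] del: One_nat_def cong: restrict_cong)
qed

lemma prob_cavity_law: "spin_law L \<Longrightarrow> prob_space (cavity_law p \<alpha> Q L)"
  unfolding cavity_law_alt by (intro prob_space_pair prob_space_measure_pmf prob_QX)

lemma T_spin_law: assumes "spin_law L" shows "spin_law (T_infty S p \<alpha> \<psi> Q L)"
  unfolding spin_law_def T_infty_eq[OF assms]
  by (auto intro!: prob_space.prob_space_distr prob_cavity_law T_map_measurable assms)

lemma spin_norm_normalise: assumes sp: "\<And>k. \<theta> k \<in> space clause_borel" "\<And>k. X k \<in> space spin_borel"
  shows "spin_norm (normalise (root_energy r \<theta> X)) \<le> 2 * spin_norm \<psi> + (\<Sum>k<r. 2 * clause_norm (\<theta> k))"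
  unfolding spin_norm_def[of "normalise _"]
proof (rule nrm_le)
  fix \<sigma> assume \<sigma>: "\<sigma> \<in> configs"
  let ?W = "root_energy r \<theta> X"
  note WC = root_energy_energies[where r = r and \<theta> = \<theta> and X = X, OF sp]
  obtain \<sigma>0 where s0: "\<sigma>0 \<in> configs" "?W \<sigma>0 = maxE ?W" by (rule maxE_attained[OF WC])
  have t: "\<sigma> 0 \<in> S" using \<sigma> by (simp add: configs_iff)
  have c: "(\<lambda>_. \<sigma> 0) \<in> configs" by (rule const_configs[OF t])
  have p1: "p - length [0] = p - 1" by simp
  have "field_sum [0] r \<theta> X \<sigma>0 - field_sum [0] r \<theta> X (\<lambda>_. \<sigma> 0) = (\<Sum>k<r. clause_field (p - 1) [0] (\<theta> k) (block (p - 1) X k) \<sigma>0 - clause_field (p - 1) [0] (\<theta> k) (block (p - 1) X k) (\<lambda>_. \<sigma> 0))"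
    unfolding field_sum_def sum_fun_apply sum_subtractf p1 ..
  also have "\<dots> \<le> (\<Sum>k<r. 2 * clause_norm (\<theta> k))"
    by (intro sum_mono clause_field_osc sp s0 c) (simp add: block_def sp)
  finally have 1: "field_sum [0] r \<theta> X \<sigma>0 - field_sum [0] r \<theta> X (\<lambda>_. \<sigma> 0) \<le> (\<Sum>k<r. 2 * clause_norm (\<theta> k))" .
  have 2: "\<bar>\<psi> (\<sigma> 0)\<bar> \<le> spin_norm \<psi>" "\<bar>\<psi> (\<sigma>0 0)\<bar> \<le> spin_norm \<psi>"
    using nrm_ge[OF psi_energies[of 0] \<sigma>] nrm_ge[OF psi_energies[of 0] s0(1)] by (simp_all add: spin_norm_def site_def)
  have 3: "?W (\<lambda>_. \<sigma> 0) \<le> maxE ?W" by (rule maxE_ge[OF WC c])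
  have "maxE ?W - ?W (\<lambda>_. \<sigma> 0) = (\<psi> (\<sigma>0 0) - \<psi> (\<sigma> 0)) + (field_sum [0] r \<theta> X \<sigma>0 - field_sum [0] r \<theta> X (\<lambda>_. \<sigma> 0))"
    unfolding s0(2)[symmetric] by (simp add: root_energy_def plus_fun_apply site_def)
  then have "maxE ?W - ?W (\<lambda>_. \<sigma> 0) \<le> 2 * spin_norm \<psi> + (\<Sum>k<r. 2 * clause_norm (\<theta> k))" using 1 2 by linarith
  then show "\<bar>site 0 (normalise ?W) \<sigma>\<bar> \<le> 2 * spin_norm \<psi> + (\<Sum>k<r. 2 * clause_norm (\<theta> k))" using 3 t by (simp add: site_def normalise_def)
qed

lemma nn_integral_cavity_law:
  assumes "spin_law L" "F \<in> borel_measurable (cavity_law p \<alpha> Q L)"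
  shows "(\<integral>\<^sup>+z. F z \<partial>cavity_law p \<alpha> Q L) = (\<integral>\<^sup>+r. \<integral>\<^sup>+y. F (r, y) \<partial>QX L \<partial>measure_pmf (poisson_pmf mean_degree))"
proof -
  interpret prob_space "QX L" by (rule prob_QX(1)[OF assms(1)])
  show ?thesis using assms(2) unfolding cavity_law_alt by (intro nn_integral_fst[symmetric])
qed

text \<open>
  By \<open>spin_norm_normalise\<close> the norm is bounded through \<open>\<psi>\<close> and the clauses at the root. So the limit of
  the iterates, which is only known to be a law, is in \<open>Pr1\<close> as soon as it is a fixed point.
\<close>

lemma T_Pr1: assumes "spin_law L" shows "T_infty S p \<alpha> \<psi> Q L \<in> Pr1 S"
proof (rule Pr1I)
  show "prob_space (T_infty S p \<alpha> \<psi> Q L)" "sets (T_infty S p \<alpha> \<psi> Q L) = sets spin_borel"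
    using T_spin_law[OF assms] by (auto simp: spin_law_def)
  let ?c = "2 * spin_norm \<psi>"
  have c0: "0 \<le> ?c" unfolding spin_norm_def by (simp add: psi_energies)
  have [measurable_cong]: "sets L = sets spin_borel" using assms by (simp add: spin_law_def)
  have m: "(\<lambda>z. ennreal (spin_norm (T_map z))) \<in> borel_measurable (cavity_law p \<alpha> Q L)"
    using measurable_compose[OF T_map_measurable[OF assms] spin_norm_measurable] by simp
  interpret P: prob_space "iid Q" by (rule prob_QX(2))
  interpret PL: prob_space "iid L" by (rule prob_QX(3)[OF assms])
  interpret QX: prob_space "QX L" by (rule prob_QX(1)[OF assms])
  have nfk: "(\<integral>\<^sup>+y. ennreal (clause_norm (fst y k)) \<partial>QX L) = ennreal mean_clause_norm" for k
  proof -
    have "(\<integral>\<^sup>+y. ennreal (clause_norm (fst y k)) \<partial>QX L) = (\<integral>\<^sup>+\<theta>. ennreal (clause_norm (\<theta> k)) \<partial>iid Q)"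
      by (subst PL.nn_integral_fst[symmetric]) (auto simp: PL.emeasure_space_1)
    also have "\<dots> = (\<integral>\<^sup>+f. ennreal (clause_norm f) \<partial>distr (iid Q) Q (\<lambda>\<theta>. \<theta> k))"
      by (subst nn_integral_distr) auto
    also have "distr (iid Q) Q (\<lambda>\<theta>. \<theta> k) = Q" by (rule distr_PiM_component) (auto intro: prob_Q)
    also have "(\<integral>\<^sup>+f. ennreal (clause_norm f) \<partial>Q) = ennreal mean_clause_norm" unfolding mean_clause_norm_def
      by (rule nn_integral_eq_integral[OF clause_norm_integrable]) (rule AE_I2, simp add: space_Q clause_norm_nonneg)
    finally show ?thesis .
  qed
  have "(\<integral>\<^sup>+x. ennreal (spin_norm x) \<partial>T_infty S p \<alpha> \<psi> Q L) = (\<integral>\<^sup>+z. ennreal (spin_norm (T_map z)) \<partial>cavity_law p \<alpha> Q L)"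
    unfolding T_infty_eq[OF assms] by (rule nn_integral_distr[OF T_map_measurable[OF assms]]) measurable
  also have "\<dots> = (\<integral>\<^sup>+r. \<integral>\<^sup>+y. ennreal (spin_norm (T_map (r, y))) \<partial>QX L \<partial>measure_pmf (poisson_pmf mean_degree))"
    by (rule nn_integral_cavity_law[OF assms m])
  also have "\<dots> \<le> (\<integral>\<^sup>+r. ennreal ?c + ennreal (real r) * ennreal (2 * mean_clause_norm) \<partial>measure_pmf (poisson_pmf mean_degree))"
  proof (rule nn_integral_mono)
    fix r
    have "(\<integral>\<^sup>+y. ennreal (spin_norm (T_map (r, y))) \<partial>QX L) \<le> (\<integral>\<^sup>+y. ennreal ?c + (\<Sum>k<r. ennreal 2 * ennreal (clause_norm (fst y k))) \<partial>QX L)"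
    proof (rule nn_integral_mono)
      fix y assume y: "y \<in> space (QX L)"
      have sp: "fst y k \<in> space clause_borel" "snd y k \<in> space spin_borel" for k using QX_space[OF assms y] .
      have "ennreal (spin_norm (T_map (r, y))) \<le> ennreal (?c + (\<Sum>k<r. 2 * clause_norm (fst y k)))"
        using spin_norm_normalise[where \<theta> = "fst y" and X = "snd y", OF sp] by (intro ennreal_leI) (simp add: T_map_def)
      also have "\<dots> = ennreal ?c + (\<Sum>k<r. ennreal 2 * ennreal (clause_norm (fst y k)))"
      proof -
        have nn: "0 \<le> 2 * clause_norm (fst y k)" for k using clause_norm_nonneg[OF sp(1)[of k]] by simp
        have "(\<Sum>k<r. ennreal 2 * ennreal (clause_norm (fst y k))) = (\<Sum>k<r. ennreal (2 * clause_norm (fst y k)))"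
          by (intro sum.cong refl) (simp add: ennreal_mult[symmetric] clause_norm_nonneg[OF sp(1)] del: ennreal_numeral)
        also have "\<dots> = ennreal (\<Sum>k<r. 2 * clause_norm (fst y k))" by (rule sum_ennreal) (rule nn)
        finally show ?thesis by (subst ennreal_plus[OF c0 sum_nonneg]) (use nn in auto)
      qed
      finally show "ennreal (spin_norm (T_map (r, y))) \<le> ennreal ?c + (\<Sum>k<r. ennreal 2 * ennreal (clause_norm (fst y k)))" .
    qed
    also have "\<dots> = ennreal ?c + (\<Sum>k<r. ennreal 2 * ennreal mean_clause_norm)"
      by (subst nn_integral_add, simp, simp, subst nn_integral_sum) (auto simp: nn_integral_cmult nfk QX.emeasure_space_1)
    also have "\<dots> = ennreal ?c + ennreal (real r) * ennreal (2 * mean_clause_norm)"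
      using mean_clause_norm_nonneg by (simp add: ennreal_mult ennreal_of_nat_eq_real_of_nat)
    finally show "(\<integral>\<^sup>+y. ennreal (spin_norm (T_map (r, y))) \<partial>QX L) \<le> ennreal ?c + ennreal (real r) * ennreal (2 * mean_clause_norm)" .
  qed
  also have "\<dots> = ennreal ?c + ennreal mean_degree * ennreal (2 * mean_clause_norm)"
    by (subst nn_integral_add) (auto simp: nn_integral_multc poisson_mean_nn mean_degree_pos)
  also have "\<dots> < \<infinity>" by (simp add: ennreal_mult_less_top)
  finally show "(\<integral>\<^sup>+x. ennreal (spin_norm x) \<partial>T_infty S p \<alpha> \<psi> Q L) < \<infinity>" .
qed

text \<open>The fields of the clauses around the root are independent: their sum is compound Poisson.\<close>

lemma nn_integral_field_sum:
  assumes L: "L \<in> Pr1 S" and "F \<in> borel_measurable energy_space"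
  shows "(\<integral>\<^sup>+y. F (field_sum \<rho> r (fst y) (snd y)) \<partial>QX L) = (\<integral>\<^sup>+Z. F Z \<partial>iid_sum (field_law L \<rho>) r)"
  using assms(2)
proof (induct r arbitrary: F)
  case 0
  interpret QX: prob_space "QX L" by (rule prob_QX(1)[OF Pr1_spin_law[OF L]])
  show ?case using 0 by (simp add: nn_integral_iid_sum_0 increment_field_law L field_sum_def QX.emeasure_space_1 del: zero_fun_apply)
next
  case (Suc r)
  note F[measurable] = Suc.prems
  let ?PQ = "iid Q" and ?PL = "iid L"
  let ?q = "p - length \<rho>"
  note cp = Pr1_spin_law[OF L]
  note [measurable_cong] = Pr1D(2)[OF L]
  interpret PQ: prob_space ?PQ by (rule prob_QX(2))
  interpret PL: prob_space ?PL by (rule prob_QX(3)[OF cp])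
  interpret L: prob_space L by (rule Pr1D(1)[OF L])
  interpret P: pair_prob_space ?PQ ?PL ..
  interpret P2: pair_prob_space ?PL ?PQ ..
  have hm: "(\<lambda>y. F (field_sum \<rho> r' (fst y) (snd y))) \<in> borel_measurable (QX L)" for r'
    by (rule measurable_compose[OF field_sum_measurable[OF cp] F])
  have hsuc: "field_sum \<rho> (Suc r) (case_nat f \<theta>) (comb_seq ?q x X) = clause_field ?q \<rho> f x + field_sum \<rho> r \<theta> X" for f \<theta> x X
  proof -
    have 1: "clause_field ?q \<rho> f (block ?q (comb_seq ?q x X) 0) = clause_field ?q \<rho> f x"
    proof -
      have "clause_gain ?q \<rho> f (block ?q (comb_seq ?q x X) 0) \<sigma> \<tau> = clause_gain ?q \<rho> f x \<sigma> \<tau>" for \<sigma> \<tau>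
        unfolding clause_gain_def block_def by (intro arg_cong2[where f = "(+)"] sum.cong) (auto simp: comb_seq_less)
      then show ?thesis by (simp add: clause_field_def[abs_def])
    qed
    have 2: "block ?q (comb_seq ?q x X) (Suc k) = block ?q X k" for k
      unfolding block_def
    proof
      fix j show "comb_seq ?q x X (Suc k * ?q + j) = X (k * ?q + j)"
      proof -
        have "Suc k * ?q + j = (k * ?q + j) + ?q" by (simp only: mult_Suc add_ac)
        then show ?thesis by (simp only: comb_seq_add)
      qed
    qed
    show ?thesis unfolding field_sum_def by (simp only: sum.lessThan_Suc_shift nat.case 1 2)
  qed
  have Fmm: "(\<lambda>z. F (clause_field ?q \<rho> (fst z) (fst (snd z)) + field_sum \<rho> r (fst (snd (snd z))) (snd (snd (snd z))))) \<in> borel_measurable (Q \<Otimes>\<^sub>M (?PL \<Otimes>\<^sub>M (?PQ \<Otimes>\<^sub>M ?PL)))"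
  proof (rule measurable_compose[OF energy_space_add_measurable F])
    show "(\<lambda>z. clause_field ?q \<rho> (fst z) (fst (snd z))) \<in> measurable (Q \<Otimes>\<^sub>M (?PL \<Otimes>\<^sub>M (?PQ \<Otimes>\<^sub>M ?PL))) energy_space" by measurable
    show "(\<lambda>z. field_sum \<rho> r (fst (snd (snd z))) (snd (snd (snd z)))) \<in> measurable (Q \<Otimes>\<^sub>M (?PL \<Otimes>\<^sub>M (?PQ \<Otimes>\<^sub>M ?PL))) energy_space"
      by (rule measurable_compose[OF _ field_sum_measurable[OF cp]]) measurable
  qed
  have "(\<integral>\<^sup>+y. F (field_sum \<rho> (Suc r) (fst y) (snd y)) \<partial>QX L) = (\<integral>\<^sup>+\<theta>. \<integral>\<^sup>+X. F (field_sum \<rho> (Suc r) \<theta> X) \<partial>?PL \<partial>?PQ)"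
    by (subst PL.nn_integral_fst[symmetric, OF hm]) simp
  also have "\<dots> = (\<integral>\<^sup>+f. \<integral>\<^sup>+\<theta>. \<integral>\<^sup>+X. F (field_sum \<rho> (Suc r) (case_nat f \<theta>) X) \<partial>?PL \<partial>?PQ \<partial>Q)"
    by (rule nn_integral_PiM_iter[OF prob_Q]) (use PL.borel_measurable_nn_integral_fst[OF hm[of "Suc r"]] in simp)
  also have "\<dots> = (\<integral>\<^sup>+f. \<integral>\<^sup>+\<theta>. \<integral>\<^sup>+x. \<integral>\<^sup>+X. F (clause_field ?q \<rho> f x + field_sum \<rho> r \<theta> X) \<partial>?PL \<partial>?PL \<partial>?PQ \<partial>Q)"
  proof (rule nn_integral_cong, rule nn_integral_cong)
    fix f \<theta> assume f: "f \<in> space Q" and \<theta>: "\<theta> \<in> space ?PQ"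
    then have "case_nat f \<theta> \<in> space ?PQ" using f by (auto simp: space_PiM PiE_iff split: nat.split)
    then have "(\<lambda>X. F (field_sum \<rho> (Suc r) (case_nat f \<theta>) X)) \<in> borel_measurable ?PL"
      using measurable_Pair2[OF hm[of "Suc r"]] by simp
    from nn_integral_PiM_comb_seq[OF Pr1D(1)[OF L] this, of ?q]
    show "(\<integral>\<^sup>+X. F (field_sum \<rho> (Suc r) (case_nat f \<theta>) X) \<partial>?PL) = (\<integral>\<^sup>+x. \<integral>\<^sup>+X. F (clause_field ?q \<rho> f x + field_sum \<rho> r \<theta> X) \<partial>?PL \<partial>?PL)"
      by (simp only: hsuc)
  qed
  also have "\<dots> = (\<integral>\<^sup>+f. \<integral>\<^sup>+x. \<integral>\<^sup>+\<theta>. \<integral>\<^sup>+X. F (clause_field ?q \<rho> f x + field_sum \<rho> r \<theta> X) \<partial>?PL \<partial>?PQ \<partial>?PL \<partial>Q)"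
  proof (rule nn_integral_cong)
    fix f assume f: "f \<in> space Q"
    have "(\<lambda>(\<theta>, x). \<integral>\<^sup>+X. F (clause_field ?q \<rho> f x + field_sum \<rho> r \<theta> X) \<partial>?PL) \<in> borel_measurable (?PQ \<Otimes>\<^sub>M ?PL)"
    proof -
      have "(\<lambda>w. F (clause_field ?q \<rho> f (snd (fst w)) + field_sum \<rho> r (fst (fst w)) (snd w))) \<in> borel_measurable ((?PQ \<Otimes>\<^sub>M ?PL) \<Otimes>\<^sub>M ?PL)"
        using measurable_compose[OF _ Fmm, of "\<lambda>w. (f, snd (fst w), fst (fst w), snd w)" "(?PQ \<Otimes>\<^sub>M ?PL) \<Otimes>\<^sub>M ?PL"] f by simp
      from PL.borel_measurable_nn_integral_fst[OF this] show ?thesis by (simp add: split_beta)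
    qed
    from P.Fubini'[OF this]
    show "(\<integral>\<^sup>+\<theta>. \<integral>\<^sup>+x. \<integral>\<^sup>+X. F (clause_field ?q \<rho> f x + field_sum \<rho> r \<theta> X) \<partial>?PL \<partial>?PL \<partial>?PQ) = (\<integral>\<^sup>+x. \<integral>\<^sup>+\<theta>. \<integral>\<^sup>+X. F (clause_field ?q \<rho> f x + field_sum \<rho> r \<theta> X) \<partial>?PL \<partial>?PQ \<partial>?PL)"
      by simp
  qed
  also have "\<dots> = (\<integral>\<^sup>+f. \<integral>\<^sup>+x. \<integral>\<^sup>+W. F (clause_field ?q \<rho> f x + W) \<partial>iid_sum (field_law L \<rho>) r \<partial>?PL \<partial>Q)"
  proof (rule nn_integral_cong, rule nn_integral_cong)
    fix f x assume "f \<in> space Q" "x \<in> space ?PL"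
    then have "clause_field ?q \<rho> f x \<in> energies" by (intro clause_field_energies) (auto simp: space_Q L_seq_space[OF L])
    from shift_energy_space[OF this, of energy_space] have sm: "(\<lambda>W. F (clause_field ?q \<rho> f x + W)) \<in> borel_measurable energy_space" by simp
    have "(\<lambda>y. F (clause_field ?q \<rho> f x + field_sum \<rho> r (fst y) (snd y))) \<in> borel_measurable (QX L)"
      by (rule measurable_compose[OF field_sum_measurable[OF cp] sm])
    from PL.nn_integral_fst[OF this]
    show "(\<integral>\<^sup>+\<theta>. \<integral>\<^sup>+X. F (clause_field ?q \<rho> f x + field_sum \<rho> r \<theta> X) \<partial>?PL \<partial>?PQ) = (\<integral>\<^sup>+W. F (clause_field ?q \<rho> f x + W) \<partial>iid_sum (field_law L \<rho>) r)"
      using Suc.hyps[OF sm] by simp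
  qed
  also have "\<dots> = (\<integral>\<^sup>+Z. \<integral>\<^sup>+W. F (Z + W) \<partial>iid_sum (field_law L \<rho>) r \<partial>field_law L \<rho>)"
  proof -
    interpret C: prob_space "iid_sum (field_law L \<rho>) r" by (rule prob_iid_sum[OF increment_field_law[OF L]])
    have g: "(\<lambda>Z. \<integral>\<^sup>+W. F (Z + W) \<partial>iid_sum (field_law L \<rho>) r) \<in> borel_measurable energy_space" by measurable
    have "(\<integral>\<^sup>+Z. \<integral>\<^sup>+W. F (Z + W) \<partial>iid_sum (field_law L \<rho>) r \<partial>field_law L \<rho>) =
      (\<integral>\<^sup>+y. \<integral>\<^sup>+W. F (clause_field ?q \<rho> (fst y) (snd y) + W) \<partial>iid_sum (field_law L \<rho>) r \<partial>(Q \<Otimes>\<^sub>M ?PL))"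
      unfolding field_law_def[of L \<rho>] by (rule nn_integral_distr[OF field_law_meas[OF Pr1D(2)[OF L]]]) (use g in \<open>simp add: field_law_def\<close>)
    also have "\<dots> = (\<integral>\<^sup>+f. \<integral>\<^sup>+x. \<integral>\<^sup>+W. F (clause_field ?q \<rho> f x + W) \<partial>iid_sum (field_law L \<rho>) r \<partial>?PL \<partial>Q)"
      using PL.nn_integral_fst[OF measurable_compose[OF field_law_meas[OF Pr1D(2)[OF L]] g]] by simp
    finally show ?thesis ..
  qed
  also have "\<dots> = (\<integral>\<^sup>+Z. F Z \<partial>iid_sum (field_law L \<rho>) (Suc r))"
    by (rule nn_integral_iid_sum_Suc[OF increment_field_law[OF L] F, symmetric])
  finally show ?case .
qed

lemma cavity_law_field_sum:
  assumes L: "L \<in> Pr1 S"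
  shows "distr (cavity_law p \<alpha> Q L) energy_space (\<lambda>z. field_sum \<rho> (fst z) (fst (snd z)) (snd (snd z))) = cpoisson (field_law L \<rho>) mean_degree"
proof (rule measure_eqI_nn_integral)
  note cp = Pr1_spin_law[OF L]
  fix F :: "_ \<Rightarrow> ennreal" assume "F \<in> borel_measurable (distr (cavity_law p \<alpha> Q L) energy_space (\<lambda>z. field_sum \<rho> (fst z) (fst (snd z)) (snd (snd z))))"
  then have F: "F \<in> borel_measurable energy_space" by simp
  have "(\<integral>\<^sup>+Z. F Z \<partial>distr (cavity_law p \<alpha> Q L) energy_space (\<lambda>z. field_sum \<rho> (fst z) (fst (snd z)) (snd (snd z))))
    = (\<integral>\<^sup>+z. F (field_sum \<rho> (fst z) (fst (snd z)) (snd (snd z))) \<partial>cavity_law p \<alpha> Q L)"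
    by (rule nn_integral_distr[OF field_sum_measurable'[OF cp]]) (use F in simp)
  also have "\<dots> = (\<integral>\<^sup>+r. \<integral>\<^sup>+y. F (field_sum \<rho> r (fst y) (snd y)) \<partial>QX L \<partial>measure_pmf (poisson_pmf mean_degree))"
    by (subst nn_integral_cavity_law[OF cp measurable_compose[OF field_sum_measurable'[OF cp] F]]) simp
  also have "\<dots> = (\<integral>\<^sup>+Z. F Z \<partial>cpoisson (field_law L \<rho>) mean_degree)"
    by (simp add: nn_integral_field_sum[OF L F] nn_integral_cpoisson[OF increment_field_law[OF L] F])
  finally show "(\<integral>\<^sup>+Z. F Z \<partial>distr (cavity_law p \<alpha> Q L) energy_space (\<lambda>z. field_sum \<rho> (fst z) (fst (snd z)) (snd (snd z)))) = (\<integral>\<^sup>+Z. F Z \<partial>cpoisson (field_law L \<rho>) mean_degree)" .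
qed simp

section \<open>Total variation and the fixed point\<close>

text \<open>
  Total variation distance at most \<open>d\<close>, tested against functions with values in the unit interval.
\<close>

definition tv_le where
  "tv_le L L' d \<longleftrightarrow> (\<forall>h\<in>borel_measurable spin_borel. (\<forall>x\<in>space spin_borel. 0 \<le> h x \<and> h x \<le> 1) \<longrightarrow>
     \<bar>(\<integral>x. h x \<partial>L) - (\<integral>x. h x \<partial>L')\<bar> \<le> d)" for L L' :: "(real \<Rightarrow> real) measure" and d :: real

lemma bounded_integral:
  assumes "prob_space M" "h \<in> borel_measurable M" "\<And>x. x \<in> space M \<Longrightarrow> 0 \<le> h x \<and> h x \<le> (1::real)"
  shows "integrable M h" "0 \<le> (\<integral>x. h x \<partial>M)" "(\<integral>x. h x \<partial>M) \<le> 1"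
proof -
  interpret prob_space M by fact
  show i: "integrable M h" by (rule integrable_const_bound[of _ 1]) (use assms in auto)
  show "0 \<le> (\<integral>x. h x \<partial>M)" by (rule integral_nonneg_AE, rule AE_I2) (use assms in auto)
  have "(\<integral>x. h x \<partial>M) \<le> (\<integral>x. 1 \<partial>M)" by (rule integral_mono[OF i]) (use assms in auto)
  then show "(\<integral>x. h x \<partial>M) \<le> 1" by (simp add: prob_space)
qed

lemma tv_le_le_one: assumes "spin_law L" "spin_law L'" shows "tv_le L L' 1"
  unfolding tv_le_def
proof (intro ballI impI)
  fix h :: "(real \<Rightarrow> real) \<Rightarrow> real" assume h: "h \<in> borel_measurable spin_borel" "\<forall>x\<in>space spin_borel. 0 \<le> h x \<and> h x \<le> 1"
  have "0 \<le> (\<integral>x. h x \<partial>L) \<and> (\<integral>x. h x \<partial>L) \<le> 1" if L: "spin_law L" for L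
  proof -
    note [measurable_cong] = L[unfolded spin_law_def, THEN conjunct2]
    have "h \<in> borel_measurable L" using h(1) by measurable
    then show ?thesis using bounded_integral(2,3)[of L h] L h(2) spin_law_space[OF L] by (auto simp: spin_law_def)
  qed
  from this[OF assms(1)] this[OF assms(2)] show "\<bar>(\<integral>x. h x \<partial>L) - (\<integral>x. h x \<partial>L')\<bar> \<le> 1" by linarith
qed

lemma tv_le_measure_eqI: assumes L: "spin_law L" "spin_law L'" and tv_le: "\<And>d. 0 < d \<Longrightarrow> tv_le L L' d" shows "L = L'"
proof (rule measure_eqI)
  interpret L: prob_space L using L by (simp add: spin_law_def)
  interpret L': prob_space L' using L by (simp add: spin_law_def)
  show s: "sets L = sets L'" using L by (simp add: spin_law_def)
  fix A assume "A \<in> sets L"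
  then have A: "A \<in> sets spin_borel" "A \<in> sets L'" using L by (auto simp: spin_law_def)
  have "\<bar>measure L A - measure L' A\<bar> \<le> 0"
  proof (rule field_le_epsilon)
    fix d :: real assume "0 < d"
    have "(indicator A :: _ \<Rightarrow> real) \<in> borel_measurable spin_borel" using A by simp
    then have "\<bar>(\<integral>x. indicator A x \<partial>L) - (\<integral>x. indicator A x \<partial>L')\<bar> \<le> d"
      using tv_le[OF \<open>0 < d\<close>] unfolding tv_le_def by (auto simp: indicator_def)
    then show "\<bar>measure L A - measure L' A\<bar> \<le> 0 + d" using A \<open>A \<in> sets L\<close> by simp
  qed
  then show "emeasure L A = emeasure L' A" by (simp add: L.emeasure_eq_measure L'.emeasure_eq_measure)
qed

text \<open>Comparing functionals of the first \<open>n\<close> coordinates, one coordinate at a time.\<close>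

lemma tv_le_sequence:
  assumes L: "spin_law L" "spin_law L'" and tv_le: "tv_le L L' d" and d: "0 \<le> d"
    and "H \<in> borel_measurable (iid spin_borel)"
    and "\<And>x. x \<in> space (iid spin_borel) \<Longrightarrow> 0 \<le> H x \<and> H x \<le> (1::real)"
    and "\<And>x y. x \<in> space (iid spin_borel) \<Longrightarrow> y \<in> space (iid spin_borel) \<Longrightarrow> (\<forall>i<n. x i = y i) \<Longrightarrow> H x = H y"
  shows "\<bar>(\<integral>x. H x \<partial>iid L) - (\<integral>x. H x \<partial>iid L')\<bar> \<le> real n * d"
  using assms(5-)
proof (induct n arbitrary: H)
  case 0
  let ?S = "space (iid spin_borel)"
  have c: "(\<integral>x. H x \<partial>iid L) = H (\<lambda>_. \<lambda>t\<in>S. 0)" if L: "spin_law L" for L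
  proof -
    interpret P: prob_space "iid L" by (rule prob_QX(3)[OF L])
    have "(\<integral>x. H x \<partial>iid L) = (\<integral>x. H (\<lambda>_. \<lambda>t\<in>S. 0) \<partial>iid L)"
    proof (rule Bochner_Integration.integral_cong[OF refl])
      fix x assume "x \<in> space (iid L)"
      then show "H x = H (\<lambda>_. \<lambda>t\<in>S. 0)" using spin_law_space[OF L]
        by (intro 0(3)) (auto simp: space_PiM space_spin_borel extensional_def)
    qed
    then show ?thesis by (simp add: P.prob_space)
  qed
  show ?case by (simp add: c L)
next
  case (Suc n)
  let ?C = "iid spin_borel"
  note Hm[measurable] = Suc.prems(1)
  define A where "A L x = (\<integral>z. H (case_nat x z) \<partial>iid L)" for L x
  have cs: "case_nat x z \<in> space ?C" if "x \<in> space spin_borel" "z \<in> space ?C" for x z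
    using that by (auto simp: space_PiM PiE_iff split: nat.split)
  have int: "(\<integral>x. H x \<partial>iid L) = (\<integral>x. A L x \<partial>L)"
    and Am: "A L \<in> borel_measurable spin_borel" and Ab: "x \<in> space spin_borel \<Longrightarrow> 0 \<le> A L x \<and> A L x \<le> 1" if L: "spin_law L" for L x
  proof -
    note [measurable_cong] = L[unfolded spin_law_def, THEN conjunct2]
    interpret P: prob_space "iid L" by (rule prob_QX(3)[OF L])
    have spc: "space (iid L) = space ?C" by (simp add: space_PiM spin_law_space[OF L])
    have "H \<in> borel_measurable (iid L)" by measurable
    from bounded_integral(1)[OF P.prob_space_axioms this] Suc.prems(2)
    have "integrable (iid L) H" by (simp add: spc)
    from integral_PiM_iter[OF _ this] L show "(\<integral>x. H x \<partial>iid L) = (\<integral>x. A L x \<partial>L)" by (simp add: A_def spin_law_def)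
    show "A L \<in> borel_measurable spin_borel" unfolding A_def by measurable
    assume x: "x \<in> space spin_borel"
    have "(\<lambda>z. H (case_nat x z)) \<in> borel_measurable (iid L)" using x by measurable
    from bounded_integral(2,3)[OF P.prob_space_axioms this] Suc.prems(2) cs[OF x] show "0 \<le> A L x \<and> A L x \<le> 1"
      unfolding A_def by (simp add: spc)
  qed
  have IH: "\<bar>A L x - A L' x\<bar> \<le> real n * d" if x: "x \<in> space spin_borel" for x
    unfolding A_def
  proof (rule Suc.hyps)
    show "(\<lambda>z. H (case_nat x z)) \<in> borel_measurable ?C" using x by measurable
    show "0 \<le> H (case_nat x z) \<and> H (case_nat x z) \<le> 1" if "z \<in> space ?C" for z by (rule Suc.prems(2)[OF cs[OF x that]])
    show "H (case_nat x z) = H (case_nat x y)" if "z \<in> space ?C" "y \<in> space ?C" "\<forall>i<n. z i = y i" for z y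
      by (rule Suc.prems(3)[OF cs[OF x that(1)] cs[OF x that(2)]]) (use that(3) in \<open>auto simp: less_Suc_eq_0_disj\<close>)
  qed
  interpret L: prob_space L using L by (simp add: spin_law_def)
  note [measurable_cong] = L(1)[unfolded spin_law_def, THEN conjunct2]
  have iA: "integrable L (A L)" "integrable L (A L')"
    by (rule bounded_integral(1)[OF L.prob_space_axioms]; use Am[OF L(1)] Am[OF L(2)] Ab[OF L(1)] Ab[OF L(2)] spin_law_space[OF L(1)] in simp)+
  have 1: "\<bar>(\<integral>x. A L x \<partial>L) - (\<integral>x. A L' x \<partial>L)\<bar> \<le> real n * d"
  proof -
    have "\<bar>\<integral>x. A L x - A L' x \<partial>L\<bar> \<le> (\<integral>x. real n * d \<partial>L)"
      by (rule integral_abs_bound[THEN order_trans], rule integral_mono)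
        (use iA IH spin_law_space[OF L(1)] in auto)
    then show ?thesis using iA by (simp add: L.prob_space)
  qed
  have 2: "\<bar>(\<integral>x. A L' x \<partial>L) - (\<integral>x. A L' x \<partial>L')\<bar> \<le> d"
    using tv_le Am[OF L(2)] Ab[OF L(2)] unfolding tv_le_def by blast
  have "real (Suc n) * d = real n * d + d" by (simp add: algebra_simps)
  then show ?case unfolding int[OF L(1)] int[OF L(2)] using 1 2 by linarith
qed

lemma T_map_local:
  assumes "\<forall>i<(p - 1) * r. X i = Y i" shows "T_map (r, \<theta>, X) = T_map (r, \<theta>, Y)"
proof -
  have "clause_field (p - 1) [0] (\<theta> k) (block (p - 1) X k) = clause_field (p - 1) [0] (\<theta> k) (block (p - 1) Y k)" if "k < r" for k
  proof -
    have "clause_gain (p - 1) [0] (\<theta> k) (block (p - 1) X k) \<sigma> \<tau> = clause_gain (p - 1) [0] (\<theta> k) (block (p - 1) Y k) \<sigma> \<tau>" for \<sigma> \<tau>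
      unfolding clause_gain_def block_def
    proof (intro arg_cong2[where f = "(+)"] refl sum.cong)
      fix j assume j: "j \<in> {..<p - 1}"
      have "k * (p - 1) + j < Suc k * (p - 1)" using j by simp
      also have "\<dots> \<le> r * (p - 1)" using that by (intro mult_le_mono1) simp
      finally show "X (k * (p - 1) + j) (\<tau> j) = Y (k * (p - 1) + j) (\<tau> j)" using assms by (simp add: mult.commute)
    qed
    then show ?thesis by (simp add: clause_field_def[abs_def])
  qed
  then have "field_sum [0] r \<theta> X = field_sum [0] r \<theta> Y" unfolding field_sum_def by (intro sum.cong) auto
  then show ?thesis by (simp add: T_map_def root_energy_def)
qed

lemma integral_T:
  assumes L: "spin_law L" and h: "h \<in> borel_measurable spin_borel" "\<And>x. x \<in> space spin_borel \<Longrightarrow> 0 \<le> h x \<and> h x \<le> (1::real)"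
  shows "(\<integral>x. h x \<partial>T_infty S p \<alpha> \<psi> Q L) =
    (\<integral>r. \<integral>\<theta>. \<integral>X. h (T_map (r, \<theta>, X)) \<partial>iid L \<partial>iid Q \<partial>measure_pmf (poisson_pmf mean_degree))"
proof -
  let ?PQ = "iid Q" and ?PL = "iid L" and ?w = "measure_pmf (poisson_pmf mean_degree)"
  interpret PQ: prob_space ?PQ by (rule prob_QX(2))
  interpret PL: prob_space ?PL by (rule prob_QX(3)[OF L])
  interpret QX: prob_space "QX L" by (rule prob_QX(1)[OF L])
  interpret C: prob_space "cavity_law p \<alpha> Q L" by (rule prob_cavity_law[OF L])
  interpret W: prob_space ?w by (rule prob_space_measure_pmf)
  interpret P: pair_prob_space ?PQ ?PL ..
  interpret P2: pair_prob_space ?w "QX L" ..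
  have m: "(\<lambda>z. h (T_map z)) \<in> borel_measurable (cavity_law p \<alpha> Q L)" by (rule measurable_compose[OF T_map_measurable[OF L] h(1)])
  have Tsp: "T_map z \<in> space spin_borel" if "z \<in> space (cavity_law p \<alpha> Q L)" for z using measurable_space[OF T_map_measurable[OF L] that] .
  have i: "integrable (cavity_law p \<alpha> Q L) (\<lambda>z. h (T_map z))"
    by (rule bounded_integral(1)[OF C.prob_space_axioms m]) (use h(2) Tsp in auto)
  have "(\<integral>x. h x \<partial>T_infty S p \<alpha> \<psi> Q L) = (\<integral>z. h (T_map z) \<partial>cavity_law p \<alpha> Q L)"
    unfolding T_infty_eq[OF L] by (rule integral_distr[OF T_map_measurable[OF L] h(1)])
  also have "\<dots> = (\<integral>r. \<integral>y. h (T_map (r, y)) \<partial>QX L \<partial>?w)"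
    using P2.integral_fst'[OF i[unfolded cavity_law_alt]] unfolding cavity_law_alt by simp
  also have "\<dots> = (\<integral>r. \<integral>\<theta>. \<integral>X. h (T_map (r, \<theta>, X)) \<partial>?PL \<partial>?PQ \<partial>?w)"
  proof (rule Bochner_Integration.integral_cong[OF refl])
    fix r
    have sp: "(r, y) \<in> space (cavity_law p \<alpha> Q L)" if "y \<in> space (QX L)" for y
      using that by (simp add: cavity_law_alt space_pair_measure)
    have "(\<lambda>y. h (T_map (r, y))) \<in> borel_measurable (QX L)"
      using measurable_Pair2[OF m[unfolded cavity_law_alt], of r] by simp
    from bounded_integral(1)[OF QX.prob_space_axioms this] have "integrable (QX L) (\<lambda>y. h (T_map (r, y)))" using h(2) Tsp[OF sp] by auto
    from P.integral_fst'[OF this] show "(\<integral>y. h (T_map (r, y)) \<partial>QX L) = (\<integral>\<theta>. \<integral>X. h (T_map (r, \<theta>, X)) \<partial>?PL \<partial>?PQ)" by simp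
  qed
  finally show ?thesis .
qed

text \<open>
  For \<open>r\<close> clauses the result depends on \<open>(p - 1) r\<close> independent fields, and changing the law of one of
  them costs at most \<open>d\<close>. The cost never exceeds 1.
\<close>

lemma T_contraction:
  assumes L: "spin_law L" "spin_law L'" and tv_le: "tv_le L L' d" and d: "0 \<le> d"
  shows "tv_le (T_infty S p \<alpha> \<psi> Q L) (T_infty S p \<alpha> \<psi> Q L') (\<integral>r. min 1 (real (p - 1) * real r * d) \<partial>measure_pmf (poisson_pmf mean_degree))"
  unfolding tv_le_def
proof (intro ballI impI)
  fix h :: "(real \<Rightarrow> real) \<Rightarrow> real" assume h: "h \<in> borel_measurable spin_borel" "\<forall>x\<in>space spin_borel. 0 \<le> h x \<and> h x \<le> 1"
  let ?PQ = "iid Q" and ?w = "measure_pmf (poisson_pmf mean_degree)" and ?C = "iid spin_borel"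
  interpret PQ: prob_space ?PQ by (rule prob_QX(2))
  define B where "B L r \<theta> = (\<integral>X. h (T_map (r, \<theta>, X)) \<partial>iid L)" for L r \<theta>
  have T: "(\<integral>x. h x \<partial>T_infty S p \<alpha> \<psi> Q L) = (\<integral>r. \<integral>\<theta>. B L r \<theta> \<partial>?PQ \<partial>?w)" if "spin_law L" for L
    unfolding B_def by (rule integral_T[OF that h(1)]) (use h(2) in auto)
  have hm: "(\<lambda>X. h (T_map (r, \<theta>, X))) \<in> borel_measurable (iid L)"
    and hb: "X \<in> space (iid L) \<Longrightarrow> 0 \<le> h (T_map (r, \<theta>, X)) \<and> h (T_map (r, \<theta>, X)) \<le> 1"
    and Bm: "B L r \<in> borel_measurable ?PQ" and Bb: "0 \<le> B L r \<theta> \<and> B L r \<theta> \<le> 1"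
    if L: "spin_law L" and \<theta>: "\<theta> \<in> space ?PQ" for L r \<theta> X
  proof -
    interpret PL: prob_space "iid L" by (rule prob_QX(3)[OF L])
    have m: "(\<lambda>z. h (T_map z)) \<in> borel_measurable (measure_pmf (poisson_pmf mean_degree) \<Otimes>\<^sub>M QX L)"
      using measurable_compose[OF T_map_measurable[OF L] h(1)] by (simp add: cavity_law_alt)
    have m2: "(\<lambda>y. h (T_map (r, y))) \<in> borel_measurable (QX L)" for r using measurable_Pair2[OF m, of r] by simp
    show m3: "(\<lambda>X. h (T_map (r, \<theta>, X))) \<in> borel_measurable (iid L)"
      using measurable_Pair2[OF m2 \<theta>] by simp
    show "B L r \<in> borel_measurable ?PQ" unfolding B_def
      by (rule PL.borel_measurable_lebesgue_integral) (use m2 in \<open>simp add: case_prod_beta'\<close>)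
    have b: "0 \<le> h (T_map (r, \<theta>, X)) \<and> h (T_map (r, \<theta>, X)) \<le> 1" if "X \<in> space (iid L)" for X
    proof -
      have "(r, \<theta>, X) \<in> space (cavity_law p \<alpha> Q L)" using that \<theta> by (simp add: cavity_law_alt space_pair_measure)
      then show ?thesis using h(2) measurable_space[OF T_map_measurable[OF L]] by blast
    qed
    then show "X \<in> space (iid L) \<Longrightarrow> 0 \<le> h (T_map (r, \<theta>, X)) \<and> h (T_map (r, \<theta>, X)) \<le> 1" .
    show "0 \<le> B L r \<theta> \<and> B L r \<theta> \<le> 1" unfolding B_def using bounded_integral(2,3)[OF PL.prob_space_axioms m3] b by blast
  qed
  obtain \<theta>0 where \<theta>0: "\<theta>0 \<in> space ?PQ" using PQ.not_empty by blast
  note Bm' = Bm[OF _ \<theta>0]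
  have Bi: "integrable ?PQ (B L r)" "0 \<le> (\<integral>\<theta>. B L r \<theta> \<partial>?PQ)" "(\<integral>\<theta>. B L r \<theta> \<partial>?PQ) \<le> 1" if "spin_law L" for L r
    by (rule bounded_integral[OF PQ.prob_space_axioms Bm'[OF that] Bb[OF that]], assumption)+
  have step: "\<bar>(\<integral>\<theta>. B L r \<theta> \<partial>?PQ) - (\<integral>\<theta>. B L' r \<theta> \<partial>?PQ)\<bar> \<le> min 1 (real (p - 1) * real r * d)" for r
  proof -
    have "\<bar>B L r \<theta> - B L' r \<theta>\<bar> \<le> real (p - 1) * real r * d" if \<theta>: "\<theta> \<in> space ?PQ" for \<theta>
    proof -
      have sc: "sets ?C = sets (iid L)" "space ?C = space (iid L)"
        using L(1) spin_law_space[OF L(1)] by (auto intro!: sets_PiM_cong simp: spin_law_def space_PiM)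
      have "\<bar>B L r \<theta> - B L' r \<theta>\<bar> \<le> real ((p - 1) * r) * d"
        unfolding B_def
      proof (rule tv_le_sequence[OF L tv_le d])
        show "(\<lambda>X. h (T_map (r, \<theta>, X))) \<in> borel_measurable ?C"
          using hm[OF L(1) \<theta>, of r] measurable_cong_sets[OF sc(1) refl] by blast
        show "0 \<le> h (T_map (r, \<theta>, X)) \<and> h (T_map (r, \<theta>, X)) \<le> 1" if "X \<in> space ?C" for X using hb[OF L(1) \<theta>] that sc(2) by simp
      qed (rule arg_cong[of _ _ h], rule T_map_local)
      then show ?thesis by simp
    qed
    then have "\<bar>\<integral>\<theta>. B L r \<theta> - B L' r \<theta> \<partial>?PQ\<bar> \<le> (\<integral>\<theta>. real (p - 1) * real r * d \<partial>?PQ)"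
      by (intro integral_abs_bound[THEN order_trans] integral_mono) (auto intro!: Bochner_Integration.integrable_diff Bi L)
    then have "\<bar>(\<integral>\<theta>. B L r \<theta> \<partial>?PQ) - (\<integral>\<theta>. B L' r \<theta> \<partial>?PQ)\<bar> \<le> real (p - 1) * real r * d"
      using Bi(1)[OF L(1)] Bi(1)[OF L(2)] by (simp add: PQ.prob_space)
    then show ?thesis using Bi(2,3)[OF L(1), of r] Bi(2,3)[OF L(2), of r] by auto
  qed
  have i: "integrable ?w (\<lambda>r. \<integral>\<theta>. B L r \<theta> \<partial>?PQ)" if "spin_law L" for L
    by (rule measure_pmf.integrable_const_bound[of _ 1]) (use Bi[OF that] in auto)
  have "\<bar>\<integral>r. (\<integral>\<theta>. B L r \<theta> \<partial>?PQ) - (\<integral>\<theta>. B L' r \<theta> \<partial>?PQ) \<partial>?w\<bar> \<le> (\<integral>r. min 1 (real (p - 1) * real r * d) \<partial>?w)"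
  proof (rule integral_abs_bound[THEN order_trans], rule integral_mono)
    show "integrable ?w (\<lambda>r. \<bar>(\<integral>\<theta>. B L r \<theta> \<partial>?PQ) - (\<integral>\<theta>. B L' r \<theta> \<partial>?PQ)\<bar>)" using i[OF L(1)] i[OF L(2)] by auto
    show "integrable ?w (\<lambda>r. min 1 (real (p - 1) * real r * d))"
      by (rule measure_pmf.integrable_const_bound[of _ 1]) (use d in auto)
  qed (rule step)
  then show "\<bar>(\<integral>x. h x \<partial>T_infty S p \<alpha> \<psi> Q L) - (\<integral>x. h x \<partial>T_infty S p \<alpha> \<psi> Q L')\<bar> \<le> (\<integral>r. min 1 (real (p - 1) * real r * d) \<partial>?w)"
    unfolding T[OF L(1)] T[OF L(2)] using i[OF L(1)] i[OF L(2)] by simp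
qed

abbreviation "T_op \<equiv> T_infty S p \<alpha> \<psi> Q"

lemma iter_spin_law: "spin_law L \<Longrightarrow> spin_law ((T_op ^^ n) L)"
  by (induct n) (auto intro: T_spin_law)

lemma iter_tv_le: assumes "spin_law L" "spin_law L'" shows "tv_le ((T_op ^^ n) L) ((T_op ^^ n) L') (survival n)"
proof (induct n)
  case 0 then show ?case using tv_le_le_one[OF assms] by simp
next
  case (Suc n)
  from T_contraction[OF iter_spin_law[OF assms(1)] iter_spin_law[OF assms(2)] Suc survival_props(1)] show ?case by simp
qed

text \<open>
  Both laws are their own iterates, hence within \<open>survival n\<close> of each other for every \<open>n\<close>.
\<close>

lemma fixed_point_unique:
  assumes "L \<in> Pr1 S" "L' \<in> Pr1 S" "T_op L = L" "T_op L' = L'" shows "L = L'"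
proof (rule tv_le_measure_eqI)
  show c: "spin_law L" "spin_law L'" using assms by (auto intro: Pr1_spin_law)
  fix d :: real assume "0 < d"
  with order_tendstoD(2)[OF survival_props(3)] obtain n where n: "survival n < d" by (auto simp: eventually_sequentially)
  have "(T_op ^^ n) L = L" "(T_op ^^ n) L' = L'" for n using assms by (induct n) auto
  then have "tv_le L L' (survival n)" using iter_tv_le[OF c, of n] by simp
  then show "tv_le L L' d" using n unfolding tv_le_def by fastforce
qed

text \<open>
  A function with values in the unit interval is up to \<open>1 / N\<close> the average of the indicators of its
  level sets \<open>i / N \<le> h\<close>.
\<close>

lemma tv_le_from_sets:
  assumes L: "spin_law L" "spin_law L'" and d: "\<And>A. A \<in> sets spin_borel \<Longrightarrow> \<bar>measure L A - measure L' A\<bar> \<le> d"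
  shows "tv_le L L' d"
  unfolding tv_le_def
proof (intro ballI impI)
  fix h :: "(real \<Rightarrow> real) \<Rightarrow> real" assume h[measurable]: "h \<in> borel_measurable spin_borel" and hb: "\<forall>x\<in>space spin_borel. 0 \<le> h x \<and> h x \<le> 1"
  show "\<bar>(\<integral>x. h x \<partial>L) - (\<integral>x. h x \<partial>L')\<bar> \<le> d"
  proof (rule field_le_epsilon)
    fix e :: real assume e: "0 < e"
    obtain N where N: "0 < N" "1 / real N < e / 2"
      using reals_Archimedean[of "e/2"] e by (metis inverse_eq_divide zero_less_Suc half_gt_zero)
    define A where "A i = {x \<in> space spin_borel. real i / real N \<le> h x}" for i
    have A[measurable]: "A i \<in> sets spin_borel" for i unfolding A_def by measurable
    define g where "g x = (\<Sum>i\<in>{1..N}. 1 / real N * indicator (A i) x)" for x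
    have approx: "\<bar>h x - g x\<bar> \<le> 1 / real N" if x: "x \<in> space spin_borel" for x
    proof -
      let ?y = "real N * h x"
      have y: "0 \<le> ?y" "?y \<le> real N" using hb x by (auto simp: mult_left_le)
      have ind: "indicator (A i) x = (if i \<in> {1..nat \<lfloor>?y\<rfloor>} then 1 else 0 :: real)" if "i \<in> {1..N}" for i
      proof -
        have "real i / real N \<le> h x \<longleftrightarrow> real i \<le> ?y" using N by (simp add: field_simps)
        also have "\<dots> \<longleftrightarrow> i \<le> nat \<lfloor>?y\<rfloor>" using y by (simp add: le_nat_floor le_floor_iff nat_le_iff le_nat_iff)
        finally show ?thesis using x that by (auto simp: A_def indicator_def)
      qed
      have le: "nat \<lfloor>?y\<rfloor> \<le> N" using y by linarith
      have "(\<Sum>i\<in>{1..N}. indicator (A i) x) = (\<Sum>i\<in>{1..N}. if i \<in> {1..nat \<lfloor>?y\<rfloor>} then 1 else 0 :: real)" by (rule sum.cong) (use ind in auto)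
      also have "\<dots> = real (card ({1..N} \<inter> {1..nat \<lfloor>?y\<rfloor>}))" by (subst sum.inter_restrict[symmetric]) simp_all
      also have "{1..N} \<inter> {1..nat \<lfloor>?y\<rfloor>} = {1..nat \<lfloor>?y\<rfloor>}" using le by auto
      finally have "g x = real (nat \<lfloor>?y\<rfloor>) / real N" unfolding g_def sum_distrib_left[symmetric] by simp
      then have "real N * (h x - g x) = ?y - real (nat \<lfloor>?y\<rfloor>)" using N by (simp add: field_simps)
      moreover have "0 \<le> ?y - real (nat \<lfloor>?y\<rfloor>)" "?y - real (nat \<lfloor>?y\<rfloor>) \<le> 1" using y by linarith+
      ultimately have "\<bar>real N * (h x - g x)\<bar> \<le> 1" by simp
      then have "\<bar>h x - g x\<bar> * real N \<le> 1" by (simp only: abs_mult abs_of_nat mult.commute)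
      then show ?thesis using N(1) by (simp only: pos_le_divide_eq of_nat_0_less_iff)
    qed
    have each: "\<bar>(\<integral>x. h x \<partial>L) - (\<Sum>i\<in>{1..N}. 1 / real N * measure L (A i))\<bar> \<le> 1 / real N" if L: "spin_law L" for L
    proof -
      interpret prob_space L using L by (simp add: spin_law_def)
      have s[measurable_cong]: "sets L = sets spin_borel" using L by (simp add: spin_law_def)
      have hi: "integrable L h" by (rule bounded_integral(1)[OF prob_space_axioms]) (use hb spin_law_space[OF L] in auto)
      have Ai: "integrable L (\<lambda>x. 1 / real N * indicator (A i) x :: real)" for i by (intro integrable_mult_right integrable_real_indicator) (auto simp: less_top[symmetric])
      have gi: "integrable L g" unfolding g_def by (intro Bochner_Integration.integrable_sum Ai)
      have "(\<integral>x. g x \<partial>L) = (\<Sum>i\<in>{1..N}. 1 / real N * measure L (A i))"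
        unfolding g_def by (subst Bochner_Integration.integral_sum[OF Ai]) (simp add: s)
      moreover have "\<bar>\<integral>x. h x - g x \<partial>L\<bar> \<le> (\<integral>x. 1 / real N \<partial>L)"
        by (rule integral_abs_bound[THEN order_trans], rule integral_mono) (use hi gi approx spin_law_space[OF L] in auto)
      ultimately show ?thesis using hi gi by (simp add: prob_space)
    qed
    have "\<bar>(\<Sum>i\<in>{1..N}. 1 / real N * measure L (A i)) - (\<Sum>i\<in>{1..N}. 1 / real N * measure L' (A i))\<bar> \<le> d"
    proof -
      have "\<bar>(\<Sum>i\<in>{1..N}. 1 / real N * measure L (A i)) - (\<Sum>i\<in>{1..N}. 1 / real N * measure L' (A i))\<bar>
        \<le> (\<Sum>i\<in>{1..N}. 1 / real N * \<bar>measure L (A i) - measure L' (A i)\<bar>)"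
        unfolding sum_subtractf[symmetric] right_diff_distrib[symmetric]
        by (rule order_trans[OF sum_abs]) (simp add: abs_mult)
      also have "\<dots> \<le> (\<Sum>i\<in>{1..N}. 1 / real N * d)" by (intro sum_mono mult_left_mono d A) auto
      also have "\<dots> = d" using N by simp
      finally show ?thesis .
    qed
    with each[OF L(1)] each[OF L(2)] N(2) show "\<bar>(\<integral>x. h x \<partial>L) - (\<integral>x. h x \<partial>L')\<bar> \<le> d + e" by linarith
  qed
qed

text \<open>Convergence in total variation is uniform over the events, and a uniform limit of measures is a
  measure.\<close>

lemma tv_le_limit_exists:
  assumes c: "\<And>n. spin_law (l n)" and cau: "\<And>n k. tv_le (l n) (l (n + k)) (q n)" and q: "q \<longlonglongrightarrow> 0"
  shows "\<exists>M. spin_law M \<and> (\<forall>n. tv_le (l n) M (q n))"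
proof -
  interpret l: prob_space "l n" for n using c by (simp add: spin_law_def)
  have s: "sets (l n) = sets spin_borel" for n using c by (simp add: spin_law_def)
  have d: "\<bar>measure (l n) A - measure (l (n + k)) A\<bar> \<le> q n" if A: "A \<in> sets spin_borel" for n k A
  proof -
    have "(indicator A :: _ \<Rightarrow> real) \<in> borel_measurable spin_borel" using A by simp
    then have "\<bar>(\<integral>x. indicator A x \<partial>l n) - (\<integral>x. indicator A x \<partial>l (n + k))\<bar> \<le> q n"
      using cau[of n k] unfolding tv_le_def by (auto simp: indicator_def)
    then show ?thesis using A by (simp add: s)
  qed
  define mu where "mu A = lim (\<lambda>n. measure (l n) A)" for A
  have lim: "(\<lambda>n. measure (l n) A) \<longlonglongrightarrow> mu A" if A: "A \<in> sets spin_borel" for A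
  proof -
    have "Cauchy (\<lambda>n. measure (l n) A)"
    proof (rule metric_CauchyI)
      fix e :: real assume "0 < e"
      then have "eventually (\<lambda>n. q n < e / 2) sequentially" by (intro order_tendstoD(2)[OF q]) simp
      then obtain M where M: "q M < e / 2" by (auto simp: eventually_sequentially)
      show "\<exists>M. \<forall>m\<ge>M. \<forall>n\<ge>M. dist (measure (l m) A) (measure (l n) A) < e"
      proof (intro exI[of _ M] allI impI)
        fix m n assume "M \<le> m" "M \<le> n"
        then obtain i j where ij: "m = M + i" "n = M + j" by (metis le_Suc_ex)
        show "dist (measure (l m) A) (measure (l n) A) < e"
          using d[OF A, of M i] d[OF A, of M j] M unfolding ij dist_real_def by linarith
      qed
    qed
    then show ?thesis unfolding mu_def using Cauchy_convergent_iff convergent_LIMSEQ_iff by blast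
  qed
  have dm: "\<bar>measure (l n) A - mu A\<bar> \<le> q n" if A: "A \<in> sets spin_borel" for n A
  proof (rule LIMSEQ_le_const2)
    show "(\<lambda>k. \<bar>measure (l n) A - measure (l (n + k)) A\<bar>) \<longlonglongrightarrow> \<bar>measure (l n) A - mu A\<bar>"
      using LIMSEQ_ignore_initial_segment[OF lim[OF A], of n] by (intro tendsto_intros) (simp add: add.commute)
  qed (use d[OF A] in auto)
  have mu0: "0 \<le> mu A" if "A \<in> sets spin_borel" for A by (rule LIMSEQ_le_const[OF lim[OF that]]) auto
  let ?f = "\<lambda>A. ennreal (mu A)"
  define M where "M = measure_of (space spin_borel) (sets spin_borel) ?f"
  have "mu {} = 0" using LIMSEQ_unique[OF lim[of "{}"]] by simp
  have pos: "positive (sets spin_borel) ?f" using \<open>mu {} = 0\<close> by (simp add: positive_def)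
  have add: "additive (sets spin_borel) ?f"
    unfolding additive_def
  proof (intro ballI impI)
    fix x y assume xy: "x \<in> sets spin_borel" "y \<in> sets spin_borel" "x \<inter> y = {}"
    have "(\<lambda>n. measure (l n) x + measure (l n) y) \<longlonglongrightarrow> mu x + mu y" by (intro tendsto_add lim xy)
    moreover have "measure (l n) x + measure (l n) y = measure (l n) (x \<union> y)" for n
      by (rule l.finite_measure_Union[symmetric]) (use xy s in auto)
    ultimately have "(\<lambda>n. measure (l n) (x \<union> y)) \<longlonglongrightarrow> mu x + mu y" by simp
    moreover have "(\<lambda>n. measure (l n) (x \<union> y)) \<longlonglongrightarrow> mu (x \<union> y)" by (rule lim) (use xy in auto)
    ultimately have "mu (x \<union> y) = mu x + mu y" by (metis LIMSEQ_unique)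
    then show "?f (x \<union> y) = ?f x + ?f y" using mu0 xy by simp
  qed
  \<comment> \<open>Countable additivity is continuity at the empty set, which passes to uniform limits.\<close>
  have ca: "countably_additive (sets spin_borel) ?f"
  proof (rule ring_of_sets.empty_continuous_imp_countably_additive[OF _ pos add])
    show "ring_of_sets (space spin_borel) (sets spin_borel)" by unfold_locales
    fix A :: "nat \<Rightarrow> (real \<Rightarrow> real) set"
    assume A: "range A \<subseteq> sets spin_borel" "decseq A" "(\<Inter>i. A i) = {}"
    have "(\<lambda>i. mu (A i)) \<longlonglongrightarrow> 0"
    proof (rule tendstoI)
      fix e :: real assume e: "0 < e"
      then have "eventually (\<lambda>n. q n < e / 2) sequentially" by (intro order_tendstoD(2)[OF q]) simp
      then obtain n where n: "q n < e / 2" by (auto simp: eventually_sequentially)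
      have "(\<lambda>i. measure (l n) (A i)) \<longlonglongrightarrow> measure (l n) (\<Inter>i. A i)"
        by (rule l.finite_Lim_measure_decseq) (use A s in auto)
      then have "(\<lambda>i. measure (l n) (A i)) \<longlonglongrightarrow> 0" by (simp add: A(3))
      then have "eventually (\<lambda>i. measure (l n) (A i) < e / 2) sequentially" by (rule order_tendstoD(2)) (use e in simp)
      then show "eventually (\<lambda>i. dist (mu (A i)) 0 < e) sequentially"
      proof eventually_elim
        fix i assume i: "measure (l n) (A i) < e / 2"
        have Ai: "A i \<in> sets spin_borel" using A(1) by auto
        show "dist (mu (A i)) 0 < e" using i n dm[OF Ai, of n] mu0[OF Ai] by (simp add: dist_real_def)
      qed
    qed
    then show "(\<lambda>i. ?f (A i)) \<longlonglongrightarrow> 0" by (metis ennreal_0 tendsto_ennrealI)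
  qed simp
  have em: "emeasure M A = ?f A" if "A \<in> sets spin_borel" for A
    unfolding M_def by (rule emeasure_measure_of_sigma[OF _ pos ca that]) (rule sets.sigma_algebra_axioms)
  have sM: "sets M = sets spin_borel" unfolding M_def by (rule sets.sets_measure_of_eq)
  have "mu (space spin_borel) = 1"
  proof -
    have "measure (l n) (space spin_borel) = 1" for n using l.prob_space[of n] sets_eq_imp_space_eq[OF s[of n]] by simp
    then show ?thesis using LIMSEQ_unique[OF lim[OF sets.top]] by simp
  qed
  then have "prob_space M" by (intro prob_spaceI) (simp add: em sets_eq_imp_space_eq[OF sM])
  then have cM: "spin_law M" using sM by (simp add: spin_law_def)
  have "measure M A = mu A" if "A \<in> sets spin_borel" for A using em[OF that] mu0[OF that] by (simp add: measure_def)
  then have "tv_le (l n) M (q n)" for n by (intro tv_le_from_sets c cM) (simp add: dm)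
  then show ?thesis using cM by blast
qed

lemma tv_le_trans: "tv_le L L' d \<Longrightarrow> tv_le L' L'' d' \<Longrightarrow> tv_le L L'' (d + d')"
  unfolding tv_le_def
proof (intro ballI impI)
  fix h :: "(real \<Rightarrow> real) \<Rightarrow> real"
  assume "\<forall>h\<in>borel_measurable spin_borel. (\<forall>x\<in>space spin_borel. 0 \<le> h x \<and> h x \<le> 1) \<longrightarrow> \<bar>(\<integral>x. h x \<partial>L) - (\<integral>x. h x \<partial>L')\<bar> \<le> d"
    "\<forall>h\<in>borel_measurable spin_borel. (\<forall>x\<in>space spin_borel. 0 \<le> h x \<and> h x \<le> 1) \<longrightarrow> \<bar>(\<integral>x. h x \<partial>L') - (\<integral>x. h x \<partial>L'')\<bar> \<le> d'"
    "h \<in> borel_measurable spin_borel" "\<forall>x\<in>space spin_borel. 0 \<le> h x \<and> h x \<le> 1"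
  then have "\<bar>(\<integral>x. h x \<partial>L) - (\<integral>x. h x \<partial>L')\<bar> \<le> d" "\<bar>(\<integral>x. h x \<partial>L') - (\<integral>x. h x \<partial>L'')\<bar> \<le> d'" by blast+
  then show "\<bar>(\<integral>x. h x \<partial>L) - (\<integral>x. h x \<partial>L'')\<bar> \<le> d + d'" by linarith
qed

lemma tv_le_sym: "tv_le L L' d \<Longrightarrow> tv_le L' L d"
  unfolding tv_le_def by (simp add: abs_minus_commute)

lemma tv_le_mono: "tv_le L L' d \<Longrightarrow> d \<le> d' \<Longrightarrow> tv_le L L' d'"
  unfolding tv_le_def by fastforce

text \<open>
  The iterates from any law form a Cauchy sequence because the \<open>(n + k)\<close>-th iterate is the \<open>n\<close>-th iterate
  from another starting law.
\<close>

lemma fixed_point_exists: "\<exists>L\<in>Pr1 S. T_op L = L"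
proof -
  define L0 where "L0 = return spin_borel (\<lambda>t\<in>S. 0 :: real)"
  have c0: "spin_law L0" unfolding spin_law_def L0_def
    by (auto intro!: prob_space_return simp: space_spin_borel extensional_def)
  define l where "l n = (T_op ^^ n) L0" for n
  have c: "spin_law (l n)" for n unfolding l_def by (rule iter_spin_law[OF c0])
  have cau: "tv_le (l n) (l (n + k)) (survival n)" for n k
    unfolding l_def funpow_add using iter_tv_le[OF c0 iter_spin_law[OF c0, of k], of n] by simp
  obtain M where M: "spin_law M" "\<And>n. tv_le (l n) M (survival n)" using tv_le_limit_exists[OF c cau survival_props(3)] by blast
  have "T_op M = M"
  proof (rule tv_le_measure_eqI[OF T_spin_law[OF M(1)] M(1)])
    fix d :: real assume "0 < d"
    then have "eventually (\<lambda>n. survival n < d / 2) sequentially" by (intro order_tendstoD(2)[OF survival_props(3)]) simp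
    then obtain n0 where n0: "\<And>n. n0 \<le> n \<Longrightarrow> survival n < d / 2" unfolding eventually_sequentially by blast
    define n where "n = n0"
    have n: "survival (Suc n) < d / 2" by (rule n0) (simp add: n_def)
    have 1: "tv_le (T_op (l n)) (T_op M) (survival (Suc n))" using T_contraction[OF c M(1) M(2) survival_props(1)] by simp
    have "tv_le (T_op M) M (survival (Suc n) + survival (Suc n))"
      by (rule tv_le_trans[OF tv_le_sym[OF 1]]) (use M(2)[of "Suc n"] in \<open>simp add: l_def\<close>)
    then show "tv_le (T_op M) M d" by (rule tv_le_mono) (use n in linarith)
  qed
  then show ?thesis using T_Pr1[OF M(1)] by metis
qed

section \<open>The limit of the mean energy\<close>

lemma fixed_point_normalised:
  assumes L: "L \<in> Pr1 S" "T_op L = L" shows "AE x in L. maxE (site 0 x) = 0"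
proof -
  note cp = Pr1_spin_law[OF L(1)]
  have "AE x in distr (cavity_law p \<alpha> Q L) spin_borel T_map. maxE (site 0 x) = 0"
  proof (subst AE_distr_iff[OF T_map_measurable[OF cp]])
    show "{x \<in> space spin_borel. maxE (site 0 x) = 0} \<in> sets spin_borel" by measurable
    show "AE z in cavity_law p \<alpha> Q L. maxE (site 0 (T_map z)) = 0"
    proof (rule AE_I2)
      fix z assume z: "z \<in> space (cavity_law p \<alpha> Q L)"
      let ?W = "root_energy (fst z) (fst (snd z)) (snd (snd z))"
      have W: "?W \<in> energies" by (rule root_energy_energies) (use cavity_space[OF cp z] in auto)
      have "maxE (site 0 (T_map z)) = maxE (\<lambda>\<sigma>. ?W \<sigma> + (- maxE ?W))"
        by (rule maxE_cong) (simp add: site_def T_map_def normalise_def configs_iff root_energy_self[symmetric])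
      also have "\<dots> = 0" by (subst maxE_add_const[OF W]) simp
      finally show "maxE (site 0 (T_map z)) = 0" .
    qed
  qed
  then show ?thesis unfolding T_infty_eq[OF cp, symmetric] L(2) .
qed

text \<open>
  A field of law \<open>L\<close> is distributed as the root energy minus its maximum. Observables commute with
  constants, so the maximum cancels in the difference.
\<close>

lemma fixed_point_equation:
  assumes L: "L \<in> Pr1 S" "T_op L = L" and F: "\<Phi> \<in> observables" and U: "U \<in> energies" "U' \<in> energies"
  shows "avg (site_law L a) \<Phi> U - avg (site_law L a) \<Phi> U' =
      avg (cpoisson (field_law L [a]) mean_degree) \<Phi> (U + site a \<psi>) - avg (cpoisson (field_law L [a]) mean_degree) \<Phi> (U' + site a \<psi>)"
proof -
  note cp = Pr1_spin_law[OF L(1)]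
  let ?C = "cavity_law p \<alpha> Q L"
  let ?H = "\<lambda>z. field_sum [a] (fst z) (fst (snd z)) (snd (snd z))"
  let ?W = "\<lambda>z. root_energy (fst z) (fst (snd z)) (snd (snd z))"
  have kp: "increment (cpoisson (field_law L [a]) mean_degree)" by (rule increment_cpoisson[OF increment_field_law[OF L(1)] mean_degree_pos])
  have sm: "(\<lambda>x. \<Phi> (V + site a x)) \<in> borel_measurable spin_borel" if "V \<in> energies" for V
    by (rule measurable_compose[OF shiftL_measurable[OF that] observables_meas[OF F]]) measurable
  have A: "avg (site_law L a) \<Phi> V = (\<integral>z. \<Phi> (V + site a (T_map z)) \<partial>?C)" "integrable ?C (\<lambda>z. \<Phi> (V + site a (T_map z)))" if V: "V \<in> energies" for V
  proof -
    have "avg (site_law L a) \<Phi> V = (\<integral>x. \<Phi> (V + site a x) \<partial>distr ?C spin_borel T_map)"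
      unfolding avg_site_law[OF L(1) F V] using L(2) by (simp add: T_infty_eq[OF cp])
    also have "\<dots> = (\<integral>z. \<Phi> (V + site a (T_map z)) \<partial>?C)"
      by (rule integral_distr[OF T_map_measurable[OF cp] sm[OF V]])
    finally show "avg (site_law L a) \<Phi> V = (\<integral>z. \<Phi> (V + site a (T_map z)) \<partial>?C)" .
    have "integrable L (\<lambda>x. \<Phi> (V + site a x))"
      by (rule avg_distr_integrable[OF increment_site_law[OF L(1), unfolded site_law_def] F V]) (use Pr1D(2)[OF L(1)] in measurable)
    then have "integrable (distr ?C spin_borel T_map) (\<lambda>x. \<Phi> (V + site a x))" using L(2) by (simp add: T_infty_eq[OF cp])
    then show "integrable ?C (\<lambda>z. \<Phi> (V + site a (T_map z)))"
      by (subst (asm) integrable_distr_eq[OF T_map_measurable[OF cp] sm[OF V]])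
  qed
  have B: "avg (cpoisson (field_law L [a]) mean_degree) \<Phi> V = (\<integral>z. \<Phi> (V + ?H z) \<partial>?C)" "integrable ?C (\<lambda>z. \<Phi> (V + ?H z))" if V: "V \<in> energies" for V
  proof -
    show "avg (cpoisson (field_law L [a]) mean_degree) \<Phi> V = (\<integral>z. \<Phi> (V + ?H z) \<partial>?C)"
      unfolding cavity_law_field_sum[OF L(1), symmetric] by (rule avg_distr[OF F V field_sum_measurable'[OF cp]])
    show "integrable ?C (\<lambda>z. \<Phi> (V + ?H z))"
      by (rule avg_distr_integrable[OF _ F V field_sum_measurable'[OF cp]]) (use kp in \<open>simp add: cavity_law_field_sum[OF L(1)]\<close>)
  qed
  have eq: "\<Phi> (V + site a (T_map z)) = \<Phi> (V + site a \<psi> + ?H z) - maxE (?W z)" if V: "V \<in> energies" and z: "z \<in> space ?C" for V z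
  proof -
    have sp: "fst (snd z) k \<in> space clause_borel" "snd (snd z) k \<in> space spin_borel" for k using cavity_space[OF cp z] .
    have HC: "?H z \<in> energies" by (rule field_sum_energies) (use sp in auto)
    have WC: "?W z \<in> energies" by (rule root_energy_energies) (use sp in auto)
    have TC: "site a (T_map z) \<in> energies" using normalise_space[OF WC] by (intro site_energies) (simp add: T_map_def space_spin_borel)
    have "\<Phi> (V + site a (T_map z)) = \<Phi> (V + site a \<psi> + ?H z + (\<lambda>_. - maxE (?W z)))"
    proof (rule observables_eq_on_configs[OF F])
      fix \<sigma> assume "\<sigma> \<in> configs"
      then have "site a (T_map z) \<sigma> = (site a \<psi> + ?H z) \<sigma> - maxE (?W z)"
        unfolding root_energy_coord by (simp add: site_def T_map_def normalise_def configs_iff)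
      then show "(V + site a (T_map z)) \<sigma> = (V + site a \<psi> + ?H z + (\<lambda>_. - maxE (?W z))) \<sigma>"
        by (simp add: plus_fun_apply)
    qed (use V TC HC psi_energies in auto)
    also have "\<dots> = \<Phi> (V + site a \<psi> + ?H z) - maxE (?W z)"
      by (subst observables_shift[OF F]) (use V HC psi_energies in auto)
    finally show ?thesis .
  qed
  have V: "U + site a \<psi> \<in> energies" "U' + site a \<psi> \<in> energies" using U psi_energies by auto
  have "avg (site_law L a) \<Phi> U - avg (site_law L a) \<Phi> U' = (\<integral>z. \<Phi> (U + site a (T_map z)) - \<Phi> (U' + site a (T_map z)) \<partial>?C)"
    unfolding A(1)[OF U(1)] A(1)[OF U(2)] by (rule Bochner_Integration.integral_diff[symmetric]; rule A(2); rule U)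
  moreover have "\<dots> = (\<integral>z. \<Phi> (U + site a \<psi> + ?H z) - \<Phi> (U' + site a \<psi> + ?H z) \<partial>?C)"
  proof (rule Bochner_Integration.integral_cong[OF refl])
    fix z assume z: "z \<in> space ?C"
    show "\<Phi> (U + site a (T_map z)) - \<Phi> (U' + site a (T_map z)) = \<Phi> (U + site a \<psi> + ?H z) - \<Phi> (U' + site a \<psi> + ?H z)"
      using eq[OF U(1) z] eq[OF U(2) z] by linarith
  qed
  moreover have "\<dots> = avg (cpoisson (field_law L [a]) mean_degree) \<Phi> (U + site a \<psi>) - avg (cpoisson (field_law L [a]) mean_degree) \<Phi> (U' + site a \<psi>)"
    unfolding B(1)[OF V(1)] B(1)[OF V(2)] by (rule Bochner_Integration.integral_diff; rule B(2); rule V)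
  ultimately show ?thesis by simp
qed

lemma cavity_fixed_point:
  assumes "L \<in> Pr1 S" "T_op L = L" shows "cavity S p Q \<psi> \<alpha> L"
  by unfold_locales (fact assms(1) fixed_point_normalised[OF assms] fixed_point_equation[OF assms])+

text \<open>
  The messages at a vertex form a compound Poisson sum by \<open>cavity_law_field_sum\<close>, and the maximum of this
  sum and \<open>\<psi>\<close> is \<open>cavity_max\<close> by \<open>cavity_max_eq\<close>.
\<close>

lemma vertex_term:
  assumes L: "L \<in> Pr1 S"
  shows "avg (cpoisson (field_law L [a]) mean_degree) maxE (site a \<psi>) = (\<integral>(r, \<theta>, X). cavity_max S p \<psi> r \<theta> X \<partial>cavity_law p \<alpha> Q L)"
proof -
  note cp = Pr1_spin_law[OF L]
  have "avg (cpoisson (field_law L [a]) mean_degree) maxE (site a \<psi>)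
    = (\<integral>z. maxE (site a \<psi> + field_sum [a] (fst z) (fst (snd z)) (snd (snd z))) \<partial>cavity_law p \<alpha> Q L)"
    unfolding cavity_law_field_sum[OF L, symmetric] by (rule avg_distr[OF maxE_observables psi_energies field_sum_measurable'[OF cp]])
  also have "\<dots> = (\<integral>(r, \<theta>, X). cavity_max S p \<psi> r \<theta> X \<partial>cavity_law p \<alpha> Q L)"
  proof (rule Bochner_Integration.integral_cong[OF refl])
    fix z assume z: "z \<in> space (cavity_law p \<alpha> Q L)"
    have sp: "fst (snd z) k \<in> space clause_borel" "snd (snd z) k \<in> space spin_borel" for k using cavity_space[OF cp z] .
    show "maxE (site a \<psi> + field_sum [a] (fst z) (fst (snd z)) (snd (snd z))) = (case z of (r, \<theta>, X) \<Rightarrow> cavity_max S p \<psi> r \<theta> X)"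
      unfolding maxE_root_energy_coord[where \<theta> = "fst (snd z)" and X = "snd (snd z)", OF sp]
        cavity_max_eq[where \<theta> = "fst (snd z)" and X = "snd (snd z)", OF sp, symmetric]
      by (simp add: case_prod_beta')
  qed
  finally show ?thesis .
qed

lemma clause_SUP:
  assumes f: "f \<in> space clause_borel" "\<And>j. X j \<in> space spin_borel" and \<sigma>: "\<sigma> \<in> configs"
  shows "(SUP \<tau>\<in>cube. f \<tau> + (\<Sum>k<p. X k (\<tau> k))) = clause_field p [] f X \<sigma>"
proof -
  have "(\<lambda>\<tau>. f \<tau> + (\<Sum>k<p. X k (\<tau> k))) ` cube = clause_gain p [] f X \<sigma> ` configs"
  proof
    show "(\<lambda>\<tau>. f \<tau> + (\<Sum>k<p. X k (\<tau> k))) ` cube \<subseteq> clause_gain p [] f X \<sigma> ` configs"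
    proof
      fix y assume "y \<in> (\<lambda>\<tau>. f \<tau> + (\<Sum>k<p. X k (\<tau> k))) ` cube"
      then obtain \<tau> where \<tau>: "\<tau> \<in> cube" "y = f \<tau> + (\<Sum>k<p. X k (\<tau> k))" by blast
      let ?t = "\<lambda>j. if j < p then \<tau> j else \<sigma> 0"
      have "?t \<in> configs" using \<tau>(1) \<sigma> by (auto simp: configs_iff PiE_iff)
      moreover have "(\<lambda>j\<in>{..<p}. if j < p then ?t j else \<sigma> ([] ! (j - p))) = \<tau>"
        using \<tau>(1) by (auto simp: PiE_iff extensional_def fun_eq_iff)
      ultimately show "y \<in> clause_gain p [] f X \<sigma> ` configs" using \<tau>(2) by (intro image_eqI[of _ _ ?t]) (simp_all add: clause_gain_def)
    qed
    show "clause_gain p [] f X \<sigma> ` configs \<subseteq> (\<lambda>\<tau>. f \<tau> + (\<Sum>k<p. X k (\<tau> k))) ` cube"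
    proof
      fix y assume "y \<in> clause_gain p [] f X \<sigma> ` configs"
      then obtain \<tau> where \<tau>: "\<tau> \<in> configs" "y = clause_gain p [] f X \<sigma> \<tau>" by blast
      have "(\<lambda>j\<in>{..<p}. if j < p then \<tau> j else \<sigma> ([] ! (j - p))) = restrict \<tau> {..<p}" by (rule restrict_ext) auto
      then have "y = f (restrict \<tau> {..<p}) + (\<Sum>k<p. X k (restrict \<tau> {..<p} k))" unfolding \<tau>(2) clause_gain_def by simp
      moreover have "restrict \<tau> {..<p} \<in> cube" using \<tau>(1) by (auto simp: configs_iff)
      ultimately show "y \<in> (\<lambda>\<tau>. f \<tau> + (\<Sum>k<p. X k (\<tau> k))) ` cube" by blast
    qed
  qed
  then show ?thesis by (simp add: clause_field_def)
qed

text \<open>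
  A clause all of whose vertices are free sends a message to no vertex, that is, a constant. So a Poisson
  number of them with mean \<open>x\<close> contributes \<open>x\<close> times the mean of one.
\<close>

lemma clause_term:
  assumes L: "L \<in> Pr1 S" and x: "0 < x"
  shows "avg (cpoisson (field_law L []) x) maxE 0 =
    x * (\<integral>(f, X). (SUP \<sigma>\<in>cube. f \<sigma> + (\<Sum>k<p. X k (\<sigma> k))) \<partial>(Q \<Otimes>\<^sub>M iid L))"
proof -
  let ?M = "Q \<Otimes>\<^sub>M iid L"
  define c where "c = (\<integral>(f, X). (SUP \<sigma>\<in>cube. f \<sigma> + (\<Sum>k<p. X k (\<sigma> k))) \<partial>?M)"
  obtain s where s: "s \<in> configs" using configs_ne by auto
  interpret P: prob_space "iid L" by (rule prob_QX(3)[OF Pr1_spin_law[OF L]])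
  interpret QP: pair_prob_space Q "iid L" ..
  have km: "(\<lambda>y. clause_field p [] (fst y) (snd y)) \<in> measurable ?M energy_space" by (rule field_law_meas[OF Pr1D(2)[OF L]])
  have kd: "field_law L [] = distr ?M energy_space (\<lambda>y. clause_field p [] (fst y) (snd y))" by (simp add: field_law_def)
  have sp: "fst y \<in> space clause_borel" "snd y j \<in> space spin_borel" if "y \<in> space ?M" for y j
    using that L_seq_space[OF L] by (auto simp: space_pair_measure space_Q)
  let ?v = "\<lambda>y. clause_field p [] (fst y) (snd y) s"
  have c_eq: "c = (\<integral>y. ?v y \<partial>?M)"
    unfolding c_def
  proof (rule Bochner_Integration.integral_cong[OF refl])
    fix y assume y: "y \<in> space ?M"
    show "(case y of (f, X) \<Rightarrow> (SUP \<sigma>\<in>cube. f \<sigma> + (\<Sum>k<p. X k (\<sigma> k)))) = ?v y"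
      using clause_SUP[where X = "snd y", OF sp[OF y] s] by (simp add: case_prod_beta')
  qed
  have vint: "integrable ?M ?v"
  proof (rule Bochner_Integration.integrable_bound)
    show "integrable ?M (\<lambda>y. nrm (clause_field p [] (fst y) (snd y)))"
      using incrementD(3)[OF increment_field_law[OF L, of "[]"]] unfolding kd by (subst (asm) integrable_distr_eq[OF km nrm_measurable])
    show "?v \<in> borel_measurable ?M" by (rule eval_measurable'[OF km s])
    show "AE y in ?M. norm (?v y) \<le> norm (nrm (clause_field p [] (fst y) (snd y)))"
    proof (rule AE_I2)
      fix y assume y: "y \<in> space ?M"
      have "clause_field p [] (fst y) (snd y) \<in> energies" by (rule clause_field_energies) (use sp[OF y] in auto)
      then show "norm (?v y) \<le> norm (nrm (clause_field p [] (fst y) (snd y)))" using nrm_ge[OF _ s] by simp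
    qed
  qed
  have step: "avg (field_law L []) \<Phi> E = \<Phi> E + c" if F: "\<Phi> \<in> observables" and E: "E \<in> energies" for \<Phi> E
  proof -
    have "avg (field_law L []) \<Phi> E = (\<integral>y. \<Phi> (E + clause_field p [] (fst y) (snd y)) \<partial>?M)"
      unfolding kd by (rule avg_distr[OF F E km])
    also have "\<dots> = (\<integral>y. \<Phi> E + ?v y \<partial>?M)"
    proof (rule Bochner_Integration.integral_cong[OF refl])
      fix y assume y: "y \<in> space ?M"
      have fc: "clause_field p [] (fst y) (snd y) \<in> energies" by (rule clause_field_energies) (use sp[OF y] in auto)
      have "\<Phi> (E + clause_field p [] (fst y) (snd y)) = \<Phi> (E + (\<lambda>_. ?v y))"
      proof (rule observables_eq_on_configs[OF F])
        fix \<sigma> assume "\<sigma> \<in> configs"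
        then have "clause_field p [] (fst y) (snd y) \<sigma> = ?v y" by (intro depends_onD[OF clause_field_depends_on[of p "[]"]]) (use s in auto)
        then show "(E + clause_field p [] (fst y) (snd y)) \<sigma> = (E + (\<lambda>_. ?v y)) \<sigma>" by (simp add: plus_fun_apply)
      qed (use E fc in auto)
      then show "\<Phi> (E + clause_field p [] (fst y) (snd y)) = \<Phi> E + ?v y" by (simp add: observables_shift[OF F E])
    qed
    also have "\<dots> = \<Phi> E + c" using vint by (simp add: c_eq QP.prob_space)
    finally show ?thesis .
  qed
  have pw: "avg (iid_sum (field_law L []) r) maxE 0 = real r * c" for r
  proof (induct r)
    case 0
    then show ?case by (simp add: avg_iid_sum_0 increment_field_law L maxE_observables)
  next
    case (Suc r)
    have "avg (iid_sum (field_law L []) (Suc r)) maxE 0 = avg (field_law L []) (avg (iid_sum (field_law L []) r) maxE) 0"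
      by (rule avg_iid_sum_Suc[OF increment_field_law[OF L] maxE_observables energies_0])
    also have "\<dots> = real r * c + c" by (subst step) (auto intro!: avg_observables increment_iid_sum increment_field_law L maxE_observables simp: Suc)
    finally show ?case by (simp add: algebra_simps del: zero_fun_apply)
  qed
  have "avg (cpoisson (field_law L []) x) maxE 0 = (\<integral>r. real r * c \<partial>measure_pmf (poisson_pmf x))"
    unfolding avg_cpoisson(1)[OF increment_field_law[OF L] x maxE_observables energies_0] pw ..
  also have "\<dots> = x * c" using poisson_mean[OF x] by simp
  finally show ?thesis unfolding c_def .
qed

lemma mean_energy_limit:
  assumes "L \<in> Pr1 S" "T_op L = L"
  shows "(\<lambda>N. avg (cpoisson (random_clause {..<N} []) (\<alpha> * real N)) maxE (\<Sum>i<N. site i \<psi>) / real N) \<longlonglongrightarrow> P_infty S p \<alpha> \<psi> Q L"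
proof -
  interpret C: cavity S p Q \<psi> \<alpha> L by (rule cavity_fixed_point[OF assms])
  have pos: "0 < \<alpha> * real (p - 1)" using alpha_pos p_ge by simp
  have "real (p - 1) = real p - 1" using p_ge by simp
  then show ?thesis
    using C.graph_max_limit[OF vertex_term[OF assms(1)] clause_term[OF assms(1) pos]]
    unfolding P_infty_def C.graph_max_def by simp
qed

end

section \<open>Concentration\<close>

context spin_space
begin

text \<open>
  One random increment moves an observable by at most its norm, so it adds at most the second moment
  of that norm to the variance.
\<close>

lemma increment_second_moment:
  assumes k: "increment \<mu>" and b: "(\<integral>\<^sup>+Z. ennreal ((nrm Z)\<^sup>2) \<partial>\<mu>) \<le> ennreal b" "0 \<le> b"
    and F: "\<Phi> \<in> observables" "E \<in> energies"
  shows "(\<integral>\<^sup>+Z. ennreal ((\<Phi> (E + Z) - c)\<^sup>2) \<partial>\<mu>) \<le> ennreal (b + (avg \<mu> \<Phi> E - c)\<^sup>2)"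
proof -
  interpret prob_space \<mu> by (rule incrementD[OF k])
  note [measurable_cong] = incrementD(2)[OF k]
  have n2: "integrable \<mu> (\<lambda>Z. (nrm Z)\<^sup>2)"
    by (rule integrableI_nonneg) (use b in \<open>auto intro: le_less_trans\<close>)
  have n2b: "(\<integral>Z. (nrm Z)\<^sup>2 \<partial>\<mu>) \<le> b"
    by (subst integral_eq_nn_integral) (use b in \<open>auto intro: enn2real_leI\<close>)
  define Y where "Y Z = \<Phi> (E + Z) - \<Phi> E" for Z
  have Yi: "integrable \<mu> Y" unfolding Y_def[abs_def] using avg_integrable[OF k F] by simp
  have Yn: "(Y Z)\<^sup>2 \<le> (nrm Z)\<^sup>2" if "Z \<in> space \<mu>" for Z
  proof -
    have Z: "Z \<in> energies" using that increment_space[OF k] by simp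
    have "\<bar>Y Z\<bar> \<le> nrm Z" using observables_abs[OF F(1), of "E + Z" E] F(2) Z by (simp add: Y_def fun_diff_def plus_fun_apply)
    then show ?thesis using nrm_nonneg[OF Z] by (simp add: abs_le_square_iff[symmetric])
  qed
  have Y2: "integrable \<mu> (\<lambda>Z. (Y Z)\<^sup>2)"
    by (rule Bochner_Integration.integrable_bound[OF n2])
      (use Yi Yn in \<open>auto intro!: AE_I2 borel_measurable_power borel_measurable_integrable\<close>)
  have "(\<integral>Z. (Y Z)\<^sup>2 \<partial>\<mu>) \<le> (\<integral>Z. (nrm Z)\<^sup>2 \<partial>\<mu>)"
    by (rule integral_mono[OF Y2 n2 Yn])
  then have Y2b: "(\<integral>Z. (Y Z)\<^sup>2 \<partial>\<mu>) \<le> b" using n2b by linarith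
  define d where "d = \<Phi> E - c"
  define y where "y = (\<integral>Z. Y Z \<partial>\<mu>)"
  have eq: "(\<Phi> (E + Z) - c)\<^sup>2 = (Y Z)\<^sup>2 + Y Z * (2 * d) + d\<^sup>2" for Z
    by (simp add: Y_def d_def power2_eq_square algebra_simps)
  have int: "integrable \<mu> (\<lambda>Z. (\<Phi> (E + Z) - c)\<^sup>2)"
    unfolding eq using Yi Y2 by simp
  have KE: "avg \<mu> \<Phi> E - c = y + d"
    unfolding y_def Y_def d_def avg_def using avg_integrable[OF k F] by (simp add: prob_space)
  have "(\<integral>Z. (\<Phi> (E + Z) - c)\<^sup>2 \<partial>\<mu>) = (\<integral>Z. (Y Z)\<^sup>2 \<partial>\<mu>) + y * (2 * d) + d\<^sup>2"
    unfolding eq y_def using Yi Y2 by (simp add: prob_space)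
  also have "\<dots> \<le> b + (y + d)\<^sup>2"
  proof -
    have "(y + d)\<^sup>2 = y\<^sup>2 + y * (2 * d) + d\<^sup>2" by (simp add: power2_eq_square algebra_simps)
    then show ?thesis using Y2b zero_le_power2[of y] by linarith
  qed
  finally have "(\<integral>Z. (\<Phi> (E + Z) - c)\<^sup>2 \<partial>\<mu>) \<le> b + (avg \<mu> \<Phi> E - c)\<^sup>2" unfolding KE .
  then show ?thesis
    by (subst nn_integral_eq_integral[OF int]) (auto intro!: ennreal_leI)
qed

lemma iid_sum_second_moment:
  assumes k: "increment \<mu>" and b: "(\<integral>\<^sup>+Z. ennreal ((nrm Z)\<^sup>2) \<partial>\<mu>) \<le> ennreal b" "0 \<le> b"
    and F: "\<Phi> \<in> observables" "E \<in> energies"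
  shows "(\<integral>\<^sup>+Z. ennreal ((\<Phi> (E + Z) - c)\<^sup>2) \<partial>iid_sum \<mu> r) \<le> ennreal (real r * b + (avg (iid_sum \<mu> r) \<Phi> E - c)\<^sup>2)"
  using F(2)
proof (induct r arbitrary: E)
  case 0
  have "(\<lambda>Z. ennreal ((\<Phi> (E + Z) - c)\<^sup>2)) \<in> borel_measurable energy_space"
    by (rule measurable_compose[OF shift_energy_space[OF 0 refl]]) (use observables_meas[OF F(1)] in measurable)
  then show ?case by (simp add: nn_integral_iid_sum_0[OF k] avg_iid_sum_0[OF k F(1) 0])
next
  case (Suc r)
  interpret prob_space \<mu> by (rule incrementD[OF k])
  note kr = increment_iid_sum(1)[OF k, of r]
  have G: "avg (iid_sum \<mu> r) \<Phi> \<in> observables" by (rule avg_observables[OF kr F(1)])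
  have m: "(\<lambda>Z. ennreal ((\<Phi> (E + Z) - c)\<^sup>2)) \<in> borel_measurable energy_space"
    by (rule measurable_compose[OF shift_energy_space[OF Suc.prems refl]]) (use observables_meas[OF F(1)] in measurable)
  have "(\<lambda>Z. avg (iid_sum \<mu> r) \<Phi> (E + Z)) \<in> borel_measurable energy_space"
    by (rule measurable_compose[OF shift_energy_space[OF Suc.prems refl] observables_meas[OF G]])
  then have [measurable]: "(\<lambda>Z. avg (iid_sum \<mu> r) \<Phi> (E + Z)) \<in> borel_measurable \<mu>"
    using measurable_cong_sets[OF incrementD(2)[OF k] refl] by blast
  have "(\<integral>\<^sup>+Z. ennreal ((\<Phi> (E + Z) - c)\<^sup>2) \<partial>iid_sum \<mu> (Suc r)) =
    (\<integral>\<^sup>+Z. \<integral>\<^sup>+W. ennreal ((\<Phi> (E + (Z + W)) - c)\<^sup>2) \<partial>iid_sum \<mu> r \<partial>\<mu>)"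
    by (rule nn_integral_iid_sum_Suc[OF k m])
  also have "\<dots> \<le> (\<integral>\<^sup>+Z. ennreal (real r * b) + ennreal ((avg (iid_sum \<mu> r) \<Phi> (E + Z) - c)\<^sup>2) \<partial>\<mu>)"
  proof (rule nn_integral_mono)
    fix Z assume "Z \<in> space \<mu>"
    then have "E + Z \<in> energies" using increment_space[OF k] Suc.prems by auto
    from Suc.hyps[OF this] b(2)
    show "(\<integral>\<^sup>+W. ennreal ((\<Phi> (E + (Z + W)) - c)\<^sup>2) \<partial>iid_sum \<mu> r)
      \<le> ennreal (real r * b) + ennreal ((avg (iid_sum \<mu> r) \<Phi> (E + Z) - c)\<^sup>2)"
      by (simp add: add.assoc ennreal_plus[symmetric] del: ennreal_plus plus_fun_apply)
  qed
  also have "\<dots> = ennreal (real r * b) + (\<integral>\<^sup>+Z. ennreal ((avg (iid_sum \<mu> r) \<Phi> (E + Z) - c)\<^sup>2) \<partial>\<mu>)"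
    by (subst nn_integral_add) (auto simp: emeasure_space_1)
  also have "\<dots> \<le> ennreal (real r * b) + ennreal (b + (avg \<mu> (avg (iid_sum \<mu> r) \<Phi>) E - c)\<^sup>2)"
    by (rule add_left_mono, rule increment_second_moment[OF k b G Suc.prems])
  also have "\<dots> = ennreal (real (Suc r) * b + (avg (iid_sum \<mu> (Suc r)) \<Phi> E - c)\<^sup>2)"
    using b(2) by (simp add: avg_iid_sum_Suc[OF k F(1) Suc.prems] ennreal_plus[symmetric] algebra_simps del: ennreal_plus)
  finally show ?case .
qed

lemma avg_iid_sum_diff:
  assumes k: "increment \<mu>" and F: "\<Phi> \<in> observables" "E \<in> energies"
  shows "\<bar>avg (iid_sum \<mu> r) \<Phi> E - avg (iid_sum \<mu> s) \<Phi> E\<bar> \<le> \<bar>real r - real s\<bar> * mean_nrm \<mu>"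
proof -
  have step: "\<bar>avg (iid_sum \<mu> (s + n)) \<Phi> E - avg (iid_sum \<mu> s) \<Phi> E\<bar> \<le> real n * mean_nrm \<mu>" for s n
  proof (induct n)
    case (Suc n)
    have "\<bar>avg \<mu> (avg (iid_sum \<mu> (s + n)) \<Phi>) E - avg (iid_sum \<mu> (s + n)) \<Phi> E\<bar> \<le> mean_nrm \<mu>"
      by (rule avg_bound[OF k avg_observables[OF increment_iid_sum(1)[OF k] F(1)] F(2)])
    with Suc show ?case
      unfolding add_Suc_right avg_iid_sum_Suc[OF k F] of_nat_Suc distrib_right by linarith
  qed simp
  show ?thesis
  proof (cases "s \<le> r")
    case True
    then show ?thesis using step[of s "r - s"] by (simp add: of_nat_diff)
  next
    case False
    then show ?thesis using step[of r "s - r"] by (simp add: of_nat_diff abs_minus_commute)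
  qed
qed

text \<open>
  The mean is Lipschitz in the number of increments, so the Poisson fluctuation of that number costs
  another variance of order \<open>m\<close>. An integer centre close to \<open>m\<close> suffices.
\<close>

lemma cpoisson_second_moment:
  assumes k: "increment \<mu>" and b: "(\<integral>\<^sup>+Z. ennreal ((nrm Z)\<^sup>2) \<partial>\<mu>) \<le> ennreal b" "0 \<le> b"
    and F: "\<Phi> \<in> observables" "E \<in> energies" and m: "0 < m"
  obtains c where "(\<integral>\<^sup>+Z. ennreal ((\<Phi> (E + Z) - c)\<^sup>2) \<partial>cpoisson \<mu> m) \<le> ennreal (m * b + (m + 1) * (mean_nrm \<mu>)\<^sup>2)"
proof -
  \<comment> \<open>The centre is the mean for a fixed number of increments, which has to be an integer near \<open>m\<close>.\<close>
  define s where "s = nat \<lfloor>m\<rfloor>"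
  have s: "(m - real s)\<^sup>2 \<le> 1"
  proof -
    have "\<bar>m - real s\<bar> \<le> 1" unfolding s_def using m by linarith
    then show ?thesis by (simp add: abs_square_le_1)
  qed
  define c where "c = avg (iid_sum \<mu> s) \<Phi> E"
  let ?P = "measure_pmf (poisson_pmf m)"
  have i2: "integrable ?P (\<lambda>r. (real r)\<^sup>2)"
    by (rule integrableI_nonneg) (auto simp: poisson_second_moment[OF m])
  have e2: "(\<integral>r. (real r)\<^sup>2 \<partial>?P) = m\<^sup>2 + m"
    by (subst integral_eq_nn_integral) (use m in \<open>auto simp: poisson_second_moment simp del: ennreal_plus\<close>)
  note i1 = poisson_integrable[OF m]
  have m2: "(\<lambda>Z. ennreal ((\<Phi> (E + Z) - c)\<^sup>2)) \<in> borel_measurable energy_space"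
    by (rule measurable_compose[OF shift_energy_space[OF F(2) refl]]) (use observables_meas[OF F(1)] in measurable)
  let ?h = "\<lambda>r. real r * b + ((real r)\<^sup>2 + real r * (- 2 * real s) + (real s)\<^sup>2) * (mean_nrm \<mu>)\<^sup>2"
  have h: "?h r = real r * b + (real r - real s)\<^sup>2 * (mean_nrm \<mu>)\<^sup>2" for r
    by (simp add: power2_eq_square algebra_simps)
  have hi: "integrable ?P ?h" using i1 i2 by simp
  have "(\<integral>\<^sup>+Z. ennreal ((\<Phi> (E + Z) - c)\<^sup>2) \<partial>cpoisson \<mu> m) =
    (\<integral>\<^sup>+r. \<integral>\<^sup>+Z. ennreal ((\<Phi> (E + Z) - c)\<^sup>2) \<partial>iid_sum \<mu> r \<partial>?P)"
    by (rule nn_integral_cpoisson[OF k m2])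
  also have "\<dots> \<le> (\<integral>\<^sup>+r. ennreal (?h r) \<partial>?P)"
  proof (rule nn_integral_mono)
    fix r
    have "(avg (iid_sum \<mu> r) \<Phi> E - c)\<^sup>2 \<le> (\<bar>real r - real s\<bar> * mean_nrm \<mu>)\<^sup>2"
      using avg_iid_sum_diff[OF k F, of r s] mean_nrm_nonneg[OF k] by (simp add: c_def abs_le_square_iff[symmetric])
    then have "real r * b + (avg (iid_sum \<mu> r) \<Phi> E - c)\<^sup>2 \<le> ?h r"
      unfolding h by (simp add: power_mult_distrib)
    then show "(\<integral>\<^sup>+Z. ennreal ((\<Phi> (E + Z) - c)\<^sup>2) \<partial>iid_sum \<mu> r) \<le> ennreal (?h r)"
      by (rule order_trans[OF iid_sum_second_moment[OF k b F] ennreal_leI])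
  qed
  also have "\<dots> = ennreal (\<integral>r. ?h r \<partial>?P)"
    by (rule nn_integral_eq_integral[OF hi], unfold h) (use b(2) in simp)
  also have "(\<integral>r. ?h r \<partial>?P) = m * b + (m\<^sup>2 + m + m * (- 2 * real s) + (real s)\<^sup>2) * (mean_nrm \<mu>)\<^sup>2"
    using i1 i2 by (simp add: e2 poisson_mean[OF m])
  also have "m\<^sup>2 + m + m * (- 2 * real s) + (real s)\<^sup>2 = m + (m - real s)\<^sup>2"
    by (simp add: power2_eq_square algebra_simps)
  also have "ennreal (m * b + (m + (m - real s)\<^sup>2) * (mean_nrm \<mu>)\<^sup>2) \<le> ennreal (m * b + (m + 1) * (mean_nrm \<mu>)\<^sup>2)"
    by (intro ennreal_leI add_left_mono mult_right_mono) (use s in auto)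
  finally show thesis by (rule that)
qed

text \<open>
  From the second moment around some \<open>c\<close> to the first absolute moment, by \<open>\<bar>x\<bar> \<le> x\<^sup>2 / (2 t) + t / 2\<close>;
  replacing \<open>c\<close> by the mean at most doubles the latter.
\<close>

lemma cpoisson_mean_deviation:
  assumes k: "increment \<mu>" and b: "(\<integral>\<^sup>+Z. ennreal ((nrm Z)\<^sup>2) \<partial>\<mu>) \<le> ennreal b" "0 \<le> b"
    and F: "\<Phi> \<in> observables" "E \<in> energies" and m: "0 < m" and t: "0 < t"
  shows "(\<integral>Z. \<bar>\<Phi> (E + Z) - avg (cpoisson \<mu> m) \<Phi> E\<bar> \<partial>cpoisson \<mu> m) \<le> (m * b + (m + 1) * (mean_nrm \<mu>)\<^sup>2) / t + t"
proof -
  let ?M = "cpoisson \<mu> m"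
  define V where "V = m * b + (m + 1) * (mean_nrm \<mu>)\<^sup>2"
  have V: "0 \<le> V" unfolding V_def using b(2) m by simp
  obtain c where c: "(\<integral>\<^sup>+Z. ennreal ((\<Phi> (E + Z) - c)\<^sup>2) \<partial>?M) \<le> ennreal V"
    using cpoisson_second_moment[OF k b F m] unfolding V_def by blast
  note kp = increment_cpoisson[OF k m]
  interpret prob_space ?M by (rule incrementD[OF kp])
  note i = avg_integrable[OF kp F]
  have i2: "integrable ?M (\<lambda>Z. (\<Phi> (E + Z) - c)\<^sup>2)"
    by (rule integrableI_nonneg) (use c i in \<open>auto intro: le_less_trans intro!: borel_measurable_power borel_measurable_diff borel_measurable_integrable\<close>)
  have V2: "(\<integral>Z. (\<Phi> (E + Z) - c)\<^sup>2 \<partial>?M) \<le> V"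
    by (subst integral_eq_nn_integral) (use c V i2 in \<open>auto intro: enn2real_leI\<close>)
  define D where "D = (\<integral>Z. \<bar>\<Phi> (E + Z) - c\<bar> \<partial>?M)"
  have iD: "integrable ?M (\<lambda>Z. \<bar>\<Phi> (E + Z) - c\<bar>)" using i by simp
  have "D \<le> (\<integral>Z. (\<Phi> (E + Z) - c)\<^sup>2 / (2 * t) + t / 2 \<partial>?M)"
    unfolding D_def
  proof (rule integral_mono[OF iD])
    show "integrable ?M (\<lambda>Z. (\<Phi> (E + Z) - c)\<^sup>2 / (2 * t) + t / 2)" using i2 by simp
    fix Z
    have "\<bar>x\<bar> \<le> x\<^sup>2 / (2 * t) + t / 2" for x :: real
      using sum_squares_bound[of "\<bar>x\<bar>" t] t by (simp add: field_simps power2_eq_square)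
    then show "\<bar>\<Phi> (E + Z) - c\<bar> \<le> (\<Phi> (E + Z) - c)\<^sup>2 / (2 * t) + t / 2" .
  qed
  also have "\<dots> = (\<integral>Z. (\<Phi> (E + Z) - c)\<^sup>2 \<partial>?M) / (2 * t) + t / 2"
    using i2 by (simp add: prob_space)
  also have "\<dots> \<le> V / (2 * t) + t / 2"
    using V2 t by (simp add: divide_right_mono)
  finally have D: "2 * D \<le> V / t + t" using t by (simp add: field_simps)
  have "avg ?M \<Phi> E - c = (\<integral>Z. \<Phi> (E + Z) - c \<partial>?M)"
    unfolding avg_def using i by (simp add: prob_space)
  then have mc: "\<bar>avg ?M \<Phi> E - c\<bar> \<le> D" unfolding D_def by (simp only: integral_abs_bound)
  have "(\<integral>Z. \<bar>\<Phi> (E + Z) - avg ?M \<Phi> E\<bar> \<partial>?M) \<le> (\<integral>Z. \<bar>\<Phi> (E + Z) - c\<bar> + \<bar>avg ?M \<Phi> E - c\<bar> \<partial>?M)"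
    by (rule integral_mono) (use i iD in auto)
  also have "\<dots> = D + \<bar>avg ?M \<Phi> E - c\<bar>" unfolding D_def using iD by (simp add: prob_space)
  finally show ?thesis using mc D unfolding V_def by linarith
qed

end

context model
begin

definition mean_clause_square where "mean_clause_square = (\<integral>f. (clause_norm f)\<^sup>2 \<partial>Q)"

lemma random_clause_second_moment:
  assumes V: "finite V" "p - length \<rho> \<le> card V"
  shows "(\<integral>\<^sup>+Z. ennreal ((nrm Z)\<^sup>2) \<partial>random_clause V \<rho>) \<le> ennreal mean_clause_square"
proof -
  let ?S = "ksubsets V (p - length \<rho>)"
  have c: "card ?S \<noteq> 0" using ksubsets_ne[OF V] finite_ksubsets[OF V(1)] by simp
  have q: "(\<integral>\<^sup>+Z. ennreal ((nrm Z)\<^sup>2) \<partial>clause_law_at l) \<le> ennreal mean_clause_square" for l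
  proof -
    have "(\<integral>\<^sup>+Z. ennreal ((nrm Z)\<^sup>2) \<partial>clause_law_at l) = (\<integral>\<^sup>+f. ennreal ((nrm (lift l f))\<^sup>2) \<partial>Q)"
      unfolding clause_law_at_def by (subst nn_integral_distr) auto
    also have "\<dots> \<le> (\<integral>\<^sup>+f. ennreal ((clause_norm f)\<^sup>2) \<partial>Q)"
      by (intro nn_integral_mono ennreal_leI power_mono) (auto simp: space_Q nrm_lift lift_energies)
    also have "\<dots> = ennreal mean_clause_square" unfolding mean_clause_square_def
      by (rule nn_integral_eq_integral[OF clause_norm_square_integrable]) simp
    finally show ?thesis .
  qed
  have "(\<integral>\<^sup>+Z. ennreal ((nrm Z)\<^sup>2) \<partial>random_clause V \<rho>) = (\<Sum>J\<in>?S. \<integral>\<^sup>+Z. ennreal ((nrm Z)\<^sup>2) \<partial>clause_law_at (clause_at J \<rho>)) / of_nat (card ?S)"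
    by (rule nn_random_clause[OF V]) measurable
  also have "\<dots> \<le> (\<Sum>J\<in>?S. ennreal mean_clause_square) / of_nat (card ?S)"
    by (intro divide_right_mono_ennreal sum_mono q)
  also have "\<dots> = ennreal mean_clause_square"
    using c by (simp add: mult.commute[of "of_nat _"] mult_divide_eq_ennreal of_nat_eq_0_iff[where 'a = ennreal])
  finally show ?thesis .
qed

end

section \<open>The law of the disorder\<close>

lemma (in prob_space) distr_pair_indep:
  assumes [measurable]: "X \<in> measurable M A" "Y \<in> measurable M B"
    and ind: "\<And>a b. a \<in> sets A \<Longrightarrow> b \<in> sets B \<Longrightarrow>
      prob ((X -` a \<inter> space M) \<inter> (Y -` b \<inter> space M)) = prob (X -` a \<inter> space M) * prob (Y -` b \<inter> space M)"
  shows "distr M (A \<Otimes>\<^sub>M B) (\<lambda>\<omega>. (X \<omega>, Y \<omega>)) = distr M A X \<Otimes>\<^sub>M distr M B Y"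
proof (rule pair_measure_eqI[symmetric])
  interpret X: prob_space "distr M A X" by (rule prob_space_distr) fact
  interpret Y: prob_space "distr M B Y" by (rule prob_space_distr) fact
  show "sigma_finite_measure (distr M A X)" "sigma_finite_measure (distr M B Y)" by unfold_locales
  show "sets (distr M A X \<Otimes>\<^sub>M distr M B Y) = sets (distr M (A \<Otimes>\<^sub>M B) (\<lambda>\<omega>. (X \<omega>, Y \<omega>)))"
    by (simp cong: sets_pair_measure_cong)
  fix a b assume "a \<in> sets (distr M A X)" "b \<in> sets (distr M B Y)"
  then have ab [measurable]: "a \<in> sets A" "b \<in> sets B" by auto
  have "(\<lambda>\<omega>. (X \<omega>, Y \<omega>)) -` (a \<times> b) \<inter> space M = (X -` a \<inter> space M) \<inter> (Y -` b \<inter> space M)" by auto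
  then show "emeasure (distr M A X) a * emeasure (distr M B Y) b = emeasure (distr M (A \<Otimes>\<^sub>M B) (\<lambda>\<omega>. (X \<omega>, Y \<omega>))) (a \<times> b)"
    using ind[OF ab] by (simp add: emeasure_distr emeasure_eq_measure ennreal_mult[symmetric])
qed

lemma Int_stable_generated_events: "Int_stable (generated_events M B X)"
proof (rule Int_stableI)
  fix a b assume "a \<in> generated_events M B X" "b \<in> generated_events M B X"
  then obtain A A' where "A \<in> sets B" "A' \<in> sets B" "a = X -` A \<inter> space M" "b = X -` A' \<inter> space M"
    by (auto simp: generated_events_def)
  then show "a \<inter> b \<in> generated_events M B X"
    unfolding generated_events_def by (intro CollectI exI[of _ "A \<inter> A'"]) auto
qed

lemma measurable_generated_events:
  assumes "X \<in> measurable M B" "generated_events M B X \<subseteq> G" "G \<subseteq> Pow (space M)"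
  shows "X \<in> measurable (sigma (space M) G) B"
proof (rule measurableI)
  show "x \<in> space (sigma (space M) G) \<Longrightarrow> X x \<in> space B" for x using measurable_space[OF assms(1)] by (simp add: space_measure_of_conv)
  show "X -` A \<inter> space (sigma (space M) G) \<in> sets (sigma (space M) G)" if "A \<in> sets B" for A
    using assms(2,3) that by (auto simp: generated_events_def space_measure_of_conv)
qed

context model
begin

lemma index_set_law_ksubsets: "index_set_law p N = uniform_count_measure (ksubsets {..<N} p)"
  by (simp add: index_set_law_def ksubsets_def)

lemma lift_index_measurable:
  "(\<lambda>y. lift (sorted_list_of_set (snd y)) (fst y)) \<in> measurable (clause_borel \<Otimes>\<^sub>M index_set_law p N) energy_space"
proof (rule measurable_compose_countable'[where f = "\<lambda>l y. lift (sorted_list_of_set l) (fst y)" and g = snd and I = "ksubsets {..<N} p"])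
  show "snd \<in> measurable (clause_borel \<Otimes>\<^sub>M index_set_law p N) (count_space (ksubsets {..<N} p))"
    by (subst measurable_cong_sets[OF refl sets_uniform_count_measure_count_space[symmetric]])
      (simp add: index_set_law_ksubsets)
  show "countable (ksubsets {..<N} p)" by (rule countable_finite) (simp add: finite_ksubsets)
qed measurable

lemma clause_increment_law:
  assumes "p \<le> N"
  shows "distr (Q \<Otimes>\<^sub>M index_set_law p N) energy_space (\<lambda>y. lift (sorted_list_of_set (snd y)) (fst y)) = random_clause {..<N} []"
proof (rule measure_eqI_nn_integral)
  let ?U = "index_set_law p N" and ?S = "ksubsets {..<N} p"
  have fS: "finite ?S" by (simp add: finite_ksubsets)
  have S0: "card ?S \<noteq> 0" using ksubsets_ne[of "{..<N}" p] assms fS by simp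
  have U: "prob_space ?U" unfolding index_set_law_ksubsets
    by (rule prob_space_uniform_count_measure) (use fS S0 in auto)
  interpret U: prob_space ?U by (rule U)
  interpret P: pair_prob_space Q ?U ..
  fix F :: "((nat \<Rightarrow> real) \<Rightarrow> real) \<Rightarrow> ennreal"
  assume "F \<in> borel_measurable (distr (Q \<Otimes>\<^sub>M ?U) energy_space (\<lambda>y. lift (sorted_list_of_set (snd y)) (fst y)))"
  then have F [measurable]: "F \<in> borel_measurable energy_space" by simp
  have m: "(\<lambda>y. lift (sorted_list_of_set (snd y)) (fst y)) \<in> measurable (Q \<Otimes>\<^sub>M ?U) energy_space"
    by (subst measurable_cong_sets[OF sets_pair_measure_cong[OF sets_Q refl] refl]) (rule lift_index_measurable)
  have "(\<integral>\<^sup>+Z. F Z \<partial>distr (Q \<Otimes>\<^sub>M ?U) energy_space (\<lambda>y. lift (sorted_list_of_set (snd y)) (fst y))) =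
    (\<integral>\<^sup>+y. F (lift (sorted_list_of_set (snd y)) (fst y)) \<partial>(Q \<Otimes>\<^sub>M ?U))"
    by (rule nn_integral_distr[OF m]) simp
  also have "\<dots> = (\<integral>\<^sup>+J. \<integral>\<^sup>+f. F (lift (sorted_list_of_set J) f) \<partial>Q \<partial>?U)"
    using P.nn_integral_snd[OF measurable_compose[OF m F]] by simp
  also have "\<dots> = (\<integral>\<^sup>+J. \<integral>\<^sup>+Z. F Z \<partial>clause_law_at (sorted_list_of_set J) \<partial>?U)"
    unfolding clause_law_at_def by (subst nn_integral_distr) auto
  also have "\<dots> = (\<Sum>J\<in>?S. ennreal (1 / real (card ?S)) * (\<integral>\<^sup>+Z. F Z \<partial>clause_law_at (sorted_list_of_set J)))"
    unfolding index_set_law_ksubsets uniform_count_measure_def by (rule nn_integral_point_measure_finite[OF fS])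
  also have "\<dots> = (\<Sum>J\<in>?S. \<integral>\<^sup>+Z. F Z \<partial>clause_law_at (sorted_list_of_set J)) / of_nat (card ?S)"
  proof -
    have "ennreal (1 / real (card ?S)) = inverse (of_nat (card ?S))"
      using S0 by (simp add: ennreal_of_nat_eq_real_of_nat inverse_ennreal inverse_eq_divide)
    then show ?thesis
      by (simp only: sum_distrib_right divide_ennreal_def mult.commute[of "inverse _"])
  qed
  also have "\<dots> = (\<integral>\<^sup>+Z. F Z \<partial>random_clause {..<N} [])"
    using nn_random_clause[of "{..<N}" "[]" F] F assms by simp
  finally show "(\<integral>\<^sup>+Z. F Z \<partial>distr (Q \<Otimes>\<^sub>M ?U) energy_space (\<lambda>y. lift (sorted_list_of_set (snd y)) (fst y))) = (\<integral>\<^sup>+Z. F Z \<partial>random_clause {..<N} [])" .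
qed simp

text \<open>
  The independent sigma-algebras are grouped twice. Grouping \<open>\<theta> k\<close> with \<open>I k\<close> shows that the clause
  energies are i.i.d.; grouping all of these against \<open>K\<close> shows that their sequence is independent of
  their number.
\<close>

lemma disorder_energy_law:
  assumes D: "disorder S p \<alpha> Q N M K \<theta> I" and N: "p \<le> N"
  shows "(\<lambda>\<omega>. \<Sum>k<K \<omega>. lift (sorted_list_of_set (I k \<omega>)) (\<theta> k \<omega>)) \<in> measurable M energy_space"
    "distr M energy_space (\<lambda>\<omega>. \<Sum>k<K \<omega>. lift (sorted_list_of_set (I k \<omega>)) (\<theta> k \<omega>)) = cpoisson (random_clause {..<N} []) (\<alpha> * real N)"
proof -
  interpret prob_space M using D by (simp add: disorder_def)
  let ?U = "index_set_law p N" and ?W = "poisson_pmf (\<alpha> * real N)" and ?\<mu> = "random_clause {..<N} []"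
  have K [measurable]: "K \<in> measurable M (count_space UNIV)" and dK: "distr M (count_space UNIV) K = measure_pmf ?W"
    and \<theta> [measurable]: "\<And>k. \<theta> k \<in> measurable M clause_borel" and d\<theta>: "\<And>k. distr M clause_borel (\<theta> k) = Q"
    and I [measurable]: "\<And>k. I k \<in> measurable M ?U" and dI: "\<And>k. distr M ?U (I k) = ?U"
    using D by (simp_all add: disorder_def)
  define F where "F = case_option (generated_events M (count_space UNIV) K)
         (case_sum (\<lambda>k. generated_events M clause_borel (\<theta> k)) (\<lambda>k. generated_events M ?U (I k)))"
  have F_simps: "F None = generated_events M (count_space UNIV) K" "F (Some (Inl k)) = generated_events M clause_borel (\<theta> k)"
    "F (Some (Inr k)) = generated_events M ?U (I k)" for k
    by (simp_all add: F_def)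
  have F: "indep_sets F UNIV" using D by (simp add: disorder_def F_def)
  have stable: "Int_stable (F i)" for i
    by (auto simp: F_def Int_stable_generated_events split: option.split sum.split)
  have Fpow: "F i \<subseteq> Pow (space M)" for i
    by (auto simp: F_def generated_events_def split: option.splits sum.splits)
  define Z where "Z k \<omega> = lift (sorted_list_of_set (I k \<omega>)) (\<theta> k \<omega>)" for k \<omega>
  have Zm: "Z k \<in> measurable M' energy_space" if [measurable]: "\<theta> k \<in> measurable M' clause_borel" "I k \<in> measurable M' ?U" for k M'
  proof -
    have "(\<lambda>\<omega>. (\<theta> k \<omega>, I k \<omega>)) \<in> measurable M' (clause_borel \<Otimes>\<^sub>M ?U)" by measurable
    from measurable_compose[OF this lift_index_measurable] show ?thesis by (simp add: Z_def[abs_def])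
  qed
  have Z [measurable]: "Z k \<in> measurable M energy_space" for k by (rule Zm) measurable
  have dZ: "distr M energy_space (Z k) = ?\<mu>" for k
  proof -
    have "distr M (clause_borel \<Otimes>\<^sub>M ?U) (\<lambda>\<omega>. (\<theta> k \<omega>, I k \<omega>)) = distr M clause_borel (\<theta> k) \<Otimes>\<^sub>M distr M ?U (I k)"
    proof (rule distr_pair_indep)
      fix a b assume ab: "a \<in> sets clause_borel" "b \<in> sets ?U"
      let ?A = "\<lambda>i. if i = Some (Inl k) then \<theta> k -` a \<inter> space M else I k -` b \<inter> space M"
      have "prob (\<Inter>i\<in>{Some (Inl k), Some (Inr k)}. ?A i) = (\<Prod>i\<in>{Some (Inl k), Some (Inr k)}. prob (?A i))"
        by (rule indep_setsD[OF F]) (use ab in \<open>auto simp: F_simps generated_events_def\<close>)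
      then show "prob ((\<theta> k -` a \<inter> space M) \<inter> (I k -` b \<inter> space M)) =
        prob (\<theta> k -` a \<inter> space M) * prob (I k -` b \<inter> space M)" by (simp add: Int_commute)
    qed measurable
    then have "distr M (clause_borel \<Otimes>\<^sub>M ?U) (\<lambda>\<omega>. (\<theta> k \<omega>, I k \<omega>)) = Q \<Otimes>\<^sub>M ?U" by (simp only: d\<theta> dI)
    from arg_cong[OF this, of "\<lambda>\<nu>. distr \<nu> energy_space (\<lambda>y. lift (sorted_list_of_set (snd y)) (fst y))"]
    show ?thesis
      unfolding clause_increment_law[OF N]
      by (subst (asm) distr_distr[OF lift_index_measurable]) (simp_all add: comp_def Z_def[abs_def])
  qed
  have ZZ: "distr M (iid energy_space) (\<lambda>\<omega> k. Z k \<omega>) = iid ?\<mu>"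
  proof -
    let ?g = "\<lambda>k::nat. {Some (Inl k), Some (Inr k)} :: (nat + nat) option set"
    have "indep_sets (\<lambda>k. sigma_sets (space M) (\<Union>i\<in>?g k. F i)) UNIV"
      by (rule indep_sets_collect_sigma) (auto intro: indep_sets_mono_index[OF _ F] stable simp: disjoint_family_on_def)
    then have "indep_sets (\<lambda>k. {Z k -` A \<inter> space M | A. A \<in> sets energy_space}) UNIV"
    proof (rule indep_sets_mono_sets)
      fix k
      let ?G = "\<Union>i\<in>?g k. F i"
      have G: "?G \<subseteq> Pow (space M)" using Fpow by blast
      have "Z k \<in> measurable (sigma (space M) ?G) energy_space"
        by (intro Zm measurable_generated_events \<theta> I G) (auto simp: F_simps)
      from measurable_sets[OF this] show "{Z k -` A \<inter> space M | A. A \<in> sets energy_space} \<subseteq> sigma_sets (space M) ?G"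
        using G by (auto simp: space_measure_of_conv)
    qed
    then have "indep_vars (\<lambda>_. energy_space) Z UNIV" by (simp add: indep_vars_def2)
    then show ?thesis
      by (subst (asm) indep_vars_iff_distr_eq_PiM') (simp_all add: dZ restrict_def)
  qed
  have Zs [measurable]: "(\<lambda>\<omega> k. Z k \<omega>) \<in> measurable M (iid energy_space)"
    by (rule measurable_PiM_single') (auto simp: space_PiM intro: measurable_space[OF Z, simplified])
  have pair: "distr M (count_space UNIV \<Otimes>\<^sub>M iid energy_space) (\<lambda>\<omega>. (K \<omega>, \<lambda>k. Z k \<omega>)) = measure_pmf ?W \<Otimes>\<^sub>M iid ?\<mu>"
    unfolding dK[symmetric] ZZ[symmetric]
  proof (rule distr_pair_indep[OF K Zs])
    fix a :: "nat set" and b assume ab: "a \<in> sets (count_space UNIV)" "b \<in> sets (iid energy_space)"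
    let ?g = "\<lambda>c::bool. if c then {None} else range Some :: (nat + nat) option set"
    let ?G = "\<Union>i\<in>range Some. F i"
    have G: "?G \<subseteq> Pow (space M)" using Fpow by blast
    have ind: "indep_sets (\<lambda>c. sigma_sets (space M) (\<Union>i\<in>?g c. F i)) UNIV"
      by (rule indep_sets_collect_sigma) (auto intro: indep_sets_mono_index[OF _ F] stable simp: disjoint_family_on_def split: if_splits)
    have "Z k \<in> measurable (sigma (space M) ?G) energy_space" for k
      by (intro Zm measurable_generated_events \<theta> I G) (auto simp: F_simps[symmetric])
    then have "(\<lambda>\<omega> k. Z k \<omega>) \<in> measurable (sigma (space M) ?G) (iid energy_space)"
      by (intro measurable_PiM_single') (auto simp: space_PiM space_measure_of_conv intro: measurable_space[OF Z, simplified])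
    from measurable_sets[OF this ab(2)] have Zb: "(\<lambda>\<omega> k. Z k \<omega>) -` b \<inter> space M \<in> sigma_sets (space M) ?G"
      using G by (simp add: space_measure_of_conv)
    let ?A = "\<lambda>c. if c then K -` a \<inter> space M else (\<lambda>\<omega> k. Z k \<omega>) -` b \<inter> space M"
    have "prob (\<Inter>c\<in>UNIV. ?A c) = (\<Prod>c\<in>UNIV. prob (?A c))"
      by (rule indep_setsD[OF ind]) (use Zb in \<open>auto simp: F_simps generated_events_def\<close>)
    then show "prob ((K -` a \<inter> space M) \<inter> ((\<lambda>\<omega> k. Z k \<omega>) -` b \<inter> space M)) =
        prob (K -` a \<inter> space M) * prob ((\<lambda>\<omega> k. Z k \<omega>) -` b \<inter> space M)"
      by (simp add: UNIV_bool ac_simps)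
  qed
  have sm: "(\<lambda>(r, z). \<Sum>k<r. z k) \<in> measurable (count_space UNIV \<Otimes>\<^sub>M iid energy_space) energy_space"
    by (rule measurable_pair_measure_countable1) (auto intro!: partial_sum_measurable)
  have eq: "(\<lambda>\<omega>. \<Sum>k<K \<omega>. lift (sorted_list_of_set (I k \<omega>)) (\<theta> k \<omega>)) = (\<lambda>(r, z). \<Sum>k<r. z k) \<circ> (\<lambda>\<omega>. (K \<omega>, \<lambda>k. Z k \<omega>))"
    by (simp add: Z_def[abs_def] comp_def)
  have pm: "(\<lambda>\<omega>. (K \<omega>, \<lambda>k. Z k \<omega>)) \<in> measurable M (count_space UNIV \<Otimes>\<^sub>M iid energy_space)" by measurable
  show "(\<lambda>\<omega>. \<Sum>k<K \<omega>. lift (sorted_list_of_set (I k \<omega>)) (\<theta> k \<omega>)) \<in> measurable M energy_space"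
    unfolding eq by (rule measurable_comp[OF pm sm])
  show "distr M energy_space (\<lambda>\<omega>. \<Sum>k<K \<omega>. lift (sorted_list_of_set (I k \<omega>)) (\<theta> k \<omega>)) = cpoisson (random_clause {..<N} []) (\<alpha> * real N)"
    unfolding eq distr_distr[OF sm pm, symmetric] pair cpoisson_def ..
qed

section \<open>Convergence of the ground state energy\<close>

text \<open>
  The Hamiltonian depends on the spins below \<open>N\<close> only, so that configurations of \<open>N\<close> spins and of
  infinitely many spins give the same values.
\<close>

lemma GSE_eq_maxE:
  assumes I: "\<And>k. I k \<subseteq> {..<N} \<and> card (I k) = p" and \<theta>: "\<And>k. \<theta> k \<in> space clause_borel" and psi: "continuous_on S \<psi>"
  shows "GSE S p \<psi> N r \<theta> I = maxE ((\<Sum>i<N. site i \<psi>) + (\<Sum>k<r. lift (sorted_list_of_set (I k)) (\<theta> k))) / real N"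
proof -
  let ?E = "(\<Sum>i<N. site i \<psi>) + (\<Sum>k<r. lift (sorted_list_of_set (I k)) (\<theta> k))"
  have EC: "?E \<in> energies" by (intro energies_add energies_sum site_energies psi lift_energies \<theta>)
  have fI: "finite (I k)" for k using I[of k] by (auto intro: finite_subset)
  have Es: "?E \<sigma> = hamiltonian p \<psi> N r \<theta> I \<sigma>" for \<sigma>
    by (simp add: hamiltonian_def plus_fun_apply sum_fun_apply site_def lift_def)
  have dE: "depends_on {..<N} ?E"
  proof (intro depends_on_add depends_on_sum)
    show "depends_on {..<N} (site i \<psi>)" if "i \<in> {..<N}" for i by (rule depends_on_mono[OF site_depends_on]) (use that in auto)
    show "depends_on {..<N} (lift (sorted_list_of_set (I k)) (\<theta> k))" for k
      by (rule depends_on_mono[OF lift_depends_on]) (use I[of k] fI[of k] in auto)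
  qed
  obtain s where s: "s \<in> S" using S_ne by auto
  let ?x = "\<lambda>\<sigma> i. if i < N then \<sigma> i else (s::real)"
  have "(hamiltonian p \<psi> N r \<theta> I) ` ({..<N} \<rightarrow>\<^sub>E S) = ?E ` configs"
  proof
    show "(hamiltonian p \<psi> N r \<theta> I) ` ({..<N} \<rightarrow>\<^sub>E S) \<subseteq> ?E ` configs"
    proof
      fix y assume "y \<in> (hamiltonian p \<psi> N r \<theta> I) ` ({..<N} \<rightarrow>\<^sub>E S)"
      then obtain \<sigma> where \<sigma>: "\<sigma> \<in> {..<N} \<rightarrow>\<^sub>E S" "y = hamiltonian p \<psi> N r \<theta> I \<sigma>" by auto
      have "?x \<sigma> \<in> configs" using \<sigma>(1) s by (auto simp: configs_iff PiE_iff)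
      moreover have "hamiltonian p \<psi> N r \<theta> I (?x \<sigma>) = y"
        unfolding \<sigma>(2) hamiltonian_def
      proof (intro arg_cong2[of _ _ _ _ "(+)"] sum.cong refl arg_cong[of _ _ "\<theta> _"] restrict_ext)
        fix k j assume "j \<in> {..<p}"
        then have "sorted_list_of_set (I k) ! j \<in> I k"
          using nth_mem[of j "sorted_list_of_set (I k)"] fI[of k] I[of k] by simp
        then show "?x \<sigma> (sorted_list_of_set (I k) ! j) = \<sigma> (sorted_list_of_set (I k) ! j)" using I[of k] by auto
      qed auto
      ultimately show "y \<in> ?E ` configs" unfolding Es[symmetric] by (intro image_eqI[of _ _ "?x \<sigma>"]) auto
    qed
    show "?E ` configs \<subseteq> (hamiltonian p \<psi> N r \<theta> I) ` ({..<N} \<rightarrow>\<^sub>E S)"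
    proof
      fix y assume "y \<in> ?E ` configs"
      then obtain \<sigma> where \<sigma>: "\<sigma> \<in> configs" "y = ?E \<sigma>" by auto
      have xs: "?x \<sigma> \<in> configs" using \<sigma>(1) s by (auto simp: configs_iff)
      let ?r = "restrict \<sigma> {..<N}"
      have rs: "?r \<in> {..<N} \<rightarrow>\<^sub>E S" using \<sigma>(1) by (auto simp: configs_iff)
      have "hamiltonian p \<psi> N r \<theta> I ?r = y"
        unfolding \<sigma>(2) Es hamiltonian_def
      proof (intro arg_cong2[of _ _ _ _ "(+)"] sum.cong refl arg_cong[of _ _ "\<theta> _"] restrict_ext)
        fix k j assume "j \<in> {..<p}"
        then have "sorted_list_of_set (I k) ! j \<in> I k"
          using nth_mem[of j "sorted_list_of_set (I k)"] fI[of k] I[of k] by simp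
        then show "?r (sorted_list_of_set (I k) ! j) = \<sigma> (sorted_list_of_set (I k) ! j)" using I[of k] by auto
      qed auto
      then show "y \<in> (hamiltonian p \<psi> N r \<theta> I) ` ({..<N} \<rightarrow>\<^sub>E S)" using rs by blast
    qed
  qed
  then show ?thesis unfolding GSE_def maxE_def by simp
qed

end

context critical_model
begin

lemma GSE_deviation:
  assumes D: "disorder S p \<alpha> Q N M K \<theta> I" and N: "p \<le> N" and t: "0 < t"
  defines "c \<equiv> avg (cpoisson (random_clause {..<N} []) (\<alpha> * real N)) maxE (\<Sum>i<N. site i \<psi>) / real N"
  shows "integrable M (\<lambda>\<omega>. GSE S p \<psi> N (K \<omega>) (\<lambda>k. \<theta> k \<omega>) (\<lambda>k. I k \<omega>))"
    "(\<integral>\<omega>. \<bar>GSE S p \<psi> N (K \<omega>) (\<lambda>k. \<theta> k \<omega>) (\<lambda>k. I k \<omega>) - c\<bar> \<partial>M)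
      \<le> ((\<alpha> * real N * mean_clause_square + (\<alpha> * real N + 1) * mean_clause_norm\<^sup>2) / t + t) / real N"
proof -
  let ?\<mu> = "random_clause {..<N} []" and ?m = "\<alpha> * real N" and ?E = "\<Sum>i<N. site i \<psi>"
  let ?G = "\<lambda>\<omega>. GSE S p \<psi> N (K \<omega>) (\<lambda>k. \<theta> k \<omega>) (\<lambda>k. I k \<omega>)"
  let ?Z = "\<lambda>\<omega>. \<Sum>k<K \<omega>. lift (sorted_list_of_set (I k \<omega>)) (\<theta> k \<omega>)"
  have N0: "0 < N" using N p_ge by simp
  have m: "0 < ?m" using N0 alpha_pos by simp
  have V: "finite {..<N}" "p - length ([] :: nat list) \<le> card {..<N}" using N by auto
  note k = increment_random_clause[OF V]
  have E: "?E \<in> energies" by (intro energies_sum site_energies psi_cont)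
  note law = disorder_energy_law[OF D N]
  have mean_clause_square: "0 \<le> mean_clause_square" unfolding mean_clause_square_def by simp
  have eq: "?G \<omega> = maxE (?E + ?Z \<omega>) / real N" if "\<omega> \<in> space M" for \<omega>
  proof (rule GSE_eq_maxE[OF _ _ psi_cont])
    fix j
    have "I j \<in> measurable M (index_set_law p N)" "\<theta> j \<in> measurable M clause_borel" using D by (simp_all add: disorder_def)
    from measurable_space[OF this(1) that] measurable_space[OF this(2) that]
    show "I j \<omega> \<subseteq> {..<N} \<and> card (I j \<omega>) = p" "\<theta> j \<omega> \<in> space clause_borel"
      by (simp_all add: index_set_law_def space_uniform_count_measure)
  qed
  have sm: "(\<lambda>Z. maxE (?E + Z)) \<in> borel_measurable energy_space"
    by (rule measurable_compose[OF shift_energy_space[OF E refl] maxE_measurable])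
  have i: "integrable (cpoisson ?\<mu> ?m) (\<lambda>Z. maxE (?E + Z))"
    by (rule avg_integrable[OF increment_cpoisson[OF k(1) m] maxE_observables E])
  then have i': "integrable M (\<lambda>\<omega>. maxE (?E + ?Z \<omega>))"
    unfolding law(2)[symmetric] by (subst (asm) integrable_distr_eq[OF law(1) sm])
  show "integrable M ?G"
    by (subst Bochner_Integration.integrable_cong[OF refl eq]) (use i' in auto)
  have "(\<integral>\<omega>. \<bar>?G \<omega> - c\<bar> \<partial>M) = (\<integral>\<omega>. \<bar>maxE (?E + ?Z \<omega>) - avg (cpoisson ?\<mu> ?m) maxE ?E\<bar> / real N \<partial>M)"
    by (rule Bochner_Integration.integral_cong[OF refl])
      (simp add: eq c_def diff_divide_distrib[symmetric] del: plus_fun_apply)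
  also have "\<dots> = (\<integral>Z. \<bar>maxE (?E + Z) - avg (cpoisson ?\<mu> ?m) maxE ?E\<bar> \<partial>cpoisson ?\<mu> ?m) / real N"
    unfolding law(2)[symmetric] by (subst integral_distr[OF law(1)]) (use sm in \<open>auto simp del: plus_fun_apply\<close>)
  also have "\<dots> \<le> ((?m * mean_clause_square + (?m + 1) * (mean_nrm ?\<mu>)\<^sup>2) / t + t) / real N"
    by (rule divide_right_mono[OF cpoisson_mean_deviation[OF k(1) random_clause_second_moment[OF V] mean_clause_square maxE_observables E m t]]) simp
  also have "\<dots> \<le> ((?m * mean_clause_square + (?m + 1) * mean_clause_norm\<^sup>2) / t + t) / real N"
    using t m mean_nrm_nonneg[OF k(1)] k(2)
    by (intro divide_right_mono add_mono add_left_mono mult_left_mono power_mono order_refl) auto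
  finally show "(\<integral>\<omega>. \<bar>?G \<omega> - c\<bar> \<partial>M) \<le> ((?m * mean_clause_square + (?m + 1) * mean_clause_norm\<^sup>2) / t + t) / real N" .
qed

lemma GSE_L1_limit:
  assumes D: "\<And>N. p \<le> N \<Longrightarrow> disorder S p \<alpha> Q N (M N) (K N) (\<theta> N) (I N)"
    and L: "L \<in> Pr1 S" "T_op L = L"
  shows "(\<lambda>N. \<integral>\<omega>. \<bar>GSE S p \<psi> N (K N \<omega>) (\<lambda>k. \<theta> N k \<omega>) (\<lambda>k. I N k \<omega>) - P_infty S p \<alpha> \<psi> Q L\<bar> \<partial>M N) \<longlonglongrightarrow> 0"
proof -
  let ?P = "P_infty S p \<alpha> \<psi> Q L"
  define c where "c N = avg (cpoisson (random_clause {..<N} []) (\<alpha> * real N)) maxE (\<Sum>i<N. site i \<psi>) / real N" for N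
  define G where "G N \<omega> = GSE S p \<psi> N (K N \<omega>) (\<lambda>k. \<theta> N k \<omega>) (\<lambda>k. I N k \<omega>)" for N \<omega>
  \<comment> \<open>The choice \<open>t = sqrt N\<close> makes both terms of the deviation bound of order \<open>sqrt N\<close>.\<close>
  define u where "u N = ((\<alpha> * real N * mean_clause_square + (\<alpha> * real N + 1) * mean_clause_norm\<^sup>2) / sqrt (real N) + sqrt (real N)) / real N" for N
  have c: "c \<longlonglongrightarrow> ?P" unfolding c_def[abs_def] by (rule mean_energy_limit[OF L])
  have "u \<longlonglongrightarrow> 0" unfolding u_def by real_asymp
  moreover have "(\<lambda>N. \<bar>c N - ?P\<bar>) \<longlonglongrightarrow> 0" using c by (simp add: LIM_zero_iff tendsto_rabs_zero_iff)
  ultimately have lim: "(\<lambda>N. u N + \<bar>c N - ?P\<bar>) \<longlonglongrightarrow> 0" using tendsto_add by fastforce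
  have "(\<lambda>N. \<integral>\<omega>. \<bar>G N \<omega> - ?P\<bar> \<partial>M N) \<longlonglongrightarrow> 0"
  proof (rule tendsto_sandwich[OF _ _ tendsto_const lim])
    show "\<forall>\<^sub>F N in sequentially. 0 \<le> (\<integral>\<omega>. \<bar>G N \<omega> - ?P\<bar> \<partial>M N)" by simp
    show "\<forall>\<^sub>F N in sequentially. (\<integral>\<omega>. \<bar>G N \<omega> - ?P\<bar> \<partial>M N) \<le> u N + \<bar>c N - ?P\<bar>"
    proof (rule eventually_sequentiallyI)
      fix N assume N: "p \<le> N"
      then have "0 < sqrt (real N)" using p_ge by simp
      note d = GSE_deviation[OF D[OF N] N this, folded G_def c_def u_def]
      interpret prob_space "M N" using D[OF N] by (simp add: disorder_def)
      have "(\<integral>\<omega>. \<bar>G N \<omega> - ?P\<bar> \<partial>M N) \<le> (\<integral>\<omega>. \<bar>G N \<omega> - c N\<bar> + \<bar>c N - ?P\<bar> \<partial>M N)"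
        by (rule integral_mono) (use d(1) in auto)
      also have "\<dots> = (\<integral>\<omega>. \<bar>G N \<omega> - c N\<bar> \<partial>M N) + \<bar>c N - ?P\<bar>"
        using d(1) by (simp add: prob_space)
      finally show "(\<integral>\<omega>. \<bar>G N \<omega> - ?P\<bar> \<partial>M N) \<le> u N + \<bar>c N - ?P\<bar>" using d(2) by linarith
    qed
  qed
  then show ?thesis unfolding G_def .
qed

end

theorem theorem1p2:
  fixes R \<alpha> :: real and S :: "real set" and p :: nat and \<psi> :: "real \<Rightarrow> real"
    and Q :: "((nat \<Rightarrow> real) \<Rightarrow> real) measure"
    and M :: "nat \<Rightarrow> 'w measure"
    and K :: "nat \<Rightarrow> 'w \<Rightarrow> nat"
    and \<theta> :: "nat \<Rightarrow> nat \<Rightarrow> 'w \<Rightarrow> (nat \<Rightarrow> real) \<Rightarrow> real"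
    and I :: "nat \<Rightarrow> nat \<Rightarrow> 'w \<Rightarrow> nat set"
  assumes "R > 0" and "S \<subseteq> {-R..R}" and "compact S" and "S \<noteq> {}"
    and "p \<ge> 2" and "\<alpha> > 0"
    and "\<exists>C. C-lipschitz_on S \<psi>"
    and "clause_law S p Q" and "symmetric_law S p Q"
    and "\<And>N. N \<ge> p \<Longrightarrow> disorder S p \<alpha> Q N (M N) (K N) (\<theta> N) (I N)"
    and "\<alpha> * real p * (real p - 1) \<le> 1"
  shows "\<exists>L\<in>Pr1 S.
    T_infty S p \<alpha> \<psi> Q L = L \<and>
    (\<forall>L'\<in>Pr1 S. T_infty S p \<alpha> \<psi> Q L' = L' \<longrightarrow> L' = L) \<and>
    (\<forall>N\<ge>p. integrable (M N) (\<lambda>\<omega>. GSE S p \<psi> N (K N \<omega>) (\<lambda>k. \<theta> N k \<omega>) (\<lambda>k. I N k \<omega>))) \<and>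
    (\<lambda>N. \<integral>\<omega>. \<bar>GSE S p \<psi> N (K N \<omega>) (\<lambda>k. \<theta> N k \<omega>) (\<lambda>k. I N k \<omega>) - P_infty S p \<alpha> \<psi> Q L\<bar> \<partial>M N)
      \<longlonglongrightarrow> 0"
proof -
  have "continuous_on S \<psi>" using assms(7) lipschitz_on_continuous_on by blast
  then interpret critical_model S p Q \<psi> \<alpha>
    by unfold_locales (use assms in auto)
  obtain L where L: "L \<in> Pr1 S" "T_op L = L" using fixed_point_exists by blast
  show ?thesis
  proof (intro bexI[OF _ L(1)] conjI ballI allI impI L(2))
    show "L' = L" if "L' \<in> Pr1 S" "T_op L' = L'" for L'
      by (rule fixed_point_unique[OF that(1) L(1) that(2) L(2)])
    show "integrable (M N) (\<lambda>\<omega>. GSE S p \<psi> N (K N \<omega>) (\<lambda>k. \<theta> N k \<omega>) (\<lambda>k. I N k \<omega>))" if "p \<le> N" for N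
      by (rule GSE_deviation(1)[OF assms(10)[OF that] that zero_less_one])
    show "(\<lambda>N. \<integral>\<omega>. \<bar>GSE S p \<psi> N (K N \<omega>) (\<lambda>k. \<theta> N k \<omega>) (\<lambda>k. I N k \<omega>) - P_infty S p \<alpha> \<psi> Q L\<bar> \<partial>M N)
      \<longlonglongrightarrow> 0"
      by (rule GSE_L1_limit[OF assms(10) L])
  qed
qed

end
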